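(* Let $n\ge 1$. (i) There is a bijection $(P,Q)\mapsto T$ from $\mathcal{D}_n\times\mathcal{D}_n$ onto $\mathcal{M}_n$ such that $\mathsf{traj}(P,Q)=\mathsf{comp}(T)$. (ii) There is a bijection $P\mapsto S$ from $\mathcal{D}_n$ onto $\mathcal{M}^*_n$ such that $\mathsf{traj}(P)=\mathsf{comp}(S)$.
   Context: A Dyck path of size $n$ is a lattice path in $\mathbb{Z}^2$ from $(0,0)$ to $(n,n)$ using north steps $\mathsf{N}=(0,1)$ and east steps $\mathsf{E}=(1,0)$ that never goes below the line $y=x$; $\mathcal{D}_n$ is the set of such paths. For a Dyck path $P$, $-P$ denotes the path obtained by reflecting $P$ over the line $y=x$. For $P,Q\in\mathcal{D}_n$, the grid polygon associated with $(P,Q)$ is the region enclosed by $P$ and $-Q$; its boundary consists of the $4n$ unit steps of $P$ and $-Q$. From the midpoint of any boundary step, emit a light beam into the interior of the polygon making a $45^\circ$ angle with that step; it travels in a straight line until it reaches the midpoint of another boundary step (meeting it at $45^\circ$). This defines a permutation $\pi$ of the $4n$ boundary steps; its cycles are the (billiard) trajectories, and $\mathsf{traj}(P,Q)$ denotes the number of cycles of $\pi$. With $L_n=\mathsf{N}^n\mathsf{E}^n$, set $\mathsf{traj}(P)=\mathsf{traj}(P,L_n)$ for $P\in\mathcal{D}_n$. A meander of order $n$ is a collection of closed, self-avoiding, mutually noncrossing curves in the plane that intersect a fixed straight line in exactly $2n$ fixed points (and nowhere else), considered up to smooth deformation; $\mathcal{M}_n$ is the set of (inequivalent) meanders of order $n$.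 A semimeander of order $n$ is defined the same way with a fixed ray and $n$ fixed points on it; $\mathcal{M}^*_n$ is the set of semimeanders of order $n$. For a meander or semimeander $T$, $\mathsf{comp}(T)$ is its number of connected components (closed curves). *)

theory Defs
  imports "HOL-Analysis.Analysis" "HOL-Combinatorics.Orbits"
begin

section \<open>Dyck paths\<close>

datatype step = North | East

text \<open>A lattice path starting at the origin is the list of its steps.\<close>

fun step_vec :: "step \<Rightarrow> complex" where
  "step_vec North = \<i>"
| "step_vec East = 1"

definition vertex :: "step list \<Rightarrow> nat \<Rightarrow> complex" where
  "vertex P k = Complex (of_nat (count_list (take k P) East)) (of_nat (count_list (take k P) North))"

definition dyck_paths :: "nat \<Rightarrow> step list set" where
  "dyck_paths n = {P. vertex P (length P) = Complex (of_nat n) (of_nat n) \<and>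
                      (\<forall>k\<le>length P. Re (vertex P k) \<le> Im (vertex P k))}"

text \<open>Reflection over the line \<open>y = x\<close>; in the text this is \<open>- P\<close>.\<close>

fun swap_step :: "step \<Rightarrow> step" where
  "swap_step North = East"
| "swap_step East = North"

definition reflect_path :: "step list \<Rightarrow> step list" where
  "reflect_path P = map swap_step P"

definition L_path :: "nat \<Rightarrow> step list" where
  "L_path n = replicate n North @ replicate n East"

section \<open>Grid polygons and billiards\<close>

text \<open>A boundary step is given by its lower or left end point together with its direction.\<close>

type_synonym unit_step = "complex \<times> step"

definition steps_of :: "step list \<Rightarrow> unit_step set" where
  "steps_of P = {(vertex P k, P ! k) |k. k < length P}"

definition boundary_steps :: "step list \<Rightarrow> step list \<Rightarrow> unit_step set" where
  "boundary_steps P Q = steps_of P \<union> steps_of (reflect_path Q)"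

definition segment_of :: "unit_step \<Rightarrow> complex set" where
  "segment_of e = closed_segment (fst e) (fst e + step_vec (snd e))"

definition mid :: "unit_step \<Rightarrow> complex" where
  "mid e = midpoint (fst e) (fst e + step_vec (snd e))"

text \<open>The library operator \<^const>\<open>inside\<close> yields the region enclosed by its argument. If \<open>P\<close> and
  \<open>- Q\<close> meet on the diagonal before their common end point, that region is disconnected.\<close>

definition polygon_interior :: "step list \<Rightarrow> step list \<Rightarrow> complex set" where
  "polygon_interior P Q = inside (\<Union>e\<in>boundary_steps P Q. segment_of e)"

text \<open>The directions at \<open>45\<close> degrees to horizontal and vertical steps.\<close>

definition diagonal_directions :: "complex set" where
  "diagonal_directions = {u. \<bar>Re u\<bar> = 1 \<and> \<bar>Im u\<bar> = 1}"

definition light_beam ::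
  "step list \<Rightarrow> step list \<Rightarrow> unit_step \<Rightarrow> complex \<Rightarrow> unit_step \<Rightarrow> bool" where
  "light_beam P Q e u f \<longleftrightarrow>
     e \<in> boundary_steps P Q \<and> f \<in> boundary_steps P Q \<and> u \<in> diagonal_directions \<and>
     (\<exists>t>0. mid f = mid e + t *\<^sub>R u) \<and>
     open_segment (mid e) (mid f) \<subseteq> polygon_interior P Q"

text \<open>Direction of travel after bouncing off a vertical or a horizontal step.\<close>

fun bounce :: "step \<Rightarrow> complex \<Rightarrow> complex" where
  "bounce North u = - cnj u"
| "bounce East u = cnj u"

text \<open>From each boundary step there are two \<open>45\<close> degree directions into the interior. In a billiard
  permutation \<open>\<pi>\<close> one of them, \<open>u e\<close>, is chosen at every step \<open>e\<close> so that the beam emitted at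
  \<open>\<pi> e\<close> is the reflection of the beam arriving there from \<open>e\<close>. Different consistent choices
  traverse the same trajectories, possibly in the opposite sense, so the number of cycles does
  not depend on the choice.\<close>

definition billiard_permutation ::
  "step list \<Rightarrow> step list \<Rightarrow> (unit_step \<Rightarrow> unit_step) \<Rightarrow> bool" where
  "billiard_permutation P Q \<pi> \<longleftrightarrow>
     \<pi> permutes boundary_steps P Q \<and>
     (\<exists>u. \<forall>e\<in>boundary_steps P Q.
        light_beam P Q e (u e) (\<pi> e) \<and> u (\<pi> e) = bounce (snd (\<pi> e)) (u e))"

definition traj :: "step list \<Rightarrow> step list \<Rightarrow> nat" where
  "traj P Q = (THE m. \<exists>\<pi>. billiard_permutation P Q \<pi> \<and> m = card (orbit \<pi> ` boundary_steps P Q))"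

section \<open>Meanders and semimeanders\<close>

definition simple_closed_curve :: "complex set \<Rightarrow> bool" where
  "simple_closed_curve c \<longleftrightarrow>
     (\<exists>g. simple_path g \<and> pathfinish g = pathstart g \<and> path_image g = c)"

text \<open>The curve \<open>c\<close> passes from one side of the real axis to the other at \<open>p\<close>. As \<open>c\<close> is
  unoriented, the parametrization may be chosen to pass upwards.\<close>

definition crosses_axis_at :: "complex set \<Rightarrow> complex \<Rightarrow> bool" where
  "crosses_axis_at c p \<longleftrightarrow>
     (\<exists>g \<epsilon>. simple_path g \<and> pathfinish g = pathstart g \<and> path_image g = c \<and>
        g (1/2) = p \<and> 0 < \<epsilon> \<and> \<epsilon> \<le> 1/2 \<and>
        (\<forall>s\<in>{0<..<\<epsilon>}. Im (g (1/2 - s)) < 0 \<and> 0 < Im (g (1/2 + s))))"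

text \<open>In the following, \<open>L\<close> is the real line or the nonnegative real half-line and \<open>A\<close> is the
  set of prescribed points on it (the end point of the half-line is not among them, so that
  near every point of \<open>A\<close> the set \<open>L\<close> is the real axis). Curves are continuous, and touching
  \<open>L\<close> without crossing it is not allowed.\<close>

definition curve_system :: "complex set \<Rightarrow> complex set \<Rightarrow> complex set set \<Rightarrow> bool" where
  "curve_system L A C \<longleftrightarrow>
     (\<forall>c\<in>C. simple_closed_curve c) \<and> disjoint C \<and>
     \<Union>C \<inter> L = A \<and>
     (\<forall>c\<in>C. c \<inter> L \<noteq> {} \<and> (\<forall>p\<in>c \<inter> L. crosses_axis_at c p))"

text \<open>Ambient isotopies of the plane that preserve \<open>L\<close> and fix the points of \<open>A\<close>.\<close>

definition ambient_isotopy ::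
  "complex set \<Rightarrow> complex set \<Rightarrow> (real \<Rightarrow> complex \<Rightarrow> complex) \<Rightarrow> bool" where
  "ambient_isotopy L A H \<longleftrightarrow>
     continuous_on ({0..1} \<times> UNIV) (\<lambda>(t, z). H t z) \<and>
     (\<forall>z. H 0 z = z) \<and>
     (\<forall>t\<in>{0..1}. (\<exists>k. homeomorphism UNIV UNIV (H t) k) \<and> H t ` L = L \<and> (\<forall>p\<in>A. H t p = p))"

definition deformation_rel ::
  "complex set \<Rightarrow> complex set \<Rightarrow> (complex set set \<times> complex set set) set" where
  "deformation_rel L A =
     {(C, D). curve_system L A C \<and> curve_system L A D \<and>
        (\<exists>H. ambient_isotopy L A H \<and> (`) (H 1) ` C = D)}"

definition meanders :: "nat \<Rightarrow> complex set set set set" where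
  "meanders n = (let A = of_nat ` {1..2*n} in {C. curve_system \<real> A C} // deformation_rel \<real> A)"

definition semimeanders :: "nat \<Rightarrow> complex set set set set" where
  "semimeanders n =
     (let A = of_nat ` {1..n} in {C. curve_system \<real>\<^sub>\<ge>\<^sub>0 A C} // deformation_rel \<real>\<^sub>\<ge>\<^sub>0 A)"

text \<open>The number of curves is the same for all members of an equivalence class (see below).\<close>

definition num_components :: "complex set set set \<Rightarrow> nat" where
  "num_components T = the_elem (card ` T)"

lemma equiv_deformation_rel: "equiv {C. curve_system L A C} (deformation_rel L A)"
proof (rule equivI)
  show "deformation_rel L A \<subseteq> {C. curve_system L A C} \<times> {C. curve_system L A C}"
    by (auto simp: deformation_rel_def)
next
  have cont: "continuous_on ({0..1} \<times> UNIV) (\<lambda>(t :: real, z :: complex). z)"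
    by (simp add: case_prod_beta continuous_on_snd continuous_on_id)
  have hom: "\<exists>k. homeomorphism UNIV UNIV (\<lambda>z :: complex. z) k"
    by (rule exI[of _ "\<lambda>z. z"]) (rule homeomorphism_ident)
  have iso: "ambient_isotopy L A (\<lambda>t z. z)"
    unfolding ambient_isotopy_def using cont hom by simp
  have "(C, C) \<in> deformation_rel L A" if "curve_system L A C" for C
    unfolding deformation_rel_def using that iso by (auto intro!: exI[of _ "\<lambda>t z. z"])
  then show "refl_on {C. curve_system L A C} (deformation_rel L A)"
    by (simp add: refl_on_def)
next
  show "sym (deformation_rel L A)"
  proof (rule symI)
    fix C D assume "(C, D) \<in> deformation_rel L A"
    then obtain H where CD: "curve_system L A C" "curve_system L A D"
      and H: "ambient_isotopy L A H" and D: "(`) (H 1) ` C = D"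
      by (auto simp: deformation_rel_def)
    have hom: "\<exists>k. homeomorphism UNIV UNIV (H t) k" "H t ` L = L" "\<forall>p\<in>A. H t p = p"
      if "t \<in> {0..1}" for t
      using H that by (auto simp: ambient_isotopy_def)
    obtain k where k: "homeomorphism UNIV UNIV (H 1) k" using hom(1)[of 1] by auto
    have kH: "k (H 1 z) = z" "H 1 (k z) = z" for z
      using k by (auto simp: homeomorphism_def)
    have contk: "continuous_on UNIV k" using k by (simp add: homeomorphism_def)
    have contH: "continuous_on ({0..1} \<times> UNIV) (\<lambda>(t, z). H t z)"
      using H by (simp add: ambient_isotopy_def)
    define G where "G t z = H (1 - t) (k z)" for t z
    have "k ` H 1 ` L = L" by (simp add: image_image kH)
    then have kL: "k ` L = L" using hom(2)[of 1] by simp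
    have "continuous_on ({0..1} \<times> UNIV) (\<lambda>x :: real \<times> complex. k (snd x))"
      by (rule continuous_on_compose2[OF contk continuous_on_snd[OF continuous_on_id]]) simp
    then have "continuous_on ({0..1} \<times> UNIV) (\<lambda>x :: real \<times> complex. (1 - fst x, k (snd x)))"
      by (intro continuous_on_Pair continuous_on_diff continuous_on_const
          continuous_on_fst continuous_on_id)
    then have "continuous_on ({0..1} \<times> UNIV) (\<lambda>x. (\<lambda>(t, z). H t z) (1 - fst x, k (snd x)))"
      by (rule continuous_on_compose2[OF contH]) auto
    then have "continuous_on ({0..1} \<times> UNIV) (\<lambda>(t, z). G t z)"
      by (simp add: G_def case_prod_beta)
    moreover have "\<exists>j. homeomorphism UNIV UNIV (G t) j" if t: "t \<in> {0..1}" for t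
    proof -
      obtain j where "homeomorphism UNIV UNIV (H (1 - t)) j" using hom(1)[of "1 - t"] t by auto
      then have "homeomorphism UNIV UNIV (H (1 - t) \<circ> k) (H 1 \<circ> j)"
        by (rule homeomorphism_compose[OF homeomorphism_symD[OF k]])
      moreover have "H (1 - t) \<circ> k = G t" by (simp add: G_def fun_eq_iff)
      ultimately show ?thesis by metis
    qed
    moreover have "G t ` L = L" if "t \<in> {0..1}" for t
    proof -
      have "G t ` L = H (1 - t) ` k ` L" by (simp add: G_def image_image)
      then show ?thesis using hom(2)[of "1 - t"] that kL by simp
    qed
    moreover have "G t p = p" if "t \<in> {0..1}" "p \<in> A" for t p
    proof -
      have "k p = p" using hom(3)[of 1] kH(1)[of p] that by simp
      then show ?thesis using hom(3)[of "1 - t"] that by (simp add: G_def)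
    qed
    moreover have "G 0 z = z" for z by (simp add: G_def kH)
    ultimately have "ambient_isotopy L A G" unfolding ambient_isotopy_def by simp
    moreover have "(`) (G 1) ` D = C"
    proof -
      have "G 1 = k" using H by (simp add: G_def ambient_isotopy_def fun_eq_iff)
      then show ?thesis unfolding D[symmetric] by (simp add: image_image kH)
    qed
    ultimately show "(D, C) \<in> deformation_rel L A"
      unfolding deformation_rel_def using CD by blast
  qed
next
  show "trans (deformation_rel L A)"
  proof (rule transI)
    fix C D E assume "(C, D) \<in> deformation_rel L A" "(D, E) \<in> deformation_rel L A"
    then obtain H K where CE: "curve_system L A C" "curve_system L A E"
      and H: "ambient_isotopy L A H" and D: "(`) (H 1) ` C = D"
      and K: "ambient_isotopy L A K" and E: "(`) (K 1) ` D = E"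
      by (auto simp: deformation_rel_def)
    have contH: "continuous_on ({0..1} \<times> UNIV) (\<lambda>(t, z). H t z)"
      and contK: "continuous_on ({0..1} \<times> UNIV) (\<lambda>(t, z). K t z)"
      using H K by (auto simp: ambient_isotopy_def)
    define G where "G t = K t \<circ> H t" for t
    have "continuous_on ({0..1} \<times> UNIV) (\<lambda>x. (\<lambda>(t, z). K t z) (fst x, (\<lambda>(t, z). H t z) x))"
      by (intro continuous_on_compose2[OF contK] continuous_on_Pair contH
          continuous_on_fst continuous_on_id) auto
    then have "continuous_on ({0..1} \<times> UNIV) (\<lambda>(t, z). G t z)"
      by (simp add: G_def case_prod_beta)
    moreover have "\<exists>j. homeomorphism UNIV UNIV (G t) j" if "t \<in> {0..1}" for t
      using H K that unfolding ambient_isotopy_def G_def by (meson homeomorphism_compose)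
    moreover have "G t ` L = L" if "t \<in> {0..1}" for t
    proof -
      have "G t ` L = K t ` H t ` L" by (simp add: G_def image_image)
      then show ?thesis using H K that by (simp add: ambient_isotopy_def)
    qed
    moreover have "G t p = p" if "t \<in> {0..1}" "p \<in> A" for t p
      using H K that by (simp add: ambient_isotopy_def G_def)
    moreover have "G 0 z = z" for z
      using H K by (simp add: ambient_isotopy_def G_def)
    ultimately have "ambient_isotopy L A G" unfolding ambient_isotopy_def by simp
    moreover have "(`) (G 1) ` C = E"
      unfolding E[symmetric] D[symmetric] by (simp add: G_def image_image image_comp o_def)
    ultimately show "(C, E) \<in> deformation_rel L A"
      unfolding deformation_rel_def using CE by blast
  qed
qed

lemma card_deformation_rel: "(C, D) \<in> deformation_rel L A \<Longrightarrow> card C = card D"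
proof -
  assume "(C, D) \<in> deformation_rel L A"
  then obtain H where H: "ambient_isotopy L A H" and D: "(`) (H 1) ` C = D"
    by (auto simp: deformation_rel_def)
  obtain k where "homeomorphism UNIV UNIV (H 1) k"
    using H unfolding ambient_isotopy_def by (meson atLeastAtMost_iff order_refl zero_le_one)
  then have "inj (H 1)" by (metis UNIV_I homeomorphism_apply1 injI)
  then have "inj_on ((`) (H 1)) C" by (auto intro: inj_onI simp: inj_image_eq_iff)
  then show ?thesis unfolding D[symmetric] by (simp add: card_image)
qed

lemma num_components_class:
  assumes "curve_system L A C"
  shows "num_components (deformation_rel L A `` {C}) = card C"
proof -
  have "C \<in> deformation_rel L A `` {C}"
    by (rule equiv_class_self[OF equiv_deformation_rel]) (simp add: assms)
  moreover have "card D = card C" if "D \<in> deformation_rel L A `` {C}" for D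
    using card_deformation_rel[of C D L A] that by simp
  ultimately have "card ` (deformation_rel L A `` {C}) = {card C}"
    by (metis (no_types, lifting) image_cong image_constant)
  then show ?thesis by (simp add: num_components_def)
qed

end

theory Submission
  imports Defs "HOL-Complex_Analysis.Complex_Analysis"
begin

text \<open>A Riemann map of a Jordan domain extends to the boundary: by Koebe's lemma, since the domain is
  uniformly locally connected (Janiszewski), and injectively by a maximum principle argument of
  Lindelof type. This gives the Schoenflies theorem in the form that every homeomorphism between
  Jordan curves extends to the closed interiors, and by cutting along arcs one after the other also
  extends as prescribed on finite families of disjoint crosscuts. Hence finite families of disjoint
  arcs in the upper half-plane with the same pairs of end points on the axis are related by a
  homeomorphism fixing the axis, which Alexander's trick turns into an isotopy.

  The complement of the real line is the union of two half-planes, and the complement of the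
  nonnegative half-line is the image of one half-plane under \<open>z\<^sup>2\<close>. Pulled back to these half-planes,
  a (semi)meander becomes a family of disjoint arcs, whose isotopy class is determined by the pairs of
  end points. These are noncrossing pairings of \<open>{0..<2n}\<close>, that is, Dyck paths; all
  of them occur, because any choice of arcs closes up to Jordan curves. In the semimeander case the
  squaring map identifies the \<open>k\<close>-th with the \<open>(2n-1-k)\<close>-th point, which is the
  pairing of \<open>L_path n\<close>.

  Light beams of direction \<open>(1, -1)\<close> join the \<open>k\<close>-th step of \<open>P\<close> to the \<open>k\<close>-th step of \<open>- Q\<close>, and those
  of direction \<open>(1, 1)\<close> join a north step of \<open>P\<close> (or \<open>Q\<close>) to its matching east step. So trajectories
  and components are both counted by the classes of the relation generated on \<open>{0..<2n}\<close> by the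
  two pairings.\<close>

section \<open>Koebe's lemma\<close>

text \<open>The curves are merely continuous and equivalence means ambient isotopy, so both
  directions of the classification are plane topology: equal pairings must produce an isotopy, and
  an isotopy must not change a pairing. The pairing records end points on the real axis of a chart
  rather than points of \<open>L\<close>, because both sides of a point of the half-line belong to
  one component of the complement. An isotopy could conceivably interchange these sides, and a curve
  meeting the half-line once has both ends of its only arc over the same point. The notion that
  copes with this is the germ: a chart together with a real point over \<open>p\<close>. Each
  \<open>p\<close> in \<open>A\<close> has exactly two germs, a system of arcs uses each germ once,
  and a curve is traversed by alternately following an arc and passing to the other germ.
  Trajectories have the same shape, alternating between two matings of the boundary steps. On the
  analytic side, Koebe's bound and the injectivity on the boundary rest on one device: rotated
  copies of a function are multiplied, so that smallness on a small piece controls the product on a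
  full turn.\<close>

lemma fashoda_real:
  fixes f1 f2 g1 g2 :: "real \<Rightarrow> real"
  assumes cont: "continuous_on {0..1} f1" "continuous_on {0..1} f2"
      "continuous_on {0..1} g1" "continuous_on {0..1} g2"
    and f: "\<And>t. t \<in> {0..1} \<Longrightarrow> a \<le> f1 t \<and> f1 t \<le> b \<and> c \<le> f2 t \<and> f2 t \<le> d"
    and g: "\<And>t. t \<in> {0..1} \<Longrightarrow> a \<le> g1 t \<and> g1 t \<le> b \<and> c \<le> g2 t \<and> g2 t \<le> d"
    and ends: "f1 0 = a" "f1 1 = b" "g2 0 = c" "g2 1 = d"
  obtains s t where "s \<in> {0..1}" "t \<in> {0..1}" "f1 s = g1 t" "f2 s = g2 t"
proof -
  define pr :: "real \<Rightarrow> real \<Rightarrow> real^2" where "pr x y = x *\<^sub>R axis 1 1 + y *\<^sub>R axis 2 1" for x y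
  have pr [simp]: "pr x y $ 1 = x" "pr x y $ 2 = y" for x y
    by (simp_all add: pr_def axis_def)
  obtain z where "z \<in> path_image (\<lambda>t. pr (f1 t) (f2 t))" "z \<in> path_image (\<lambda>t. pr (g1 t) (g2 t))"
  proof (rule fashoda[of "\<lambda>t. pr (f1 t) (f2 t)" "\<lambda>t. pr (g1 t) (g2 t)" "pr a c" "pr b d"])
    show "path (\<lambda>t. pr (f1 t) (f2 t))" "path (\<lambda>t. pr (g1 t) (g2 t))"
      unfolding path_def pr_def by (intro continuous_intros cont)+
    show "path_image (\<lambda>t. pr (f1 t) (f2 t)) \<subseteq> cbox (pr a c) (pr b d)"
      using f by (auto simp: path_image_def mem_box_cart forall_2)
    show "path_image (\<lambda>t. pr (g1 t) (g2 t)) \<subseteq> cbox (pr a c) (pr b d)"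
      using g by (auto simp: path_image_def mem_box_cart forall_2)
  qed (use ends in \<open>auto simp: pathstart_def pathfinish_def\<close>)
  then obtain s t where "s \<in> {0..1}" "t \<in> {0..1}" "pr (f1 s) (f2 s) = pr (g1 t) (g2 t)"
    by (auto simp: path_image_def)
  then show ?thesis using that[of s t] pr by metis
qed

text \<open>The map \<open>z \<mapsto> (cmod z, Re (z ^ m) / cmod z ^ m)\<close> identifies \<open>z\<close> with its images under rotations by multiples of
  \<open>2 pi / m\<close> and under conjugation. The image of \<open>\<gamma>\<close> runs from the lower to the upper edge of a rectangle
  that the image of \<open>\<alpha>\<close> traverses from left to right.\<close>

lemma fold_crossing:
  fixes \<gamma> \<alpha> :: "real \<Rightarrow> complex"
  assumes "path \<gamma>" "0 \<notin> path_image \<gamma>" "path \<alpha>" "pathstart \<alpha> = 0"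
    and far: "\<And>z. z \<in> path_image \<gamma> \<Longrightarrow> cmod z < cmod (pathfinish \<alpha>)"
    and st: "Re (pathstart \<gamma> ^ m) = - (cmod (pathstart \<gamma>) ^ m)"
    and fi: "Re (pathfinish \<gamma> ^ m) = cmod (pathfinish \<gamma>) ^ m"
  obtains z w where "z \<in> path_image \<gamma>" "w \<in> path_image \<alpha>" "cmod z = cmod w" "Re (z ^ m) = Re (w ^ m)"
proof -
  obtain z0 where z0: "z0 \<in> path_image \<gamma>" "\<And>z. z \<in> path_image \<gamma> \<Longrightarrow> cmod z0 \<le> cmod z"
    using continuous_attains_inf[of "path_image \<gamma>" cmod] compact_path_image[OF assms(1)]
      path_image_nonempty[of \<gamma>] by (auto intro: continuous_intros)
  \<comment> \<open>Half the least modulus on \<gamma>, so that \<gamma> stays strictly to the right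
    of the left edge while \<alpha>, which starts at 0, is clipped to that edge.\<close>
  define p where "p = cmod z0 / 2"
  define r where "r = cmod (pathfinish \<alpha>)"
  have p: "0 < p" "\<And>z. z \<in> path_image \<gamma> \<Longrightarrow> p < cmod z"
    using z0 assms(2) by (auto simp: p_def) (smt (verit) field_sum_of_halves zero_less_norm_iff z0)
  have g0: "\<gamma> 0 \<noteq> 0" "\<gamma> 1 \<noteq> 0"
    using assms(2) pathstart_in_path_image[of \<gamma>] pathfinish_in_path_image[of \<gamma>]
    by (auto simp: pathstart_def pathfinish_def)
  have pr: "p < r" using p(2)[OF z0(1)] far[OF z0(1)] by (simp add: r_def)
  \<comment> \<open>The coordinates are clipped to the rectangle with sides from \<open>p\<close> to
    \<open>r\<close> and from -1 to 1. Clipping keeps \<open>Y\<close> continuous at 0 and does not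
    affect \<gamma>, whose moduli lie strictly between \<open>p\<close> and
    \<open>r\<close>.\<close>
  define X where "X z = max p (min (cmod z) r)" for z
  define Y where "Y z = Re (z ^ m) / (max p (cmod z)) ^ m" for z
  have contX: "continuous_on S X" for S unfolding X_def by (intro continuous_intros)
  have contY: "continuous_on S Y" for S unfolding Y_def
    using p(1) by (intro continuous_intros) (auto simp: max_def)
  have X: "p \<le> X z" "X z \<le> r" for z using pr by (auto simp: X_def)
  have Y: "-1 \<le> Y z \<and> Y z \<le> 1" for z
  proof -
    have "\<bar>Re (z ^ m)\<bar> \<le> cmod (z ^ m)" by (rule abs_Re_le_cmod)
    also have "\<dots> = cmod z ^ m" by (simp add: norm_power)
    also have "\<dots> \<le> (max p (cmod z)) ^ m" by (intro power_mono) auto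
    finally have "\<bar>Y z\<bar> \<le> 1" using p(1) by (simp add: Y_def abs_divide divide_le_eq)
    then show ?thesis by auto
  qed
  have ca: "continuous_on {0..1} \<alpha>" and cg: "continuous_on {0..1} \<gamma>"
    using assms by (auto simp: path_def)
  have Yg: "Y z = Re (z ^ m) / cmod z ^ m" "X z = cmod z" if "z \<in> path_image \<gamma>" for z
    using p(2)[OF that] far[OF that] by (auto simp: Y_def X_def r_def max_def)
  obtain s t where st: "s \<in> {0..1}" "t \<in> {0..1}" "X (\<alpha> s) = X (\<gamma> t)" "Y (\<alpha> s) = Y (\<gamma> t)"
  proof (rule fashoda_real[of "\<lambda>t. X (\<alpha> t)" "\<lambda>t. Y (\<alpha> t)" "\<lambda>t. X (\<gamma> t)" "\<lambda>t. Y (\<gamma> t)" p r "-1" 1])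
    show "X (\<alpha> 0) = p" using assms(4) p(1) pr by (simp add: X_def pathstart_def)
    show "X (\<alpha> 1) = r" using pr by (simp add: X_def pathfinish_def r_def)
    show "Y (\<gamma> 0) = -1"
      using g0 Yg[OF pathstart_in_path_image] st p(1) p(2)[OF pathstart_in_path_image] by (simp add: pathstart_def)
    show "Y (\<gamma> 1) = 1"
      using g0 Yg[OF pathfinish_in_path_image] fi p(1) p(2)[OF pathfinish_in_path_image] by (simp add: pathfinish_def)
  qed (use X Y in \<open>auto intro!: continuous_on_compose2[OF contX[of UNIV]] continuous_on_compose2[OF contY[of UNIV]] ca cg\<close>)
  have gt: "\<gamma> t \<in> path_image \<gamma>" using st by (auto simp: path_image_def)
  \<comment> \<open>\<open>X (\<gamma> t)\<close> lies strictly inside its interval, so the clipping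
    is inactive at \<open>\<alpha> s\<close> as well and the true coordinates agree.\<close>
  have "cmod (\<alpha> s) = cmod (\<gamma> t)"
    using st(3) p(2)[OF gt] far[OF gt] Yg[OF gt] unfolding X_def r_def by (auto simp: max_def min_def split: if_splits)
  moreover have "Re (\<alpha> s ^ m) = Re (\<gamma> t ^ m)"
    using calculation st(4) p(1) p(2)[OF gt] by (auto simp: Y_def max_def split: if_splits)
  ultimately show ?thesis using that[of "\<gamma> t" "\<alpha> s"] gt st by (auto simp: path_image_def)
qed

text \<open>The conditions on the ends say that the arguments of start and finish are an odd and an
  even multiple of pi/m. Only this angular extent of \<gamma> enters the bound, not its distance to
  the unit circle; hence curves of the same extent that run off to the circle with \<epsilon>
  tending to 0 force \<open>f 0 = 0\<close>.\<close>

lemma koebe_bound: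
  fixes f :: "complex \<Rightarrow> complex"
  assumes hol: "f holomorphic_on ball 0 1" and M: "\<And>z. z \<in> ball 0 1 \<Longrightarrow> cmod (f z) \<le> M"
    and m: "0 < m"
    and g: "path \<gamma>" "path_image \<gamma> \<subseteq> ball 0 1 - {0}" "\<And>z. z \<in> path_image \<gamma> \<Longrightarrow> cmod (f z) \<le> \<epsilon>"
    and st: "Re (pathstart \<gamma> ^ m) = - (cmod (pathstart \<gamma>) ^ m)"
    and fi: "Re (pathfinish \<gamma> ^ m) = cmod (pathfinish \<gamma>) ^ m"
  shows "cmod (f 0) ^ (2*m) \<le> \<epsilon> * M ^ (2*m - 1)"
proof (rule ccontr)
  define \<eta> where "\<eta> = \<epsilon> * M ^ (2*m - 1)"
  assume "\<not> ?thesis"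
  then have big: "\<eta> < cmod (f 0) ^ (2*m)" by (simp add: \<eta>_def)
  define \<omega> where "\<omega> k = exp (2 * of_real pi * \<i> * of_nat k / of_nat m)" for k
  have w1 [simp]: "cmod (\<omega> k) = 1" for k unfolding \<omega>_def by (simp add: norm_exp_eq_Re)
  \<comment> \<open>Each rotated or reflected copy of \<open>\<gamma>\<close> makes one of the \<open>2 * m\<close> factors of \<open>F\<close> small, and together
    the copies separate \<open>0\<close> from the unit circle.\<close>
  define F1 where "F1 z = (\<Prod>k<m. f (\<omega> k * z))" for z
  define F where "F z = F1 z * cnj (F1 (cnj z))" for z
  have F1hol: "F1 holomorphic_on ball 0 1"
  proof -
    have "(f \<circ> (\<lambda>z. \<omega> k * z)) holomorphic_on ball 0 1" for k
      by (rule holomorphic_on_compose_gen[OF _ hol]) (auto intro!: holomorphic_intros simp: norm_mult)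
    then show ?thesis unfolding F1_def by (intro holomorphic_intros) (simp add: o_def)
  qed
  have cb: "cnj ` ball 0 1 = ball 0 1"
  proof
    show "ball 0 1 \<subseteq> cnj ` ball 0 1" by (metis (no_types, lifting) complex_cnj_cnj complex_mod_cnj image_iff mem_ball_0 subsetI)
  qed auto
  have Fhol: "F holomorphic_on ball 0 1"
  proof -
    have "(cnj \<circ> F1 \<circ> cnj) holomorphic_on ball 0 1"
      by (rule holomorphic_on_compose_cnj_cnj) (use F1hol cb in auto)
    then show ?thesis unfolding F_def using F1hol by (intro holomorphic_intros) (auto simp: o_def)
  qed
  have M0: "0 \<le> M" using M[of 0] norm_ge_zero[of "f 0"] by (metis centre_in_ball order_trans zero_less_one)
  have F1M: "cmod (F1 z) \<le> M ^ m" if "z \<in> ball 0 1" for z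
  proof -
    have "cmod (F1 z) \<le> (\<Prod>k<m. M)"
      unfolding F1_def prod_norm[symmetric] by (intro prod_mono) (use that M in \<open>auto simp: norm_mult\<close>)
    then show ?thesis by simp
  qed
  have F1e: "cmod (F1 w) \<le> \<epsilon> * M ^ (m - 1)"
    if "w \<in> ball 0 1" "z \<in> path_image \<gamma>" "w \<noteq> 0" "z ^ m = w ^ m" for w z
  proof -
    \<comment> \<open>As \<open>z\<close> and \<open>w\<close> have the same \<open>m\<close>-th
      power, \<open>z\<close> is a rotation of \<open>w\<close> and \<open>f z\<close> is one of the
      factors of \<open>F1 w\<close>; the others are bounded by \<open>M\<close>.\<close>
    have "(z / w) ^ m = 1" using that by (simp add: power_divide)
    then have "z / w \<in> {\<omega> k | k. k < m}" using complex_roots_unity[of m] m by (auto simp: \<omega>_def)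
    then obtain k where k: "k < m" "z / w = \<omega> k" by auto
    then have k: "k < m" "z = \<omega> k * w" using that(3) by (auto simp: field_simps)
    have "cmod (F1 w) = cmod (f (\<omega> k * w)) * (\<Prod>j\<in>{..<m}-{k}. cmod (f (\<omega> j * w)))"
      unfolding F1_def prod_norm[symmetric] by (rule prod.remove) (use k in auto)
    also have "\<dots> \<le> \<epsilon> * (\<Prod>j\<in>{..<m}-{k}. M)"
    proof (rule mult_mono)
      show "cmod (f (\<omega> k * w)) \<le> \<epsilon>" using k g(3)[OF that(2)] by simp
      then show "0 \<le> \<epsilon>" using norm_ge_zero order_trans by blast
      show "(\<Prod>j\<in>{..<m}-{k}. cmod (f (\<omega> j * w))) \<le> (\<Prod>j\<in>{..<m}-{k}. M)"
        by (intro prod_mono) (use that M in \<open>auto simp: norm_mult\<close>)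
    qed (auto intro: prod_nonneg)
    finally show ?thesis using k by simp
  qed
  have e0: "0 \<le> \<epsilon>" using g(3)[OF pathstart_in_path_image] norm_ge_zero order_trans by blast
  have Fe: "cmod (F w) \<le> \<eta>"
    if "w \<in> ball 0 1" "z \<in> path_image \<gamma>" "cmod z = cmod w" "Re (z ^ m) = Re (w ^ m)" for w z
  proof -
    have w0: "w \<noteq> 0" using that g(2) by auto
    have eta: "\<eta> = (\<epsilon> * M ^ (m - 1)) * M ^ m"
    proof -
      have "2*m - 1 = (m - 1) + m" using m by simp
      then show ?thesis unfolding \<eta>_def by (simp only: power_add mult.assoc)
    qed
    \<comment> \<open>Equal fold coordinates determine \<open>z ^ m\<close> up to conjugation; the
      conjugate case is absorbed by the second factor of \<open>F\<close>.\<close>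
    have "cmod (z ^ m) = cmod (w ^ m)" using that by (simp add: norm_power)
    then have "Im (z ^ m) ^ 2 = Im (w ^ m) ^ 2" using that(4) cmod_power2 by (metis add_left_cancel)
    then have "Im (z ^ m) = Im (w ^ m) \<or> Im (z ^ m) = - Im (w ^ m)" by (simp add: power2_eq_iff)
    then have "z ^ m = w ^ m \<or> z ^ m = cnj w ^ m"
      using that(4) by (auto simp: complex_eq_iff simp flip: complex_cnj_power)
    then consider "z ^ m = w ^ m" | "z ^ m = cnj w ^ m" by blast
    then show ?thesis
    proof cases
      case 1
      have "cmod (F w) \<le> (\<epsilon> * M ^ (m - 1)) * M ^ m"
        unfolding F_def norm_mult complex_mod_cnj
        by (intro mult_mono F1e[OF that(1,2) w0 1] F1M) (use that M0 e0 in auto)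
      then show ?thesis by (simp add: eta)
    next
      case 2
      have "cmod (F w) \<le> M ^ m * (\<epsilon> * M ^ (m - 1))"
        unfolding F_def norm_mult complex_mod_cnj
        by (intro mult_mono F1e[OF _ that(2) _ 2] F1M) (use that w0 M0 e0 in auto)
      then show ?thesis by (simp add: eta mult_ac)
    qed
  qed
  have F0: "cmod (F 0) = cmod (f 0) ^ (2 * m)"
    by (simp add: F_def F1_def norm_mult norm_power mult_2 power_add)
  define U where "U = {z \<in> ball 0 1. \<eta> < cmod (F z)}"
  have opU: "open U"
  proof -
    have "U = ball 0 1 \<inter> (\<lambda>z. cmod (F z)) -` {\<eta><..}" by (auto simp: U_def)
    then show ?thesis using continuous_open_preimage[of "ball 0 1" "\<lambda>z. cmod (F z)" "{\<eta><..}"]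
        holomorphic_on_imp_continuous_on[OF Fhol] by (auto intro: continuous_intros)
  qed
  \<comment> \<open>By the maximum principle this component cannot stay in the disc of radius
    \<open>cmod z1\<close>, since \<open>F\<close> is at most \<eta> in modulus on its frontier. So
    it contains a path from 0 to beyond \<gamma>, and that path must cross a copy of \<gamma>, where
    \<open>F\<close> is small.\<close>
  define G where "G = connected_component_set U 0"
  have U0: "0 \<in> U" using big F0 by (simp add: U_def)
  have G0: "0 \<in> G" by (simp add: G_def U0)
  have opG: "open G" unfolding G_def by (rule open_connected_component[OF opU])
  have GU: "G \<subseteq> U" unfolding G_def by (rule connected_component_subset)
  obtain z1 where z1: "z1 \<in> path_image \<gamma>" "\<And>z. z \<in> path_image \<gamma> \<Longrightarrow> cmod z \<le> cmod z1"
    using continuous_attains_sup[of "path_image \<gamma>" cmod] compact_path_image[OF g(1)]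
      path_image_nonempty[of \<gamma>] by (auto intro: continuous_intros)
  have z11: "cmod z1 < 1" using z1 g(2) by auto
  have "\<not> G \<subseteq> cball 0 (cmod z1)"
  proof
    assume Gc: "G \<subseteq> cball 0 (cmod z1)"
    then have "closure G \<subseteq> cball 0 (cmod z1)" by (simp add: closure_minimal)
    then have clG1: "closure G \<subseteq> ball 0 1" using z11 by auto
    have "cmod (F 0) \<le> \<eta>"
    proof (rule maximum_modulus_frontier[of F G])
      show "F holomorphic_on interior G" using GU opG by (auto simp: interior_open U_def intro!: holomorphic_on_subset[OF Fhol])
      show "continuous_on (closure G) F"
        using holomorphic_on_imp_continuous_on[OF Fhol] clG1 continuous_on_subset by blast
      show "bounded G" using Gc bounded_cball bounded_subset by blast
      fix z assume z: "z \<in> frontier G"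
      have "z \<in> frontier U" using frontier_of_connected_component_subset[of U 0] z by (auto simp: G_def)
      then have "z \<notin> U" using opU by (simp add: frontier_def interior_open)
      moreover have "z \<in> ball 0 1" using z clG1 by (auto simp: frontier_def)
      ultimately show "cmod (F z) \<le> \<eta>" by (auto simp: U_def)
    qed (use G0 in auto)
    then show False using big F0 by simp
  qed
  then obtain w where w: "w \<in> G" "cmod z1 < cmod w" by (auto simp: subset_iff)
  have "path_connected G"
    by (rule connected_open_path_connected[OF opG]) (simp add: G_def)
  then obtain \<alpha> where a: "path \<alpha>" "path_image \<alpha> \<subseteq> G" "pathstart \<alpha> = 0" "pathfinish \<alpha> = w"
    using w(1) G0 unfolding path_connected_def by blast
  obtain z v where zv: "z \<in> path_image \<gamma>" "v \<in> path_image \<alpha>" "cmod z = cmod v" "Re (z ^ m) = Re (v ^ m)"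
  proof (rule fold_crossing[of \<gamma> \<alpha> m])
    show "cmod z < cmod (pathfinish \<alpha>)" if "z \<in> path_image \<gamma>" for z
      using z1(2)[OF that] w a by simp
  qed (use g a st fi in auto)
  then have "v \<in> U" using a GU by auto
  then show False using Fe[OF _ zv(1,3,4)] by (auto simp: U_def)
qed

section \<open>Jordan domains\<close>

lemma simple_path_eqD:
  assumes "simple_path g" "s \<in> {0..1}" "t \<in> {0..1}" "g s = g t"
  shows "s = t \<or> s = 0 \<and> t = 1 \<or> s = 1 \<and> t = 0"
  using assms unfolding simple_path_def loop_free_def by blast

lemma loop_starting_at:
  fixes J :: "complex set"
  assumes "simple_closed_curve J" "p \<in> J"
  obtains h where "simple_path h" "path_image h = J" "h 0 = p" "h 1 = p"
proof -
  obtain g where g: "simple_path g" "pathfinish g = pathstart g" "path_image g = J"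
    using assms by (auto simp: simple_closed_curve_def)
  obtain u where u: "u \<in> {0..1}" "g u = p" using assms g by (auto simp: path_image_def)
  show ?thesis
  proof (rule that[of "shiftpath u g"])
    show "simple_path (shiftpath u g)" using g u by (simp add: simple_path_shiftpath)
    show "path_image (shiftpath u g) = J" using g u by (simp add: path_image_shiftpath)
    show "shiftpath u g 0 = p" using u by (auto simp: shiftpath_def)
    show "shiftpath u g 1 = p" using u g by (auto simp: shiftpath_def pathstart_def pathfinish_def)
  qed
qed

lemma jordan_facts:
  assumes "simple_closed_curve J"
  shows "compact J" "connected J" "J \<noteq> {}" "open (inside J)" "connected (inside J)" "inside J \<noteq> {}"
    "bounded (inside J)" "frontier (inside J) = J" "frontier (outside J) = J"
    "closure (inside J) = J \<union> inside J" "J \<inter> inside J = {}" "inside J \<union> outside J = - J"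
    "inside J \<inter> outside J = {}"
    "simply_connected (inside J)" "compact (J \<union> inside J)"
proof -
  obtain g where g: "simple_path g" "pathfinish g = pathstart g" "path_image g = J"
    using assms by (auto simp: simple_closed_curve_def)
  note * = Jordan_inside_outside[OF g(1,2), unfolded g(3)]
  show "compact J" "connected J" "J \<noteq> {}"
    using g by (metis compact_simple_path_image connected_simple_path_image path_image_nonempty)+
  show "open (inside J)" "connected (inside J)" "inside J \<noteq> {}" and b: "bounded (inside J)" and
    fr: "frontier (inside J) = J" and "frontier (outside J) = J" "inside J \<union> outside J = - J"
    "inside J \<inter> outside J = {}"
    using * by auto
  show "closure (inside J) = J \<union> inside J" using fr by (metis closure_Un_frontier sup_commute)
  then show "compact (J \<union> inside J)" using b by (metis compact_closure)
  show "J \<inter> inside J = {}" using inside_no_overlap[of J] by (simp add: Int_commute)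
  show "simply_connected (inside J)" using simply_connected_inside_simple_path[OF g(1)] g(3) by simp
qed

text \<open>Janiszewski's theorem: if neither of two sets, one compact and one closed, separates two
  points, and their intersection is connected, then neither does their union. The sets are
  \<open>J\<close> and the complement of the ball enlarged by the arc of \<open>J\<close> away from
  \<open>p\<close>; they meet exactly in that arc.\<close>

lemma jordan_inside_uniformly_locally_connected:
  assumes J: "simple_closed_curve J" and p: "p \<in> J" and e: "e > 0"
  obtains d where "d > 0" "\<And>w w'. w \<in> inside J \<inter> ball p d \<Longrightarrow> w' \<in> inside J \<inter> ball p d \<Longrightarrow>
     connected_component (inside J \<inter> ball p e) w w'"
proof -
  obtain h where h: "simple_path h" "path_image h = J" "h 0 = p" "h 1 = p"
    using loop_starting_at[OF J p] by metis
  have ch: "continuous_on {0..1} h" using h(1) by (simp add: simple_path_def path_def)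
  obtain d0 where d0: "d0 > 0" "\<And>t. t \<in> {0..1} \<Longrightarrow> dist t 0 < d0 \<Longrightarrow> dist (h t) (h 0) < e"
    using ch[unfolded continuous_on_iff, rule_format, of 0 e] e by auto
  obtain d1 where d1: "d1 > 0" "\<And>t. t \<in> {0..1} \<Longrightarrow> dist t 1 < d1 \<Longrightarrow> dist (h t) (h 1) < e"
    using ch[unfolded continuous_on_iff, rule_format, of 1 e] e by auto
  \<comment> \<open>All parameters within \<delta> of 0 or 1 are mapped into the ball of radius
    \<open>e\<close>, so removing them leaves an arc that contains everything of \<open>J\<close>
    outside the ball.\<close>
  define \<delta> where "\<delta> = Min {d0, d1, 1/2} / 2"
  have dl: "0 < \<delta>" "\<delta> < d0" "\<delta> < d1" "\<delta> < 1/2" using d0(1) d1(1) by (auto simp: \<delta>_def min_def)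
  define Jb where "Jb = h ` {\<delta>..1-\<delta>}"
  have cb: "continuous_on {\<delta>..1-\<delta>} h" by (rule continuous_on_subset[OF ch]) (use dl in auto)
  have Jb: "compact Jb" "connected Jb" "Jb \<subseteq> J"
    using cb h(2) dl by (auto simp: Jb_def path_image_def intro: compact_continuous_image connected_continuous_image)
  have pJb: "p \<notin> Jb"
  proof
    assume "p \<in> Jb"
    then obtain t where t: "\<delta> \<le> t" "t \<le> 1 - \<delta>" "h t = p" by (auto simp: Jb_def)
    then show False using simple_path_eqD[OF h(1), of t 0] h(3) dl by auto
  qed
  have near: "J - ball p e \<subseteq> Jb"
  proof
    fix z assume z: "z \<in> J - ball p e"
    then obtain t where t: "t \<in> {0..1}" "z = h t" using h(2) by (auto simp: path_image_def)
    have "\<not> t < \<delta>" "\<not> 1 - \<delta> < t"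
      using d0(2)[OF t(1)] d1(2)[OF t(1)] z t dl h(3,4) by (auto simp: dist_commute dist_real_def)
    then show "z \<in> Jb" using t by (auto simp: Jb_def)
  qed
  obtain d2 where d2: "d2 > 0" "ball p d2 \<inter> Jb = {}"
    using open_contains_ball[of "- Jb"] pJb compact_imp_closed[OF Jb(1)] by (auto simp: open_Compl)
      blast
  define d where "d = min d2 e"
  have d: "d > 0" "d \<le> d2" "d \<le> e" using d2 e by (auto simp: d_def)
  define T where "T = - ball p e \<union> Jb"
  have T: "closed T" using compact_imp_closed[OF Jb(1)] by (auto simp: T_def)
  show ?thesis
  proof (rule that[OF d(1)])
    fix w w' assume w: "w \<in> inside J \<inter> ball p d" "w' \<in> inside J \<inter> ball p d"
    have "ball p d \<subseteq> ball p d2" using d by auto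
    have "connected_component (- (J \<union> T)) w w'"
    proof (rule Janiszewski[OF jordan_facts(1)[OF J] T])
      have "J \<inter> T = Jb" using near Jb(3) by (auto simp: T_def)
      then show "connected (J \<inter> T)" using Jb(2) by simp
      show "connected_component (- J) w w'"
        using w jordan_facts(5,11)[OF J] by (intro connected_componentI[of "inside J"]) auto
      show "connected_component (- T) w w'"
        using w d d2(2) by (intro connected_componentI[of "ball p d"]) (use \<open>ball p d \<subseteq> ball p d2\<close> in \<open>auto simp: T_def\<close>)
    qed
    then obtain C where C: "connected C" "C \<subseteq> - (J \<union> T)" "w \<in> C" "w' \<in> C"
      by (auto simp: connected_component_def)
    have "C \<subseteq> inside J"
    proof
      fix z assume "z \<in> C"
      then have "connected_component (- J) w z" using C by (auto simp: connected_component_def)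
      then show "z \<in> inside J" using inside_same_component w by blast
    qed
    then have "C \<subseteq> inside J \<inter> ball p e" using C by (auto simp: T_def)
    then show "connected_component (inside J \<inter> ball p e) w w'" using C by (auto simp: connected_component_def)
  qed
qed

section \<open>Auxiliary facts on powers and on points of the unit circle\<close>

lemma Re_power_sector:
  assumes m: "even m" "m > 0" and u: "Im u = cmod u * sin (pi / m)"
  shows "Re (u ^ m) = - (cmod u ^ m)"
proof -
  have "(Re u)^2 = (cmod u * cos (pi/m))^2"
  proof -
    have "(Re u)^2 = (cmod u)^2 - (Im u)^2" by (simp add: cmod_power2)
    also have "\<dots> = (cmod u)^2 * (1 - (sin (pi/m))^2)" using u by (simp add: power_mult_distrib algebra_simps)
    also have "\<dots> = (cmod u * cos (pi/m))^2" by (simp add: cos_squared_eq power_mult_distrib)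
    finally show ?thesis .
  qed
  \<comment> \<open>\<open>Im u\<close> fixes the argument of \<open>u\<close> only up to reflection
    in the imaginary axis; as \<open>m\<close> is even, both choices have the same
    \<open>m\<close>-th power up to conjugation.\<close>
  then consider "Re u = cmod u * cos (pi/m)" | "Re u = - (cmod u * cos (pi/m))"
    by (auto simp: power2_eq_iff)
  moreover have cm: "cis (pi/m) ^ m = -1"
  proof -
    have "real m * (pi / real m) = pi" using m by simp
    then show ?thesis using Complex.DeMoivre[of "pi / real m" m] by (simp only: cis_pi)
  qed
  ultimately show ?thesis
  proof cases
    case 1
    then have "u = of_real (cmod u) * cis (pi/m)" using u by (simp add: complex_eq_iff)
    then have "u ^ m = of_real (cmod u ^ m) * cis (pi/m) ^ m" by (metis of_real_power power_mult_distrib)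
    then show ?thesis using cm by simp
  next
    case 2
    then have "u = - (of_real (cmod u) * cnj (cis (pi/m)))" using u by (simp add: complex_eq_iff)
    then have "u ^ m = of_real (cmod u ^ m) * cnj (cis (pi/m) ^ m)"
      using m by (metis complex_cnj_power of_real_power power_minus_even power_mult_distrib)
    then show ?thesis using cm by simp
  qed
qed

lemma Re_power_real:
  assumes "even m" "Im u = 0"
  shows "Re (u ^ m) = cmod u ^ m"
proof -
  have "u = of_real (Re u)" using assms by (simp add: complex_eq_iff)
  then have "u ^ m = of_real (Re u ^ m)" "cmod u = \<bar>Re u\<bar>" by (metis of_real_power, metis norm_of_real)
  then show ?thesis using assms by (simp add: power_even_abs)
qed

lemma norm_cis_diff_le: "cmod (cis x - cis y) \<le> \<bar>x - y\<bar>"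
proof -
  have "cis x - cis y = cis y * (cis (x - y) - 1)" by (simp add: algebra_simps cis_mult)
  then have "cis x - cis y = cis y * (exp (\<i> * of_real (x - y)) - 1)" by (simp only: cis_conv_exp)
  then have "cmod (cis x - cis y) = 2 * \<bar>sin ((x - y) / 2)\<bar>"
    by (simp only: norm_mult norm_cis dist_exp_i_1 mult_1)
  then show ?thesis using abs_sin_x_le_abs_x[of "(x - y) / 2"] by simp
qed

text \<open>Lindelof's device: the product of \<open>g - \<zeta>\<close> over the \<open>m\<close>
  rotations about \<open>w\<close> vanishes on the whole frontier of the common domain
  \<open>V\<close>, hence at \<open>w\<close>, which every rotation fixes. The exterior point
  \<open>q\<close> next to \<open>p\<close> keeps the closure of \<open>V\<close> off the circle
  through \<open>q\<close>.\<close>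

lemma lindelof_boundary_value:
  assumes "open \<Omega>" "bounded \<Omega>" and g: "continuous_on (closure \<Omega>) g" "g holomorphic_on \<Omega>"
    and p: "p \<in> closure \<Omega>" "p \<in> closure (- closure \<Omega>)" and r: "r > 0"
    and z: "\<And>z. z \<in> frontier \<Omega> \<inter> ball p r \<Longrightarrow> g z = \<zeta>"
  obtains w where "w \<in> \<Omega>" "g w = \<zeta>"
proof -
  \<comment> \<open>The bounds r/8 for \<open>q\<close> and \<open>w\<close> make the disc about
    \<open>w\<close> through \<open>q\<close> lie in the ball about \<open>p\<close> of radius
    \<open>r\<close>, where the boundary value is known.\<close>
  obtain q where q: "q \<notin> closure \<Omega>" "dist q p < r / 8"
    using p(2) r by (metis ComplD closure_approachable divide_pos_pos zero_less_numeral)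
  obtain \<rho> where \<rho>: "\<rho> > 0" "ball q \<rho> \<inter> closure \<Omega> = {}"
    using open_contains_ball[of "- closure \<Omega>"] q by (auto simp: open_Compl) blast
  obtain w where w: "w \<in> \<Omega>" "dist w p < r / 8"
    using p(1) r by (metis closure_approachable divide_pos_pos zero_less_numeral)
  define R where "R = dist w q"
  have R: "0 < R" "R < r / 4"
  proof -
    show "0 < R" using w q closure_subset by (auto simp: R_def)
    show "R < r / 4" using dist_triangle[of w q p] w q by (simp add: R_def dist_commute)
  qed
  \<comment> \<open>One \<open>m\<close>-th of a turn moves points of the circle of radius
    \<open>R\<close> by less than \<rho>.\<close>
  obtain m :: nat where m: "m > 0" "R * (2 * pi) / real m < \<rho>"
  proof -
    obtain m :: nat where "R * (2 * pi) / \<rho> < real m" using reals_Archimedean2 by blast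
    moreover have "0 < R * (2 * pi) / \<rho>" using R \<rho> by simp
    ultimately have m: "m > 0" by (auto intro: gr0I)
    then have "R * (2 * pi) / real m < \<rho>" using \<rho>(1) \<open>R * (2 * pi) / \<rho> < real m\<close> by (simp add: field_simps)
    with m have "m > 0" "R * (2 * pi) / real m < \<rho>" by auto
    then show ?thesis using that by blast
  qed
  define rot where "rot k z = w + cis (2 * pi * real k / real m) * (z - w)" for k z
  have rotd: "dist w (rot k z) = dist w z" for k z
    by (simp add: rot_def dist_norm norm_mult) (metis norm_minus_commute)
  have crot: "continuous_on S (rot k)" for S k unfolding rot_def by (intro continuous_intros)
  define V where "V = ball w R \<inter> (\<Inter>k\<in>{..<m}. rot k -` \<Omega>)"
  have "open (rot k -` \<Omega>)" for k
    using continuous_open_preimage[OF crot open_UNIV assms(1)] by simp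
  then have opV: "open V" unfolding V_def by (intro open_Int open_INT) auto
  have rotw: "rot k w = w" for k by (simp add: rot_def)
  have wV: "w \<in> V" using w R by (simp add: V_def rotw)
  have clV: "rot k z \<in> closure \<Omega>" "dist w z \<le> R" if "z \<in> closure V" "k < m" for k z
  proof -
    have "rot k ` closure V \<subseteq> closure \<Omega>"
      by (rule image_closure_subset[OF crot]) (use closure_subset[of \<Omega>] that in \<open>auto simp: V_def\<close>)
    then show "rot k z \<in> closure \<Omega>" using that by blast
    have "closure V \<subseteq> cball w R" by (rule closure_minimal) (auto simp: V_def)
    then show "dist w z \<le> R" using that by auto
  qed
  \<comment> \<open>A frontier point of \<open>V\<close> at distance \<open>R\<close> from \<open>w\<close> would need all its rotations in the closure of
    \<open>\<Omega>\<close>, but one of them is in \<open>ball q \<rho>\<close>. So every frontier point has a rotation in the frontier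
    of \<open>\<Omega>\<close>, where \<open>g = \<zeta>\<close>.\<close>
  define F where "F z = (\<Prod>k<m. g (rot k z) - \<zeta>)" for z
  have "cmod (F w) \<le> 0"
  proof (rule maximum_modulus_frontier[of F V])
    have hrot: "rot k holomorphic_on S" for k S unfolding rot_def by (intro holomorphic_intros)
    have "(g \<circ> rot k) holomorphic_on V" if "k < m" for k
      by (rule holomorphic_on_compose_gen[OF _ g(2)])
        (use that hrot in \<open>auto simp: V_def\<close>)
    then show "F holomorphic_on interior V" using opV
      unfolding F_def by (intro holomorphic_intros) (auto simp: o_def interior_open)
    have "continuous_on (closure V) (\<lambda>z. g (rot k z))" if "k < m" for k
      by (rule continuous_on_compose2[OF g(1) crot]) (use that clV in auto)
    then show "continuous_on (closure V) F" unfolding F_def by (intro continuous_intros) auto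
    show "bounded V" by (rule bounded_subset[of "ball w R"]) (auto simp: V_def)
    fix z assume "z \<in> frontier V"
    then have z1: "z \<in> closure V" "z \<notin> V" using opV by (auto simp: frontier_def interior_open)
    have "dist w z \<noteq> R"
    proof
      assume dR: "dist w z = R"
      define a b where "a = Arg (z - w)" and "b = Arg (q - w)"
      have nz: "cmod (z - w) = R" "cmod (q - w) = R" using dR R by (auto simp: R_def dist_norm norm_minus_commute)
      have az: "z - w = R * cis a" "q - w = R * cis b"
        using nz rcis_cmod_Arg[of "z - w"] rcis_cmod_Arg[of "q - w"] by (simp_all add: a_def b_def rcis_def)
      \<comment> \<open>\<open>t\<close> is the fraction of a full turn that carries
        \<open>z\<close> to \<open>q\<close>, and \<open>k / m\<close> its lower approximation, so
        the \<open>k\<close>-th rotation carries \<open>z\<close> to within \<rho> of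
        \<open>q\<close>.\<close>
      define t where "t = frac ((b - a) / (2 * pi))"
      define k where "k = nat \<lfloor>t * m\<rfloor>"
      have t: "0 \<le> t" "t < 1" by (auto simp: t_def frac_lt_1)
      have k0: "real k = of_int \<lfloor>t * m\<rfloor>" using t by (simp add: k_def)
      have k: "k < m" "\<bar>t * m - k\<bar> \<le> 1"
      proof -
        have "real k \<le> t * m" using k0 by linarith
        also have "\<dots> < 1 * real m" using t m by (intro mult_strict_right_mono) auto
        finally show "k < m" by simp
        show "\<bar>t * m - k\<bar> \<le> 1" using k0 by linarith
      qed
      have cb: "cis b = cis (a + 2 * pi * t)"
      proof -
        have "b = a + 2 * pi * t + 2 * pi * of_int \<lfloor>(b - a) / (2 * pi)\<rfloor>"
          by (simp add: t_def frac_def field_simps)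
        then have "cis b = cis (a + 2 * pi * t) * cis (2 * pi * of_int \<lfloor>(b - a) / (2 * pi)\<rfloor>)"
          by (metis cis_mult)
        then show ?thesis by (simp add: cis_multiple_2pi)
      qed
      have "rot k z - q = cis (2 * pi * k / m) * (z - w) - (q - w)" by (simp add: rot_def)
      also have "\<dots> = R * (cis (2 * pi * k / m) * cis a - cis b)" unfolding az by (simp add: algebra_simps)
      also have "\<dots> = R * (cis (2 * pi * k / m + a) - cis (a + 2 * pi * t))" by (simp only: cis_mult cb)
      finally have "rot k z - q = R * (cis (2 * pi * k / m + a) - cis (a + 2 * pi * t))" .
      then have "cmod (rot k z - q) = R * cmod (cis (2 * pi * k / m + a) - cis (a + 2 * pi * t))"
        using R by (simp add: norm_mult)
      also have "cmod (cis (2 * pi * k / m + a) - cis (a + 2 * pi * t)) \<le> \<bar>(2 * pi * k / m + a) - (a + 2 * pi * t)\<bar>"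
        by (rule norm_cis_diff_le)
      also have "\<bar>(2 * pi * k / m + a) - (a + 2 * pi * t)\<bar> = 2 * pi / m * \<bar>t * m - k\<bar>"
      proof -
        have "(2 * pi * k / m + a) - (a + 2 * pi * t) = - (2 * pi / m * (t * m - k))" using m by (simp add: field_simps)
        then show ?thesis by (simp add: abs_mult)
      qed
      also have "\<dots> \<le> 2 * pi / m * 1" using k m by (intro mult_left_mono) auto
      finally have "cmod (rot k z - q) \<le> R * (2 * pi / m)" using R by simp
      then have "rot k z \<in> ball q \<rho>" using m by (simp add: dist_norm norm_minus_commute)
      then show False using clV(1)[OF z1(1) k(1)] \<rho> by auto
    qed
    then have "dist w z < R" using clV(2)[OF z1(1) m(1)] by simp
    then obtain k where k: "k < m" "rot k z \<notin> \<Omega>" using z1(2) by (auto simp: V_def)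
    have "rot k z \<in> frontier \<Omega>" using clV(1)[OF z1(1) k(1)] k assms(1) by (simp add: frontier_def interior_open)
    moreover have "dist p (rot k z) < r"
      using dist_triangle[of p "rot k z" w] w(2) rotd[of k z] \<open>dist w z < R\<close> R by (simp add: dist_commute)
    ultimately have "g (rot k z) = \<zeta>" using z by auto
    then have "F z = 0" using k by (auto simp: F_def)
    then show "cmod (F z) \<le> 0" by simp
  qed (rule wV)
  then have "g w = \<zeta>" by (auto simp: F_def rotw)
  then show ?thesis using that w by blast
qed

section \<open>Boundary values of Riemann maps\<close>

text \<open>If the images accumulated at two points of the circle, local connectivity would join
  \<open>x n\<close> to \<open>y n\<close> near \<open>p\<close>, and the image path would keep a
  fixed angular extent while \<psi> is uniformly close to \<open>p\<close> on it. Koebe's bound then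
  gives \<open>\<psi> 0 = p\<close>, which is impossible because \<open>p\<close> is not inside
  \<open>J\<close>.\<close>

lemma riemann_map_cluster_unique:
  assumes J: "simple_closed_curve J"
    and phi: "\<phi> holomorphic_on inside J" "\<psi> holomorphic_on ball 0 1"
      "\<And>z. z \<in> inside J \<Longrightarrow> \<phi> z \<in> ball 0 1 \<and> \<psi> (\<phi> z) = z"
      "\<And>z. z \<in> ball 0 1 \<Longrightarrow> \<psi> z \<in> inside J \<and> \<phi> (\<psi> z) = z"
    and p: "p \<in> J" and x: "\<And>n. x n \<in> inside J" "x \<longlonglongrightarrow> p" "(\<lambda>n. \<phi> (x n)) \<longlonglongrightarrow> \<alpha>"
    and y: "\<And>n. y n \<in> inside J" "y \<longlonglongrightarrow> p" "(\<lambda>n. \<phi> (y n)) \<longlonglongrightarrow> \<beta>"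
    and unit: "cmod \<alpha> = 1" "cmod \<beta> = 1"
  shows "\<alpha> = \<beta>"
proof (rule ccontr)
  assume ne: "\<alpha> \<noteq> \<beta>"
  \<comment> \<open>Rotation by \<open>c\<close> makes \<alpha> and \<beta> conjugate to each other,
    with imaginary parts \<open>2 * s\<close> and \<open>- 2 * s\<close>, so that image paths have
    to pass from a height above \<open>s\<close> to one below 0.\<close>
  define c where "c = \<i> * cnj (\<alpha> - \<beta>) / of_real (cmod (\<alpha> - \<beta>))"
  define s where "s = cmod (\<alpha> - \<beta>) / 4"
  have s: "0 < s" using ne by (simp add: s_def)
  have c1: "cmod c = 1" using ne by (simp add: c_def norm_divide norm_mult del: complex_cnj_diff)
  have "Im (c * (\<alpha> - \<beta>)) = 4 * s"
  proof -
    have "c * (\<alpha> - \<beta>) = \<i> * ((\<alpha> - \<beta>) * cnj (\<alpha> - \<beta>)) / of_real (cmod (\<alpha> - \<beta>))"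
      by (simp add: c_def)
    also have "\<dots> = \<i> * of_real (cmod (\<alpha> - \<beta>))"
      unfolding complex_norm_square[symmetric] using ne by (simp add: power2_eq_square)
    finally show ?thesis by (simp add: s_def)
  qed
  moreover have "Im (c * (\<alpha> + \<beta>)) = 0"
  proof -
    have "cnj \<alpha> * \<alpha> = 1" "cnj \<beta> * \<beta> = 1"
      using unit complex_norm_square[of \<alpha>] complex_norm_square[of \<beta>] by (simp_all add: mult.commute)
    then have "cnj (\<alpha> - \<beta>) * (\<alpha> + \<beta>) = cnj \<alpha> * \<beta> - cnj (cnj \<alpha> * \<beta>)"
      by (simp add: algebra_simps)
    then have "Re (cnj (\<alpha> - \<beta>) * (\<alpha> + \<beta>)) = 0" by simp
    moreover have "c * (\<alpha> + \<beta>) = \<i> * (cnj (\<alpha> - \<beta>) * (\<alpha> + \<beta>)) / of_real (cmod (\<alpha> - \<beta>))"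
      by (simp add: c_def)
    ultimately show ?thesis by (simp only: Im_divide_of_real) simp
  qed
  ultimately have ca: "Im (c * \<alpha>) = 2 * s" and cb: "Im (c * \<beta>) = - 2 * s" by (simp_all add: algebra_simps)
  have c0: "c \<noteq> 0" using c1 by auto
  \<comment> \<open>\<open>m\<close> depends only on \<alpha> and \<beta>, not on \<epsilon>. It is
    even, as \<open>Re_power_sector\<close> requires, and so large that the ray at angle pi/m runs
    below height \<open>s\<close> in the unit disc.\<close>
  obtain N :: nat where N: "pi / s < real N" using reals_Archimedean2 by blast
  define m where "m = 2 * Suc N"
  have m: "even m" "0 < m" by (auto simp: m_def)
  have sinm: "sin (pi / m) \<le> s" "0 < sin (pi / m)"
  proof -
    have "pi < s * real N" using N s by (simp add: field_simps)
    also have "s * real N \<le> s * real m" using s by (intro mult_left_mono) (auto simp: m_def)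
    finally have "pi / m \<le> s" using m by (simp add: pos_divide_le_eq)
    then show "sin (pi / m) \<le> s" using sin_x_le_x[of "pi / m"] by simp
    show "0 < sin (pi / m)" using m pi_gt_zero by (intro sin_gt_zero) (auto simp: field_simps m_def add_pos_nonneg)
  qed
  define f where "f z = \<psi> (z / c) - p" for z
  have zc: "z / c \<in> ball 0 1 \<longleftrightarrow> z \<in> ball 0 1" for z using c1 by (simp add: norm_divide)
  have fhol: "f holomorphic_on ball 0 1"
  proof -
    have "(\<psi> \<circ> (\<lambda>z. z / c)) holomorphic_on ball 0 1"
      by (rule holomorphic_on_compose_gen[OF _ phi(2)]) (use zc c0 in \<open>auto intro!: holomorphic_intros\<close>)
    then show ?thesis unfolding f_def by (auto simp: o_def intro: holomorphic_intros)
  qed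
  obtain M0 where M0: "\<And>z. z \<in> inside J \<Longrightarrow> cmod z \<le> M0"
    using jordan_facts(7)[OF J] bounded_iff by metis
  define M where "M = M0 + cmod p"
  have M: "cmod (f z) \<le> M" if "z \<in> ball 0 1" for z
    using M0[of "\<psi> (z/c)"] phi(4)[of "z/c"] zc that norm_triangle_ineq4[of "\<psi> (z/c)" p]
    by (auto simp: f_def M_def)
  have f0: "f 0 \<noteq> 0" using phi(4)[of 0] p jordan_facts(11)[OF J] by (auto simp: f_def)
  have main: "cmod (f 0) ^ (2*m) \<le> \<epsilon> * M ^ (2*m - 1)" if e: "0 < \<epsilon>" "\<epsilon> < cmod (f 0)" for \<epsilon>
  proof -
    obtain d where d: "d > 0" "\<And>w w'. w \<in> inside J \<inter> ball p d \<Longrightarrow> w' \<in> inside J \<inter> ball p d \<Longrightarrow>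
       connected_component (inside J \<inter> ball p \<epsilon>) w w'"
      using jordan_inside_uniformly_locally_connected[OF J p e(1)] by blast
    have "\<forall>\<^sub>F n in sequentially. dist (x n) p < d" using x(2) d(1) by (rule tendstoD)
    moreover have "\<forall>\<^sub>F n in sequentially. dist (y n) p < d" using y(2) d(1) by (rule tendstoD)
    moreover have "(\<lambda>n. Im (c * \<phi> (x n))) \<longlonglongrightarrow> Im (c * \<alpha>)" by (intro tendsto_intros x)
    then have "\<forall>\<^sub>F n in sequentially. s < Im (c * \<phi> (x n))" by (rule order_tendstoD) (use ca s in auto)
    moreover have "(\<lambda>n. Im (c * \<phi> (y n))) \<longlonglongrightarrow> Im (c * \<beta>)" by (intro tendsto_intros y)
    then have "\<forall>\<^sub>F n in sequentially. Im (c * \<phi> (y n)) < 0" by (rule order_tendstoD) (use cb s in auto)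
    ultimately have "\<forall>\<^sub>F n in sequentially. dist (x n) p < d \<and> dist (y n) p < d \<and>
        s < Im (c * \<phi> (x n)) \<and> Im (c * \<phi> (y n)) < 0" by eventually_elim auto
    then obtain n where n: "dist (x n) p < d" "dist (y n) p < d"
        "s < Im (c * \<phi> (x n))" "Im (c * \<phi> (y n)) < 0"
      using eventually_happens'[OF sequentially_bot] by blast
    have "connected_component (inside J \<inter> ball p \<epsilon>) (x n) (y n)"
      by (rule d(2)) (use n x y in \<open>auto simp: dist_commute\<close>)
    then have "path_component (inside J \<inter> ball p \<epsilon>) (x n) (y n)"
      by (simp add: open_path_connected_component open_Int jordan_facts(4)[OF J])
    then obtain \<eta> where eta: "path \<eta>" "path_image \<eta> \<subseteq> inside J \<inter> ball p \<epsilon>" "pathstart \<eta> = x n" "pathfinish \<eta> = y n"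
      by (auto simp: path_component_def)
    define g where "g t = c * \<phi> (\<eta> t)" for t
    have et: "\<eta> t \<in> inside J" "dist p (\<eta> t) < \<epsilon>" if "t \<in> {0..1}" for t
    proof -
      have "\<eta> t \<in> path_image \<eta>" using that by (simp add: path_image_def)
      then have "\<eta> t \<in> inside J \<inter> ball p \<epsilon>" using eta(2) by blast
      then show "\<eta> t \<in> inside J" "dist p (\<eta> t) < \<epsilon>" by auto
    qed
    have cg: "continuous_on {0..1} g" unfolding g_def
      by (intro continuous_intros continuous_on_compose2[OF holomorphic_on_imp_continuous_on[OF phi(1)]])
        (use eta et in \<open>auto simp: path_def\<close>)
    have gb: "cmod (g t) < 1" "f (g t) = \<eta> t - p" if "t \<in> {0..1}" for t
      using phi(3)[OF et(1)[OF that]] c1 c0 by (auto simp: g_def norm_mult f_def)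
    have ge: "cmod (f (g t)) \<le> \<epsilon>" if "t \<in> {0..1}" for t
      using gb(2)[OF that] et(2)[OF that] by (simp add: dist_norm norm_minus_commute)
    have g0: "g t \<noteq> 0" if "t \<in> {0..1}" for t by (rule notI) (use ge[OF that] e in simp)
    \<comment> \<open>\<open>h\<close> is the sine of the argument. It passes from at least
      sin(pi/m) to at most 0, so the intermediate value theorem yields the two ends that Koebe's
      bound asks for.\<close>
    define h where "h t = Im (g t) / cmod (g t)" for t
    have ch: "continuous_on {0..1} h" unfolding h_def using g0 by (intro continuous_intros cg) auto
    have h01: "h 0 \<ge> sin (pi / m)" "h 1 \<le> 0"
    proof -
      have "s < Im (g 0)" using n(3) eta(3) by (simp add: g_def pathstart_def)
      also have "Im (g 0) \<le> h 0"
        using gb(1)[of 0] g0[of 0] \<open>s < Im (g 0)\<close> s by (simp add: h_def pos_le_divide_eq mult_left_le)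
      finally show "h 0 \<ge> sin (pi / m)" using sinm by simp
      show "h 1 \<le> 0" using n(4) eta(4) by (simp add: h_def g_def pathfinish_def divide_nonpos_nonneg)
    qed
    obtain t1 where t1: "0 \<le> t1" "t1 \<le> 1" "h t1 = sin (pi / m)"
      using IVT2'[of h 1 "sin (pi/m)" 0] h01 sinm ch by auto
    obtain t2 where t2: "0 \<le> t2" "t2 \<le> 1" "h t2 = 0"
      using IVT2'[of h 1 0 0] h01 sinm ch by auto
    define \<gamma> where "\<gamma> = subpath t1 t2 g"
    have pg: "path g" using cg by (simp add: path_def)
    have sub: "path_image \<gamma> \<subseteq> g ` {0..1}"
      using path_image_subpath_subset[of t1 t2 g] t1 t2 by (simp add: \<gamma>_def path_image_def)
    show ?thesis
    proof (rule koebe_bound[OF fhol M m(2)])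
      show "path \<gamma>" using path_subpath[OF pg] t1 t2 by (simp add: \<gamma>_def)
      show "path_image \<gamma> \<subseteq> ball 0 1 - {0}" using sub gb g0 by auto
      show "cmod (f z) \<le> \<epsilon>" if "z \<in> path_image \<gamma>" for z using sub ge that by auto
      show "Re (pathstart \<gamma> ^ m) = - (cmod (pathstart \<gamma>) ^ m)"
        by (rule Re_power_sector[OF m]) (use t1 g0 in \<open>auto simp: \<gamma>_def h_def field_simps\<close>)
      show "Re (pathfinish \<gamma> ^ m) = cmod (pathfinish \<gamma>) ^ m"
        by (rule Re_power_real[OF m(1)]) (use t2 g0 in \<open>auto simp: \<gamma>_def h_def field_simps\<close>)
    qed
  qed
  have "M > 0" using f0 M[of 0] by (smt (verit) centre_in_ball zero_less_norm_iff)
  define k where "k = cmod (f 0) ^ (2*m) / M ^ (2*m - 1)"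
  have "k > 0" using f0 \<open>M > 0\<close> by (simp add: k_def)
  define \<epsilon> where "\<epsilon> = min (k / 2) (cmod (f 0) / 2)"
  have "0 < \<epsilon>" "\<epsilon> < cmod (f 0)" "\<epsilon> < k" using \<open>k > 0\<close> f0 by (auto simp: \<epsilon>_def min_def)
  then have "k * M ^ (2*m - 1) \<le> \<epsilon> * M ^ (2*m - 1)" using main[of \<epsilon>] \<open>M > 0\<close> by (simp add: k_def)
  then show False using \<open>\<epsilon> < k\<close> \<open>M > 0\<close> by simp
qed

text \<open>A limit in the open disc is excluded, since continuity of \<psi> would give
  \<open>p = \<psi> \<alpha>\<close>, a point inside \<open>J\<close>.\<close>

lemma riemann_map_frontier:
  assumes J: "simple_closed_curve J"
    and phi: "\<psi> holomorphic_on ball 0 1"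
      "\<And>z. z \<in> inside J \<Longrightarrow> \<phi> z \<in> ball 0 1 \<and> \<psi> (\<phi> z) = z"
      "\<And>z. z \<in> ball 0 1 \<Longrightarrow> \<psi> z \<in> inside J"
    and p: "p \<in> J" and x: "\<And>n. x n \<in> inside J" "x \<longlonglongrightarrow> p" "(\<lambda>n. \<phi> (x n)) \<longlonglongrightarrow> \<alpha>"
  shows "cmod \<alpha> = 1"
proof -
  have "\<alpha> \<in> cball 0 1"
    by (rule closed_sequentially[OF closed_cball _ x(3)]) (use phi(2)[OF x(1)] less_imp_le in auto)
  moreover have "\<not> cmod \<alpha> < 1"
  proof
    assume a: "cmod \<alpha> < 1"
    have "isCont \<psi> \<alpha>"
      using holomorphic_on_imp_continuous_on[OF phi(1)] a by (simp add: continuous_on_eq_continuous_at)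
    then have "(\<lambda>n. \<psi> (\<phi> (x n))) \<longlonglongrightarrow> \<psi> \<alpha>" using x(3) by (rule isCont_tendsto_compose)
    then have "x \<longlonglongrightarrow> \<psi> \<alpha>" using phi(2)[OF x(1)] by simp
    then have "p = \<psi> \<alpha>" using x(2) LIMSEQ_unique by blast
    then show False using phi(3)[of \<alpha>] a p jordan_facts(11)[OF J] by auto
  qed
  ultimately show ?thesis by simp
qed

text \<open>Uniform continuity is what extends \<phi> to the closure. If it fails, compactness
  yields two sequences with a common limit whose images have different limits: continuity excludes a
  limit inside \<open>J\<close>, uniqueness of cluster values excludes one on
  \<open>J\<close>.\<close>

lemma riemann_map_uniformly_continuous:
  assumes J: "simple_closed_curve J"
    and phi: "\<phi> holomorphic_on inside J" "\<psi> holomorphic_on ball 0 1"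
      "\<And>z. z \<in> inside J \<Longrightarrow> \<phi> z \<in> ball 0 1 \<and> \<psi> (\<phi> z) = z"
      "\<And>z. z \<in> ball 0 1 \<Longrightarrow> \<psi> z \<in> inside J \<and> \<phi> (\<psi> z) = z"
  shows "uniformly_continuous_on (inside J) \<phi>"
proof (rule ccontr)
  assume "\<not> ?thesis"
  then obtain e where e: "e > 0" "\<And>d. d > 0 \<Longrightarrow> \<exists>x\<in>inside J. \<exists>y\<in>inside J. dist x y < d \<and> \<not> dist (\<phi> x) (\<phi> y) < e"
    unfolding uniformly_continuous_on_def by (metis dist_commute)
  have "\<forall>n. \<exists>x y. x \<in> inside J \<and> y \<in> inside J \<and> dist x y < inverse (real (Suc n)) \<and> \<not> dist (\<phi> x) (\<phi> y) < e"
    using e(2) by (metis inverse_positive_iff_positive of_nat_0_less_iff zero_less_Suc)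
  then obtain x y where xy: "\<And>n. x n \<in> inside J" "\<And>n. y n \<in> inside J"
      "\<And>n. dist (x n) (y n) < inverse (real (Suc n))" "\<And>n. \<not> dist (\<phi> (x n)) (\<phi> (y n)) < e"
    by metis
  define K where "K = (J \<union> inside J) \<times> cball (0::complex) 1 \<times> cball (0::complex) 1"
  have "compact K" unfolding K_def by (intro compact_Times jordan_facts(15)[OF J] compact_cball)
  moreover have "(x n, \<phi> (x n), \<phi> (y n)) \<in> K" for n
    using xy(1,2)[of n] phi(3)[of "x n"] phi(3)[of "y n"] by (auto simp: K_def)
  ultimately obtain l r where l: "l \<in> K" "strict_mono r" "((\<lambda>n. (x n, \<phi> (x n), \<phi> (y n))) \<circ> r) \<longlonglongrightarrow> l"
    unfolding compact_def by (metis (mono_tags, lifting))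
  obtain p \<alpha> \<beta> where pab: "l = (p, \<alpha>, \<beta>)" by (cases l) auto
  have lx: "(\<lambda>n. x (r n)) \<longlonglongrightarrow> p" and la: "(\<lambda>n. \<phi> (x (r n))) \<longlonglongrightarrow> \<alpha>" and lb: "(\<lambda>n. \<phi> (y (r n))) \<longlonglongrightarrow> \<beta>"
    using tendsto_fst[OF l(3)] tendsto_fst[OF tendsto_snd[OF l(3)]] tendsto_snd[OF tendsto_snd[OF l(3)]]
    by (simp_all add: pab o_def)
  have "(\<lambda>n. dist (x n) (y n)) \<longlonglongrightarrow> 0"
    by (rule real_tendsto_sandwich[OF _ _ tendsto_const LIMSEQ_inverse_real_of_nat])
      (use xy(3) less_imp_le in \<open>auto intro!: always_eventually\<close>)
  then have "(\<lambda>n. dist (x (r n)) (y (r n))) \<longlonglongrightarrow> 0"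
    using LIMSEQ_subseq_LIMSEQ[OF _ l(2)] by (force simp: o_def)
  then have "(\<lambda>n. x (r n) - y (r n)) \<longlonglongrightarrow> 0" by (simp add: dist_norm tendsto_norm_zero_iff)
  then have ly: "(\<lambda>n. y (r n)) \<longlonglongrightarrow> p" by (rule Lim_transform2[OF lx])
  have "(\<lambda>n. dist (\<phi> (x (r n))) (\<phi> (y (r n)))) \<longlonglongrightarrow> dist \<alpha> \<beta>" by (intro tendsto_dist la lb)
  then have "e \<le> dist \<alpha> \<beta>" by (rule tendsto_lowerbound) (use xy(4) in \<open>auto intro!: always_eventually simp: not_less\<close>)
  then have ne: "\<alpha> \<noteq> \<beta>" using e(1) by auto
  have "p \<in> J \<union> inside J" using l(1) by (simp add: K_def pab)
  then show False
  proof
    assume p: "p \<in> inside J"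
    have "isCont \<phi> p"
      using holomorphic_on_imp_continuous_on[OF phi(1)] p jordan_facts(4)[OF J]
      by (simp add: continuous_on_eq_continuous_at)
    then have "\<alpha> = \<phi> p" "\<beta> = \<phi> p"
      using isCont_tendsto_compose[OF _ lx] isCont_tendsto_compose[OF _ ly] la lb LIMSEQ_unique by blast+
    then show False using ne by simp
  next
    assume p: "p \<in> J"
    have "cmod \<alpha> = 1" by (rule riemann_map_frontier[OF J phi(2,3) _ p _ lx la]) (use phi xy in auto)
    moreover have "cmod \<beta> = 1" by (rule riemann_map_frontier[OF J phi(2,3) _ p _ ly lb]) (use phi xy in auto)
    ultimately show False
      using riemann_map_cluster_unique[OF J phi p _ lx la _ ly lb] xy ne by blast
  qed
qed

text \<open>The fibre of a boundary value \<zeta> is connected, being a decreasing intersection of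
  continua, so with two points it contains a whole arc of \<open>J\<close>. A constant value on an
  arc would be attained inside by \<open>lindelof_boundary_value\<close>, but \<phi> has modulus
  less than 1 there.\<close>

lemma riemann_map_boundary_inj:
  assumes J: "simple_closed_curve J"
    and phi: "\<phi> holomorphic_on inside J" "\<psi> holomorphic_on ball 0 1"
      "\<And>z. z \<in> inside J \<Longrightarrow> \<phi> z \<in> ball 0 1 \<and> \<psi> (\<phi> z) = z"
      "\<And>z. z \<in> ball 0 1 \<Longrightarrow> \<psi> z \<in> inside J \<and> \<phi> (\<psi> z) = z"
    and g: "continuous_on (J \<union> inside J) g" "\<And>z. z \<in> inside J \<Longrightarrow> g z = \<phi> z"
      "\<And>z. z \<in> J \<Longrightarrow> cmod (g z) = 1"
    and pq: "p \<in> J" "q \<in> J" "g p = g q"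
  shows "p = q"
proof (rule ccontr)
  assume ne: "p \<noteq> q"
  define \<zeta> where "\<zeta> = g p"
  have z1: "cmod \<zeta> = 1" using g(3) pq by (simp add: \<zeta>_def)
  \<comment> \<open>Caps of the disc shrinking to \<zeta>. They are convex, so the closures of their
    images are connected.\<close>
  define S where "S n = ball 0 1 \<inter> {z. Re (z * cnj \<zeta>) > 1 - inverse (real (Suc n))}" for n
  define K where "K n = closure (\<psi> ` S n)" for n
  define Z where "Z = {z \<in> J. g z = \<zeta>}"
  have hs: "{z. Re (z * cnj \<zeta>) > a} = {z. inner \<zeta> z > a}" for a
    by (auto simp: inner_complex_def algebra_simps)
  have convS: "convex (S n)" for n
    unfolding S_def hs by (intro convex_Int convex_ball convex_halfspace_gt)
  have SnS: "S n \<subseteq> S m" if "m \<le> n" for m n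
    using that by (auto simp: S_def) (smt (verit) inverse_le_iff_le of_nat_0_le_iff of_nat_mono)
  have psiS: "\<psi> ` S n \<subseteq> inside J" for n using phi(4) by (auto simp: S_def)
  have KJ: "K n \<subseteq> J \<union> inside J" for n
    unfolding K_def using closure_mono[OF psiS[of n]] jordan_facts(10)[OF J] by simp
  have "connected (\<Inter> (range K))"
  proof (rule connected_nest)
    show "compact (K n)" for n
      unfolding K_def using bounded_subset[OF jordan_facts(7)[OF J] psiS] compact_closure by blast
    show "connected (K n)" for n unfolding K_def
      by (intro connected_imp_connected_closure connected_continuous_image convex_connected convS
        continuous_on_subset[OF holomorphic_on_imp_continuous_on[OF phi(2)]]) (auto simp: S_def)
    show "K n \<subseteq> K m" if "m \<le> n" for m n
      unfolding K_def by (intro closure_mono image_mono SnS that)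
  qed
  moreover have "\<Inter> (range K) = Z"
  proof (intro equalityI subsetI)
    fix x assume x: "x \<in> \<Inter> (range K)"
    then have xJ: "x \<in> J \<union> inside J" using KJ[of 0] by auto
    have gx: "cmod (g x) \<le> 1 \<and> Re (g x * cnj \<zeta>) \<ge> 1 - inverse (real (Suc n))" for n
    proof -
      have "g ` closure (\<psi> ` S n) \<subseteq> cball 0 1 \<inter> {z. inner \<zeta> z \<ge> 1 - inverse (real (Suc n))}"
      proof (rule image_closure_subset)
        show "continuous_on (closure (\<psi> ` S n)) g" using g(1) KJ[of n] continuous_on_subset by (auto simp: K_def)
        show "closed (cball 0 1 \<inter> {z. inner \<zeta> z \<ge> 1 - inverse (real (Suc n))})"
          by (intro closed_Int closed_cball closed_halfspace_ge)
        show "g ` \<psi> ` S n \<subseteq> cball 0 1 \<inter> {z. inner \<zeta> z \<ge> 1 - inverse (real (Suc n))}"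
          using g(2) phi(4) by (auto simp: S_def inner_complex_def algebra_simps)
      qed
      moreover have "g x \<in> g ` closure (\<psi> ` S n)" using x by (auto simp: K_def)
      ultimately have "g x \<in> cball 0 1 \<inter> {z. inner \<zeta> z \<ge> 1 - inverse (real (Suc n))}" by blast
      then show ?thesis by (auto simp: inner_complex_def algebra_simps)
    qed
    \<comment> \<open>In the closed unit disc only \<zeta> itself satisfies this.\<close>
    have "Re (g x * cnj \<zeta>) \<ge> 1"
    proof (rule LIMSEQ_le_const2)
      show "(\<lambda>n. 1 - inverse (real (Suc n))) \<longlonglongrightarrow> 1"
        using tendsto_diff[OF tendsto_const[of 1] LIMSEQ_inverse_real_of_nat] by simp
    qed (use gx in auto)
    moreover have "(cmod (g x - \<zeta>))^2 = (cmod (g x))^2 + (cmod \<zeta>)^2 - 2 * Re (g x * cnj \<zeta>)"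
      by (simp only: cmod_power2) (simp add: power2_eq_square algebra_simps)
    moreover have "(cmod (g x))^2 \<le> 1" using gx by (simp add: power_le_one)
    ultimately have "(cmod (g x - \<zeta>))^2 \<le> 0" using z1 by simp
    then have "g x = \<zeta>" by simp
    moreover have "x \<notin> inside J" using g(2)[of x] phi(3)[of x] z1 \<open>g x = \<zeta>\<close> by auto
    ultimately show "x \<in> Z" using xJ by (simp add: Z_def)
  next
    fix x assume x: "x \<in> Z"
    have "x \<in> closure (inside J)" using x jordan_facts(10)[OF J] by (simp add: Z_def)
    then obtain w where w: "\<And>n. w n \<in> inside J" "w \<longlonglongrightarrow> x" by (auto simp: closure_sequential)
    have "(\<lambda>n. g (w n)) \<longlonglongrightarrow> g x"
      by (rule continuous_on_tendsto_compose[OF g(1) w(2)]) (use x w Z_def in auto)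
    then have l: "(\<lambda>n. \<phi> (w n)) \<longlonglongrightarrow> \<zeta>" using x w g(2) by (simp add: Z_def)
    have "x \<in> K n" for n
    proof -
      have "(\<lambda>k. Re (\<phi> (w k) * cnj \<zeta>)) \<longlonglongrightarrow> Re (\<zeta> * cnj \<zeta>)" by (intro tendsto_intros l)
      moreover have "Re (\<zeta> * cnj \<zeta>) = 1" using z1 complex_norm_square[of \<zeta>] by (metis Re_complex_of_real one_power2)
      ultimately have "\<forall>\<^sub>F k in sequentially. Re (\<phi> (w k) * cnj \<zeta>) > 1 - inverse (real (Suc n))"
        by (intro order_tendstoD) auto
      then obtain k0 where "\<And>k. k \<ge> k0 \<Longrightarrow> Re (\<phi> (w k) * cnj \<zeta>) > 1 - inverse (real (Suc n))"
        unfolding eventually_sequentially by blast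
      then have ws: "w (k + k0) \<in> \<psi> ` S n" for k
        using phi(3)[OF w(1)] by (intro image_eqI[of _ _ "\<phi> (w (k + k0))"]) (auto simp: S_def)
      moreover have "(\<lambda>k. w (k + k0)) \<longlonglongrightarrow> x" using w(2) by (rule LIMSEQ_ignore_initial_segment)
      ultimately show ?thesis unfolding K_def closure_sequential
        by (intro exI[of _ "\<lambda>k. w (k + k0)"] conjI allI ws)
    qed
    then show "x \<in> \<Inter> (range K)" by auto
  qed
  ultimately have conZ: "connected Z" by simp
  obtain h where h: "simple_path h" "path_image h = J" "h 0 = p" "h 1 = p"
    using loop_starting_at[OF J pq(1)] by metis
  have ch: "continuous_on {0..1} h" using h(1) by (simp add: simple_path_def path_def)
  obtain s where s: "s \<in> {0..1}" "h s = q" using pq h(2) by (auto simp: path_image_def)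
  have s01: "0 < s" "s < 1" using s h ne by (metis atLeastAtMost_iff order_le_less)+
  have hJ: "h t \<in> J" if "t \<in> {0..1}" for t using h(2) that by (auto simp: path_image_def)
  have pZ: "p \<in> Z" "q \<in> Z" using pq by (auto simp: Z_def \<zeta>_def)
  \<comment> \<open>If \<open>Z\<close> missed a point of each of the two arcs from \<open>p\<close>
    to \<open>q\<close>, cutting \<open>J\<close> at these points would separate \<open>p\<close>
    from \<open>q\<close> within \<open>Z\<close>.\<close>
  have "h ` {0..s} \<subseteq> Z \<or> h ` {s..1} \<subseteq> Z"
  proof (rule ccontr)
    assume "\<not> ?thesis"
    then obtain a b where ab: "a \<in> {0..s}" "h a \<notin> Z" "b \<in> {s..1}" "h b \<notin> Z"
      unfolding image_subset_iff by blast
    have ab1: "0 < a" "a < s" "s < b" "b < 1" using ab pZ s h by (metis atLeastAtMost_iff order_le_less)+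
    define A B where "A = h ` {a..b}" and "B = h ` {0..a} \<union> h ` {b..1}"
    have "compact A" "compact B" unfolding A_def B_def
      using ab1 s01 by (auto intro!: compact_Un compact_continuous_image continuous_on_subset[OF ch])
    moreover have "Z \<subseteq> A \<union> B"
    proof
      fix z assume "z \<in> Z"
      then obtain t where "t \<in> {0..1}" "z = h t" using h(2) by (auto simp: Z_def path_image_def)
      then show "z \<in> A \<union> B" by (cases "t < a"; cases "t > b") (auto simp: A_def B_def)
    qed
    moreover have "A \<inter> B \<inter> Z = {}"
    proof (rule ccontr)
      assume "A \<inter> B \<inter> Z \<noteq> {}"
      then obtain t t' where t: "t \<in> {a..b}" "t' \<in> {0..a} \<union> {b..1}" "h t = h t'" "h t \<in> Z"
        by (auto simp: A_def B_def) metis+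
      then have "t = t'" using simple_path_eqD[OF h(1), of t t'] ab1 by auto
      then show False using t ab by auto
    qed
    moreover have "q \<in> A \<inter> Z" "p \<in> B \<inter> Z" using pZ s ab1 h(3) by (auto simp: A_def B_def)
    ultimately show False
      using connected_closedD[OF conZ, of A B] compact_imp_closed by blast
  qed
  \<comment> \<open>\<open>I\<close> parametrizes the other arc, and \<open>h t0\<close> is a point
    off it, so that near \<open>h t0\<close> the curve lies in \<open>Z\<close>.\<close>
  then obtain t0 I where t0: "t0 \<in> {0..1}" "h t0 \<notin> h ` I" "compact I" "I \<subseteq> {0..1}" "h ` ({0..1} - I) \<subseteq> Z"
  proof
    assume a: "h ` {0..s} \<subseteq> Z"
    show thesis
    proof (rule that[of "s/2" "{s..1}"])
      show "h (s/2) \<notin> h ` {s..1}"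
      proof
        assume "h (s/2) \<in> h ` {s..1}"
        then obtain t where "t \<in> {s..1}" "h (s/2) = h t" by blast
        then show False using simple_path_eqD[OF h(1), of "s/2" t] s01 by auto
      qed
      show "h ` ({0..1} - {s..1}) \<subseteq> Z" using a by (force simp: subset_iff)
    qed (use s01 in auto)
  next
    assume a: "h ` {s..1} \<subseteq> Z"
    show thesis
    proof (rule that[of "(s+1)/2" "{0..s}"])
      show "h ((s+1)/2) \<notin> h ` {0..s}"
      proof
        assume "h ((s+1)/2) \<in> h ` {0..s}"
        then obtain t where "t \<in> {0..s}" "h ((s+1)/2) = h t" by blast
        then show False using simple_path_eqD[OF h(1), of "(s+1)/2" t] s01 by auto
      qed
      show "h ` ({0..1} - {0..s}) \<subseteq> Z" using a by (force simp: subset_iff)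
    qed (use s01 in auto)
  qed
  have "compact (h ` I)" using t0 by (auto intro: compact_continuous_image continuous_on_subset[OF ch])
  then obtain r where r: "r > 0" "ball (h t0) r \<inter> h ` I = {}"
    using open_contains_ball[of "- h ` I"] t0(2) by (auto simp: open_Compl compact_imp_closed) blast
  obtain w where w: "w \<in> inside J" "g w = \<zeta>"
  proof (rule lindelof_boundary_value[of "inside J" g "h t0" r \<zeta>])
    show "open (inside J)" "bounded (inside J)" using jordan_facts[OF J] by auto
    show "continuous_on (closure (inside J)) g" using g(1) jordan_facts(10)[OF J] by simp
    show "g holomorphic_on inside J" using phi(1) g(2) by (metis holomorphic_transform)
    show "h t0 \<in> closure (inside J)" using hJ[OF t0(1)] jordan_facts(10)[OF J] by simp
    have "outside J \<subseteq> - closure (inside J)"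
      using outside_no_overlap[of J] jordan_facts(10,13)[OF J] by blast
    moreover have "h t0 \<in> closure (outside J)"
      using hJ[OF t0(1)] jordan_facts(9)[OF J] by (auto simp: frontier_def)
    ultimately show "h t0 \<in> closure (- closure (inside J))" using closure_mono by blast
    fix z assume z: "z \<in> frontier (inside J) \<inter> ball (h t0) r"
    then obtain t where "t \<in> {0..1}" "z = h t" using jordan_facts(8)[OF J] h(2) by (auto simp: path_image_def)
    then have "z \<in> Z" using z r(2) t0(5) by (cases "t \<in> I") auto
    then show "g z = \<zeta>" by (simp add: Z_def)
  qed (use r in auto)
  then show False using g(2)[of w] phi(3)[of w] z1 by auto
qed

theorem schoenflies_disc:
  assumes J: "simple_closed_curve J"
  obtains f k where "homeomorphism (J \<union> inside J) (cball (0::complex) 1) f k" "f ` J = sphere 0 1"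
proof -
  have nU: "inside J \<noteq> UNIV" using jordan_facts(7)[OF J] not_bounded_UNIV by metis
  have "\<exists>f g. f holomorphic_on inside J \<and> g holomorphic_on ball 0 1 \<and>
      (\<forall>z\<in>inside J. f z \<in> ball 0 1 \<and> g (f z) = z) \<and> (\<forall>z\<in>ball 0 1. g z \<in> inside J \<and> f (g z) = z)"
    using Riemann_mapping_theorem[of "inside J"] jordan_facts(4,6,14)[OF J] nU by meson
  then obtain \<phi> \<psi> where phi: "\<phi> holomorphic_on inside J" "\<psi> holomorphic_on ball 0 1"
      "\<And>z. z \<in> inside J \<Longrightarrow> \<phi> z \<in> ball 0 1 \<and> \<psi> (\<phi> z) = z"
      "\<And>z. z \<in> ball 0 1 \<Longrightarrow> \<psi> z \<in> inside J \<and> \<phi> (\<psi> z) = z"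
    by blast
  obtain g where g: "uniformly_continuous_on (closure (inside J)) g" "\<And>z. z \<in> inside J \<Longrightarrow> \<phi> z = g z"
    using uniformly_continuous_on_extension_on_closure[OF riemann_map_uniformly_continuous[OF J phi]] by metis
  define D where "D = J \<union> inside J"
  have clD: "closure (inside J) = D" using jordan_facts(10)[OF J] by (simp add: D_def)
  have cg: "continuous_on D g" using uniformly_continuous_imp_continuous[OF g(1)] clD by simp
  have gJ: "cmod (g p) = 1" if p: "p \<in> J" for p
  proof -
    have "p \<in> closure (inside J)" using p jordan_facts(10)[OF J] by simp
    then obtain w where w: "\<And>n. w n \<in> inside J" "w \<longlonglongrightarrow> p" by (auto simp: closure_sequential)
    have "(\<lambda>n. g (w n)) \<longlonglongrightarrow> g p"
      by (rule continuous_on_tendsto_compose[OF cg w(2)]) (use p w D_def in auto)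
    then have "(\<lambda>n. \<phi> (w n)) \<longlonglongrightarrow> g p" using w g(2) by simp
    then show ?thesis by (intro riemann_map_frontier[OF J phi(2,3) _ p w]) (use phi in auto)
  qed
  have gi: "cmod (g z) < 1" if "z \<in> inside J" for z using phi(3)[OF that] g(2)[OF that] by simp
  have cD: "compact D" using jordan_facts(15)[OF J] by (simp add: D_def)
  have im: "g ` D = cball 0 1"
  proof
    show "g ` D \<subseteq> cball 0 1" using gJ gi by (force simp: D_def)
    have "ball 0 1 \<subseteq> g ` D"
    proof
      fix z :: complex assume "z \<in> ball 0 1"
      then show "z \<in> g ` D" using phi(4)[of z] g(2)[of "\<psi> z"] by (intro image_eqI[of _ _ "\<psi> z"]) (auto simp: D_def)
    qed
    moreover have "closed (g ` D)" using compact_continuous_image[OF cg cD] compact_imp_closed by blast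
    ultimately have "closure (ball 0 1) \<subseteq> g ` D" by (rule closure_minimal)
    then show "cball 0 1 \<subseteq> g ` D" by simp
  qed
  have inj: "inj_on g D"
  proof
    fix x y assume xy: "x \<in> D" "y \<in> D" "g x = g y"
    consider "x \<in> J" "y \<in> J" | "x \<in> inside J" "y \<in> inside J"
      using xy gJ gi unfolding D_def by (metis Un_iff less_irrefl)
    then show "x = y"
    proof cases
      case 1
      then show ?thesis
        using riemann_map_boundary_inj[OF J phi, of g x y] cg g(2) gJ xy by (auto simp: D_def)
    next
      case 2
      then show ?thesis using phi(3) g(2) xy by metis
    qed
  qed
  obtain k where k: "homeomorphism D (cball 0 1) g k"
    using homeomorphism_compact[OF cD cg im inj] by blast
  have "g ` J = sphere 0 1"
  proof
    show "g ` J \<subseteq> sphere 0 1" using gJ by auto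
    show "sphere 0 1 \<subseteq> g ` J"
    proof
      fix z :: complex assume z: "z \<in> sphere 0 1"
      then obtain x where "x \<in> D" "g x = z" using im by (metis image_iff sphere_cball subsetD)
      then show "z \<in> g ` J" using gi[of x] z by (auto simp: D_def)
    qed
  qed
  then show ?thesis using that[of g k] k by (simp add: D_def)
qed

section \<open>Schoenflies theorem and crosscuts\<close>

lemma homeomorphism_bij: "homeomorphism S T f g \<Longrightarrow> bij_betw f S T"
  by (auto simp: homeomorphism_def bij_betw_def intro: inj_on_inverseI)

text \<open>Homeomorphisms are handled here as continuous bijections. The condition
  \<open>im\<close> says that the images overlap no more than the domains do, which makes the union
  of the two injective maps injective.\<close>

lemma homeo_glue:
  fixes f g :: "complex \<Rightarrow> complex"
  assumes "closed S" "closed T" "continuous_on S f" "continuous_on T g"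
    "bij_betw f S S'" "bij_betw g T T'" and eq: "\<And>z. z \<in> S \<Longrightarrow> z \<in> T \<Longrightarrow> f z = g z"
    and im: "S' \<inter> T' \<subseteq> f ` (S \<inter> T)"
  obtains h where "continuous_on (S \<union> T) h" "bij_betw h (S \<union> T) (S' \<union> T')"
    "\<And>z. z \<in> S \<Longrightarrow> h z = f z" "\<And>z. z \<in> T \<Longrightarrow> h z = g z"
proof
  let ?h = "\<lambda>z. if z \<in> S then f z else g z"
  show "continuous_on (S \<union> T) ?h" using assms by (intro continuous_on_cases) auto
  show hS: "\<And>z. z \<in> S \<Longrightarrow> ?h z = f z" and hT: "\<And>z. z \<in> T \<Longrightarrow> ?h z = g z" using eq by auto
  have mixed: "x \<in> T" if "x \<in> S" "y \<in> T" "f x = g y" for x y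
  proof -
    have "f x \<in> S'" "f x \<in> T'" using assms(5,6) that bij_betwE by metis+
    then have "f x \<in> f ` (S \<inter> T)" using im by blast
    then obtain w where "w \<in> S \<inter> T" "f x = f w" by auto
    then show ?thesis using assms(5) that by (auto simp: bij_betw_def dest: inj_onD)
  qed
  have "inj_on ?h (S \<union> T)"
  proof (rule inj_onI)
    fix x y assume xy: "x \<in> S \<union> T" "y \<in> S \<union> T" "?h x = ?h y"
    have iS: "inj_on f S" and iT: "inj_on g T" using assms(5,6) by (auto simp: bij_betw_def)
    consider "x \<in> S" "y \<in> S" | "x \<in> T" "y \<in> T" | "x \<in> S" "y \<in> T" | "x \<in> T" "y \<in> S" using xy by auto
    then show "x = y"
    proof cases
      case 1 then show ?thesis using xy(3) iS by (auto dest: inj_onD)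
    next
      case 2 then show ?thesis using xy(3) iT hT by (metis inj_onD)
    next
      case 3
      then have "x \<in> T" using mixed[of x y] xy(3) hS hT by metis
      then show ?thesis using 3 xy(3) iT hT by (metis inj_onD)
    next
      case 4
      then have "y \<in> T" using mixed[of y x] xy(3) hS hT by metis
      then show ?thesis using 4 xy(3) iT hT by (metis inj_onD)
    qed
  qed
  moreover have "?h ` (S \<union> T) = S' \<union> T'"
  proof -
    have "?h ` (S \<union> T) = ?h ` S \<union> ?h ` T" by (rule image_Un)
    also have "?h ` S = f ` S" by (rule image_cong) auto
    also have "?h ` T = g ` T" by (rule image_cong) (use hT in auto)
    finally show ?thesis using assms(5,6) by (simp add: bij_betw_def)
  qed
  ultimately show "bij_betw ?h (S \<union> T) (S' \<union> T')" by (simp add: bij_betw_def)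
qed

lemma sphere_homeo_cone:
  fixes g :: "complex \<Rightarrow> complex"
  assumes "continuous_on (sphere 0 1) g" "bij_betw g (sphere 0 1) (sphere 0 1)"
  obtains G where "continuous_on (cball 0 1) G" "bij_betw G (cball 0 1) (cball 0 1)"
    "\<And>z. z \<in> sphere 0 1 \<Longrightarrow> G z = g z"
proof
  \<comment> \<open>The cone over \<open>g\<close>. At 0 the quotient is 0 / 0 = 0, but the factor
    \<open>cmod z\<close> makes the value 0 whatever \<open>g 0\<close> is; continuity there follows
    from \<open>cmod (G z) = cmod z\<close>.\<close>
  define G where "G z = cmod z *\<^sub>R g (z / of_real (cmod z))" for z
  have s: "z / of_real (cmod z) \<in> sphere 0 1" if "z \<noteq> 0" for z :: complex using that by (simp add: norm_divide)
  have g1: "cmod (g z) = 1" if "z \<in> sphere 0 1" for z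
    using assms(2) that by (auto simp: bij_betw_def)
  have Gn: "cmod (G z) = cmod z" for z
    using g1[OF s[of z]] by (cases "z = 0") (auto simp: G_def)
  have im: "(\<lambda>z. z / of_real (cmod z)) ` (- {0}) \<subseteq> sphere 0 1" using s by blast
  have c1: "continuous_on (- {0}) G"
    unfolding G_def by (intro continuous_intros continuous_on_compose2[OF assms(1) _ im]) auto
  show "continuous_on (cball 0 1) G"
    unfolding continuous_on_eq_continuous_within
  proof
    fix x :: complex assume "x \<in> cball 0 1"
    show "continuous (at x within cball 0 1) G"
    proof (cases "x = 0")
      case True
      have "(G \<longlongrightarrow> 0) (at 0 within cball 0 1)"
        by (rule Lim_null_comparison[of _ cmod]) (use Gn in \<open>auto intro!: tendsto_norm_zero tendsto_ident_at\<close>)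
      then show ?thesis using True by (simp add: continuous_within G_def)
    next
      case False
      have "isCont G x" using c1 False by (simp add: continuous_on_eq_continuous_at open_Compl)
      then show ?thesis using continuous_at_imp_continuous_at_within by blast
    qed
  qed
  show "G z = g z" if "z \<in> sphere 0 1" for z using that by (simp add: G_def)
  have "inj_on G (cball 0 1)"
  proof (rule inj_onI)
    fix x y assume xy: "G x = G y"
    then have n: "cmod x = cmod y" using Gn by metis
    show "x = y"
    proof (cases "x = 0")
      case False
      then have "g (x / of_real (cmod x)) = g (y / of_real (cmod y))" using xy n by (auto simp: G_def)
      then have "x / of_real (cmod x) = y / of_real (cmod y)"
        using assms(2) s[of x] s[of y] False n by (auto simp: bij_betw_def dest: inj_onD)
      then show ?thesis using False n by auto
    qed (use n in auto)
  qed
  moreover have "cball 0 1 \<subseteq> G ` cball 0 1"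
  proof
    fix y :: complex assume y: "y \<in> cball 0 1"
    show "y \<in> G ` cball 0 1"
    proof (cases "y = 0")
      case True then show ?thesis by (intro image_eqI[of _ _ 0]) (auto simp: G_def)
    next
      case False
      obtain z where z: "z \<in> sphere 0 1" "g z = y / of_real (cmod y)"
        using s[OF False] assms(2) by (metis bij_betw_def image_iff)
      show ?thesis
      proof (rule image_eqI[of _ _ "of_real (cmod y) * z"])
        show "y = G (complex_of_real (cmod y) * z)"
          using z False by (simp add: G_def norm_mult scaleR_conv_of_real)
      qed (use z y in \<open>auto simp: norm_mult\<close>)
    qed
  qed
  ultimately show "bij_betw G (cball 0 1) (cball 0 1)" using Gn by (force simp: bij_betw_def)
qed

text \<open>Through the disc models the boundary map becomes a homeomorphism of the circle, where
  coning extends it.\<close>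

theorem schoenflies_extension:
  assumes J: "simple_closed_curve J" "simple_closed_curve J'"
    and f: "continuous_on J f" "bij_betw f J J'"
  obtains F where "continuous_on (J \<union> inside J) F" "bij_betw F (J \<union> inside J) (J' \<union> inside J')"
    "\<And>z. z \<in> J \<Longrightarrow> F z = f z"
proof -
  obtain a a' where a: "homeomorphism (J \<union> inside J) (cball (0::complex) 1) a a'" "a ` J = sphere 0 1"
    using schoenflies_disc[OF J(1)] by blast
  obtain b b' where b: "homeomorphism (J' \<union> inside J') (cball (0::complex) 1) b b'" "b ` J' = sphere 0 1"
    using schoenflies_disc[OF J(2)] by blast
  have aa: "a' (a z) = z" if "z \<in> J \<union> inside J" for z using a(1) that by (auto simp: homeomorphism_def)
  have bb: "b' (b z) = z" if "z \<in> J' \<union> inside J'" for z using b(1) that by (auto simp: homeomorphism_def)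
  define g where "g = b \<circ> f \<circ> a'"
  have aa': "a (a' z) = z" if "cmod z = 1" for z using a(1) that by (auto simp: homeomorphism_def)
  have bb': "b (b' z) = z" if "cmod z = 1" for z using b(1) that by (auto simp: homeomorphism_def)
  have a's: "bij_betw a' (sphere 0 1) J"
  proof (rule bij_betw_byWitness[where f' = a])
    show "a' ` sphere 0 1 \<subseteq> J" unfolding a(2)[symmetric] using aa by auto
  qed (use a(2) aa aa' in auto)
  have bs: "bij_betw b J' (sphere 0 1)"
  proof (rule bij_betw_byWitness[where f' = b'])
    show "b' ` sphere 0 1 \<subseteq> J'" unfolding b(2)[symmetric] using bb by auto
  qed (use b(2) bb bb' in auto)
  have cg: "continuous_on (sphere 0 1) g"
  proof -
    have "continuous_on (sphere 0 1) a'" using a(1) by (auto simp: homeomorphism_def intro: continuous_on_subset)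
    moreover have "continuous_on J' b" using b(1) by (auto simp: homeomorphism_def intro: continuous_on_subset)
    ultimately show ?thesis unfolding g_def using a's f
      by (intro continuous_on_compose) (auto simp: bij_betw_def image_comp)
  qed
  have bg: "bij_betw g (sphere 0 1) (sphere 0 1)"
    unfolding g_def comp_assoc using bij_betw_trans[OF a's bij_betw_trans[OF f(2) bs]] by (simp add: comp_assoc)
  obtain G where G: "continuous_on (cball 0 1) G" "bij_betw G (cball 0 1) (cball 0 1)"
    "\<And>z. z \<in> sphere 0 1 \<Longrightarrow> G z = g z" using sphere_homeo_cone[OF cg bg] by blast
  show ?thesis
  proof (rule that[of "b' \<circ> (G \<circ> a)"])
    have ab: "bij_betw a (J \<union> inside J) (cball 0 1)" "bij_betw b' (cball 0 1) (J' \<union> inside J')"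
      using homeomorphism_bij[OF a(1)] homeomorphism_bij[OF homeomorphism_symD[OF b(1)]] by auto
    show "bij_betw (b' \<circ> (G \<circ> a)) (J \<union> inside J) (J' \<union> inside J')"
      by (intro bij_betw_trans[OF bij_betw_trans[OF ab(1) G(2)] ab(2)])
    show "continuous_on (J \<union> inside J) (b' \<circ> (G \<circ> a))"
    proof (intro continuous_on_compose)
      show "continuous_on (J \<union> inside J) a" using a(1) by (simp add: homeomorphism_def)
      have i: "a ` (J \<union> inside J) = cball 0 1" "G ` cball 0 1 = cball 0 1"
        using ab(1) G(2) by (simp_all add: bij_betw_def)
      show "continuous_on (a ` (J \<union> inside J)) G" unfolding i by (rule G(1))
      have "(G \<circ> a) ` (J \<union> inside J) = cball 0 1" unfolding image_comp[symmetric] i ..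
      then show "continuous_on ((G \<circ> a) ` (J \<union> inside J)) b'" using b(1) by (simp add: homeomorphism_def)
    qed
    fix z assume z: "z \<in> J"
    have "a z \<in> sphere 0 1" using a(2) z by blast
    then have "G (a z) = b (f z)" using G(3) aa z by (simp add: g_def)
    moreover have "f z \<in> J'" using f(2) z by (auto simp: bij_betw_def)
    ultimately show "(b' \<circ> (G \<circ> a)) z = f z" using bb by simp
  qed
qed

section \<open>Crosscuts and the two halves that they cut off\<close>

definition crosscut :: "complex set \<Rightarrow> complex set \<Rightarrow> bool" where
  "crosscut J c \<longleftrightarrow> (\<exists>g. arc g \<and> path_image g = c \<and> c \<inter> J = {pathstart g, pathfinish g}) \<and> c \<subseteq> J \<union> inside J"

text \<open>The letters stand for the upper arc \<open>u\<close> and the lower arc \<open>d\<close> of \<open>J\<close> between \<open>a\<close> and \<open>b\<close>, and for a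
  crosscut \<open>c\<close>.\<close>

definition theta :: "complex set \<Rightarrow> complex set \<Rightarrow> complex set \<Rightarrow> complex set \<Rightarrow> complex \<Rightarrow> complex \<Rightarrow> bool" where
  "theta J u d c a b \<longleftrightarrow> (\<exists>gu gd gc. arc gu \<and> arc gd \<and> arc gc \<and> path_image gu = u \<and> path_image gd = d \<and>
     path_image gc = c \<and> pathstart gu = a \<and> pathfinish gu = b \<and> pathstart gd = a \<and> pathfinish gd = b \<and>
     pathstart gc = a \<and> pathfinish gc = b \<and> u \<union> d = J \<and> u \<inter> d = {a,b} \<and> c \<inter> J = {a,b} \<and> c \<subseteq> J \<union> inside J)"

text \<open>Inclusions are established by connectedness for an arc without its end points; this
  passes closed conditions on to the ends.\<close>

lemma arc_subset_closure_endless: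
  fixes g :: "real \<Rightarrow> 'a::t2_space"
  assumes "arc g"
  shows "path_image g \<subseteq> closure (path_image g - {pathstart g, pathfinish g})"
proof -
  have "g ` closure {0<..<1} \<subseteq> closure (path_image g - {pathstart g, pathfinish g})"
  proof (rule image_closure_subset)
    show "continuous_on (closure {0<..<1}) g" using assms by (simp add: arc_def path_def)
    have "g t \<in> path_image g - {pathstart g, pathfinish g}" if "t \<in> {0<..<1}" for t
      using assms that by (auto simp: arc_def path_image_def pathstart_def pathfinish_def dest: inj_onD)
    then show "g ` {0<..<1} \<subseteq> closure (path_image g - {pathstart g, pathfinish g})"
      using closure_subset by blast
  qed simp
  then show ?thesis by (simp add: path_image_def)
qed

lemma theta_swap: "theta J u d c a b \<Longrightarrow> theta J d u c a b"
  unfolding theta_def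
proof (elim exE conjE)
  fix gu gd gc
  assume "arc gu" "arc gd" "arc gc" "path_image gu = u" "path_image gd = d" "path_image gc = c"
    "pathstart gu = a" "pathfinish gu = b" "pathstart gd = a" "pathfinish gd = b"
    "pathstart gc = a" "pathfinish gc = b" "u \<union> d = J" "u \<inter> d = {a,b}" "c \<inter> J = {a,b}" "c \<subseteq> J \<union> inside J"
  then show "\<exists>gu gd gc. arc gu \<and> arc gd \<and> arc gc \<and> path_image gu = d \<and> path_image gd = u \<and>
     path_image gc = c \<and> pathstart gu = a \<and> pathfinish gu = b \<and> pathstart gd = a \<and> pathfinish gd = b \<and>
     pathstart gc = a \<and> pathfinish gc = b \<and> d \<union> u = J \<and> d \<inter> u = {a,b} \<and> c \<inter> J = {a,b} \<and> c \<subseteq> J \<union> inside J"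
    by (intro exI[of _ gd] exI[of _ gu] exI[of _ gc]) (simp add: Un_commute Int_commute)
qed

lemma theta_basic:
  assumes "theta J u d c a b"
  shows "simple_closed_curve J" "u \<union> d = J" "u \<inter> d = {a,b}" "c \<inter> J = {a,b}" "u \<inter> c = {a,b}"
    "compact u" "compact c" "simple_closed_curve (u \<union> c)" "a \<noteq> b" "connected (c - {a,b})" "c - {a,b} \<noteq> {}"
proof -
  obtain gu gd gc where g: "arc gu" "arc gd" "arc gc" "path_image gu = u" "path_image gd = d"
     "path_image gc = c" "pathstart gu = a" "pathfinish gu = b" "pathstart gd = a" "pathfinish gd = b"
     "pathstart gc = a" "pathfinish gc = b" "u \<union> d = J" "u \<inter> d = {a,b}" "c \<inter> J = {a,b}"
    using assms by (auto simp: theta_def)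
  show 1: "u \<union> d = J" "u \<inter> d = {a,b}" "c \<inter> J = {a,b}" by fact+
  show 2: "u \<inter> c = {a,b}" using 1 by blast
  show "compact u" "compact c" using g compact_arc_image by metis+
  have loop: "simple_closed_curve (path_image p \<union> path_image q)"
    if "arc p" "arc q" "pathstart p = a" "pathfinish p = b" "pathstart q = a" "pathfinish q = b"
      "path_image p \<inter> path_image q = {a,b}" for p q :: "real \<Rightarrow> complex"
    unfolding simple_closed_curve_def
    by (rule exI[of _ "p +++ reversepath q"])
      (use that in \<open>auto simp: path_image_join intro!: simple_path_join_loop arc_reversepath\<close>)
  show "simple_closed_curve J" using loop[OF g(1,2)] g by simp
  show "simple_closed_curve (u \<union> c)" using loop[OF g(1,3)] g 2 by simp
  show "a \<noteq> b" using g arc_distinct_ends by blast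
  show "connected (c - {a,b})"
    using connected_simple_path_endless[OF arc_imp_simple_path[OF g(3)]] g(6,11,12) by simp
  show "c - {a,b} \<noteq> {}"
  proof
    assume e: "c - {a,b} = {}"
    have "c \<subseteq> closure (c - {a,b})" using arc_subset_closure_endless[OF g(3)] g(6,11,12) by simp
    then have "c = {}" unfolding e by simp
    then show False using g(6) path_image_nonempty by blast
  qed
qed

lemma theta_split:
  assumes th: "theta J u d c a b"
  shows "inside (u \<union> c) \<inter> inside (d \<union> c) = {}"
    "inside (u \<union> c) \<union> inside (d \<union> c) \<union> (c - {a,b}) = inside J"
proof -
  obtain gu gd gc where g: "arc gu" "arc gd" "arc gc" "path_image gu = u" "path_image gd = d"
     "path_image gc = c" "pathstart gu = a" "pathfinish gu = b" "pathstart gd = a" "pathfinish gd = b"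
     "pathstart gc = a" "pathfinish gc = b" "c \<subseteq> J \<union> inside J"
    using th by (auto simp: theta_def)
  note tb = theta_basic[OF th] and tb' = theta_basic[OF theta_swap[OF th]]
  have ci: "c \<inter> inside J \<noteq> {}" using g(13) tb(4,11) by blast
  have "inside (path_image gu \<union> path_image gc) \<inter> inside (path_image gd \<union> path_image gc) = {} \<and>
    inside (path_image gu \<union> path_image gc) \<union> inside (path_image gd \<union> path_image gc) \<union>
      (path_image gc - {a,b}) = inside (path_image gu \<union> path_image gd)"
    by (rule split_inside_simple_closed_curve[of gu a b gd gc])
      (use g(1-12) tb(2-5,9) tb'(5) ci arc_imp_simple_path in \<open>simp_all add: Int_commute\<close>)
  then show "inside (u \<union> c) \<inter> inside (d \<union> c) = {}"
    "inside (u \<union> c) \<union> inside (d \<union> c) \<union> (c - {a,b}) = inside J"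
    using g(4-6) tb(2) by simp_all
qed

text \<open>Off \<open>J\<close>, the arc \<open>e\<close> is connected and avoids \<open>c\<close>,
  so it lies in one of the two disjoint open sides; its end points are limits and hence lie on the
  corresponding part of \<open>J\<close>.\<close>

lemma crosscut_side:
  assumes th: "theta J u d c a b" and e: "crosscut J e" "e \<inter> c = {}"
  shows "(crosscut (u \<union> c) e \<and> e \<inter> (u \<union> c) = e \<inter> J \<and> e \<inter> J \<subseteq> u) \<or>
         (crosscut (d \<union> c) e \<and> e \<inter> (d \<union> c) = e \<inter> J \<and> e \<inter> J \<subseteq> d)"
proof -
  obtain g where g: "arc g" "path_image g = e" "e \<inter> J = {pathstart g, pathfinish g}" and eJ: "e \<subseteq> J \<union> inside J"
    using e by (auto simp: crosscut_def)
  have eJ': "e - J = path_image g - {pathstart g, pathfinish g}" using g by blast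
  have con: "connected (e - J)"
    unfolding eJ' by (rule connected_simple_path_endless[OF arc_imp_simple_path[OF g(1)]])
  have ecl: "e \<subseteq> closure (e - J)"
    unfolding eJ' using arc_subset_closure_endless[OF g(1)] g(2) by simp
  have main: "crosscut (u \<union> c) e \<and> e \<inter> (u \<union> c) = e \<inter> J \<and> e \<inter> J \<subseteq> u"
    if th: "theta J u d c a b" and sub: "e - J \<subseteq> inside (u \<union> c)" for u d
  proof -
    note tb = theta_basic[OF th]
    have "closure (e - J) \<subseteq> (u \<union> c) \<union> inside (u \<union> c)"
      using closure_mono[OF sub] jordan_facts(10)[OF tb(8)] by simp
    then have eu: "e \<subseteq> u \<union> inside (u \<union> c)" using ecl e(2) by blast
    have "inside (u \<union> c) \<inter> J = {}" using theta_split(2)[OF th] jordan_facts(11)[OF tb(1)] by blast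
    then have "e \<inter> J \<subseteq> u" "e \<inter> (u \<union> c) = e \<inter> J" using eu e(2) tb(2) by blast+
    then show ?thesis using g eu by (auto simp: crosscut_def)
  qed
  have "e - J \<subseteq> inside (u \<union> c) \<union> inside (d \<union> c)" using eJ e(2) theta_split(2)[OF th] by blast
  moreover have "open (inside (u \<union> c))" "open (inside (d \<union> c))"
    using jordan_facts(4) theta_basic(8)[OF th] theta_basic(8)[OF theta_swap[OF th]] by auto
  ultimately have "e - J \<subseteq> inside (u \<union> c) \<or> e - J \<subseteq> inside (d \<union> c)"
    using connectedD[OF con, of "inside (u \<union> c)" "inside (d \<union> c)"] theta_split(1)[OF th] by blast
  then show ?thesis using main[OF th] main[OF theta_swap[OF th]] by blast
qed

lemma arc_homeo:
  fixes g g' :: "real \<Rightarrow> complex"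
  assumes "arc g" "arc g'"
  obtains k where "continuous_on (path_image g) k" "bij_betw k (path_image g) (path_image g')"
    "k (pathstart g) = pathstart g'" "k (pathfinish g) = pathfinish g'"
proof -
  have ig: "inj_on g {0..1}" "inj_on g' {0..1}" and cg: "continuous_on {0..1} g" "continuous_on {0..1} g'"
    using assms by (auto simp: arc_def path_def)
  obtain h where h: "homeomorphism {0..1} (path_image g) g h"
    using homeomorphism_compact[OF compact_Icc cg(1) _ ig(1), of "path_image g"] by (auto simp: path_image_def)
  have h': "h (g t) = t" if "t \<in> {0..1}" for t using h that by (auto simp: homeomorphism_def)
  show ?thesis
  proof (rule that[of "g' \<circ> h"])
    show "continuous_on (path_image g) (g' \<circ> h)"
      using h cg by (intro continuous_on_compose) (auto simp: homeomorphism_def)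
    have "bij_betw h (path_image g) {0..1}" by (rule homeomorphism_bij[OF homeomorphism_symD[OF h]])
    moreover have "bij_betw g' {0..1} (path_image g')" using ig by (simp add: bij_betw_def path_image_def)
    ultimately show "bij_betw (g' \<circ> h) (path_image g) (path_image g')" by (rule bij_betw_trans)
  qed (use h' in \<open>auto simp: pathstart_def pathfinish_def\<close>)
qed

text \<open>Induction on the family: one crosscut cuts the domain into two Jordan domains, each with
  strictly fewer crosscuts, and the extensions to both agree on the cut. The crosscuts are
  prescribed only as sets, which leaves the parametrization of the cut free.\<close>

theorem crosscut_family_extension:
  assumes "finite \<A>" "simple_closed_curve J" "simple_closed_curve J'"
    "continuous_on J f" "bij_betw f J J'" "\<And>c. c \<in> \<A> \<Longrightarrow> crosscut J c"
    "\<And>c e. c \<in> \<A> \<Longrightarrow> e \<in> \<A> \<Longrightarrow> c \<noteq> e \<Longrightarrow> c \<inter> e = {} \<and> m c \<inter> m e = {}"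
    "\<And>c. c \<in> \<A> \<Longrightarrow> crosscut J' (m c) \<and> m c \<inter> J' = f ` (c \<inter> J)"
  shows "\<exists>F. continuous_on (J \<union> inside J) F \<and> bij_betw F (J \<union> inside J) (J' \<union> inside J') \<and>
    (\<forall>z\<in>J. F z = f z) \<and> (\<forall>c\<in>\<A>. F ` c = m c)"
  using assms
proof (induction \<A> arbitrary: J J' f rule: finite_psubset_induct)
  case (psubset \<A>)
  note J = psubset.prems(1) and J' = psubset.prems(2) and f = psubset.prems(3,4)
    and cc = psubset.prems(5) and dis = psubset.prems(6) and m = psubset.prems(7)
  show ?case
  proof (cases "\<A> = {}")
    case True
    then show ?thesis using schoenflies_extension[OF J J' f] by (metis empty_iff)
  next
    case False
    then obtain c where c: "c \<in> \<A>" by blast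
    obtain gc where gc: "arc gc" "path_image gc = c" "c \<inter> J = {pathstart gc, pathfinish gc}" "c \<subseteq> J \<union> inside J"
      using cc[OF c] by (auto simp: crosscut_def)
    define a b where "a = pathstart gc" and "b = pathfinish gc"
    have ab: "a \<noteq> b" "a \<in> J" "b \<in> J" using gc arc_distinct_ends[OF gc(1)] by (auto simp: a_def b_def)
    have fab: "f a \<noteq> f b" using f(2) ab by (auto simp: bij_betw_def dest: inj_onD)
    obtain g where g: "simple_path g" "pathfinish g = pathstart g" "path_image g = J"
      using J by (auto simp: simple_closed_curve_def)
    obtain gu gd where ud: "arc gu" "arc gd" "pathstart gu = a" "pathfinish gu = b" "pathstart gd = b"
        "pathfinish gd = a" "path_image gu \<inter> path_image gd = {a,b}" "path_image gu \<union> path_image gd = J"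
      using exists_double_arc[OF g(1,2), of a b] ab g(3) by metis
    define u d where "u = path_image gu" and "d = path_image gd"
    have th: "theta J u d c a b"
      unfolding theta_def by (rule exI[of _ gu], rule exI[of _ "reversepath gd"], rule exI[of _ gc])
        (use ud gc in \<open>auto simp: u_def d_def a_def b_def arc_reversepath\<close>)
    obtain gm0 where gm0: "arc gm0" "path_image gm0 = m c" "m c \<inter> J' = {pathstart gm0, pathfinish gm0}"
      and mJ: "m c \<subseteq> J' \<union> inside J'" and mf: "m c \<inter> J' = {f a, f b}"
      using m[OF c] gc(3) by (auto simp: crosscut_def a_def b_def)
    \<comment> \<open>Only the pair of ends of \<open>m c\<close> is known, so the arc may have to
      be reversed to run from \<open>f a\<close> to \<open>f b\<close>.\<close>
    obtain gm where gm: "arc gm" "path_image gm = m c" "pathstart gm = f a" "pathfinish gm = f b"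
    proof (cases "pathstart gm0 = f a")
      case True
      then show ?thesis using that[of gm0] gm0 mf fab by (metis doubleton_eq_iff)
    next
      case False
      then show ?thesis using that[of "reversepath gm0"] gm0 mf fab
        by (metis arc_reversepath doubleton_eq_iff path_image_reversepath pathfinish_reversepath pathstart_reversepath)
    qed
    have injf: "inj_on f J" and imf: "f ` J = J'" using f(2) by (auto simp: bij_betw_def)
    have uJ: "u \<subseteq> J" "d \<subseteq> J" using ud by (auto simp: u_def d_def)
    have th': "theta J' (f ` u) (f ` d) (m c) (f a) (f b)"
      unfolding theta_def
    proof (rule exI[of _ "f \<circ> gu"], rule exI[of _ "f \<circ> reversepath gd"], rule exI[of _ gm], intro conjI)
      have arcf: "arc (f \<circ> p)" if "arc p" "path_image p \<subseteq> J" for p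
        using that f(1) injf unfolding arc_def path_image_def
        by (intro conjI path_continuous_image comp_inj_on) (auto simp: path_image_def intro: continuous_on_subset inj_on_subset)
      show "arc (f \<circ> gu)" "arc (f \<circ> reversepath gd)"
        using arcf[OF ud(1)] arcf[OF arc_reversepath[OF ud(2)]] uJ by (simp_all add: u_def d_def)
      show "f ` u \<union> f ` d = J'" using imf ud by (auto simp: u_def d_def)
      show "f ` u \<inter> f ` d = {f a, f b}" using inj_on_image_Int[OF injf uJ] ud by (simp add: u_def d_def)
    qed (use ud gm mf mJ in \<open>auto simp: u_def d_def path_image_compose pathstart_compose pathfinish_compose\<close>)
    note tb = theta_basic[OF th] and tb' = theta_basic[OF theta_swap[OF th]]
      and sb = theta_basic[OF th'] and sb' = theta_basic[OF theta_swap[OF th']]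
    \<comment> \<open>Any homeomorphism between the two cuts that agrees with \<open>f\<close> at
      the ends will do; using the same \<open>k\<close> on both sides is what makes the extensions
      fit.\<close>
    obtain k where k: "continuous_on c k" "bij_betw k c (m c)" "k a = f a" "k b = f b"
      using arc_homeo[OF gc(1) gm(1)] gm gc by (auto simp: a_def b_def)
    define part where "part u = {e \<in> \<A> - {c}. crosscut (u \<union> c) e \<and> e \<inter> (u \<union> c) = e \<inter> J \<and> e \<inter> J \<subseteq> u}" for u
    have half: "\<exists>F. continuous_on ((u \<union> c) \<union> inside (u \<union> c)) F \<and>
        bij_betw F ((u \<union> c) \<union> inside (u \<union> c)) ((f ` u \<union> m c) \<union> inside (f ` u \<union> m c)) \<and>
        (\<forall>z\<in>u. F z = f z) \<and> (\<forall>z\<in>c. F z = k z) \<and> (\<forall>e\<in>part u. F ` e = m e)"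
      if th: "theta J u d c a b" and th': "theta J' (f ` u) (f ` d) (m c) (f a) (f b)" for u d
    proof -
      note tb = theta_basic[OF th] and sb = theta_basic[OF th']
      have uJ: "u \<subseteq> J" using tb(2) by blast
      obtain f1 where f1: "continuous_on (u \<union> c) f1" "bij_betw f1 (u \<union> c) (f ` u \<union> m c)"
        "\<And>z. z \<in> u \<Longrightarrow> f1 z = f z" "\<And>z. z \<in> c \<Longrightarrow> f1 z = k z"
      proof (rule homeo_glue[of u c f k "f ` u" "m c"])
        show "closed u" "closed c" using tb compact_imp_closed by auto
        show "continuous_on u f" using f(1) uJ continuous_on_subset by blast
        show "bij_betw f u (f ` u)" using injf uJ by (auto simp: bij_betw_def intro: inj_on_subset)
        show "f z = k z" if "z \<in> u" "z \<in> c" for z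
        proof -
          have "z \<in> {a,b}" using that tb(5) by blast
          then show ?thesis using k(3,4) by auto
        qed
        show "f ` u \<inter> m c \<subseteq> f ` (u \<inter> c)" using sb(5) tb(5) by auto
      qed (use k in auto)
      have "\<exists>F. continuous_on ((u \<union> c) \<union> inside (u \<union> c)) F \<and>
        bij_betw F ((u \<union> c) \<union> inside (u \<union> c)) ((f ` u \<union> m c) \<union> inside (f ` u \<union> m c)) \<and>
        (\<forall>z\<in>u \<union> c. F z = f1 z) \<and> (\<forall>e\<in>part u. F ` e = m e)"
      proof (rule psubset.IH)
        show "part u \<subset> \<A>" using c by (auto simp: part_def)
        show "crosscut (u \<union> c) e" if "e \<in> part u" for e using that by (simp add: part_def)
        show "x \<inter> e = {} \<and> m x \<inter> m e = {}" if "x \<in> part u" "e \<in> part u" "x \<noteq> e" for x e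
          using dis that by (auto simp: part_def)
        show "crosscut (f ` u \<union> m c) (m e) \<and> m e \<inter> (f ` u \<union> m c) = f1 ` (e \<inter> (u \<union> c))"
          if e: "e \<in> part u" for e
        proof -
          have eA: "e \<in> \<A>" "e \<noteq> c" and eJ: "e \<inter> (u \<union> c) = e \<inter> J" "e \<inter> J \<subseteq> u" using e by (auto simp: part_def)
          have me: "crosscut J' (m e)" "m e \<inter> J' = f ` (e \<inter> J)" "m e \<inter> m c = {}" using m eA dis c by auto
          have "e \<inter> J \<noteq> {}" using cc[OF eA(1)] by (auto simp: crosscut_def)
          \<comment> \<open>This decides on which side of \<open>m c\<close> the target arc lies:
            otherwise its end points would belong to the images of both parts of \<open>J\<close>,
            that is, be ends of \<open>m c\<close>, which is disjoint from
            \<open>m e\<close>.\<close>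
          have "\<not> m e \<inter> J' \<subseteq> f ` d"
          proof
            assume "m e \<inter> J' \<subseteq> f ` d"
            then have "f ` (e \<inter> J) \<subseteq> f ` u \<inter> f ` d" using me eJ by blast
            then have "f ` (e \<inter> J) \<subseteq> m c" using sb(3,4) by blast
            then show False using me \<open>e \<inter> J \<noteq> {}\<close> by blast
          qed
          then have s: "crosscut (f ` u \<union> m c) (m e)" "m e \<inter> (f ` u \<union> m c) = m e \<inter> J'"
            using crosscut_side[OF th' me(1,3)] by blast+
          have "f1 ` (e \<inter> J) = f ` (e \<inter> J)" using f1(3) eJ by (intro image_cong) auto
          then show ?thesis using s eJ me by simp
        qed
      qed (use tb sb f1 in auto)
      then show ?thesis using f1(3,4) by (metis UnI1 UnI2)
    qed
    obtain F1 where F1': "continuous_on ((u \<union> c) \<union> inside (u \<union> c)) F1"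
        "bij_betw F1 ((u \<union> c) \<union> inside (u \<union> c)) ((f ` u \<union> m c) \<union> inside (f ` u \<union> m c))"
        "\<forall>z\<in>u. F1 z = f z" "\<forall>z\<in>c. F1 z = k z" "\<forall>e\<in>part u. F1 ` e = m e"
      using half[OF th th'] by (elim exE conjE) (rule that)
    note F1 = F1'(1,2) F1'(3-5)[rule_format]
    obtain F2 where F2': "continuous_on ((d \<union> c) \<union> inside (d \<union> c)) F2"
        "bij_betw F2 ((d \<union> c) \<union> inside (d \<union> c)) ((f ` d \<union> m c) \<union> inside (f ` d \<union> m c))"
        "\<forall>z\<in>d. F2 z = f z" "\<forall>z\<in>c. F2 z = k z" "\<forall>e\<in>part d. F2 ` e = m e"
      using half[OF theta_swap[OF th] theta_swap[OF th']] by (elim exE conjE) (rule that)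
    note F2 = F2'(1,2) F2'(3-5)[rule_format]
    define D1 D2 E1 E2 where "D1 = (u \<union> c) \<union> inside (u \<union> c)" and "D2 = (d \<union> c) \<union> inside (d \<union> c)"
      and "E1 = (f ` u \<union> m c) \<union> inside (f ` u \<union> m c)" and "E2 = (f ` d \<union> m c) \<union> inside (f ` d \<union> m c)"
    have overlap: "((u \<union> c) \<union> inside (u \<union> c)) \<inter> ((d \<union> c) \<union> inside (d \<union> c)) = c"
        "((u \<union> c) \<union> inside (u \<union> c)) \<union> ((d \<union> c) \<union> inside (d \<union> c)) = J \<union> inside J"
      if th: "theta J u d c a b" for J u d c and a b :: complex
    proof -
      note tb = theta_basic[OF th] and tb' = theta_basic[OF theta_swap[OF th]]
      have "inside (u \<union> c) \<inter> J = {}" "inside (d \<union> c) \<inter> J = {}"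
        using theta_split(2)[OF th] jordan_facts(11)[OF tb(1)] by blast+
      moreover have "inside (u \<union> c) \<inter> c = {}" "inside (d \<union> c) \<inter> c = {}"
        using jordan_facts(11)[OF tb(8)] jordan_facts(11)[OF tb'(8)] by blast+
      ultimately show "((u \<union> c) \<union> inside (u \<union> c)) \<inter> ((d \<union> c) \<union> inside (d \<union> c)) = c"
        using tb(2,3,4) theta_split(1)[OF th] by blast
      show "((u \<union> c) \<union> inside (u \<union> c)) \<union> ((d \<union> c) \<union> inside (d \<union> c)) = J \<union> inside J"
        using tb(2,4) theta_split(2)[OF th] by blast
    qed
    have ov: "D1 \<inter> D2 = c" "D1 \<union> D2 = J \<union> inside J" "E1 \<inter> E2 = m c" "E1 \<union> E2 = J' \<union> inside J'"
      unfolding D1_def D2_def E1_def E2_def using overlap[OF th] overlap[OF th'] by auto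
    have cD: "c \<subseteq> D1" "c \<subseteq> D2" by (auto simp: D1_def D2_def)
    obtain F where F: "continuous_on (D1 \<union> D2) F" "bij_betw F (D1 \<union> D2) (E1 \<union> E2)"
      "\<And>z. z \<in> D1 \<Longrightarrow> F z = F1 z" "\<And>z. z \<in> D2 \<Longrightarrow> F z = F2 z"
    proof (rule homeo_glue[of D1 D2 F1 F2 E1 E2])
      show "closed D1" "closed D2"
        using jordan_facts(15)[OF tb(8)] jordan_facts(15)[OF tb'(8)] by (auto simp: D1_def D2_def compact_imp_closed)
      show "F1 z = F2 z" if "z \<in> D1" "z \<in> D2" for z
      proof -
        have "z \<in> c" using that ov(1) by blast
        then show ?thesis using F1(4) F2(4) by simp
      qed
      have "F1 ` c = k ` c" using F1(4) by (rule image_cong[OF refl])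
      then show "E1 \<inter> E2 \<subseteq> F1 ` (D1 \<inter> D2)" using ov k(2) by (simp add: bij_betw_def)
    qed (use F1 F2 in \<open>auto simp: D1_def D2_def E1_def E2_def\<close>)
    have FJ: "F z = f z" if "z \<in> J" for z
    proof -
      have "z \<in> u \<or> z \<in> d" using tb(2) that by blast
      then show ?thesis using F(3,4) F1(3) F2(3) by (auto simp: D1_def D2_def)
    qed
    have FA: "F ` e = m e" if e: "e \<in> \<A>" for e
    proof (cases "e = c")
      case True
      have "F ` c = k ` c" by (rule image_cong[OF refl]) (use F(3) F1(4) cD in auto)
      then show ?thesis using True k(2) by (simp add: bij_betw_def)
    next
      case False
      then have "e \<in> part u \<or> e \<in> part d"
        using crosscut_side[OF th cc[OF e]] dis[OF e c] e by (auto simp: part_def)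
      then show ?thesis
      proof
        assume eu: "e \<in> part u"
        then have "e \<subseteq> D1" by (auto simp: part_def crosscut_def D1_def)
        then have "F ` e = F1 ` e" using F(3) by (intro image_cong) auto
        then show ?thesis using F1(5)[OF eu] by simp
      next
        assume eu: "e \<in> part d"
        then have "e \<subseteq> D2" by (auto simp: part_def crosscut_def D2_def)
        then have "F ` e = F2 ` e" using F(4) by (intro image_cong) auto
        then show ?thesis using F2(5)[OF eu] by simp
      qed
    qed
    show ?thesis using F(1,2) FJ FA ov by (intro exI[of _ F]) auto
  qed
qed

section \<open>Arcs in the half-plane\<close>

abbreviation upper :: "complex set" where "upper \<equiv> {z. 0 \<le> Im z}"

definition half_plane_arcs :: "complex set set \<Rightarrow> bool" where
  "half_plane_arcs \<A> \<longleftrightarrow> finite \<A> \<and> (\<forall>c\<in>\<A>. \<forall>e\<in>\<A>. c \<noteq> e \<longrightarrow> c \<inter> e = {}) \<and>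
     (\<forall>c\<in>\<A>. c \<subseteq> upper \<and> (\<exists>g. arc g \<and> path_image g = c \<and> c \<inter> \<real> = {pathstart g, pathfinish g}))"

definition semicircle :: "real \<Rightarrow> real \<Rightarrow> complex set" where
  "semicircle x y = {z. 0 \<le> Im z \<and> cmod (z - of_real ((x + y) / 2)) = (y - x) / 2}"

lemma path_image_semicircle:
  assumes "x < y"
  shows "path_image (part_circlepath (of_real ((x + y) / 2)) ((y - x) / 2) 0 pi) = semicircle x y"
proof -
  define c r where "c = (x + y) / 2" and "r = (y - x) / 2"
  have r: "r > 0" using assms by (simp add: r_def)
  have "path_image (part_circlepath (of_real c) r 0 pi) = semicircle x y"
  proof (intro equalityI subsetI)
    fix z assume "z \<in> path_image (part_circlepath (of_real c) r 0 pi)"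
    then obtain t where t: "0 \<le> t" "t \<le> pi" "z = of_real c + of_real r * exp (\<i> * of_real t)"
      by (auto simp: path_image_part_circlepath)
    then show "z \<in> semicircle x y"
      using r by (simp add: semicircle_def c_def[symmetric] r_def[symmetric] Im_exp sin_ge_zero norm_mult norm_exp_eq_Re)
  next
    fix z assume z: "z \<in> semicircle x y"
    define w where "w = z - of_real c"
    have w: "0 \<le> Im w" "cmod w = r" using z by (auto simp: semicircle_def c_def r_def w_def)
    have "0 \<le> Arg w" "Arg w \<le> pi" using w Arg_le_pi Arg_less_0 by (auto simp: not_less[symmetric])
    moreover have "z = of_real c + of_real r * exp (\<i> * Arg w)"
      using w rcis_cmod_Arg[of w] by (simp add: rcis_def cis_conv_exp w_def)
    ultimately show "z \<in> path_image (part_circlepath (of_real c) r 0 pi)" unfolding path_image_part_circlepath[OF pi_ge_zero] by auto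
  qed
  then show ?thesis by (simp add: c_def r_def)
qed

definition half_circle :: "real \<Rightarrow> complex set" where
  "half_circle R = {z. 0 \<le> Im z \<and> cmod z = R} \<union> {z. Im z = 0 \<and> cmod z \<le> R}"

lemma half_circle:
  assumes R: "R > 0"
  shows "simple_closed_curve (half_circle R)" "inside (half_circle R) = {z. 0 < Im z \<and> cmod z < R}"
proof -
  have cp: "path_image (part_circlepath 0 R 0 pi) = {z. 0 \<le> Im z \<and> cmod z = R}"
    using path_image_semicircle[of "-R" R] R by (simp add: semicircle_def)
  have sg: "closed_segment (- of_real R) (of_real R) = {z. Im z = 0 \<and> cmod z \<le> R}"
  proof -
    have "closed_segment (- of_real R) (of_real R) = (of_real ` closed_segment (-R) R :: complex set)"
      by (metis closed_segment_of_real of_real_minus)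
    also have "\<dots> = {z. Im z = 0 \<and> cmod z \<le> R}"
    proof (intro equalityI subsetI)
      fix z :: complex assume z: "z \<in> {z. Im z = 0 \<and> cmod z \<le> R}"
      then have "z = of_real (Re z)" "\<bar>Re z\<bar> \<le> R" by (auto simp: complex_eq_iff cmod_def)
      then show "z \<in> of_real ` closed_segment (-R) R" using R by (auto simp: closed_segment_eq_real_ivl abs_le_iff)
    qed (use R in \<open>auto simp: closed_segment_eq_real_ivl abs_le_iff\<close>)
    finally show ?thesis .
  qed
  let ?g = "part_circlepath 0 R 0 pi +++ linepath (- of_real R) (of_real R)"
  have ends: "pathstart (part_circlepath 0 R 0 pi) = of_real R" "pathfinish (part_circlepath 0 R 0 pi) = - of_real R"
    by (simp_all add: exp_pi_i')
  have "simple_path ?g"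
  proof (rule simple_path_join_loop)
    show "arc (part_circlepath 0 R 0 pi)" using R by (intro arc_part_circlepath) auto
    show "arc (linepath (- complex_of_real R) (of_real R))" using R by (intro arc_linepath) (auto simp: complex_eq_iff)
    show "path_image (part_circlepath 0 R 0 pi) \<inter> path_image (linepath (- of_real R) (of_real R))
      \<subseteq> {pathstart (part_circlepath 0 R 0 pi), pathstart (linepath (- of_real R) (of_real R))}"
      unfolding cp path_image_linepath sg ends by (auto simp: complex_eq_iff cmod_def abs_if split: if_splits)
  qed (use ends in auto)
  moreover have "path_image ?g = half_circle R"
    using ends by (simp add: path_image_join cp sg half_circle_def)
  ultimately show "simple_closed_curve (half_circle R)"
    unfolding simple_closed_curve_def using ends by (intro exI[of _ ?g]) auto
  \<comment> \<open>A bounded convex open set is the inside of its frontier, so the half-disc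
    determines the inside of \<open>half_circle R\<close>.\<close>
  let ?S = "ball 0 R \<inter> {z. 0 < Im z}"
  have op: "open ?S" by (intro open_Int open_ball open_halfspace_Im_gt)
  have cv: "convex ?S" by (intro convex_Int convex_ball convex_halfspace_Im_gt)
  have "\<i> * of_real (R / 2) \<in> ?S" using R by (auto simp: norm_mult)
  then have "?S \<noteq> {}" by blast
  then have ne: "interior (ball 0 R) \<inter> interior {z. 0 < Im z} \<noteq> {}"
    by (simp add: interior_open open_halfspace_Im_gt)
  have cl2: "closure {z. 0 < Im z} = {z. 0 \<le> Im z}"
    using closure_halfspace_gt[of \<i> 0] by (simp add: inner_complex_def)
  have "closure ?S = closure (ball 0 R) \<inter> closure {z. 0 < Im z}"
  proof (rule closure_Int_convex)
    show "rel_interior (ball 0 R) \<inter> rel_interior {z. 0 < Im z} \<noteq> {}"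
      using ne by (metis interior_ball interior_open open_halfspace_Im_gt rel_interior_open open_ball)
  qed (auto intro: convex_halfspace_Im_gt)
  then have "closure ?S = cball 0 R \<inter> {z. 0 \<le> Im z}" using R cl2 by simp
  moreover have io: "interior ?S = ?S" by (rule interior_open[OF op])
  moreover have "(cball 0 R \<inter> {z. 0 \<le> Im z}) - ?S = half_circle R"
    by (intro set_eqI iffI) (auto simp: half_circle_def)
  ultimately have "frontier ?S = half_circle R" by (simp only: frontier_def)
  moreover have "inside (frontier ?S) = ?S"
    using inside_frontier_eq_interior[of ?S] cv io by (simp only: bounded_Int bounded_ball simp_thms)
  ultimately show "inside (half_circle R) = {z. 0 < Im z \<and> cmod z < R}" by auto
qed

text \<open>In a half-disc containing all arcs the arcs become crosscuts, and the identity of the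
  boundary extends over them. Extension by the identity outside is continuous because the boundary
  is fixed.\<close>

theorem half_plane_arcs_homeo:
  assumes A: "half_plane_arcs \<A>" and B: "half_plane_arcs \<B>"
    and AB: "(\<lambda>c. c \<inter> \<real>) ` \<A> = (\<lambda>c. c \<inter> \<real>) ` \<B>"
  obtains F R where "continuous_on upper F" "bij_betw F upper upper" "\<And>x. x \<in> \<real> \<Longrightarrow> F x = x"
    "R > 0" "\<And>z. z \<in> upper \<Longrightarrow> R \<le> cmod z \<Longrightarrow> F z = z" "F ` \<Union>\<A> = \<Union>\<B>"
proof -
  have cA: "\<exists>g. arc g \<and> path_image g = c \<and> c \<inter> \<real> = {pathstart g, pathfinish g}" "c \<subseteq> upper"
    if "c \<in> \<A> \<union> \<B>" for c using A B that by (auto simp: half_plane_arcs_def)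
  have "compact c" if "c \<in> \<A> \<union> \<B>" for c using cA(1)[OF that] compact_arc_image by auto
  then have "bounded (\<Union>(\<A> \<union> \<B>))"
    using A B by (intro bounded_Union) (auto simp: half_plane_arcs_def compact_imp_bounded)
  then obtain R where R: "R > 0" "\<Union>(\<A> \<union> \<B>) \<subseteq> ball 0 R" using bounded_subset_ballD by blast
  define J where "J = half_circle R"
  note hc = half_circle[OF R(1), folded J_def]
  have cJ: "crosscut J c" "c \<inter> J = c \<inter> \<real>" if c: "c \<in> \<A> \<union> \<B>" for c
  proof -
    have b: "z \<in> upper \<and> cmod z < R" if "z \<in> c" for z using cA(2)[OF c] R(2) c that by force
    show "c \<inter> J = c \<inter> \<real>"
      using b by (force simp: J_def half_circle_def complex_is_Real_iff)
    moreover have "c \<subseteq> J \<union> inside J"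
      using b unfolding hc by (force simp: J_def half_circle_def)
    ultimately show "crosscut J c" using cA(1)[OF c] by (auto simp: crosscut_def)
  qed
  define m where "m c = (SOME b. b \<in> \<B> \<and> b \<inter> \<real> = c \<inter> \<real>)" for c
  have m: "m c \<in> \<B> \<and> m c \<inter> \<real> = c \<inter> \<real>" if "c \<in> \<A>" for c
  proof -
    have "c \<inter> \<real> \<in> (\<lambda>c. c \<inter> \<real>) ` \<B>" using AB that by blast
    then have "\<exists>b. b \<in> \<B> \<and> b \<inter> \<real> = c \<inter> \<real>" by auto
    then show ?thesis unfolding m_def by (rule someI_ex)
  qed
  have nonempty: "c \<inter> \<real> \<noteq> {}" if "c \<in> \<A> \<union> \<B>" for c using cA(1)[OF that] by auto
  have disj: "c \<inter> e = {}" if "c \<in> \<A>" "e \<in> \<A>" "c \<noteq> e" for c e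
    using A that by (auto simp: half_plane_arcs_def)
  have disjB: "c \<inter> e = {}" if "c \<in> \<B>" "e \<in> \<B>" "c \<noteq> e" for c e
    using B that by (auto simp: half_plane_arcs_def)
  have "\<exists>F. continuous_on (J \<union> inside J) F \<and> bij_betw F (J \<union> inside J) (J \<union> inside J) \<and>
    (\<forall>z\<in>J. F z = id z) \<and> (\<forall>c\<in>\<A>. F ` c = m c)"
  proof (rule crosscut_family_extension)
    show "finite \<A>" using A by (simp add: half_plane_arcs_def)
    show "c \<inter> e = {} \<and> m c \<inter> m e = {}" if "c \<in> \<A>" "e \<in> \<A>" "c \<noteq> e" for c e
    proof
      show "c \<inter> e = {}" using disj that by blast
      have "m c \<noteq> m e" using m that nonempty disj by (metis Int_Un_eq(3) Int_absorb Int_assoc Int_commute Int_empty_left UnI1)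
      then show "m c \<inter> m e = {}" using disjB m that by blast
    qed
    show "crosscut J (m c) \<and> m c \<inter> J = id ` (c \<inter> J)" if "c \<in> \<A>" for c
      using cJ m[OF that] that by (metis UnCI image_id id_apply)
  qed (use hc cJ in \<open>auto simp: bij_betw_def intro: continuous_on_id\<close>)
  then obtain F where F: "continuous_on (J \<union> inside J) F" "bij_betw F (J \<union> inside J) (J \<union> inside J)"
    "\<And>z. z \<in> J \<Longrightarrow> F z = z" "\<And>c. c \<in> \<A> \<Longrightarrow> F ` c = m c" by auto
  \<comment> \<open>\<open>T\<close> contains the whole real axis besides the outer region, so that
    it meets the half-disc in all of \<open>J\<close> and the glued map fixes the axis.\<close>
  define T where "T = {z \<in> upper. R \<le> cmod z \<or> z \<in> \<real>}"
  define D where "D = J \<union> inside J"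
  have Deq: "D = {z. 0 \<le> Im z \<and> cmod z \<le> R}"
    unfolding D_def hc by (auto simp: J_def half_circle_def)
  have DT: "D \<union> T = upper" "D \<inter> T = J"
    unfolding Deq T_def J_def half_circle_def by (auto simp: complex_is_Real_iff)
  obtain G where G: "continuous_on (D \<union> T) G" "bij_betw G (D \<union> T) (D \<union> T)"
    "\<And>z. z \<in> D \<Longrightarrow> G z = F z" "\<And>z. z \<in> T \<Longrightarrow> G z = id z"
  proof (rule homeo_glue[of D T F id D T])
    show "closed D" using jordan_facts(15)[OF hc(1)] by (simp add: D_def compact_imp_closed)
    have "T = {z. 0 \<le> Im z} \<inter> ({z. R \<le> cmod z} \<union> \<real>)" by (auto simp: T_def)
    moreover have "closed {z::complex. R \<le> cmod z}" by (intro closed_Collect_le continuous_intros)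
    ultimately show "closed T" using closed_halfspace_Im_ge[of 0] by (auto intro!: closed_Int closed_Un closed_complex_Reals)
    show "F z = id z" if "z \<in> D" "z \<in> T" for z using DT F(3) that by auto
    show "D \<inter> T \<subseteq> F ` (D \<inter> T)" unfolding DT using F(3) by (force simp: image_iff)
  qed (use F in \<open>auto simp: D_def intro: continuous_on_id\<close>)
  have GA: "G ` c = m c" if "c \<in> \<A>" for c
  proof -
    have "c \<subseteq> D" using cJ(1)[of c] that by (auto simp: crosscut_def D_def)
    then have "G ` c = F ` c" using G(3) by (intro image_cong) auto
    then show ?thesis using F(4)[OF that] by simp
  qed
  have mA: "m ` \<A> = \<B>"
  proof
    show "m ` \<A> \<subseteq> \<B>" using m by auto
    show "\<B> \<subseteq> m ` \<A>"
    proof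
      fix b assume b: "b \<in> \<B>"
      then obtain c where c: "c \<in> \<A>" "c \<inter> \<real> = b \<inter> \<real>" using AB by (metis (no_types, lifting) image_iff)
      then have "m c \<inter> \<real> = b \<inter> \<real>" "m c \<in> \<B>" using m by auto
      then have "m c = b" using disjB[OF _ b, of "m c"] nonempty[of b] b by blast
      then show "b \<in> m ` \<A>" using c by auto
    qed
  qed
  show ?thesis
  proof (rule that[of G R])
    have "G ` \<Union>\<A> = (\<Union>c\<in>\<A>. m c)" using GA by (simp add: image_Union)
    then show "G ` \<Union>\<A> = \<Union>\<B>" using mA by simp
    show "G x = x" if "x \<in> \<real>" for x using G(4)[of x] that by (simp add: T_def complex_is_Real_iff)
    show "G z = z" if "z \<in> upper" "R \<le> cmod z" for z using G(4)[of z] that by (simp add: T_def)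
  qed (use G DT R in auto)
qed

text \<open>Shrinking the support of \<open>h\<close> towards 0 deforms it to the identity. Since
  \<open>L\<close> is a cone, the conjugate of \<open>h\<close> by a scaling fixes \<open>L\<close>
  pointwise as well.\<close>

theorem alexander_isotopy:
  fixes h :: "complex \<Rightarrow> complex"
  assumes h: "continuous_on UNIV h" "bij h" and R: "R > 0" "\<And>z. R \<le> cmod z \<Longrightarrow> h z = z"
    and L: "\<And>z. z \<in> L \<Longrightarrow> h z = z" "\<And>t z. 0 < t \<Longrightarrow> z \<in> L \<Longrightarrow> t *\<^sub>R z \<in> L" and A: "A \<subseteq> L"
  obtains H where "ambient_isotopy L A H" "H 1 = h"
proof -
  define k where "k z = h z - z" for z
  \<comment> \<open>This is \<open>t *\<^sub>R h (z /\<^sub>R t)\<close> for \<open>t > 0\<close>, and the identity for \<open>t = 0\<close>.\<close>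
  define H where "H t z = z + t *\<^sub>R k (z /\<^sub>R t)" for t z
  have ck: "continuous_on S k" for S
    unfolding k_def using h(1) continuous_on_subset by (intro continuous_intros) auto
  \<comment> \<open>The displacement \<open>k\<close> is bounded because it vanishes outside a disc;
    so \<open>t\<close> times a value of \<open>k\<close> tends to 0 uniformly as \<open>t\<close>
    does, which gives continuity at \<open>t = 0\<close>.\<close>
  have "compact (k ` cball 0 R)" by (intro compact_continuous_image ck compact_cball)
  then obtain C where C: "\<And>z. z \<in> cball 0 R \<Longrightarrow> cmod (k z) \<le> C"
    using compact_imp_bounded bounded_iff by (metis imageI)
  have C': "cmod (k z) \<le> \<bar>C\<bar>" for z
    using C[of z] R(2)[of z] by (cases "cmod z \<le> R") (auto simp: k_def)
  have H0: "H 0 z = z" for z by (simp add: H_def)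
  have Ht: "H t z = t *\<^sub>R h (z /\<^sub>R t)" if "t > 0" for t z
    using that by (simp add: H_def k_def algebra_simps)
  have "continuous_on ({0..1} \<times> UNIV) (\<lambda>(t, z). H t z)"
    unfolding continuous_on_eq_continuous_within
  proof
    fix x :: "real \<times> complex" assume "x \<in> {0..1} \<times> UNIV"
    then obtain t z where tz: "x = (t, z)" "0 \<le> t" by auto
    show "continuous (at x within {0..1} \<times> UNIV) (\<lambda>(t, z). H t z)"
    proof (cases "t = 0")
      case False
      have "continuous_on ({0<..} \<times> UNIV) (\<lambda>y::real \<times> complex. snd y + fst y *\<^sub>R k (snd y /\<^sub>R fst y))"
        by (intro continuous_intros continuous_on_compose2[OF ck[of UNIV]]) auto
      then have "isCont (\<lambda>y::real \<times> complex. snd y + fst y *\<^sub>R k (snd y /\<^sub>R fst y)) x"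
        using tz False by (subst (asm) continuous_on_eq_continuous_at) (auto intro: open_Times)
      then show ?thesis
        unfolding H_def case_prod_beta using continuous_at_imp_continuous_at_within by blast
    next
      case True
      have "((\<lambda>y. fst y *\<^sub>R k (snd y /\<^sub>R fst y)) \<longlongrightarrow> 0) (at x within {0..1} \<times> UNIV)"
      proof (rule Lim_null_comparison[of _ "\<lambda>y. \<bar>fst y\<bar> * \<bar>C\<bar>"])
        show "\<forall>\<^sub>F y in at x within {0..1} \<times> UNIV. cmod (fst y *\<^sub>R k (snd y /\<^sub>R fst y)) \<le> \<bar>fst y\<bar> * \<bar>C\<bar>"
          using C' by (intro always_eventually allI) (simp add: mult_left_mono)
        have "((\<lambda>y. \<bar>fst y\<bar> * \<bar>C\<bar>) \<longlongrightarrow> \<bar>fst x\<bar> * \<bar>C\<bar>) (at x within {0..1} \<times> UNIV)"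
          by (intro tendsto_intros)
        then show "((\<lambda>y. \<bar>fst y\<bar> * \<bar>C\<bar>) \<longlongrightarrow> 0) (at x within {0..1} \<times> UNIV)" using tz True by simp
      qed
      moreover have "(snd \<longlongrightarrow> z) (at x within {0..1} \<times> UNIV)"
        using tendsto_snd[OF tendsto_ident_at[of x]] tz by simp
      ultimately have "((\<lambda>y. snd y + fst y *\<^sub>R k (snd y /\<^sub>R fst y)) \<longlongrightarrow> z + 0) (at x within {0..1} \<times> UNIV)"
        by (intro tendsto_add)
      then show ?thesis using tz True unfolding H_def case_prod_unfold by (simp add: continuous_within)
    qed
  qed
  moreover have "(\<exists>k. homeomorphism UNIV UNIV (H t) k) \<and> H t ` L = L \<and> (\<forall>p\<in>A. H t p = p)"
    if t: "t \<in> {0..1}" for t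
  proof (cases "t = 0")
    case True
    then have "H t = (\<lambda>z. z)" using H0 by auto
    then show ?thesis using homeomorphism_ident by auto
  next
    case False
    then have t0: "t > 0" using t by simp
    have ct: "continuous_on UNIV (H t)"
      unfolding H_def using t0 by (intro continuous_intros continuous_on_compose2[OF ck[of UNIV]]) auto
    have inj: "inj (H t)"
    proof (rule injI)
      fix x y assume "H t x = H t y"
      then have "h (x /\<^sub>R t) = h (y /\<^sub>R t)" using Ht[OF t0] t0 by simp
      then have "x /\<^sub>R t = y /\<^sub>R t" using h(2) by (metis bij_is_inj inj_eq)
      then show "x = y" using t0 by simp
    qed
    have surj: "range (H t) = UNIV"
    proof -
      have "\<exists>x. y = H t x" for y
      proof -
        obtain w where "h w = y /\<^sub>R t" using h(2) by (metis bij_pointE)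
        then have "H t (t *\<^sub>R w) = y" using t0 Ht[OF t0] by simp
        then show ?thesis by metis
      qed
      then show ?thesis by auto
    qed
    obtain k' where "homeomorphism UNIV (H t ` UNIV) (H t) k'"
      using invariance_of_domain_homeomorphism[OF open_UNIV ct _ inj] by auto
    then have hom: "\<exists>k. homeomorphism UNIV UNIV (H t) k" using surj by auto
    have fixL: "H t z = z" if "z \<in> L" for z
      using L(1)[OF L(2)[of "inverse t", OF _ that]] t0 by (simp add: Ht[OF t0])
    then have "H t ` L = L" by force
    then show ?thesis using hom fixL A by blast
  qed
  ultimately have "ambient_isotopy L A H" unfolding ambient_isotopy_def using H0 by blast
  moreover have "H 1 = h" by (auto simp: Ht)
  ultimately show ?thesis using that by blast
qed

section \<open>Curve systems in half-plane charts\<close>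

lemma closure_limI:
  fixes l :: "'a::first_countable_topology"
  shows "(\<And>n. x n \<in> S) \<Longrightarrow> x \<longlonglongrightarrow> l \<Longrightarrow> l \<in> closure S"
  unfolding closure_sequential by blast

lemma connected_subset_of_disjoint_union:
  fixes \<A> :: "'a::topological_space set set"
  assumes "finite \<A>" "\<And>a. a \<in> \<A> \<Longrightarrow> closed a" "\<And>a b. a \<in> \<A> \<Longrightarrow> b \<in> \<A> \<Longrightarrow> a \<noteq> b \<Longrightarrow> a \<inter> b = {}"
    and S: "connected S" "S \<subseteq> \<Union>\<A>" "a \<in> \<A>" "S \<inter> a \<noteq> {}"
  shows "S \<subseteq> a"
proof -
  have "closed (\<Union>(\<A> - {a}))" using assms by (intro closed_Union) auto
  moreover have "a \<inter> \<Union>(\<A> - {a}) = {}" using assms(3) S(3) by blast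
  moreover have sub: "S \<subseteq> a \<union> \<Union>(\<A> - {a})" using S(2) by blast
  ultimately have "a \<inter> S = {} \<or> \<Union>(\<A> - {a}) \<inter> S = {}"
    by (intro connected_closedD[OF S(1)]) (use assms(2) S(3) in auto)
  then show ?thesis using sub S(4) by blast
qed

lemma components_disjoint_union:
  fixes \<A> :: "'a::topological_space set set"
  assumes "finite \<A>" "\<And>a. a \<in> \<A> \<Longrightarrow> closed a \<and> connected a \<and> a \<noteq> {}"
    "\<And>a b. a \<in> \<A> \<Longrightarrow> b \<in> \<A> \<Longrightarrow> a \<noteq> b \<Longrightarrow> a \<inter> b = {}"
  shows "components (\<Union>\<A>) = \<A>"
proof -
  have *: "connected_component_set (\<Union>\<A>) x = a" if "a \<in> \<A>" "x \<in> a" for a x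
  proof
    show "connected_component_set (\<Union>\<A>) x \<subseteq> a"
    proof (rule connected_subset_of_disjoint_union[of \<A>])
      show "connected_component_set (\<Union>\<A>) x \<inter> a \<noteq> {}"
        using that by (metis IntI UnionI connected_component_refl_eq empty_iff mem_Collect_eq)
    qed (use assms that in \<open>auto simp: connected_component_subset\<close>)
    show "a \<subseteq> connected_component_set (\<Union>\<A>) x"
      using that assms(2) by (intro connected_component_maximal) auto
  qed
  show ?thesis
  proof (intro equalityI subsetI)
    fix K assume "K \<in> components (\<Union>\<A>)"
    then obtain x a where "x \<in> a" "a \<in> \<A>" "K = connected_component_set (\<Union>\<A>) x" by (auto simp: components_def)
    then show "K \<in> \<A>" using * by metis
  next
    fix a assume a: "a \<in> \<A>"
    then obtain x where "x \<in> a" using assms(2) by blast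
    then show "a \<in> components (\<Union>\<A>)" using * a unfolding components_def by (metis UnionI image_eqI)
  qed
qed

lemma arc_of_interval:
  fixes h :: "real \<Rightarrow> 'a::topological_space"
  assumes "s < t" "continuous_on {s..t} h" "inj_on h {s..t}"
  obtains g where "arc g" "path_image g = h ` {s..t}" "pathstart g = h s" "pathfinish g = h t"
proof
  let ?l = "\<lambda>u. (1 - u) * s + u * t"
  have im: "?l ` {0..1} = {s..t}"
    using assms(1) closed_segment_image_interval[of s t] by (simp add: closed_segment_eq_real_ivl)
  have "inj_on ?l {0..1}"
  proof (rule inj_onI)
    fix x y assume "?l x = ?l y"
    then have "(x - y) * (t - s) = 0" by (simp add: algebra_simps)
    then show "x = y" using assms(1) by simp
  qed
  then show "arc (h \<circ> ?l)"
    unfolding arc_def path_def using im assms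
    by (intro conjI continuous_on_compose comp_inj_on continuous_intros) auto
  show "path_image (h \<circ> ?l) = h ` {s..t}"
    unfolding path_image_def image_comp[symmetric] im ..
qed (auto simp: pathstart_def pathfinish_def)

lemma half_plane_arcs_components:
  assumes "half_plane_arcs \<A>"
  shows "components (\<Union>\<A>) = \<A>"
proof (rule components_disjoint_union)
  fix a assume "a \<in> \<A>"
  then obtain g where "arc g" "path_image g = a" using assms by (auto simp: half_plane_arcs_def)
  then show "closed a \<and> connected a \<and> a \<noteq> {}"
    using closed_arc_image connected_arc_image path_image_nonempty by metis
qed (use assms in \<open>auto simp: half_plane_arcs_def\<close>)

text \<open>The charts \<open>q i\<close> map the open upper half-plane onto the components of the complement of \<open>L\<close>, and
  the real axis onto \<open>L\<close>. Meanders use the two charts \<open>z\<close> and \<open>cnj z\<close>, semimeanders the single chart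
  \<open>z\<^sup>2\<close>. The assumption \<open>germs\<close> says that every point of \<open>A\<close> is covered twice, once from above and
  once from below the axis.\<close>

locale half_plane_charts =
  fixes I :: "'i set" and q :: "'i \<Rightarrow> complex \<Rightarrow> complex" and L A :: "complex set"
  assumes fin_I: "finite I"
    and chart_cont: "\<And>i. i \<in> I \<Longrightarrow> continuous_on upper (q i)"
    and chart_inj: "\<And>i j z w. i \<in> I \<Longrightarrow> j \<in> I \<Longrightarrow> 0 < Im z \<Longrightarrow> 0 < Im w \<Longrightarrow> q i z = q j w \<Longrightarrow> i = j \<and> z = w"
    and chart_L: "\<And>i z. i \<in> I \<Longrightarrow> 0 \<le> Im z \<Longrightarrow> q i z \<in> L \<longleftrightarrow> Im z = 0"
    and chart_cover: "\<And>w. \<exists>i\<in>I. \<exists>z\<in>upper. q i z = w"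
    and chart_proper: "\<And>B. \<exists>R. \<forall>i\<in>I. \<forall>z\<in>upper. cmod (q i z) \<le> B \<longrightarrow> cmod z \<le> R"
    and chart_lift: "\<And>(g :: real \<Rightarrow> complex) s t. s < t \<Longrightarrow> continuous_on {s..t} g \<Longrightarrow> g s \<in> A \<Longrightarrow> g t \<in> A \<Longrightarrow>
      (\<And>r. r \<in> {s<..<t} \<Longrightarrow> g r \<notin> L) \<Longrightarrow>
      \<exists>i\<in>I. \<exists>h. continuous_on {s..t} h \<and> (\<forall>r\<in>{s..t}. h r \<in> upper \<and> q i (h r) = g r)"
    and L_cone: "\<And>t z. 0 < t \<Longrightarrow> z \<in> L \<Longrightarrow> t *\<^sub>R z \<in> L"
    and L_real: "L \<subseteq> \<real>"
    and A_L: "A \<subseteq> L"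
    and L_near: "\<And>p. p \<in> A \<Longrightarrow> \<exists>\<delta>>0. ball p \<delta> \<inter> \<real> \<subseteq> L"
    and fin_A: "finite A"
    and germs: "\<And>p. p \<in> A \<Longrightarrow> \<exists>i x j y \<epsilon>. (i, x) \<noteq> (j, y) \<and>
      {(k, z). k \<in> I \<and> Im z = 0 \<and> q k z = p} = {(i, x), (j, y)} \<and> 0 < \<epsilon> \<and>
      (\<forall>z\<in>ball x \<epsilon>. 0 < Im z \<longrightarrow> 0 < Im (q i z)) \<and> (\<forall>z\<in>ball y \<epsilon>. 0 < Im z \<longrightarrow> Im (q j z) < 0)"
begin

text \<open>A germ is a side of the axis at \<open>p\<close>. It is encoded with its chart because
  for meanders the same real number lies over \<open>p\<close> in both charts, whereas for
  semimeanders two real numbers lie over \<open>p\<close> in one chart.\<close>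

definition germs_over :: "complex \<Rightarrow> ('i \<times> complex) set" where
  "germs_over p = {(k, z). k \<in> I \<and> Im z = 0 \<and> q k z = p}"

lemma germs_over_card:
  assumes "p \<in> A"
  shows "card (germs_over p) = 2"
proof -
  obtain i x j y where "(i, x) \<noteq> (j, y)" "germs_over p = {(i, x), (j, y)}"
    using germs[OF assms] unfolding germs_over_def by blast
  then show ?thesis by auto
qed

lemma germs_over_finite: "p \<in> A \<Longrightarrow> finite (germs_over p)"
  using germs_over_card[of p] by (intro card_ge_0_finite) simp

text \<open>In a bounded region of the half-plane and away from the germs over \<open>p\<close>, the
  charts keep a positive distance from \<open>p\<close> by compactness; properness reduces
  everything to a bounded region.\<close>

lemma near_germ:
  assumes "p \<in> A" "e > 0"
  obtains d where "d > 0"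
    "\<And>i z. i \<in> I \<Longrightarrow> z \<in> upper \<Longrightarrow> dist p (q i z) < d \<Longrightarrow> \<exists>x. (i, x) \<in> germs_over p \<and> dist x z < e"
proof -
  obtain R where R: "\<And>i z. i \<in> I \<Longrightarrow> z \<in> upper \<Longrightarrow> cmod (q i z) \<le> cmod p + 1 \<Longrightarrow> cmod z \<le> R"
    using chart_proper[of "cmod p + 1"] by blast
  define K where "K i = cball 0 R \<inter> {z. 0 \<le> Im z} \<inter> - (\<Union>x\<in>{x. (i, x) \<in> germs_over p}. ball x e)" for i
  have "\<exists>d>0. \<forall>z\<in>K i. d \<le> dist p (q i z)" if i: "i \<in> I" for i
  proof -
    have "compact (K i)" unfolding K_def
      by (intro compact_Int_closed compact_cball closed_halfspace_Im_ge) auto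
    then have "compact (q i ` K i)"
      by (intro compact_continuous_image continuous_on_subset[OF chart_cont[OF i]]) (auto simp: K_def)
    then have cl: "closed (q i ` K i)" by (rule compact_imp_closed)
    have "p \<notin> q i ` K i"
    proof
      assume "p \<in> q i ` K i"
      then obtain z where z: "z \<in> K i" "q i z = p" by auto
      then have "(i, z) \<in> germs_over p"
        using chart_L[OF i, of z] assms(1) A_L i by (auto simp: germs_over_def K_def)
      then show False using z assms(2) by (auto simp: K_def)
    qed
    then obtain d where "d > 0" "\<And>y. y \<in> q i ` K i \<Longrightarrow> d \<le> dist p y"
      using separate_point_closed[OF cl] by blast
    then show ?thesis by blast
  qed
  then obtain d where d: "\<And>i. i \<in> I \<Longrightarrow> d i > 0 \<and> (\<forall>z\<in>K i. d i \<le> dist p (q i z))" by metis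
  \<comment> \<open>The entry 1 matches the bound \<open>cmod p + 1\<close> under which
    \<open>R\<close> was chosen, and keeps the set nonempty.\<close>
  define \<delta> where "\<delta> = Min (insert 1 (d ` I))"
  have dl: "\<delta> > 0" "\<delta> \<le> 1" "\<And>i. i \<in> I \<Longrightarrow> \<delta> \<le> d i"
    using fin_I d by (auto simp: \<delta>_def)
  show ?thesis
  proof (rule that[OF dl(1)])
    fix i z assume i: "i \<in> I" and z: "z \<in> upper" and dz: "dist p (q i z) < \<delta>"
    have "cmod (q i z) \<le> cmod p + 1"
      using dz dl(2) norm_triangle_ineq2[of "q i z" p] by (simp add: dist_norm norm_minus_commute)
    then have "cmod z \<le> R" using R i z by blast
    moreover have "z \<notin> K i" using d[OF i] dl(3)[OF i] dz by force
    ultimately show "\<exists>x. (i, x) \<in> germs_over p \<and> dist x z < e" using z by (auto simp: K_def)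
  qed
qed

lemma crossing_sides:
  assumes "crosses_axis_at c p"
  shows "p \<in> closure (c \<inter> {z. Im z < 0})" "p \<in> closure (c \<inter> {z. 0 < Im z})"
proof -
  obtain g e where g: "simple_path g" "path_image g = c" "g (1/2) = p" "0 < e" "e \<le> 1/2"
    "\<And>s. s \<in> {0<..<e} \<Longrightarrow> Im (g (1/2 - s)) < 0 \<and> 0 < Im (g (1/2 + s))"
    using assms by (auto simp: crosses_axis_at_def)
  have cg: "continuous_on {0..1} g" using g by (simp add: simple_path_def path_def)
  \<comment> \<open>The offset 2 keeps \<open>r n\<close> below \<open>e\<close> already for
    \<open>n = 0\<close>.\<close>
  define r where "r n = e / real (n + 2)" for n
  have r: "r n \<in> {0<..<e}" for n using g(4) by (auto simp: r_def field_simps add_pos_nonneg)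
  have r0: "r \<longlonglongrightarrow> 0"
  proof -
    have "(\<lambda>n. e / real n) \<longlonglongrightarrow> 0" by (rule lim_const_over_n)
    then show ?thesis unfolding r_def using LIMSEQ_ignore_initial_segment[of "\<lambda>n. e / real n" 0 2] by simp
  qed
  have in01: "1/2 - r n \<in> {0..1}" "1/2 + r n \<in> {0..1}" for n using r[of n] g(5) by auto
  have l1: "(\<lambda>n. g (1/2 - r n)) \<longlonglongrightarrow> g (1/2)" and l2: "(\<lambda>n. g (1/2 + r n)) \<longlonglongrightarrow> g (1/2)"
    by (rule continuous_on_tendsto_compose[OF cg], use in01 in \<open>auto intro!: tendsto_eq_intros r0\<close>)+
  have "g (1/2 - r n) \<in> c \<inter> {z. Im z < 0}" "g (1/2 + r n) \<in> c \<inter> {z. 0 < Im z}" for n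
    using g(2) g(6)[OF r[of n]] in01[of n] by (auto simp: path_image_def)
  then show "p \<in> closure (c \<inter> {z. Im z < 0})" "p \<in> closure (c \<inter> {z. 0 < Im z})"
    using closure_limI[OF _ l1] closure_limI[OF _ l2] g(3) by simp_all
qed

text \<open>The curve approaches \<open>p\<close> from both sides of the axis, and near
  \<open>p\<close> each side is covered by one germ only; so each germ is a limit of lifted points
  of the curve.\<close>

lemma crossing_germ:
  assumes p: "p \<in> A" and c: "crosses_axis_at c p" and g: "(k, x) \<in> germs_over p"
  shows "x \<in> closure {z. 0 < Im z \<and> q k z \<in> c}"
proof -
  obtain i a j b e where gm: "(i, a) \<noteq> (j, b)" "germs_over p = {(i, a), (j, b)}" "0 < e"
    "\<And>z. z \<in> ball a e \<Longrightarrow> 0 < Im z \<Longrightarrow> 0 < Im (q i z)" "\<And>z. z \<in> ball b e \<Longrightarrow> 0 < Im z \<Longrightarrow> Im (q j z) < 0"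
    using germs[OF p] unfolding germs_over_def by blast
  have main: "\<exists>m z x. (m, x) \<in> germs_over p \<and> m \<in> I \<and> 0 < Im z \<and> q m z \<in> c \<inter> S \<and> dist x z < r"
    if S: "p \<in> closure (c \<inter> S)" "\<And>z. z \<in> S \<Longrightarrow> Im z \<noteq> 0" and r: "r > 0" for S r
  proof -
    obtain d where d: "d > 0" "\<And>i z. i \<in> I \<Longrightarrow> z \<in> upper \<Longrightarrow> dist p (q i z) < d \<Longrightarrow>
        \<exists>x. (i, x) \<in> germs_over p \<and> dist x z < r"
      using near_germ[OF p r] by blast
    obtain w where w: "w \<in> c \<inter> S" "dist w p < d" using S(1) d(1) by (auto simp: closure_approachable)
    obtain m z where mz: "m \<in> I" "z \<in> upper" "q m z = w" using chart_cover by blast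
    have "w \<notin> L" using w S(2) L_real by (auto simp: complex_is_Real_iff)
    then have "0 < Im z" using chart_L[OF mz(1), of z] mz by auto
    moreover obtain x where "(m, x) \<in> germs_over p" "dist x z < r"
      using d(2)[OF mz(1,2)] mz w by (auto simp: dist_commute)
    ultimately show ?thesis using mz w by blast
  qed
  show ?thesis unfolding closure_approachable
  proof (intro allI impI)
    fix r :: real assume r: "r > 0"
    consider "(k, x) = (i, a)" | "(k, x) = (j, b)" using g gm(2) by auto
    then show "\<exists>y\<in>{z. 0 < Im z \<and> q k z \<in> c}. dist y x < r"
    proof cases
      case 1
      obtain m z x' where z: "(m, x') \<in> germs_over p" "0 < Im z" "q m z \<in> c" "0 < Im (q m z)" "dist x' z < min r e"
        using main[OF crossing_sides(2)[OF c], of "min r e"] r gm(3) by auto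
      then have "(m, x') \<noteq> (j, b)" using gm(5)[of z] by auto
      then have "(m, x') = (i, a)" using gm(2) z(1) by auto
      then show ?thesis using z 1 by (auto simp: dist_commute)
    next
      case 2
      obtain m z x' where z: "(m, x') \<in> germs_over p" "0 < Im z" "q m z \<in> c" "Im (q m z) < 0" "dist x' z < min r e"
        using main[OF crossing_sides(1)[OF c], of "min r e"] r gm(3) by auto
      then have "(m, x') \<noteq> (i, a)" using gm(4)[of z] by auto
      then have "(m, x') = (j, b)" using gm(2) z(1) by auto
      then show ?thesis using z 2 by (auto simp: dist_commute)
    qed
  qed
qed

text \<open>Between consecutive points of \<open>L\<close> the curve lifts to a chart. That the
  lifted arcs are disjoint also at their real ends follows by counting: the ends of the pieces cover
  all germs over the points of the curve, and there are as many ends as germs. This is where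
  crossing instead of touching enters.\<close>

lemma curve_arcs:
  assumes C: "curve_system L A C" and c: "c \<in> C"
  obtains E where "finite E"
    "\<And>i a. (i, a) \<in> E \<Longrightarrow> i \<in> I \<and> a \<subseteq> upper \<and> (\<exists>g. arc g \<and> path_image g = a \<and> a \<inter> \<real> = {pathstart g, pathfinish g}) \<and> q i ` a \<subseteq> c"
    "\<And>i a b. (i, a) \<in> E \<Longrightarrow> (i, b) \<in> E \<Longrightarrow> a \<noteq> b \<Longrightarrow> a \<inter> b = {}"
    "\<And>i z. i \<in> I \<Longrightarrow> z \<in> upper \<Longrightarrow> q i z \<in> c \<Longrightarrow> \<exists>a. (i, a) \<in> E \<and> z \<in> a"
proof -
  have scc: "simple_closed_curve c" and cL: "c \<inter> L \<noteq> {}" and cross: "\<And>p. p \<in> c \<inter> L \<Longrightarrow> crosses_axis_at c p"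
    and cA: "c \<inter> L = c \<inter> A"
    using C c by (auto simp: curve_system_def)
  obtain p0 where p0: "p0 \<in> c" "p0 \<in> L" using cL by blast
  obtain g where g: "simple_path g" "path_image g = c" "g 0 = p0" "g 1 = p0"
    using loop_starting_at[OF scc p0(1)] by metis
  have cg: "continuous_on {0..1} g" using g(1) by (simp add: simple_path_def path_def)
  have gc: "g t \<in> c" if "t \<in> {0..1}" for t using g(2) that by (auto simp: path_image_def)
  define T where "T = {t \<in> {0..1}. g t \<in> L}"
  \<comment> \<open>Parameter 1 is dropped since it names the same point as 0.\<close>
  define T0 where "T0 = T - {1}"
  have T01: "0 \<in> T" "1 \<in> T" using g p0 by (auto simp: T_def)
  have gbij: "bij_betw g T0 (c \<inter> A)"
    unfolding bij_betw_def
  proof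
    show "inj_on g T0"
    proof (rule inj_onI)
      fix s t assume "s \<in> T0" "t \<in> T0" "g s = g t"
      then show "s = t" using simple_path_eqD[OF g(1), of s t] by (auto simp: T0_def T_def)
    qed
    show "g ` T0 = c \<inter> A"
    proof
      show "g ` T0 \<subseteq> c \<inter> A" using gc cA by (auto simp: T0_def T_def)
      show "c \<inter> A \<subseteq> g ` T0"
      proof
        fix p assume p: "p \<in> c \<inter> A"
        then obtain t where t: "t \<in> {0..1}" "g t = p" using g(2) by (auto simp: path_image_def)
        show "p \<in> g ` T0"
        proof (cases "t = 1")
          case True
          then have "p = g 0" "0 \<in> T0" using g t T01 by (auto simp: T0_def)
          then show ?thesis by blast
        next
          case False
          then have "t \<in> T0" using t p cA by (auto simp: T0_def T_def)
          then show ?thesis using t by blast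
        qed
      qed
    qed
  qed
  have finT0: "finite T0" using bij_betw_finite[OF gbij] fin_A by blast
  then have finT: "finite T" by (simp add: T0_def)
  define n where "n s = Min {t \<in> T. s < t}" for s
  have n: "n s \<in> T" "s < n s" "\<And>t. t \<in> T \<Longrightarrow> s < t \<Longrightarrow> n s \<le> t" if s: "s \<in> T0" for s
  proof -
    have fi: "finite {t \<in> T. s < t}" using finT by simp
    have "1 \<in> {t \<in> T. s < t}" using s T01 by (auto simp: T0_def T_def)
    then have ne: "{t \<in> T. s < t} \<noteq> {}" by blast
    show "n s \<in> T" "s < n s" using Min_in[OF fi ne] by (auto simp: n_def)
    show "n s \<le> t" if "t \<in> T" "s < t" for t using Min_le[OF fi] that by (auto simp: n_def)
  qed
  have s01: "0 \<le> s" "s < 1" "n s \<le> 1" "{s..n s} \<subseteq> {0..1}" if "s \<in> T0" for s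
    using that n[OF that] by (auto simp: T0_def T_def)
  have offL: "g r \<notin> L" if "s \<in> T0" "r \<in> {s<..<n s}" for s r
    using n(3)[OF that(1), of r] that s01[OF that(1)] by (auto simp: T_def)
  have "\<exists>i h. i \<in> I \<and> continuous_on {s..n s} h \<and> (\<forall>r\<in>{s..n s}. h r \<in> upper \<and> q i (h r) = g r)"
    if s: "s \<in> T0" for s
  proof -
    have "g s \<in> A" "g (n s) \<in> A" using s n(1)[OF s] cA gc by (auto simp: T0_def T_def)
    then show ?thesis
      using chart_lift[OF n(2)[OF s] continuous_on_subset[OF cg s01(4)[OF s]]] offL[OF s] by blast
  qed
  then obtain ix hh where ih: "\<And>s. s \<in> T0 \<Longrightarrow> ix s \<in> I" "\<And>s. s \<in> T0 \<Longrightarrow> continuous_on {s..n s} (hh s)"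
     "\<And>s r. s \<in> T0 \<Longrightarrow> r \<in> {s..n s} \<Longrightarrow> hh s r \<in> upper"
     "\<And>s r. s \<in> T0 \<Longrightarrow> r \<in> {s..n s} \<Longrightarrow> q (ix s) (hh s r) = g r"
    by metis
  have real_iff: "Im (hh s r) = 0 \<longleftrightarrow> r = s \<or> r = n s" if "s \<in> T0" "r \<in> {s..n s}" for s r
  proof -
    have "Im (hh s r) = 0 \<longleftrightarrow> g r \<in> L" using chart_L[OF ih(1)[OF that(1)], of "hh s r"] ih(3,4)[OF that] by auto
    also have "\<dots> \<longleftrightarrow> r = s \<or> r = n s"
      using offL[OF that(1), of r] that n(1)[OF that(1)] by (force simp: T0_def T_def)
    finally show ?thesis .
  qed
  define aa where "aa s = hh s ` {s..n s}" for s
  have compact_aa: "compact (aa s)" if "s \<in> T0" for s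
    unfolding aa_def by (intro compact_continuous_image ih that compact_Icc)
  have find: "\<exists>s\<in>T0. ix s = i \<and> z \<in> aa s" if z: "i \<in> I" "0 < Im z" "q i z \<in> c" for i z
  proof -
    obtain r where r: "r \<in> {0..1}" "g r = q i z" using z(3) g(2) by (auto simp: path_image_def)
    have "r \<notin> T" using r chart_L[OF z(1), of z] z by (auto simp: T_def)
    define s where "s = Max {t \<in> T. t < r}"
    have "0 \<in> {t \<in> T. t < r}" using T01 \<open>r \<notin> T\<close> r by (cases "r = 0") auto
    then have ne: "{t \<in> T. t < r} \<noteq> {}" "finite {t \<in> T. t < r}" using finT by auto
    have s: "s \<in> T" "s < r" using Max_in[OF ne(2,1)] by (auto simp: s_def)
    then have sT: "s \<in> T0" using r by (auto simp: T0_def)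
    have "r < n s"
    proof (rule ccontr)
      assume "\<not> r < n s"
      then have "n s \<in> {t \<in> T. t < r}" using n(1)[OF sT] \<open>r \<notin> T\<close> by (auto simp: not_less less_le)
      then have "n s \<le> s" using Max_ge[OF ne(2)] by (simp add: s_def)
      then show False using n(2)[OF sT] by simp
    qed
    then have rs: "r \<in> {s..n s}" "r \<noteq> s" "r \<noteq> n s" using s by auto
    then have "0 < Im (hh s r)" using real_iff[OF sT rs(1)] ih(3)[OF sT rs(1)] by auto
    then have "ix s = i \<and> hh s r = z"
      using chart_inj[OF ih(1)[OF sT] z(1), of "hh s r" z] ih(4)[OF sT rs(1)] r z by auto
    then show ?thesis using sT rs by (auto simp: aa_def)
  qed
  define Gc where "Gc = {(k, z). k \<in> I \<and> Im z = 0 \<and> q k z \<in> c}"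
  \<comment> \<open>\<open>G (s, b)\<close> is the germ at the beginning or, if \<open>b\<close>
    holds, at the end of the piece that starts at \<open>s\<close>.\<close>
  define G where "G = (\<lambda>(s, b). (ix s, hh s (if b then n s else s)))"
  have Gc_eq: "Gc = (\<Union>p\<in>c \<inter> A. germs_over p)"
    using chart_L cA by (fastforce simp: Gc_def germs_over_def)
  have "card Gc = 2 * card (c \<inter> A)"
  proof -
    have "card Gc = (\<Sum>p\<in>c \<inter> A. card (germs_over p))" unfolding Gc_eq
      by (rule card_UN_disjoint) (use fin_A germs_over_finite in \<open>auto simp: germs_over_def\<close>)
    also have "\<dots> = (\<Sum>p\<in>c \<inter> A. 2)" by (rule sum.cong) (use germs_over_card in auto)
    finally show ?thesis by simp
  qed
  also have "\<dots> = card (T0 \<times> (UNIV :: bool set))"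
    using bij_betw_same_card[OF gbij] by (simp add: card_cartesian_product)
  finally have cardG: "card Gc = card (T0 \<times> (UNIV :: bool set))" .
  have Gsurj: "G ` (T0 \<times> UNIV) = Gc"
  proof
    show "G ` (T0 \<times> UNIV) \<subseteq> Gc"
    proof
      fix y assume "y \<in> G ` (T0 \<times> UNIV)"
      then obtain s b where s: "s \<in> T0" and y: "y = G (s, b)" by auto
      let ?r = "if b then n s else s"
      have "?r \<in> {s..n s}" using n(2)[OF s] by auto
      then show "y \<in> Gc" unfolding y
        using ih(1)[OF s] ih(4)[OF s] real_iff[OF s] gc s01[OF s] n(2)[OF s] by (auto simp: G_def Gc_def)
    qed
    show "Gc \<subseteq> G ` (T0 \<times> UNIV)"
    proof
      fix y assume y: "y \<in> Gc"
      obtain k x where yx: "y = (k, x)" by (cases y)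
      then have kx: "(k, x) \<in> Gc" using y by simp
      then obtain p where p: "p \<in> c" "p \<in> A" "(k, x) \<in> germs_over p" using Gc_eq by auto
      then have kI: "k \<in> I" by (auto simp: germs_over_def)
      \<comment> \<open>All points of the curve lifted by chart \<open>k\<close> into the open
        half-plane lie on finitely many compact arcs; their limit \<open>x\<close> therefore lies on
        one of these, as an end.\<close>
      define U where "U = (\<Union>s\<in>{s\<in>T0. ix s = k}. aa s)"
      have "closed U" unfolding U_def using finT0 compact_aa compact_imp_closed by (intro closed_UN) auto
      moreover have "{z. 0 < Im z \<and> q k z \<in> c} \<subseteq> U" using find[OF kI] by (auto simp: U_def)
      ultimately have "closure {z. 0 < Im z \<and> q k z \<in> c} \<subseteq> U" by (simp add: closure_minimal)
      then have "x \<in> U" using crossing_germ[OF p(2) cross p(3)] p A_L by auto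
      then obtain s r where s: "s \<in> T0" "ix s = k" "r \<in> {s..n s}" "x = hh s r" by (auto simp: U_def aa_def)
      then have "r = s \<or> r = n s" using real_iff[OF s(1,3)] kx by (auto simp: Gc_def)
      then have "y = G (s, r = n s)" using s yx n(2)[OF s(1)] by (auto simp: G_def)
      then show "y \<in> G ` (T0 \<times> UNIV)" using s(1) by blast
    qed
  qed
  have Ginj: "inj_on G (T0 \<times> UNIV)"
    by (rule eq_card_imp_inj_on) (use finT0 cardG Gsurj in auto)
  \<comment> \<open>Essential if the curve meets \<open>A\<close> only once: then the piece is the
    whole loop, and its ends differ only in the chart.\<close>
  have ends_ne: "hh s s \<noteq> hh s (n s)" if "s \<in> T0" for s
    using inj_onD[OF Ginj, of "(s, False)" "(s, True)"] that by (auto simp: G_def)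
  have inj_hh: "inj_on (hh s) {s..n s}" if s: "s \<in> T0" for s
  proof (rule inj_onI)
    fix r r' assume r: "r \<in> {s..n s}" "r' \<in> {s..n s}" "hh s r = hh s r'"
    then have "g r = g r'" using ih(4)[OF s] by metis
    then consider "r = r'" | "r = 0" "r' = 1" | "r = 1" "r' = 0"
      using simple_path_eqD[OF g(1), of r r'] r s01(4)[OF s] by blast
    then show "r = r'"
    proof cases
      case 2
      then have "r = s" "r' = n s" using r s01[OF s] by auto
      then show ?thesis using ends_ne[OF s] r by auto
    next
      case 3
      then have "r' = s" "r = n s" using r s01[OF s] by auto
      then show ?thesis using ends_ne[OF s] r by auto
    qed
  qed
  have disj: "aa s \<inter> aa s' = {}" if s: "s \<in> T0" "s' \<in> T0" "ix s = ix s'" "s \<noteq> s'" for s s'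
  proof (rule ccontr)
    assume "aa s \<inter> aa s' \<noteq> {}"
    then obtain r r' where r: "r \<in> {s..n s}" "r' \<in> {s'..n s'}" "hh s r = hh s' r'" by (auto simp: aa_def) metis
    show False
    proof (cases "Im (hh s r) = 0")
      case True
      then have "r = s \<or> r = n s" "r' = s' \<or> r' = n s'" using real_iff s r by metis+
      then have "G (s, r = n s) = G (s', r' = n s')" using r s by (auto simp: G_def)
      then show False using inj_onD[OF Ginj] s by blast
    next
      case False
      then have rr: "s < r" "r < n s" "s' < r'" "r' < n s'" using real_iff s r by (metis atLeastAtMost_iff less_le)+
      have "g r = g r'" using ih(4) s r by metis
      then have "r = r'" using simple_path_eqD[OF g(1), of r r'] rr s01[OF s(1)] s01[OF s(2)] by auto
      moreover have "s < s' \<Longrightarrow> n s \<le> s'" "s' < s \<Longrightarrow> n s' \<le> s" using n(3) s by (auto simp: T0_def)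
      ultimately show False using rr s(4) by linarith
    qed
  qed
  show ?thesis
  proof (rule that[of "(\<lambda>s. (ix s, aa s)) ` T0"])
    show "finite ((\<lambda>s. (ix s, aa s)) ` T0)" using finT0 by simp
    show "i \<in> I \<and> a \<subseteq> upper \<and> (\<exists>g. arc g \<and> path_image g = a \<and> a \<inter> \<real> = {pathstart g, pathfinish g}) \<and> q i ` a \<subseteq> c"
      if ia: "(i, a) \<in> (\<lambda>s. (ix s, aa s)) ` T0" for i a
    proof -
      obtain s where s: "s \<in> T0" "i = ix s" "a = aa s" using ia by auto
      obtain \<gamma> where ga: "arc \<gamma>" "path_image \<gamma> = aa s" "pathstart \<gamma> = hh s s" "pathfinish \<gamma> = hh s (n s)"
        using arc_of_interval[OF n(2)[OF s(1)] ih(2)[OF s(1)] inj_hh[OF s(1)]] by (auto simp: aa_def)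
      have "aa s \<inter> \<real> = {hh s s, hh s (n s)}"
        using real_iff[OF s(1)] n(2)[OF s(1)] by (auto simp: aa_def complex_is_Real_iff)
      moreover have "aa s \<subseteq> upper" "q (ix s) ` aa s \<subseteq> c"
        using ih(3,4)[OF s(1)] gc s01[OF s(1)] by (auto simp: aa_def)
      ultimately show ?thesis using ga ih(1)[OF s(1)] s by metis
    qed
    show "a \<inter> b = {}" if "(i, a) \<in> (\<lambda>s. (ix s, aa s)) ` T0" "(i, b) \<in> (\<lambda>s. (ix s, aa s)) ` T0" "a \<noteq> b" for i a b
      using that disj by (auto 4 0)
    show "\<exists>a. (i, a) \<in> (\<lambda>s. (ix s, aa s)) ` T0 \<and> z \<in> a" if z: "i \<in> I" "z \<in> upper" "q i z \<in> c" for i z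
    proof (cases "Im z = 0")
      case True
      then have "(i, z) \<in> G ` (T0 \<times> UNIV)" unfolding Gsurj using z by (simp add: Gc_def)
      then obtain s b where s: "s \<in> T0" "i = ix s" "z = hh s (if b then n s else s)" by (auto simp: G_def)
      then have "z \<in> aa s" using n(2)[OF s(1)] by (auto simp: aa_def)
      then show ?thesis using s by blast
    next
      case False
      then show ?thesis using find[OF z(1) _ z(3)] z(2) by force
    qed
  qed
qed

lemma curve_system_finite:
  assumes "curve_system L A C"
  shows "finite C"
proof -
  have "\<exists>p. p \<in> c \<inter> A" if "c \<in> C" for c
    using assms that unfolding curve_system_def by blast
  then obtain f where f: "\<And>c. c \<in> C \<Longrightarrow> f c \<in> c \<inter> A" by metis
  have "inj_on f C"
  proof (rule inj_onI)
    fix c d assume "c \<in> C" "d \<in> C" "f c = f d"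
    then show "c = d" using f[of c] f[of d] assms unfolding curve_system_def disjoint_def by auto
  qed
  moreover have "f ` C \<subseteq> A" using f by auto
  ultimately show ?thesis using fin_A finite_subset inj_on_finite by blast
qed

definition pre :: "complex set set \<Rightarrow> 'i \<Rightarrow> complex set" where
  "pre C i = {z \<in> upper. q i z \<in> \<Union>C}"

text \<open>Arcs of different curves are disjoint because the curves are. Describing the arcs as
  connected components makes them depend on \<open>C\<close> alone and not on
  parametrizations.\<close>

theorem curve_system_arcs:
  assumes C: "curve_system L A C" and i: "i \<in> I"
  shows "half_plane_arcs (components (pre C i))"
proof -
  have "\<forall>c\<in>C. \<exists>E. finite E \<and> (\<forall>i a. (i, a) \<in> E \<longrightarrow> i \<in> I \<and> a \<subseteq> upper \<and> (\<exists>g. arc g \<and> path_image g = a \<and> a \<inter> \<real> = {pathstart g, pathfinish g}) \<and> q i ` a \<subseteq> c)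
    \<and> (\<forall>i a b. (i, a) \<in> E \<longrightarrow> (i, b) \<in> E \<longrightarrow> a \<noteq> b \<longrightarrow> a \<inter> b = {})
    \<and> (\<forall>i z. i \<in> I \<longrightarrow> z \<in> upper \<longrightarrow> q i z \<in> c \<longrightarrow> (\<exists>a. (i, a) \<in> E \<and> z \<in> a))"
    (is "\<forall>c\<in>C. \<exists>E. ?P c E")
  proof
    fix c assume c: "c \<in> C"
    show "\<exists>E. ?P c E" by (rule curve_arcs[OF C c]) (rule exI, blast)
  qed
  then obtain E where E: "\<forall>c\<in>C. ?P c (E c)" by (rule bchoice[THEN exE])
  have E1: "finite (E c)" if "c \<in> C" for c using bspec[OF E that] by (elim conjE)
  have E2: "i \<in> I \<and> a \<subseteq> upper \<and> (\<exists>g. arc g \<and> path_image g = a \<and> a \<inter> \<real> = {pathstart g, pathfinish g}) \<and> q i ` a \<subseteq> c"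
    if "c \<in> C" "(i, a) \<in> E c" for c i a using bspec[OF E that(1)] that(2) by (elim conjE) simp
  have E3: "a \<inter> b = {}" if "c \<in> C" "(i, a) \<in> E c" "(i, b) \<in> E c" "a \<noteq> b" for c i a b
    using bspec[OF E that(1)] that(2-) by (elim conjE) simp
  have E4: "\<exists>a. (i, a) \<in> E c \<and> z \<in> a" if "c \<in> C" "i \<in> I" "z \<in> upper" "q i z \<in> c" for c i z
    using bspec[OF E that(1)] that(2-) by (elim conjE) simp
  define \<A> where "\<A> = {a. \<exists>c\<in>C. (i, a) \<in> E c}"
  have arcs: "a \<subseteq> upper \<and> (\<exists>g. arc g \<and> path_image g = a \<and> a \<inter> \<real> = {pathstart g, pathfinish g})" if "a \<in> \<A>" for a
  proof -
    obtain c where "c \<in> C" "(i, a) \<in> E c" using \<open>a \<in> \<A>\<close> unfolding \<A>_def by blast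
    then show ?thesis using E2[of c i a] by simp
  qed
  have sub: "q i ` a \<subseteq> c" if "c \<in> C" "(i, a) \<in> E c" for a c
    using E2[OF that] by simp
  have "\<A> = (\<Union>c\<in>C. snd ` (E c \<inter> {i} \<times> UNIV))" by (force simp: \<A>_def)
  moreover have "finite (snd ` (E c \<inter> {i} \<times> UNIV))" if "c \<in> C" for c using E1[OF that] by simp
  ultimately have "finite \<A>" using curve_system_finite[OF C] by simp
  moreover have "a \<inter> b = {}" if ab: "a \<in> \<A>" "b \<in> \<A>" "a \<noteq> b" for a b
  proof -
    obtain c d where cd: "c \<in> C" "d \<in> C" "(i, a) \<in> E c" "(i, b) \<in> E d" using ab by (auto simp: \<A>_def)
    show ?thesis
    proof (cases "c = d")
      case True
      then show ?thesis using E3[OF cd(1,3)] cd ab(3) by simp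
    next
      case False
      then have "c \<inter> d = {}" using C cd by (auto simp: curve_system_def disjoint_def)
      then show ?thesis using sub[OF cd(1,3)] sub[OF cd(2,4)] by blast
    qed
  qed
  ultimately have hp: "half_plane_arcs \<A>" using arcs unfolding half_plane_arcs_def by blast
  have "\<Union>\<A> = pre C i"
  proof (intro equalityI subsetI)
    fix z assume "z \<in> \<Union>\<A>"
    then obtain a c where "z \<in> a" "a \<in> \<A>" "c \<in> C" "(i, a) \<in> E c" by (auto simp: \<A>_def)
    then show "z \<in> pre C i" using arcs[of a] sub[of c a] by (auto simp: pre_def)
  next
    fix z assume z: "z \<in> pre C i"
    then obtain c where c: "c \<in> C" "q i z \<in> c" "z \<in> upper" by (auto simp: pre_def)
    then obtain a where "(i, a) \<in> E c" "z \<in> a" using E4[OF c(1) i c(3,2)] by blast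
    then show "z \<in> \<Union>\<A>" using c by (auto simp: \<A>_def)
  qed
  then show ?thesis using half_plane_arcs_components[OF hp] hp by metis
qed

end

section \<open>Curve systems from arcs\<close>

text \<open>Near \<open>p\<close> the two branches of the curve avoid the axis, so each has a
  constant sign. Both half-planes are approached, hence the signs are opposite, and reversing the
  parametrization if necessary makes the crossing upwards.\<close>

lemma crosses_axisI:
  assumes c: "simple_closed_curve c" and p: "p \<in> c" and d: "d > 0"
    and axis: "\<And>z. z \<in> c \<Longrightarrow> dist p z < d \<Longrightarrow> Im z = 0 \<Longrightarrow> z = p"
    and cl: "p \<in> closure (c \<inter> {z. Im z < 0})" "p \<in> closure (c \<inter> {z. 0 < Im z})"
  shows "crosses_axis_at c p"
proof -
  obtain h where h: "simple_path h" "path_image h = c" "h 0 = p" "h 1 = p"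
    using loop_starting_at[OF c p] by metis
  \<comment> \<open>The loop \<open>h\<close> starts at \<open>p\<close>; the shift moves
    \<open>p\<close> to parameter 1/2, as \<open>crosses_axis_at\<close> demands.\<close>
  define g where "g = shiftpath (1/2) h"
  have hh: "pathfinish h = pathstart h" using h by (simp add: pathstart_def pathfinish_def)
  have g: "simple_path g" "path_image g = c" "pathfinish g = pathstart g" "g (1/2) = p"
    using h hh by (simp_all add: g_def simple_path_shiftpath path_image_shiftpath closed_shiftpath)
      (simp add: shiftpath_def)
  have cg: "continuous_on {0..1} g" using g(1) by (simp add: simple_path_def path_def)
  obtain e0 where e0: "e0 > 0" "\<And>t. t \<in> {0..1} \<Longrightarrow> dist t (1/2) < e0 \<Longrightarrow> dist (g t) (g (1/2)) < d"
    using cg[unfolded continuous_on_iff, rule_format, of "1/2" d] d by auto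
  define e where "e = min e0 (1/2)"
  have e: "e > 0" "e \<le> 1/2" "e \<le> e0" using e0 by (auto simp: e_def)
  have nz: "Im (g t) \<noteq> 0" if t: "t \<noteq> 1/2" "dist t (1/2) < e" for t
  proof
    assume "Im (g t) = 0"
    have t01: "0 < t" "t < 1" using t e by (auto simp: dist_real_def)
    then have "dist p (g t) < d" using e0(2)[of t] t e g(4) by (simp add: dist_commute)
    then have "g t = g (1/2)" using axis[of "g t"] \<open>Im (g t) = 0\<close> t01 g(2,4) by (auto simp: path_image_def)
    then show False using simple_path_eqD[OF g(1), of t "1/2"] t01 t by auto
  qed
  have const: "(\<forall>s\<in>{0<..<e}. 0 < Im (g (1/2 + \<sigma> * s))) \<or> (\<forall>s\<in>{0<..<e}. Im (g (1/2 + \<sigma> * s)) < 0)"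
    if "\<bar>\<sigma>\<bar> = 1" for \<sigma> :: real
  proof (rule ccontr)
    assume n: "\<not> ?thesis"
    have nz': "Im (g (1/2 + \<sigma> * s)) \<noteq> 0" if "s \<in> {0<..<e}" for s
      using that \<open>\<bar>\<sigma>\<bar> = 1\<close> by (intro nz) (auto simp: dist_real_def abs_mult)
    define f where "f s = Im (g (1/2 + \<sigma> * s))" for s
    have "(\<lambda>s. 1/2 + \<sigma> * s) ` {0<..<e} \<subseteq> {0..1}"
      using \<open>\<bar>\<sigma>\<bar> = 1\<close> e by (auto simp: abs_if split: if_splits)
    then have "continuous_on {0<..<e} f" unfolding f_def
      by (intro continuous_intros continuous_on_compose2[OF cg])
    then have "connected (f ` {0<..<e})" by (intro connected_continuous_image) auto
    moreover obtain s s' where "s \<in> {0<..<e}" "s' \<in> {0<..<e}" "f s \<le> 0" "0 \<le> f s'"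
      using n by (auto simp: f_def not_less)
    ultimately have "0 \<in> f ` {0<..<e}" by (meson connectedD_interval imageI)
    then show False using nz' by (auto simp: f_def)
  qed
  \<comment> \<open>Parameters at distance at least e/2 from 1/2 are mapped to a compact set without
    \<open>p\<close>, so points of the curve close to \<open>p\<close> have parameters within
    \<open>e\<close> of 1/2.\<close>
  define K where "K = g ` ({0..1/2 - e/2} \<union> {1/2 + e/2..1})"
  have "compact K" unfolding K_def
    by (intro compact_continuous_image compact_Un compact_Icc continuous_on_subset[OF cg]) (use e in auto)
  moreover have "p \<notin> K"
  proof
    assume "p \<in> K"
    then obtain t where t: "t \<in> {0..1/2 - e/2} \<union> {1/2 + e/2..1}" "g t = g (1/2)"
      using g(4) unfolding K_def by (metis imageE)
    then show False using simple_path_eqD[OF g(1), of t "1/2"] e by auto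
  qed
  ultimately obtain r where r: "r > 0" "\<And>y. y \<in> K \<Longrightarrow> r \<le> dist p y"
    using separate_point_closed[of K p] compact_imp_closed by blast
  have near: "\<exists>t. z = g t \<and> dist t (1/2) < e" if "z \<in> c" "dist z p < r" for z
  proof -
    obtain t where t: "t \<in> {0..1}" "z = g t" using g(2) \<open>z \<in> c\<close> by (auto simp: path_image_def)
    have "z \<notin> K" using r(2)[of z] that by (auto simp: dist_commute)
    then have "dist t (1/2) < e" using t e(1) by (fastforce simp: K_def dist_real_def abs_if)
    then show ?thesis using t by blast
  qed
  have Imp: "Im p = 0"
  proof -
    have "closure (c \<inter> {z. Im z < 0}) \<subseteq> {z. Im z \<le> 0}" "closure (c \<inter> {z. 0 < Im z}) \<subseteq> {z. 0 \<le> Im z}"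
      by (rule closure_minimal; auto intro: closed_halfspace_Im_le closed_halfspace_Im_ge)+
    then show ?thesis using cl by force
  qed
  \<comment> \<open>The factor \<open>m\<close> treats both half-planes at once:
    \<open>m = 1\<close> stands for the upper, \<open>m = -1\<close> for the lower one.\<close>
  have "\<exists>s\<in>{0<..<e}. (0 < m * Im (g (1/2 + s))) \<or> (0 < m * Im (g (1/2 - s)))" if m: "m = 1 \<or> m = -1" for m :: real
  proof -
    have "p \<in> closure (c \<inter> {z. 0 < m * Im z})" using m cl by auto
    then obtain z where z: "z \<in> c" "0 < m * Im z" "dist z p < r" using r(1) by (auto simp: closure_approachable)
    then obtain t where t: "z = g t" "dist t (1/2) < e" using near by blast
    have "t \<noteq> 1/2"
    proof
      assume "t = 1/2"
      then have "z = p" using t(1) g(4) by metis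
      then show False using z(2) Imp by simp
    qed
    then consider "t > 1/2" | "t < 1/2" by linarith
    then show ?thesis
    proof cases
      case 1
      then show ?thesis using z t by (intro bexI[of _ "t - 1/2"]) (auto simp: dist_real_def)
    next
      case 2
      then show ?thesis using z t by (intro bexI[of _ "1/2 - t"]) (auto simp: dist_real_def)
    qed
  qed
  from this[of 1] this[of "-1"] const[of 1] const[of "-1"]
  consider "\<forall>s\<in>{0<..<e}. Im (g (1/2 - s)) < 0 \<and> 0 < Im (g (1/2 + s))"
    | "\<forall>s\<in>{0<..<e}. 0 < Im (g (1/2 - s)) \<and> Im (g (1/2 + s)) < 0"
    by simp (smt (verit, best))
  then show ?thesis
  proof cases
    case 1
    then show ?thesis unfolding crosses_axis_at_def using g e by (intro exI[of _ g] exI[of _ e]) auto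
  next
    case 2
    have rv: "reversepath g (1/2 - s) = g (1/2 + s)" "reversepath g (1/2 + s) = g (1/2 - s)" for s
      unfolding reversepath_def by (rule arg_cong[of _ _ g], simp)+
    then have "reversepath g (1/2) = p" using rv(1)[of 0] g(4) by simp
    then show ?thesis unfolding crosses_axis_at_def
      using 2 g e rv by (intro exI[of _ "reversepath g"] exI[of _ e]) (simp add: simple_path_reversepath)
  qed
qed

text \<open>Together with disjointness, \<open>ends\<close> makes every germ over \<open>A\<close>
  an end of exactly one arc. Besides serving to construct curves from arcs, the locale is
  interpreted with the arcs of a given curve system.\<close>

locale chart_arcs = half_plane_charts I q L A for I :: "'i set" and q L A +
  fixes \<A> :: "'i \<Rightarrow> complex set set"
  assumes arcs: "\<And>i. i \<in> I \<Longrightarrow> half_plane_arcs (\<A> i)"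
    and ends: "\<And>i. i \<in> I \<Longrightarrow> \<Union>(\<A> i) \<inter> \<real> = {x. Im x = 0 \<and> q i x \<in> A}"
begin

definition E :: "('i \<times> complex set) set" where "E = Sigma I \<A>"

definition img :: "'i \<times> complex set \<Rightarrow> complex set" where "img e = q (fst e) ` snd e"

lemma finite_E: "finite E"
  using fin_I arcs by (auto simp: E_def half_plane_arcs_def)

lemma E_disj:
  assumes "(i, a) \<in> E" "(i, b) \<in> E" "z \<in> a" "z \<in> b"
  shows "a = b"
proof -
  have "i \<in> I" "a \<in> \<A> i" "b \<in> \<A> i" using assms by (simp_all add: E_def)
  then show ?thesis using arcs[of i] assms(3,4) unfolding half_plane_arcs_def by blast
qed

lemma E_upper: "(i, a) \<in> E \<Longrightarrow> i \<in> I" "(i, a) \<in> E \<Longrightarrow> z \<in> a \<Longrightarrow> 0 \<le> Im z"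
proof -
  show 1: "i \<in> I" if "(i, a) \<in> E" using that by (simp add: E_def)
  show "0 \<le> Im z" if "(i, a) \<in> E" "z \<in> a"
  proof -
    have "a \<in> \<A> i" using that by (simp add: E_def)
    then have "a \<subseteq> upper" using arcs[OF 1[OF that(1)]] by (simp add: half_plane_arcs_def)
    then show ?thesis using that(2) by blast
  qed
qed

lemma E_arc:
  assumes "(i, a) \<in> E"
  obtains g where "arc g" "path_image g = a" "a \<inter> \<real> = {pathstart g, pathfinish g}"
proof -
  have i: "i \<in> I" "a \<in> \<A> i" using assms by (simp_all add: E_def)
  have "\<forall>c\<in>\<A> i. c \<subseteq> upper \<and> (\<exists>g. arc g \<and> path_image g = c \<and> c \<inter> \<real> = {pathstart g, pathfinish g})"
    using arcs[OF i(1)] unfolding half_plane_arcs_def by (elim conjE)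
  from bspec[OF this i(2)] show ?thesis using that by (elim conjE exE) simp
qed

lemma E_germ:
  assumes "(k, x) \<in> germs_over p" "p \<in> A"
  obtains a where "(k, a) \<in> E" "x \<in> a"
proof -
  have k: "k \<in> I" "x \<in> {x. Im x = 0 \<and> q k x \<in> A}" using assms by (auto simp: germs_over_def)
  then have "x \<in> \<Union>(\<A> k)" unfolding ends[OF k(1), symmetric] by blast
  then show ?thesis using that k(1) by (auto simp: E_def)
qed

lemma E_arc_from:
  assumes ia: "(i, a) \<in> E" "x \<in> a" "Im x = 0"
  obtains g y where "arc g" "path_image g = a" "pathstart g = x" "pathfinish g = y" "x \<noteq> y" "a \<inter> \<real> = {x, y}"
    "(i, x) \<in> germs_over (q i x)" "(i, y) \<in> germs_over (q i y)" "q i x \<in> A" "q i y \<in> A"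
proof -
  obtain g where g: "arc g" "path_image g = a" "a \<inter> \<real> = {pathstart g, pathfinish g}"
    using E_arc[OF ia(1)] by metis
  have gA: "(i, u) \<in> germs_over (q i u) \<and> q i u \<in> A" if u: "u \<in> a \<inter> \<real>" for u
  proof -
    have iI: "i \<in> I" using E_upper(1)[OF ia(1)] .
    have "u \<in> \<Union>(\<A> i) \<inter> \<real>" using u ia(1) by (auto simp: E_def)
    then show ?thesis using ends[OF iI] iI by (auto simp: germs_over_def)
  qed
  have "x \<in> a \<inter> \<real>" using ia by (simp add: complex_is_Real_iff)
  then consider "x = pathstart g" | "x = pathfinish g" using g(3) by blast
  then show ?thesis
  proof cases
    case 1
    then show ?thesis
      using that[of g "pathfinish g"] g gA arc_distinct_ends[OF g(1)] by auto
  next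
    case 2
    then show ?thesis
      using that[of "reversepath g" "pathstart g"] g gA arc_distinct_ends[OF g(1)] by (auto simp: arc_reversepath)
  qed
qed

lemma E_endpoint:
  assumes "(i, a) \<in> E"
  obtains x where "x \<in> a" "Im x = 0"
proof -
  obtain g where "arc g" "path_image g = a" "a \<inter> \<real> = {pathstart g, pathfinish g}"
    using E_arc[OF assms] by metis
  then show ?thesis using that complex_is_Real_iff by blast
qed

lemma img_L:
  assumes "(i, a) \<in> E" "w \<in> img (i, a)" "w \<in> L"
  obtains x where "x \<in> a" "Im x = 0" "w = q i x" "w \<in> A"
proof -
  obtain z where z: "z \<in> a" "w = q i z" using assms by (auto simp: img_def)
  then have "Im z = 0" using chart_L[OF E_upper(1)[OF assms(1)] E_upper(2)[OF assms(1) z(1)]] assms(3) by simp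
  then show ?thesis using that[of z] z E_arc_from[OF assms(1) z(1)] by metis
qed

text \<open>Off the axis all charts together are injective, and arcs in the same chart are
  disjoint.\<close>

lemma img_inter_L:
  assumes "(i, a) \<in> E" "(j, b) \<in> E" "(i, a) \<noteq> (j, b)" "w \<in> img (i, a)" "w \<in> img (j, b)"
  shows "w \<in> L"
proof (rule ccontr)
  assume nL: "w \<notin> L"
  obtain z where z1: "z \<in> a" "w = q i z" using assms(4) by (auto simp: img_def)
  obtain z' where z2: "z' \<in> b" "w = q j z'" using assms(5) by (auto simp: img_def)
  note z = z1 z2
  have "0 < Im z" "0 < Im z'"
    using chart_L[OF E_upper(1)[OF assms(1)] E_upper(2)[OF assms(1) z(1)]]
      chart_L[OF E_upper(1)[OF assms(2)] E_upper(2)[OF assms(2) z(3)]] z nL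
      E_upper(2)[OF assms(1) z(1)] E_upper(2)[OF assms(2) z(3)] by auto
  then have "i = j" "z = z'" using chart_inj E_upper(1) assms(1,2) z by metis+
  then show False using E_disj assms z by blast
qed

lemma img_compact: "e \<in> E \<Longrightarrow> compact (img e)" "e \<in> E \<Longrightarrow> connected (img e)"
proof -
  assume e: "e \<in> E"
  obtain i a where ia: "e = (i, a)" by (cases e)
  obtain g where g: "arc g" "path_image g = a"
    using E_arc e ia by metis
  have "continuous_on a (q i)"
    by (rule continuous_on_subset[OF chart_cont]) (use e E_upper ia in auto)
  then show "compact (img e)" "connected (img e)"
    using compact_continuous_image connected_continuous_image compact_arc_image[OF g(1)] connected_arc_image[OF g(1)]
    by (auto simp: img_def ia g(2))
qed

text \<open>In general the image is only a simple path: both ends of an arc may lie over the same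
  point, and then the image is already a closed curve.\<close>

lemma img_path:
  assumes ia: "(i, a) \<in> E" and g: "arc g" "path_image g = a" "a \<inter> \<real> = {pathstart g, pathfinish g}"
  shows "simple_path (q i \<circ> g)" "path_image (q i \<circ> g) = img (i, a)"
    "q i (pathstart g) \<noteq> q i (pathfinish g) \<Longrightarrow> arc (q i \<circ> g)"
proof -
  note up = E_upper(1)[OF ia] E_upper(2)[OF ia]
  have ca: "continuous_on a (q i)" by (rule continuous_on_subset[OF chart_cont]) (use up in auto)
  show "path_image (q i \<circ> g) = img (i, a)" using g(2) by (simp add: path_image_compose img_def)
  have pg: "path (q i \<circ> g)" using g ca by (intro path_continuous_image) (auto simp: arc_def)
  have injg: "inj_on g {0..1}" using g(1) by (simp add: arc_def)
  have ga: "g s \<in> a" if "s \<in> {0..1}" for s using g(2) that by (auto simp: path_image_def)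
  have real_ends: "s = 0 \<or> s = 1" if "s \<in> {0..1}" "Im (g s) = 0" for s
  proof -
    have "g s \<in> a \<inter> \<real>" using ga that by (simp add: complex_is_Real_iff)
    then have "g s = g 0 \<or> g s = g 1" using g(3) by (auto simp: pathstart_def pathfinish_def)
    then show ?thesis using injg that by (auto dest: inj_onD)
  qed
  have eq: "s = t \<or> (s \<in> {0,1} \<and> t \<in> {0,1})" if s: "s \<in> {0..1}" "t \<in> {0..1}" "q i (g s) = q i (g t)" for s t
  proof (cases "Im (g s) = 0")
    case True
    then have "Im (g t) = 0" using chart_L[OF up(1)] up(2) ga s by metis
    then show ?thesis using real_ends s True by blast
  next
    case False
    then have "Im (g t) \<noteq> 0" using chart_L[OF up(1)] up(2) ga s by metis
    then have "0 < Im (g s)" "0 < Im (g t)" using False up(2)[OF ga] s by (auto simp: less_le)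
    then have "g s = g t" using chart_inj[OF up(1) up(1)] s(3) by blast
    then show ?thesis using injg s by (auto dest: inj_onD)
  qed
  show "simple_path (q i \<circ> g)" unfolding simple_path_def loop_free_def
    using pg eq by fastforce
  show "arc (q i \<circ> g)" if "q i (pathstart g) \<noteq> q i (pathfinish g)"
    unfolding arc_def
  proof (intro conjI pg inj_onI)
    fix s t assume "s \<in> {0..1}" "t \<in> {0..1}" "(q i \<circ> g) s = (q i \<circ> g) t"
    then show "s = t" using eq[of s t] that by (auto simp: pathstart_def pathfinish_def)
  qed
qed

text \<open>Arcs in the charts are concatenated to a chain that is prolonged at its free end \<open>\<phi>\<close> until it
  returns to its first end \<open>\<sigma>\<close>; the set is then closed up. \<open>used F\<close> are the end points of the arcs in \<open>F\<close>.\<close>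

definition closed_up :: "complex set \<Rightarrow> ('i \<times> complex set) set \<Rightarrow> bool" where
  "closed_up S F \<longleftrightarrow> F \<subseteq> E \<and> S = (\<Union>e\<in>F. img e) \<and> simple_closed_curve S \<and>
     (\<forall>p\<in>S \<inter> A. \<forall>(k, x)\<in>germs_over p. \<exists>a. (k, a) \<in> F \<and> x \<in> a)"

definition used :: "('i \<times> complex set) set \<Rightarrow> ('i \<times> complex) set" where
  "used F = {(k, x). \<exists>a. (k, a) \<in> F \<and> x \<in> a}"

definition chain :: "('i \<times> complex set) set \<Rightarrow> (real \<Rightarrow> complex) \<Rightarrow> 'i \<times> complex \<Rightarrow> 'i \<times> complex \<Rightarrow> bool" where
  "chain F g \<sigma> \<phi> \<longleftrightarrow> F \<subseteq> E \<and> arc g \<and> path_image g = (\<Union>e\<in>F. img e) \<and>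
     pathstart g \<in> A \<and> pathfinish g \<in> A \<and> \<sigma> \<in> germs_over (pathstart g) \<and> \<phi> \<in> germs_over (pathfinish g) \<and>
     (\<Union>p\<in>path_image g \<inter> A. germs_over p) - used F = {\<sigma>, \<phi>}"

lemma germs_over_unique: "g \<in> germs_over p \<Longrightarrow> g \<in> germs_over p' \<Longrightarrow> p = p'"
  by (auto simp: germs_over_def)

lemma chain_closes:
  assumes "chain F g \<sigma> \<phi>"
  shows "\<exists>S F'. closed_up S F' \<and> path_image g \<subseteq> S"
  using assms
proof (induction "card (E - F)" arbitrary: F g \<phi> rule: less_induct)
  case less
  note ch = less.prems
  have F: "F \<subseteq> E" "arc g" "path_image g = (\<Union>e\<in>F. img e)" "pathstart g \<in> A" "pathfinish g \<in> A"
    "\<sigma> \<in> germs_over (pathstart g)" "\<phi> \<in> germs_over (pathfinish g)"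
    "(\<Union>p\<in>path_image g \<inter> A. germs_over p) - used F = {\<sigma>, \<phi>}"
    using ch unfolding chain_def by blast+
  obtain j y where jy: "\<phi> = (j, y)" by (cases \<phi>)
  obtain b where b: "(j, b) \<in> E" "y \<in> b" using E_germ[of j y] F(5,7) jy by metis
  have y0: "Im y = 0" "q j y = pathfinish g" "j \<in> I" using F(7) jy by (auto simp: germs_over_def)
  have nF: "(j, b) \<notin> F" using F(8) b jy by (auto simp: used_def)
  obtain gb y2 where gb: "arc gb" "path_image gb = b" "pathstart gb = y" "pathfinish gb = y2" "y \<noteq> y2"
    "b \<inter> \<real> = {y, y2}" "(j, y2) \<in> germs_over (q j y2)" "q j y2 \<in> A"
    using E_arc_from[OF b y0(1)] by metis
  have bends: "b \<inter> \<real> = {pathstart gb, pathfinish gb}" using gb by simp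
  note ip = img_path[OF b(1) gb(1,2) bends]
  define F' where "F' = insert (j, b) F"
  have F'E: "F' \<subseteq> E" using F(1) b by (auto simp: F'_def)
  have y2b: "y2 \<in> b" using gb by blast
  have inter: "w = q j y \<or> w = q j y2" if w: "w \<in> path_image g" "w \<in> img (j, b)" for w
  proof -
    obtain i a where ia: "(i, a) \<in> F" "w \<in> img (i, a)" using w(1) F(3) by auto
    have "w \<in> L" using img_inter_L[of i a j b w] ia b nF w F(1) by auto
    then obtain x where "x \<in> b" "Im x = 0" "w = q j x" using img_L[OF b(1) w(2)] by metis
    moreover then have "x \<in> {y, y2}" using gb(6) by (simp add: complex_is_Real_iff set_eq_iff) blast
    ultimately show ?thesis by auto
  qed
  have usedF': "used F' = used F \<union> {(j, x) | x. x \<in> b}" by (auto simp: used_def F'_def)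
  have img0: "(\<Union>e\<in>F'. img e) = path_image g \<union> img (j, b)" by (auto simp: F'_def F(3))
  have jb_germs: "(k, x) \<in> germs_over p \<Longrightarrow> (k, x) \<in> {(j, x) | x. x \<in> b} \<Longrightarrow> (k, x) = (j, y) \<or> (k, x) = (j, y2)" for k x p
    using gb(6) by (auto simp: germs_over_def complex_is_Real_iff set_eq_iff)
  have ends_img: "q j y \<in> img (j, b)" "q j y2 \<in> img (j, b)" using b y2b by (auto simp: img_def)
  have pf: "pathfinish g \<in> path_image g" "pathstart g \<in> path_image g" by auto
  show ?case
  proof (cases "(j, y2) = \<sigma>")
    case True
    have q2: "q j y2 = pathstart g" using F(6) True germs_over_unique[OF gb(7)] by metis
    have ne: "q j y \<noteq> q j y2" using arc_distinct_ends[OF F(2)] q2 y0 by auto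
    define S where "S = path_image g \<union> img (j, b)"
    have "simple_closed_curve S" unfolding simple_closed_curve_def
    proof (intro exI conjI)
      show "simple_path (g +++ (q j \<circ> gb))"
      proof (rule simple_path_join_loop)
        show "arc (q j \<circ> gb)" using ip(3) ne gb by simp
        show "path_image g \<inter> path_image (q j \<circ> gb) \<subseteq> {pathstart g, pathstart (q j \<circ> gb)}"
          using inter ip(2) q2 gb(3) by (auto simp: pathstart_compose)
      qed (use F(2) q2 y0 gb in \<open>auto simp: pathstart_compose pathfinish_compose\<close>)
      show "path_image (g +++ (q j \<circ> gb)) = S"
        using ip(2) y0 gb by (simp add: path_image_join pathstart_compose S_def)
    qed (use q2 gb in \<open>auto simp: pathfinish_compose\<close>)
    moreover have "\<exists>a. (k, a) \<in> F' \<and> x \<in> a" if p: "p \<in> S \<inter> A" and kx: "(k, x) \<in> germs_over p" for p k x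
    proof -
      have pg: "p \<in> path_image g"
      proof (rule ccontr)
        assume n: "p \<notin> path_image g"
        then have "p \<in> img (j, b)" using p by (auto simp: S_def)
        then obtain u where "u \<in> b" "Im u = 0" "p = q j u" using img_L[OF b(1)] p A_L by blast
        moreover then have "u \<in> {y, y2}" using gb(6) by (simp add: complex_is_Real_iff set_eq_iff) blast
        ultimately show False using n y0(2) q2 pf by auto
      qed
      show ?thesis
      proof (cases "(k, x) \<in> used F")
        case True
        then show ?thesis by (auto simp: used_def F'_def)
      next
        case False
        then have "(k, x) \<in> {\<sigma>, \<phi>}" using F(8) pg p kx by blast
        then show ?thesis using True jy b y2b by (auto simp: F'_def)
      qed
    qed
    ultimately have "closed_up S F'"
      using F'E img0 unfolding closed_up_def by (auto simp: S_def)
    then show ?thesis by (intro exI[of _ S] exI[of _ F']) (auto simp: S_def)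
  next
    case False
    \<comment> \<open>Over visited points all germs but \<sigma> and \<phi> are already ends of arcs
      of the chain.\<close>
    have p2n: "q j y2 \<notin> path_image g"
    proof
      assume p2: "q j y2 \<in> path_image g"
      have "(j, y2) \<notin> used F"
      proof
        assume "(j, y2) \<in> used F"
        then obtain a where "(j, a) \<in> F" "y2 \<in> a" by (auto simp: used_def)
        then have "a = b" using E_disj[of j a b y2] F(1) b y2b by auto
        then show False using nF \<open>(j, a) \<in> F\<close> by simp
      qed
      then have "(j, y2) \<in> {\<sigma>, \<phi>}" using F(8) p2 gb(7,8) by blast
      then show False using False jy gb(5) by auto
    qed
    then have ne: "q j y \<noteq> q j y2" using y0 pf by metis
    define g' where "g' = g +++ (q j \<circ> gb)"
    have arcg': "arc g'" unfolding g'_def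
    proof (rule arc_join)
      show "arc (q j \<circ> gb)" using ip(3) ne gb by simp
      show "path_image g \<inter> path_image (q j \<circ> gb) \<subseteq> {pathstart (q j \<circ> gb)}"
        using inter ip(2) p2n gb(3) by (auto simp: pathstart_compose)
    qed (use F(2) y0 gb in \<open>auto simp: pathstart_compose\<close>)
    have img': "path_image g' = path_image g \<union> img (j, b)"
      unfolding g'_def using ip(2) y0 gb by (simp add: path_image_join pathstart_compose)
    have st': "pathstart g' = pathstart g" "pathfinish g' = q j y2" using gb by (auto simp: g'_def pathfinish_compose)
    have "card (germs_over (q j y2)) = 2" using germs_over_card gb(8) by blast
    then obtain \<phi>' where phi': "germs_over (q j y2) = {(j, y2), \<phi>'}" "\<phi>' \<noteq> (j, y2)"
      using gb(7) by (metis card_2_iff doubleton_eq_iff insert_iff singletonD)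
    obtain k' x' where kx': "\<phi>' = (k', x')" by (cases \<phi>')
    have phi'g: "\<phi>' \<in> germs_over (q j y2)" using phi' by blast
    have phi'u: "\<phi>' \<notin> used F'"
    proof
      assume "\<phi>' \<in> used F'"
      then consider "\<phi>' \<in> used F" | "\<phi>' = (j, y)" using usedF' jb_germs[of k' x'] phi'g phi'(2) kx' by auto
      then show False
      proof cases
        case 1
        then obtain a where "(k', a) \<in> F" "x' \<in> a" by (auto simp: used_def kx')
        then have "q k' x' \<in> path_image g" using F(3) by (force simp: img_def)
        then show False using p2n phi'g kx' by (auto simp: germs_over_def)
      next
        case 2
        then show False using phi'g ne by (auto simp: germs_over_def)
      qed
    qed
    have unused: "(\<Union>p\<in>path_image g' \<inter> A. germs_over p) - used F' = {\<sigma>, \<phi>'}"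
    proof (intro equalityI subsetI)
      fix u assume u: "u \<in> (\<Union>p\<in>path_image g' \<inter> A. germs_over p) - used F'"
      then obtain p where p: "p \<in> path_image g'" "p \<in> A" "u \<in> germs_over p" by blast
      have nu: "u \<notin> used F" "u \<noteq> (j, y)" "u \<noteq> (j, y2)" using u usedF' b y2b by auto
      show "u \<in> {\<sigma>, \<phi>'}"
      proof (cases "p \<in> path_image g")
        case True
        then have "u \<in> {\<sigma>, \<phi>}" using F(8) p nu by blast
        then show ?thesis using nu jy by auto
      next
        case False
        then have "p \<in> img (j, b)" using p img' by auto
        then obtain v where "v \<in> b" "Im v = 0" "p = q j v" using img_L[OF b(1)] p A_L by blast
        moreover then have "v \<in> {y, y2}" using gb(6) by (simp add: complex_is_Real_iff set_eq_iff) blast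
        ultimately have "p = q j y2" using False y0(2) pf by auto
        then show ?thesis using p phi' nu by auto
      qed
    next
      fix u assume "u \<in> {\<sigma>, \<phi>'}"
      then show "u \<in> (\<Union>p\<in>path_image g' \<inter> A. germs_over p) - used F'"
      proof
        assume u: "u = \<sigma>"
        have "\<sigma> \<noteq> (j, y)"
        proof
          assume "\<sigma> = (j, y)"
          then have "pathstart g = q j y" using F(6) by (auto simp: germs_over_def)
          then show False using y0 arc_distinct_ends[OF F(2)] by simp
        qed
        obtain k x where kx: "\<sigma> = (k, x)" by (cases \<sigma>)
        have "\<sigma> \<notin> {(j, x) | x. x \<in> b}"
          using jb_germs[of k x] F(6) False \<open>\<sigma> \<noteq> (j, y)\<close> kx by metis
        moreover have "\<sigma> \<notin> used F" using F(8) by blast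
        ultimately have "\<sigma> \<notin> used F'" using usedF' by blast
        then show ?thesis using u F(4,6) img' pf by blast
      next
        assume "u \<in> {\<phi>'}"
        then show ?thesis using phi'u phi'g gb(8) img' ends_img by blast
      qed
    qed
    have "chain F' g' \<sigma> \<phi>'"
      unfolding chain_def using F'E arcg' img' img0 st' F(4,6) gb(8) phi'g unused by simp
    moreover have "card (E - F') < card (E - F)"
      using finite_E b nF by (intro psubset_card_mono) (auto simp: F'_def)
    ultimately obtain S F'' where "closed_up S F''" "path_image g' \<subseteq> S" using less.hyps by blast
    then show ?thesis using img' by blast
  qed
qed

text \<open>A chain must start with an image that is an arc with distinct ends. If both ends of the
  arc at \<open>p\<close> lie over one point, the curve consists of this image alone.\<close>

lemma closed_up_through:
  assumes p: "p \<in> A"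
  obtains S F where "closed_up S F" "p \<in> S"
proof -
  obtain k x where kx: "(k, x) \<in> germs_over p"
    using germs_over_card[OF p] by (metis card.empty all_not_in_conv surj_pair zero_neq_numeral)
  obtain a where a: "(k, a) \<in> E" "x \<in> a" using E_germ[OF kx p] by metis
  have x0: "Im x = 0" "q k x = p" "k \<in> I" using kx by (auto simp: germs_over_def)
  obtain g y where g: "arc g" "path_image g = a" "pathstart g = x" "pathfinish g = y" "x \<noteq> y"
    "a \<inter> \<real> = {x, y}" "(k, y) \<in> germs_over (q k y)" "q k y \<in> A"
    using E_arc_from[OF a x0(1)] by metis
  have bends: "a \<inter> \<real> = {pathstart g, pathfinish g}" using g by simp
  note ip = img_path[OF a(1) g(1,2) bends]
  have ya: "y \<in> a" using g by blast
  have in_a: "u = x \<or> u = y" if "(i, u) \<in> germs_over w" "u \<in> a" for i u w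
    using that g(6) by (auto simp: germs_over_def complex_is_Real_iff set_eq_iff)
  have img_A: "w = p \<or> w = q k y" if w: "w \<in> img (k, a)" "w \<in> A" for w
  proof -
    obtain u where "u \<in> a" "Im u = 0" "w = q k u" using img_L[OF a(1) w(1)] w(2) A_L by blast
    moreover then have "u \<in> {x, y}" using g(6) by (simp add: complex_is_Real_iff set_eq_iff) blast
    ultimately show ?thesis using x0 by auto
  qed
  have pimg: "p \<in> img (k, a)" "q k y \<in> img (k, a)" using a x0 ya by (auto simp: img_def)
  show ?thesis
  proof (cases "q k y = p")
    case True
    have "{(k, x), (k, y)} \<subseteq> germs_over p" using kx g(7) True by simp
    then have ge: "germs_over p = {(k, x), (k, y)}"
      using germs_over_card[OF p] germs_over_finite[OF p] g(5) by (intro card_seteq[symmetric]) auto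
    have "simple_closed_curve (img (k, a))" unfolding simple_closed_curve_def
      by (intro exI[of _ "q k \<circ> g"]) (use ip True x0 g in \<open>auto simp: pathstart_compose pathfinish_compose\<close>)
    moreover have "\<exists>b. (i, b) \<in> {(k, a)} \<and> u \<in> b" if "w \<in> img (k, a) \<inter> A" "(i, u) \<in> germs_over w" for w i u
    proof -
      have "w = p" using img_A that True by blast
      then show ?thesis using that ge a ya by auto
    qed
    ultimately have "closed_up (img (k, a)) {(k, a)}" using a unfolding closed_up_def by auto
    then show ?thesis using that pimg by blast
  next
    case False
    have other: "\<exists>v. germs_over w = {u, v} \<and> v \<noteq> u" if "w \<in> A" "u \<in> germs_over w" for w u
      using germs_over_card[OF that(1)] that(2) by (metis card_2_iff doubleton_eq_iff insert_iff singletonD)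
    obtain \<sigma> where s: "germs_over p = {(k, x), \<sigma>}" "\<sigma> \<noteq> (k, x)" using other[OF p kx] by blast
    obtain \<phi> where f: "germs_over (q k y) = {(k, y), \<phi>}" "\<phi> \<noteq> (k, y)" using other[OF g(8,7)] by blast
    have us: "used {(k, a)} = {(k, u) | u. u \<in> a}" by (auto simp: used_def)
    have "\<sigma> \<notin> used {(k, a)}"
    proof
      assume u: "\<sigma> \<in> used {(k, a)}"
      then obtain v where v: "\<sigma> = (k, v)" "v \<in> a" by (auto simp: us)
      then have "v = y" using in_a[of k v p] s by auto
      then show False using v s(1) False by (auto simp: germs_over_def)
    qed
    moreover have "\<phi> \<notin> used {(k, a)}"
    proof
      assume u: "\<phi> \<in> used {(k, a)}"
      then obtain v where v: "\<phi> = (k, v)" "v \<in> a" by (auto simp: us)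
      then have "v = x" using in_a[of k v "q k y"] f by auto
      then have "(k, x) \<in> germs_over (q k y)" using v f by auto
      then show False using x0 False by (auto simp: germs_over_def)
    qed
    moreover have "path_image (q k \<circ> g) \<inter> A = {p, q k y}" using ip(2) img_A pimg p g(8) by auto
    ultimately have "(\<Union>w\<in>path_image (q k \<circ> g) \<inter> A. germs_over w) - used {(k, a)} = {\<sigma>, \<phi>}"
      using s f a ya by (auto simp: us)
    then have "chain {(k, a)} (q k \<circ> g) \<sigma> \<phi>"
      unfolding chain_def using a ip False x0 g p s f by (simp add: pathstart_compose pathfinish_compose)
    then obtain S F where "closed_up S F" "path_image (q k \<circ> g) \<subseteq> S" using chain_closes by blast
    then show ?thesis using that ip(2) pimg by blast
  qed
qed

text \<open>A common point would lie in \<open>A\<close>, and all germs over it already belong to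
  arcs in \<open>F\<close>.\<close>

lemma closed_up_disjoint:
  assumes S: "closed_up S F" and e: "e \<in> E" "e \<notin> F"
  shows "S \<inter> img e = {}"
proof (rule ccontr)
  assume "S \<inter> img e \<noteq> {}"
  then obtain w where w: "w \<in> S" "w \<in> img e" by blast
  obtain j b where jb: "e = (j, b)" by (cases e)
  have Fs: "F \<subseteq> E" "S = (\<Union>e\<in>F. img e)" "\<And>p k x. p \<in> S \<Longrightarrow> p \<in> A \<Longrightarrow> (k, x) \<in> germs_over p \<Longrightarrow> \<exists>a. (k, a) \<in> F \<and> x \<in> a"
    using S unfolding closed_up_def by blast+
  obtain i a where ia: "(i, a) \<in> F" "w \<in> img (i, a)" using w Fs by auto
  have "w \<in> L" using img_inter_L[of i a j b w] ia e w jb Fs(1) by auto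
  then obtain x where x: "x \<in> b" "Im x = 0" "w = q j x" "w \<in> A" using img_L[of j b w] e w jb by metis
  have "(j, x) \<in> germs_over w" using x E_upper(1)[of j b] e jb by (auto simp: germs_over_def)
  then obtain a' where "(j, a') \<in> F" "x \<in> a'" using Fs(3)[OF w(1) x(4)] by blast
  then show False using E_disj[of j a' b x] Fs(1) e jb x by auto
qed

text \<open>The curves obtained through the points of \<open>A\<close> are equal or disjoint, so
  they form a curve system; it exhausts the arcs because each arc has an end over
  \<open>A\<close>.\<close>

theorem realization:
  obtains C where "curve_system L A C" "\<And>i. i \<in> I \<Longrightarrow> pre C i = \<Union>(\<A> i)"
proof -
  have "\<forall>p\<in>A. \<exists>S. \<exists>F. closed_up S F \<and> p \<in> S" using closed_up_through by metis
  then obtain S where "\<forall>p\<in>A. \<exists>F. closed_up (S p) F \<and> p \<in> S p" by (rule bchoice[THEN exE])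
  then obtain F where SF: "\<forall>p\<in>A. closed_up (S p) (F p) \<and> p \<in> S p" by (rule bchoice[THEN exE])
  have S: "closed_up (S p) (F p)" "p \<in> S p" if "p \<in> A" for p using SF that by auto
  have scc: "simple_closed_curve (S p)" and Fp: "F p \<subseteq> E" "S p = (\<Union>e\<in>F p. img e)"
    and gp: "\<And>k x w. w \<in> S p \<Longrightarrow> w \<in> A \<Longrightarrow> (k, x) \<in> germs_over w \<Longrightarrow> \<exists>a. (k, a) \<in> F p \<and> x \<in> a"
    if "p \<in> A" for p
    using S(1)[OF that] unfolding closed_up_def by blast+
  \<comment> \<open>\<open>S p\<close> is connected and covered by the disjoint closed sets
    \<open>S r\<close> and \<open>U\<close>.\<close>
  have sub: "S p \<subseteq> S r" if pr: "p \<in> A" "r \<in> A" "S p \<inter> S r \<noteq> {}" for p r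
  proof -
    define U where "U = (\<Union>e\<in>E - F r. img e)"
    have "closed U" unfolding U_def using finite_E
      by (intro closed_UN ballI compact_imp_closed img_compact) auto
    moreover have "closed (S r)" using jordan_facts(1)[OF scc[OF pr(2)]] compact_imp_closed by blast
    moreover have "S r \<inter> U = {}" using closed_up_disjoint[OF S(1)[OF pr(2)]] unfolding U_def by blast
    moreover have "S p \<subseteq> S r \<union> U" using Fp[OF pr(1)] Fp(2)[OF pr(2)] unfolding U_def by blast
    ultimately have "S r \<inter> S p = {} \<or> U \<inter> S p = {}"
      by (intro connected_closedD[OF jordan_facts(2)[OF scc[OF pr(1)]]]) auto
    then show ?thesis using pr(3) \<open>S p \<subseteq> S r \<union> U\<close> by blast
  qed
  have img_LA: "w \<in> A" if "p \<in> A" "w \<in> S p" "w \<in> L" for p w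
  proof -
    obtain i a where "(i, a) \<in> F p" "w \<in> img (i, a)" using Fp(2)[OF \<open>p \<in> A\<close>] \<open>w \<in> S p\<close> by auto
    then show ?thesis using img_L[of i a w] Fp(1)[OF \<open>p \<in> A\<close>] \<open>w \<in> L\<close> by blast
  qed
  have X: "(\<Union>p\<in>A. S p) = (\<Union>e\<in>E. img e)"
  proof
    show "(\<Union>p\<in>A. S p) \<subseteq> (\<Union>e\<in>E. img e)" using Fp by blast
    show "(\<Union>e\<in>E. img e) \<subseteq> (\<Union>p\<in>A. S p)"
    proof
      fix w assume "w \<in> (\<Union>e\<in>E. img e)"
      then obtain i a where ia: "(i, a) \<in> E" "w \<in> img (i, a)" by auto
      obtain x where x: "x \<in> a" "Im x = 0" using E_endpoint[OF ia(1)] by metis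
      obtain pA: "q i x \<in> A" and g: "(i, x) \<in> germs_over (q i x)" using E_arc_from[OF ia(1) x] by metis
      obtain a' where "(i, a') \<in> F (q i x)" "x \<in> a'" using gp[OF pA S(2)[OF pA] pA g] by blast
      then have "(i, a) \<in> F (q i x)" using E_disj[of i a' a x] Fp(1)[OF pA] ia x by auto
      then show "w \<in> (\<Union>p\<in>A. S p)" using Fp(2)[OF pA] ia pA by blast
    qed
  qed
  have cross: "crosses_axis_at (S p) w" if p: "p \<in> A" and w: "w \<in> S p" "w \<in> L" for p w
  proof -
    have wA: "w \<in> A" using img_LA p w by blast
    obtain d0 where d0: "d0 > 0" "ball w d0 \<inter> \<real> \<subseteq> L" using L_near[OF wA] by blast
    obtain d1 where d1: "d1 > 0" "\<And>u. u \<in> A \<Longrightarrow> u \<noteq> w \<Longrightarrow> d1 \<le> dist w u"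
      using finite_set_avoid[OF fin_A, of w] by blast
    obtain i x j y e where gm: "(i, x) \<noteq> (j, y)" "germs_over w = {(i, x), (j, y)}" "0 < e"
      "\<And>z. z \<in> ball x e \<Longrightarrow> 0 < Im z \<Longrightarrow> 0 < Im (q i z)" "\<And>z. z \<in> ball y e \<Longrightarrow> 0 < Im z \<Longrightarrow> Im (q j z) < 0"
      using germs[OF wA] unfolding germs_over_def by blast
    \<comment> \<open>To be applied to both germs over \<open>w\<close>: the arc at a germ
      approaches \<open>w\<close> from the side of the axis to which that germ belongs.\<close>
    have side: "w \<in> closure (S p \<inter> T)"
      if k: "(k, v) \<in> germs_over w" and T: "\<And>z. z \<in> ball v e \<Longrightarrow> 0 < Im z \<Longrightarrow> q k z \<in> T" for k v T
    proof -
      obtain a where a: "(k, a) \<in> F p" "v \<in> a" using gp[OF p w(1) wA k] by blast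
      have aE: "(k, a) \<in> E" using a Fp(1)[OF p] by blast
      obtain g where g: "arc g" "path_image g = a" "a \<inter> \<real> = {pathstart g, pathfinish g}"
        using E_arc[OF aE] by metis
      have "a - {pathstart g, pathfinish g} = a - \<real>" using g(3) by blast
      then have "v \<in> closure (a - \<real>)" using arc_subset_closure_endless[OF g(1)] g(2) a by auto
      then have "v \<in> closure (ball v e \<inter> (a - \<real>))"
        using open_Int_closure_subset[OF open_ball, of v e "a - \<real>"] gm(3) by auto
      then obtain z where z: "\<And>n. z n \<in> ball v e \<inter> (a - \<real>)" "z \<longlonglongrightarrow> v" unfolding closure_sequential by blast
      have zu: "z n \<in> upper" "0 < Im (z n)" for n
        using z(1)[of n] E_upper(2)[OF aE, of "z n"] by (auto simp: complex_is_Real_iff less_le)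
      have "v \<in> upper" using E_upper(2)[OF aE a(2)] by simp
      then have "(\<lambda>n. q k (z n)) \<longlonglongrightarrow> q k v"
        by (intro continuous_on_tendsto_compose[OF chart_cont[OF E_upper(1)[OF aE]] z(2)]) (use zu in auto)
      moreover have "q k (z n) \<in> S p \<inter> T" for n
      proof
        have "z n \<in> a" "z n \<in> ball v e" using z(1)[of n] by auto
        then show "q k (z n) \<in> T" using T zu(2) by blast
        have "q k (z n) \<in> img (k, a)" using \<open>z n \<in> a\<close> by (simp add: img_def)
        then show "q k (z n) \<in> S p" using Fp(2)[OF p] a(1) by blast
      qed
      moreover have "q k v = w" using k by (simp add: germs_over_def)
      ultimately show ?thesis using closure_limI[of "\<lambda>n. q k (z n)" "S p \<inter> T"] by metis
    qed
    show ?thesis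
    proof (rule crosses_axisI[OF scc[OF p] w(1), of "min d0 d1"])
      show "min d0 d1 > 0" using d0 d1 by simp
      show "z = w" if "z \<in> S p" "dist w z < min d0 d1" "Im z = 0" for z
      proof -
        have "z \<in> L" using d0(2) that by (auto simp: complex_is_Real_iff subset_iff)
        then have "z \<in> A" using img_LA p that by blast
        then show ?thesis using d1(2)[of z] that by auto
      qed
      show "w \<in> closure (S p \<inter> {z. Im z < 0})" by (rule side[of j y]) (use gm in auto)
      show "w \<in> closure (S p \<inter> {z. 0 < Im z})" by (rule side[of i x]) (use gm in auto)
    qed
  qed
  have "curve_system L A (S ` A)"
    unfolding curve_system_def
  proof (intro conjI ballI)
    fix c assume "c \<in> S ` A"
    then obtain p where p: "p \<in> A" "c = S p" by blast
    show "simple_closed_curve c" using scc p by simp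
    show "c \<inter> L \<noteq> {}" using S(2)[OF p(1)] p A_L by blast
    show "crosses_axis_at c w" if "w \<in> c \<inter> L" for w using cross[OF p(1)] p that by blast
  next
    show "disjoint (S ` A)"
    proof (rule disjointI)
      fix a b assume "a \<in> S ` A" "b \<in> S ` A" "a \<noteq> b"
      then show "a \<inter> b = {}" using sub by (metis Int_commute image_iff subset_antisym)
    qed
    show "\<Union>(S ` A) \<inter> L = A" using img_LA S(2) A_L by blast
  qed
  moreover have "pre (S ` A) i = \<Union>(\<A> i)" if i: "i \<in> I" for i
  proof (intro equalityI subsetI)
    fix z assume "z \<in> pre (S ` A) i"
    then have z: "0 \<le> Im z" "q i z \<in> (\<Union>e\<in>E. img e)" using X by (auto simp: pre_def)
    then obtain j b w where jb: "(j, b) \<in> E" "w \<in> b" "q i z = q j w" by (auto simp: img_def)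
    note jI = E_upper(1)[OF jb(1)] and w0 = E_upper(2)[OF jb(1,2)]
    show "z \<in> \<Union>(\<A> i)"
    proof (cases "Im z = 0")
      case True
      then have "q j w \<in> L" using chart_L[OF i, of z] jb by simp
      moreover have "q j w \<in> img (j, b)" using jb by (simp add: img_def)
      ultimately have "q j w \<in> A" using img_L[OF jb(1)] by metis
      then have "z \<in> {x. Im x = 0 \<and> q i x \<in> A}" using True jb(3) by simp
      then show ?thesis unfolding ends[OF i, symmetric] by blast
    next
      case False
      then have "Im w \<noteq> 0" using chart_L[OF i z(1)] chart_L[OF jI w0] jb(3) by auto
      then have "i = j" "z = w" using chart_inj[OF i jI, of z w] jb(3) z(1) w0 False by auto
      then show ?thesis using jb by (auto simp: E_def)
    qed
  next
    fix z assume "z \<in> \<Union>(\<A> i)"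
    then obtain a where a: "(i, a) \<in> E" "z \<in> a" using i by (auto simp: E_def)
    then have "q i z \<in> (\<Union>p\<in>A. S p)" unfolding X by (force simp: img_def)
    then show "z \<in> pre (S ` A) i" using E_upper(2)[OF a] by (auto simp: pre_def)
  qed
  ultimately show ?thesis using that by blast
qed

end

section \<open>Isotopy classes of curve systems\<close>

lemma connected_subset_of_disjoint_open_union:
  fixes \<A> :: "'a::topological_space set set"
  assumes "\<And>a. a \<in> \<A> \<Longrightarrow> open a" "\<And>a b. a \<in> \<A> \<Longrightarrow> b \<in> \<A> \<Longrightarrow> a \<noteq> b \<Longrightarrow> a \<inter> b = {}"
    and S: "connected S" "S \<subseteq> \<Union>\<A>" "a \<in> \<A>" "S \<inter> a \<noteq> {}"
  shows "S \<subseteq> a"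
proof -
  have "open (\<Union>(\<A> - {a}))" using assms(1) by (intro open_Union) auto
  moreover have "a \<inter> \<Union>(\<A> - {a}) = {}" using assms(2) S(3) by blast
  moreover have sub: "S \<subseteq> a \<union> \<Union>(\<A> - {a})" using S(2) by blast
  ultimately have "a \<inter> S = {} \<or> \<Union>(\<A> - {a}) \<inter> S = {}"
    by (intro connectedD[OF S(1)]) (use assms(1) S(3) in auto)
  then show ?thesis using sub S(4) by blast
qed

context half_plane_charts
begin

section \<open>Pairings of the real end points, and the number of curves\<close>

definition matching :: "complex set set \<Rightarrow> 'i \<Rightarrow> complex set set" where
  "matching C i = (\<lambda>a. a \<inter> \<real>) ` components (pre C i)"

lemma curve_system_chart_arcs:
  assumes C: "curve_system L A C"
  shows "chart_arcs I q L A (\<lambda>i. components (pre C i))"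
proof unfold_locales
  show "half_plane_arcs (components (pre C i))" if "i \<in> I" for i by (rule curve_system_arcs[OF C that])
  show "\<Union>(components (pre C i)) \<inter> \<real> = {x. Im x = 0 \<and> q i x \<in> A}" if i: "i \<in> I" for i
  proof -
    have "A = \<Union>C \<inter> L" using C by (simp add: curve_system_def)
    then have "q i x \<in> \<Union>C \<longleftrightarrow> q i x \<in> A" if "Im x = 0" for x using chart_L[OF i, of x] that by auto
    then have "{x. Im x = 0 \<and> q i x \<in> \<Union>C} = {x. Im x = 0 \<and> q i x \<in> A}" by blast
    moreover have "pre C i \<inter> \<real> = {x. Im x = 0 \<and> q i x \<in> \<Union>C}" by (auto simp: pre_def complex_is_Real_iff)
    ultimately show ?thesis unfolding Union_components by simp
  qed
qed

definition adjacent :: "('i \<Rightarrow> complex set set) \<Rightarrow> (complex \<times> complex) set" where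
  "adjacent M = {(p, p'). \<exists>i\<in>I. \<exists>e\<in>M i. p \<in> q i ` e \<and> p' \<in> q i ` e}"

text \<open>A class of points is the trace of one curve: each arc lies in one curve, and conversely
  the arcs with ends in one class form a closed set that is disjoint from the remaining arcs, so
  that a connected curve cannot leave it.\<close>

theorem card_curve_system:
  assumes C: "curve_system L A C"
  shows "card C = card ((\<lambda>p. (adjacent (matching C))\<^sup>* `` {p}) ` A)"
proof -
  interpret CA: chart_arcs I q L A "\<lambda>i. components (pre C i)" by (rule curve_system_chart_arcs[OF C])
  define R where "R = adjacent (matching C)"
  have Rdef: "(p, p') \<in> R \<longleftrightarrow> (\<exists>i a. (i, a) \<in> CA.E \<and> p \<in> q i ` (a \<inter> \<real>) \<and> p' \<in> q i ` (a \<inter> \<real>))" for p p'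
    unfolding R_def adjacent_def matching_def CA.E_def by auto
  have Cc: "\<Union>C \<inter> L = A" "disjoint C" "\<And>c. c \<in> C \<Longrightarrow> simple_closed_curve c" "\<And>c. c \<in> C \<Longrightarrow> c \<inter> L \<noteq> {}"
    using C by (auto simp: curve_system_def)
  have cl: "closed c" "connected c" if "c \<in> C" for c
    using jordan_facts(1,2)[OF Cc(3)[OF that]] compact_imp_closed by auto
  have dj: "a \<inter> b = {}" if "a \<in> C" "b \<in> C" "a \<noteq> b" for a b using Cc(2) that by (simp add: disjoint_def)
  have XC: "\<Union>C = (\<Union>e\<in>CA.E. CA.img e)"
  proof (intro equalityI subsetI)
    fix w assume w: "w \<in> \<Union>C"
    obtain i z where iz: "i \<in> I" "z \<in> upper" "q i z = w" using chart_cover by blast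
    then have "z \<in> \<Union>(components (pre C i))" unfolding Union_components using w by (simp add: pre_def)
    then obtain a where "a \<in> components (pre C i)" "z \<in> a" by blast
    then have "(i, a) \<in> CA.E" "w \<in> CA.img (i, a)" using iz by (auto simp: CA.E_def CA.img_def)
    then show "w \<in> (\<Union>e\<in>CA.E. CA.img e)" by blast
  next
    fix w assume "w \<in> (\<Union>e\<in>CA.E. CA.img e)"
    then obtain i a z where "a \<in> components (pre C i)" "z \<in> a" "w = q i z" by (auto simp: CA.E_def CA.img_def)
    then show "w \<in> \<Union>C" using in_components_subset by (fastforce simp: pre_def)
  qed
  have arc_in: "CA.img e \<subseteq> c" if "e \<in> CA.E" "c \<in> C" "CA.img e \<inter> c \<noteq> {}" for e c
    by (rule connected_subset_of_disjoint_union[OF curve_system_finite[OF C] _ dj CA.img_compact(2)[OF that(1)] _ that(2,3)])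
      (use cl XC that(1) in auto)
  have cls: "R\<^sup>* `` {p} = c \<inter> A" if c: "c \<in> C" and p: "p \<in> c \<inter> A" for c p
  proof
    have "p' \<in> c \<inter> A" if "(p, p') \<in> R\<^sup>*" for p'
      using that
    proof (induction rule: rtrancl_induct)
      case base then show ?case using p by simp
    next
      case (step y z)
      then obtain i a u v where iv: "(i, a) \<in> CA.E" "u \<in> a \<inter> \<real>" "v \<in> a \<inter> \<real>" "y = q i u" "z = q i v"
        using Rdef[of y z] by auto
      then have "y \<in> CA.img (i, a)" "z \<in> CA.img (i, a)" by (auto simp: CA.img_def)
      then have "z \<in> c" using arc_in[OF iv(1) c] step by blast
      moreover have "z \<in> A" using CA.E_arc_from[OF iv(1), of v] iv(3,5) by (auto simp: complex_is_Real_iff)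
      ultimately show ?case by blast
    qed
    then show "R\<^sup>* `` {p} \<subseteq> c \<inter> A" by auto
    define S where "S = R\<^sup>* `` {p}"
    define E1 where "E1 = {e \<in> CA.E. \<exists>x\<in>snd e \<inter> \<real>. q (fst e) x \<in> S}"
    define U1 U2 where "U1 = (\<Union>e\<in>E1. CA.img e)" and "U2 = (\<Union>e\<in>CA.E - E1. CA.img e)"
    have S_step: "p'' \<in> S" if "p' \<in> S" "(p', p'') \<in> R" for p' p''
      using that unfolding S_def by (auto intro: rtrancl_into_rtrancl)
    have E1S: "q i x \<in> S" if "(i, a) \<in> E1" "x \<in> a \<inter> \<real>" for i a x
    proof -
      obtain y where y: "y \<in> a \<inter> \<real>" "q i y \<in> S" "(i, a) \<in> CA.E" using \<open>(i, a) \<in> E1\<close> by (auto simp: E1_def)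
      then have "(q i y, q i x) \<in> R" using Rdef \<open>x \<in> a \<inter> \<real>\<close> by blast
      then show ?thesis using S_step y(2) by blast
    qed
    have "closed U1" "closed U2" unfolding U1_def U2_def E1_def
      using CA.finite_E by (auto intro!: closed_UN compact_imp_closed CA.img_compact)
    moreover have "U1 \<inter> U2 = {}"
    proof (rule ccontr)
      assume "U1 \<inter> U2 \<noteq> {}"
      then obtain w i a j b where w: "(i, a) \<in> E1" "w \<in> CA.img (i, a)" "(j, b) \<in> CA.E" "(j, b) \<notin> E1" "w \<in> CA.img (j, b)"
        unfolding U1_def U2_def by auto
      have ia: "(i, a) \<in> CA.E" using w(1) by (simp add: E1_def)
      have "w \<in> L" using CA.img_inter_L[OF ia w(3) _ w(2,5)] w(1,4) by auto
      obtain x where x: "x \<in> a" "Im x = 0" "w = q i x" using CA.img_L[OF ia w(2) \<open>w \<in> L\<close>] by metis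
      obtain y where y: "y \<in> b" "Im y = 0" "w = q j y" using CA.img_L[OF w(3,5) \<open>w \<in> L\<close>] by metis
      have "w \<in> S" using E1S[OF w(1), of x] x by (simp add: complex_is_Real_iff)
      then have "(j, b) \<in> E1" using w(3) y by (auto simp: E1_def complex_is_Real_iff)
      then show False using w(4) by simp
    qed
    moreover have "c \<subseteq> U1 \<union> U2" using XC c unfolding U1_def U2_def by blast
    ultimately have "U1 \<inter> c = {} \<or> U2 \<inter> c = {}" by (intro connected_closedD[OF cl(2)[OF c]]) auto
    moreover have mem: "\<exists>i a x. (i, a) \<in> CA.E \<and> x \<in> a \<and> Im x = 0 \<and> w = q i x" if wA: "w \<in> A" for w
    proof -
      have "germs_over w \<noteq> {}" using germs_over_card[OF wA] by auto
      then obtain k x where kx: "(k, x) \<in> germs_over w" by auto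
      obtain a where "(k, a) \<in> CA.E" "x \<in> a" using CA.E_germ[OF kx wA] by metis
      then show ?thesis using kx by (auto simp: germs_over_def)
    qed
    moreover have "p \<in> U1"
    proof -
      obtain i a x where x: "(i, a) \<in> CA.E" "x \<in> a" "Im x = 0" "p = q i x" using mem p by blast
      moreover have "p \<in> S" by (simp add: S_def)
      ultimately have "(i, a) \<in> E1" "p \<in> CA.img (i, a)" by (auto simp: E1_def CA.img_def complex_is_Real_iff)
      then show ?thesis unfolding U1_def by blast
    qed
    ultimately have U2c: "U2 \<inter> c = {}" using p by blast
    show "c \<inter> A \<subseteq> R\<^sup>* `` {p}"
    proof
      fix w assume w: "w \<in> c \<inter> A"
      then obtain i a x where x: "(i, a) \<in> CA.E" "x \<in> a" "Im x = 0" "w = q i x" using mem by blast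
      then have "w \<in> CA.img (i, a)" by (auto simp: CA.img_def)
      then have "(i, a) \<in> E1" using U2c w x(1) unfolding U2_def by blast
      then show "w \<in> R\<^sup>* `` {p}" using E1S[of i a x] x by (simp add: S_def complex_is_Real_iff)
    qed
  qed
  have "inj_on (\<lambda>c. c \<inter> A) C"
  proof (rule inj_onI)
    fix c d assume cd: "c \<in> C" "d \<in> C" "c \<inter> A = d \<inter> A"
    then have "c \<inter> d \<noteq> {}" using Cc(1) Cc(4)[of c] by blast
    then show "c = d" using dj cd by blast
  qed
  moreover have "(\<lambda>c. c \<inter> A) ` C = (\<lambda>p. R\<^sup>* `` {p}) ` A"
  proof (intro equalityI subsetI)
    fix u assume "u \<in> (\<lambda>c. c \<inter> A) ` C"
    then obtain c where c: "c \<in> C" "u = c \<inter> A" by blast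
    then obtain p where "p \<in> c \<inter> A" using Cc(1) Cc(4)[of c] by blast
    then show "u \<in> (\<lambda>p. R\<^sup>* `` {p}) ` A" using cls[OF c(1)] c(2) by blast
  next
    fix u assume "u \<in> (\<lambda>p. R\<^sup>* `` {p}) ` A"
    then obtain p where p: "p \<in> A" "u = R\<^sup>* `` {p}" by blast
    then obtain c where "c \<in> C" "p \<in> c" using Cc(1) by blast
    then show "u \<in> (\<lambda>c. c \<inter> A) ` C" using cls p by blast
  qed
  ultimately show ?thesis unfolding R_def[symmetric] by (metis card_image)
qed

section \<open>From equal pairings to an ambient isotopy\<close>

lemma chart_closed_map:
  assumes i: "i \<in> I" and S: "closed S" "S \<subseteq> upper"
  shows "closed (q i ` S)"
  unfolding closed_sequential_limits
proof (intro allI impI, elim conjE)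
  fix y l assume y: "\<forall>n. y n \<in> q i ` S" and l: "y \<longlonglongrightarrow> l"
  have "bounded (range y)" using l convergent_imp_bounded by blast
  then obtain B where B: "\<And>n. cmod (y n) \<le> B" by (auto simp: bounded_iff)
  \<comment> \<open>By properness the preimages of the bounded sequence lie in one disc, where
    compactness applies.\<close>
  obtain R where R: "\<And>z. z \<in> upper \<Longrightarrow> cmod (q i z) \<le> B \<Longrightarrow> cmod z \<le> R" using chart_proper[of B] i by blast
  have "compact (S \<inter> cball 0 R)" using S by (simp add: closed_Int_compact)
  then have "compact (q i ` (S \<inter> cball 0 R))"
    using S by (intro compact_continuous_image continuous_on_subset[OF chart_cont[OF i]]) auto
  then have "closed (q i ` (S \<inter> cball 0 R))" by (rule compact_imp_closed)
  moreover have "y n \<in> q i ` (S \<inter> cball 0 R)" for n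
  proof -
    obtain z where "z \<in> S" "y n = q i z" using y by blast
    then show ?thesis using R[of z] B[of n] S by auto
  qed
  ultimately have "l \<in> q i ` (S \<inter> cball 0 R)" using closed_sequentially l by metis
  then show "l \<in> q i ` S" by blast
qed

text \<open>Since the \<open>F i\<close> fix the real axis, they induce a map of the plane. Its
  continuity is tested on preimages of closed sets, which are finite unions of chart images of
  closed sets.\<close>

lemma glue_charts:
  assumes F: "\<And>i. i \<in> I \<Longrightarrow> continuous_on upper (F i)" "\<And>i. i \<in> I \<Longrightarrow> bij_betw (F i) upper upper"
      "\<And>i x. i \<in> I \<Longrightarrow> x \<in> \<real> \<Longrightarrow> F i x = x"
      "\<And>i z. i \<in> I \<Longrightarrow> z \<in> upper \<Longrightarrow> R i \<le> cmod z \<Longrightarrow> F i z = z"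
  obtains h R0 where "continuous_on UNIV h" "bij h" "R0 > 0" "\<And>w. R0 \<le> cmod w \<Longrightarrow> h w = w"
    "\<And>w. w \<in> L \<Longrightarrow> h w = w" "\<And>i z. i \<in> I \<Longrightarrow> z \<in> upper \<Longrightarrow> h (q i z) = q i (F i z)"
proof -
  have Fup: "F i z \<in> upper" if "i \<in> I" "z \<in> upper" for i z using F(2)[OF that(1)] that(2) by (auto simp: bij_betw_def)
  have Fr: "Im (F i z) = 0 \<longleftrightarrow> Im z = 0" if iz: "i \<in> I" "z \<in> upper" for i z
  proof
    assume z: "Im (F i z) = 0"
    then have "F i (F i z) = F i z" using F(3)[OF iz(1)] by (simp add: complex_is_Real_iff)
    then have "F i z = z" using F(2)[OF iz(1)] iz Fup by (auto simp: bij_betw_def dest: inj_onD)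
    then show "Im z = 0" using z by simp
  next
    assume "Im z = 0"
    then show "Im (F i z) = 0" using F(3)[OF iz(1), of z] by (simp add: complex_is_Real_iff)
  qed
  have Fpos: "0 < Im (F i z)" if "i \<in> I" "0 < Im z" for i z
  proof -
    have "z \<in> upper" using that by simp
    then show ?thesis using Fr[OF that(1)] Fup[OF that(1)] that(2) by (auto simp: less_le)
  qed
  \<comment> \<open>Some lift of \<open>w\<close> is chosen; by \<open>wd\<close> the value does not
    depend on it, as lifts are ambiguous only on the real axis, where every \<open>F i\<close> is
    the identity.\<close>
  define h where "h w = (let (i, z) = (SOME iz. fst iz \<in> I \<and> snd iz \<in> upper \<and> q (fst iz) (snd iz) = w) in q i (F i z))" for w
  have wd: "q i (F i z) = q j (F j z')" if a: "i \<in> I" "z \<in> upper" "j \<in> I" "z' \<in> upper" "q i z = q j z'" for i j z z'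
  proof (cases "Im z = 0")
    case True
    then have "Im z' = 0" using chart_L a by (metis mem_Collect_eq)
    then show ?thesis using True F(3) a by (simp add: complex_is_Real_iff)
  next
    case False
    then have "Im z' \<noteq> 0" using chart_L a by (metis mem_Collect_eq)
    then have "i = j \<and> z = z'" using chart_inj[OF a(1,3)] a False by (auto simp: less_le)
    then show ?thesis by simp
  qed
  have hq: "h (q i z) = q i (F i z)" if iz: "i \<in> I" "z \<in> upper" for i z
  proof -
    define jz where "jz = (SOME iz. fst iz \<in> I \<and> snd iz \<in> upper \<and> q (fst iz) (snd iz) = q i z)"
    have "fst jz \<in> I \<and> snd jz \<in> upper \<and> q (fst jz) (snd jz) = q i z"
      unfolding jz_def by (rule someI[of _ "(i, z)"]) (use iz in simp)
    moreover have "h (q i z) = q (fst jz) (F (fst jz) (snd jz))"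
      unfolding h_def jz_def[symmetric] by (simp add: case_prod_unfold)
    ultimately show ?thesis using wd iz by metis
  qed
  have hL: "h w = w" if w: "w \<in> L" for w
  proof -
    obtain i z where iz: "i \<in> I" "z \<in> upper" "q i z = w" using chart_cover by blast
    then have "Im z = 0" using chart_L[OF iz(1), of z] w by simp
    then show ?thesis using hq[OF iz(1,2)] F(3)[OF iz(1), of z] iz by (simp add: complex_is_Real_iff)
  qed
  have "continuous_on UNIV h"
  proof (rule continuous_on_closed_vimage[OF closed_UNIV, THEN iffD2], intro allI impI)
    fix K :: "complex set" assume K: "closed K"
    have "h -` K = (\<Union>i\<in>I. q i ` {z \<in> upper. q i (F i z) \<in> K})"
    proof (intro equalityI subsetI)
      fix w assume w: "w \<in> h -` K"
      obtain i z where "i \<in> I" "z \<in> upper" "q i z = w" using chart_cover by blast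
      then show "w \<in> (\<Union>i\<in>I. q i ` {z \<in> upper. q i (F i z) \<in> K})" using w hq by fastforce
    qed (use hq in auto)
    moreover have "closed (q i ` {z \<in> upper. q i (F i z) \<in> K})" if i: "i \<in> I" for i
    proof (rule chart_closed_map[OF i])
      have "continuous_on upper (\<lambda>z. q i (F i z))"
        by (rule continuous_on_compose2[OF chart_cont[OF i] F(1)[OF i]]) (use Fup[OF i] in auto)
      then have "closed ((\<lambda>z. q i (F i z)) -` K \<inter> upper)"
        using continuous_on_closed_vimage[OF closed_halfspace_Im_ge[of 0]] K by blast
      moreover have "{z \<in> upper. q i (F i z) \<in> K} = (\<lambda>z. q i (F i z)) -` K \<inter> upper" by auto
      ultimately show "closed {z \<in> upper. q i (F i z) \<in> K}" by simp
    qed auto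
    ultimately show "closed (h -` K \<inter> UNIV)" using fin_I by (simp add: closed_UN)
  qed
  moreover have "bij h"
  proof (rule bijI)
    show "inj h"
    proof (rule injI)
      fix w w' assume e: "h w = h w'"
      obtain i z where iz: "i \<in> I" "z \<in> upper" "q i z = w" using chart_cover by blast
      obtain j z' where jz: "j \<in> I" "z' \<in> upper" "q j z' = w'" using chart_cover by blast
      have e': "q i (F i z) = q j (F j z')" using e hq iz jz by metis
      show "w = w'"
      proof (cases "Im z = 0")
        case True
        then have "q i (F i z) \<in> L" using Fr[OF iz(1,2)] chart_L[OF iz(1), of "F i z"] by simp
        then have "Im (F j z') = 0" using e' chart_L[OF jz(1), of "F j z'"] Fup[OF jz(1,2)] by simp
        then have "Im z' = 0" using Fr[OF jz(1,2)] by simp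
        then show ?thesis using True hL chart_L iz jz e by (metis mem_Collect_eq)
      next
        case False
        then have p1: "0 < Im z" using iz by (simp add: less_le)
        have "Im z' \<noteq> 0"
        proof
          assume "Im z' = 0"
          then have "q j (F j z') \<in> L" using Fr[OF jz(1,2)] chart_L[OF jz(1), of "F j z'"] by simp
          then have "Im (F i z) = 0" using e' chart_L[OF iz(1), of "F i z"] Fup[OF iz(1,2)] by simp
          then show False using Fr[OF iz(1,2)] False by simp
        qed
        then have p2: "0 < Im z'" using jz by (simp add: less_le)
        have ij: "i = j" "F i z = F j z'" using chart_inj[OF iz(1) jz(1) Fpos[OF iz(1) p1] Fpos[OF jz(1) p2] e'] by auto
        then have "z = z'" using F(2)[OF iz(1)] iz jz by (auto simp: bij_betw_def dest: inj_onD)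
        then show ?thesis using ij iz jz by simp
      qed
    qed
    show "surj h"
      unfolding surj_def
    proof
      fix w
      obtain i z where iz: "i \<in> I" "z \<in> upper" "q i z = w" using chart_cover by blast
      then obtain z' where "z' \<in> upper" "F i z' = z" using F(2)[OF iz(1)] by (metis bij_betw_def image_iff)
      then show "\<exists>v. w = h v" using hq iz by metis
    qed
  qed
  moreover obtain R0 where "R0 > 0" "\<And>w. R0 \<le> cmod w \<Longrightarrow> h w = w"
  proof -
    have "bounded (\<Union>i\<in>I. q i ` (upper \<inter> cball 0 (R i)))"
    proof (intro bounded_UN fin_I ballI)
      fix i assume i: "i \<in> I"
      have "compact (upper \<inter> cball 0 (R i))" by (intro closed_Int_compact closed_halfspace_Im_ge compact_cball)
      then have "compact (q i ` (upper \<inter> cball 0 (R i)))"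
        by (intro compact_continuous_image continuous_on_subset[OF chart_cont[OF i]]) auto
      then show "bounded (q i ` (upper \<inter> cball 0 (R i)))" by (rule compact_imp_bounded)
    qed
    then obtain R0 where R0: "R0 > 0" "(\<Union>i\<in>I. q i ` (upper \<inter> cball 0 (R i))) \<subseteq> ball 0 R0"
      using bounded_subset_ballD by blast
    have "h w = w" if w: "R0 \<le> cmod w" for w
    proof -
      obtain i z where iz: "i \<in> I" "z \<in> upper" "q i z = w" using chart_cover by blast
      have "z \<notin> cball 0 (R i)"
      proof
        assume "z \<in> cball 0 (R i)"
        then have "w \<in> ball 0 R0" using R0(2) iz by blast
        then show False using w by simp
      qed
      then show ?thesis using F(4)[OF iz(1,2)] hq[OF iz(1,2)] iz by simp
    qed
    then show ?thesis using that R0(1) by blast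
  qed
  ultimately show ?thesis using that[of h R0] hL hq by blast
qed

text \<open>The half-plane homeomorphisms match the preimages of the curve systems only as unions.
  That single curves go to single curves follows from connectedness, applied to \<open>h\<close> and
  to its inverse.\<close>

theorem deformation_of_matching:
  assumes C: "curve_system L A C" and D: "curve_system L A D"
    and M: "\<And>i. i \<in> I \<Longrightarrow> matching C i = matching D i"
  shows "(C, D) \<in> deformation_rel L A"
proof -
  have "\<forall>i\<in>I. \<exists>F. \<exists>R. continuous_on upper F \<and> bij_betw F upper upper \<and> (\<forall>x\<in>\<real>. F x = x) \<and>
      (\<forall>z\<in>upper. R \<le> cmod z \<longrightarrow> F z = z) \<and> F ` pre C i = pre D i"
  proof
    fix i assume i: "i \<in> I"
    show "\<exists>F. \<exists>R. continuous_on upper F \<and> bij_betw F upper upper \<and> (\<forall>x\<in>\<real>. F x = x) \<and>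
      (\<forall>z\<in>upper. R \<le> cmod z \<longrightarrow> F z = z) \<and> F ` pre C i = pre D i"
    proof (rule half_plane_arcs_homeo[OF curve_system_arcs[OF C i] curve_system_arcs[OF D i] M[OF i, unfolded matching_def]])
      fix F R
      assume F: "continuous_on upper F" "bij_betw F upper upper" "\<And>x. x \<in> \<real> \<Longrightarrow> F x = x"
        "0 < R" "\<And>z. z \<in> upper \<Longrightarrow> R \<le> cmod z \<Longrightarrow> F z = z"
        "F ` \<Union>(components (pre C i)) = \<Union>(components (pre D i))"
      have "F ` pre C i = pre D i" using F(6) by (simp only: Union_components)
      then show ?thesis using F(1-3,5) by (intro exI[of _ F] exI[of _ R] conjI ballI impI)
    qed
  qed
  then obtain F where "\<forall>i\<in>I. \<exists>R. continuous_on upper (F i) \<and> bij_betw (F i) upper upper \<and> (\<forall>x\<in>\<real>. F i x = x) \<and>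
      (\<forall>z\<in>upper. R \<le> cmod z \<longrightarrow> F i z = z) \<and> F i ` pre C i = pre D i" by (rule bchoice[THEN exE])
  then obtain R where FR: "\<forall>i\<in>I. continuous_on upper (F i) \<and> bij_betw (F i) upper upper \<and> (\<forall>x\<in>\<real>. F i x = x) \<and>
      (\<forall>z\<in>upper. R i \<le> cmod z \<longrightarrow> F i z = z) \<and> F i ` pre C i = pre D i" by (rule bchoice[THEN exE])
  obtain h R0 where h: "continuous_on UNIV h" "bij h" "R0 > 0" "\<And>w. R0 \<le> cmod w \<Longrightarrow> h w = w"
    "\<And>w. w \<in> L \<Longrightarrow> h w = w" "\<And>i z. i \<in> I \<Longrightarrow> z \<in> upper \<Longrightarrow> h (q i z) = q i (F i z)"
    by (rule glue_charts[of F R]) (use FR in simp_all)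
  obtain H where H: "ambient_isotopy L A H" "H 1 = h"
    using alexander_isotopy[OF h(1-5) L_cone A_L] by blast
  have hC: "h w \<in> \<Union>D" if w: "w \<in> \<Union>C" for w
  proof -
    obtain i z where iz: "i \<in> I" "z \<in> upper" "q i z = w" using chart_cover by blast
    then have "z \<in> pre C i" using w by (simp add: pre_def)
    then have "F i z \<in> pre D i" using FR iz(1) by blast
    then show ?thesis using h(6)[OF iz(1,2)] iz(3) by (simp add: pre_def)
  qed
  have hD: "\<exists>w\<in>\<Union>C. h w = v" if v: "v \<in> \<Union>D" for v
  proof -
    obtain i z where iz: "i \<in> I" "z \<in> upper" "q i z = v" using chart_cover by blast
    then have "z \<in> pre D i" using v by (simp add: pre_def)
    then obtain z' where z': "z' \<in> pre C i" "z = F i z'" using FR iz(1) by blast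
    then have "q i z' \<in> \<Union>C" "h (q i z') = v" using h(6)[OF iz(1), of z'] iz(3) by (simp_all add: pre_def)
    then show ?thesis by blast
  qed
  obtain k where k: "homeomorphism UNIV UNIV h k"
    using H unfolding ambient_isotopy_def by (metis atLeastAtMost_iff order_refl zero_le_one)
  have kh: "k (h z) = z" "h (k z) = z" for z using k by (auto simp: homeomorphism_def)
  have step: "\<exists>d\<in>D. f ` c \<subseteq> d"
    if C: "curve_system L A C" and D: "curve_system L A D" and f: "continuous_on UNIV f" "f ` \<Union>C \<subseteq> \<Union>D" "c \<in> C" for f c C D
  proof -
    have sc: "simple_closed_curve c" using C f(3) by (auto simp: curve_system_def)
    have con: "connected (f ` c)"
      using jordan_facts(2)[OF sc] continuous_on_subset[OF f(1)] by (intro connected_continuous_image) auto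
    obtain z where "z \<in> c" using jordan_facts(3)[OF sc] by blast
    then obtain d where d: "d \<in> D" "f z \<in> d" using f by blast
    have "f ` c \<subseteq> d"
    proof (rule connected_subset_of_disjoint_union[OF curve_system_finite[OF D] _ _ con])
      show "closed a" if "a \<in> D" for a
        using D that jordan_facts(1) compact_imp_closed by (auto simp: curve_system_def)
      show "a \<inter> b = {}" if "a \<in> D" "b \<in> D" "a \<noteq> b" for a b
        using D that by (auto simp: curve_system_def disjoint_def)
    qed (use d f \<open>z \<in> c\<close> in auto)
    then show ?thesis using d by blast
  qed
  have kD: "k ` \<Union>D \<subseteq> \<Union>C" using hD kh by (metis image_subsetI)
  have kc: "continuous_on UNIV k" using k by (simp add: homeomorphism_def)
  have img: "\<exists>d\<in>D. h ` c = d" if c: "c \<in> C" for c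
  proof -
    obtain d where d: "d \<in> D" "h ` c \<subseteq> d" using step[OF C D h(1) _ c] hC by blast
    obtain c' where c': "c' \<in> C" "k ` d \<subseteq> c'" using step[OF D C kc kD d(1)] by blast
    have "c \<subseteq> c'" using d(2) c'(2) kh by (metis image_eqI subset_iff)
    moreover have "c \<noteq> {}" using C c jordan_facts(3) by (auto simp: curve_system_def)
    ultimately have "c = c'" using C c c' unfolding curve_system_def disjoint_def by blast
    then have "d \<subseteq> h ` c" using c'(2) kh by (metis image_eqI subset_iff)
    then show ?thesis using d by blast
  qed
  have "(`) h ` C = D"
  proof
    show "(`) h ` C \<subseteq> D" using img by auto
    show "D \<subseteq> (`) h ` C"
    proof
      fix d assume d: "d \<in> D"
      then obtain v where v: "v \<in> d" using D jordan_facts(3) by (auto simp: curve_system_def) blast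
      then obtain w c where w: "w \<in> c" "c \<in> C" "h w = v" using hD d by blast
      obtain d' where d': "d' \<in> D" "h ` c = d'" using img[OF w(2)] by blast
      then have "v \<in> d \<inter> d'" using v w by blast
      then have "d = d'" using D d d' unfolding curve_system_def disjoint_def by blast
      then show "d \<in> (`) h ` C" using d' w by blast
    qed
  qed
  then show ?thesis unfolding deformation_rel_def using C D H by blast
qed

section \<open>From an ambient isotopy to equal pairings\<close>

lemma chart_open_map:
  assumes "i \<in> I" "open U" "U \<subseteq> {z. 0 < Im z}"
  shows "open (q i ` U)"
proof (rule invariance_of_domain)
  show "continuous_on U (q i)" by (rule continuous_on_subset[OF chart_cont[OF assms(1)]]) (use assms(3) in force)
  show "inj_on (q i) U" using chart_inj[OF assms(1,1)] assms(3) by (auto simp: inj_on_def subset_iff)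
qed fact

text \<open>An isotopy preserving \<open>L\<close> cannot move a point from one chart to another, nor (by continuity in \<open>t\<close>)
  exchange the two sides of \<open>L\<close> at a fixed point \<open>p\<close>. This is what makes \<open>matching\<close> an isotopy invariant,
  also if both sides belong to the same chart.\<close>

lemma isotopy_orbit:
  assumes H: "ambient_isotopy L A H" and w: "w \<notin> L"
  shows "connected ((\<lambda>t. H t w) ` {0..1})" "(\<lambda>t. H t w) ` {0..1} \<subseteq> - L" "w \<in> (\<lambda>t. H t w) ` {0..1}"
proof -
  have c: "continuous_on ({0..1} \<times> UNIV) (\<lambda>(t, z). H t z)" and H0: "H 0 w = w"
    and hom: "\<And>t. t \<in> {0..1} \<Longrightarrow> (\<exists>k. homeomorphism UNIV UNIV (H t) k) \<and> H t ` L = L"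
    using H by (auto simp: ambient_isotopy_def)
  have "continuous_on {0..1} (\<lambda>t. (\<lambda>(t, z). H t z) (t, w))"
    by (rule continuous_on_compose2[OF c]) (auto intro: continuous_intros)
  then show "connected ((\<lambda>t. H t w) ` {0..1})" by (intro connected_continuous_image) auto
  show "(\<lambda>t. H t w) ` {0..1} \<subseteq> - L"
  proof clarify
    fix t :: real assume t: "t \<in> {0..1}" and "H t w \<in> L"
    then obtain v where v: "v \<in> L" "H t w = H t v" using hom[OF t] by blast
    obtain k where "homeomorphism UNIV UNIV (H t) k" using hom[OF t] by blast
    then have "w = v" using v(2) by (metis UNIV_I homeomorphism_apply1)
    then show False using v w by simp
  qed
  show "w \<in> (\<lambda>t. H t w) ` {0..1}" using H0 by force
qed

lemma isotopy_chart:
  assumes H: "ambient_isotopy L A H" and i: "i \<in> I" and z: "0 < Im z"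
  obtains z' where "0 < Im z'" "q i z' = H 1 (q i z)"
proof -
  have nL: "q i z \<notin> L" using chart_L[OF i, of z] z by simp
  define U where "U j = q j ` {z. 0 < Im z}" for j
  have "(\<lambda>t. H t (q i z)) ` {0..1} \<subseteq> U i"
  proof (rule connected_subset_of_disjoint_open_union[of "U ` I"])
    show "open a" if "a \<in> U ` I" for a
      using that chart_open_map[OF _ open_halfspace_Im_gt] by (auto simp: U_def)
    show "a \<inter> b = {}" if ab: "a \<in> U ` I" "b \<in> U ` I" "a \<noteq> b" for a b
    proof (rule ccontr)
      assume "a \<inter> b \<noteq> {}"
      then obtain j k where "j \<in> I" "k \<in> I" "a = U j" "b = U k" "U j \<inter> U k \<noteq> {}" using ab(1,2) by blast
      then have "j = k" using chart_inj by (auto simp: U_def)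
      then show False using \<open>a = U j\<close> \<open>b = U k\<close> ab(3) by simp
    qed
    have "- L \<subseteq> \<Union>(U ` I)"
    proof
      fix w assume w: "w \<in> - L"
      obtain j v where "j \<in> I" "v \<in> upper" "q j v = w" using chart_cover by blast
      moreover then have "0 < Im v" using chart_L[of j v] w by (auto simp: less_le)
      ultimately show "w \<in> \<Union>(U ` I)" by (auto simp: U_def)
    qed
    then show "(\<lambda>t. H t (q i z)) ` {0..1} \<subseteq> \<Union>(U ` I)" using isotopy_orbit(2)[OF H nL] by blast
    show "(\<lambda>t. H t (q i z)) ` {0..1} \<inter> U i \<noteq> {}"
      using isotopy_orbit(3)[OF H nL] z unfolding U_def by blast
  qed (use isotopy_orbit(1)[OF H nL] i in auto)
  then have "H 1 (q i z) \<in> U i" by auto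
  then show ?thesis using that by (auto simp: U_def)
qed

text \<open>Compactness of the time interval makes the neighbourhood of the fixed point uniform in
  \<open>t\<close>.\<close>

lemma isotopy_near_fixed_point:
  assumes H: "ambient_isotopy L A H" and p: "p \<in> A" and d: "d > 0"
  obtains r where "r > 0" "\<And>z t. dist p z < r \<Longrightarrow> t \<in> {0..1} \<Longrightarrow> dist p (H t z) < d"
proof -
  have c: "continuous_on ({0..1} \<times> UNIV) (\<lambda>(t, z). H t z)" and fixp: "\<And>t. t \<in> {0..1} \<Longrightarrow> H t p = p"
    using H p by (auto simp: ambient_isotopy_def)
  have "uniformly_continuous_on ({0..1} \<times> cball p 1) (\<lambda>(t, z). H t z)"
    by (intro compact_uniformly_continuous continuous_on_subset[OF c] compact_Times) auto
  then obtain r where r: "r > 0" "\<And>x y. x \<in> {0..1} \<times> cball p 1 \<Longrightarrow> y \<in> {0..1} \<times> cball p 1 \<Longrightarrow> dist y x < r \<Longrightarrow>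
      dist ((\<lambda>(t, z). H t z) y) ((\<lambda>(t, z). H t z) x) < d"
    using d unfolding uniformly_continuous_on_def by meson
  show ?thesis
  proof (rule that[of "min r 1"])
    fix z t assume z: "dist p z < min r 1" and t: "t \<in> {0..1::real}"
    have "dist (H t p) (H t z) < d"
      using r(2)[of "(t, z)" "(t, p)"] z t by (simp add: dist_Pair_Pair)
    then show "dist p (H t z) < d" using fixp[OF t] by simp
  qed (use r in simp)
qed

text \<open>Near \<open>p\<close> the complement of \<open>L\<close> is covered by the disjoint open
  sets \<open>V\<close> and \<open>W\<close>, the images of half-discs at this germ and at the
  others. The orbit of a point close to \<open>p\<close> stays near \<open>p\<close> and off
  \<open>L\<close>, so it cannot pass from \<open>V\<close> to \<open>W\<close>.\<close>

lemma isotopy_germ: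
  assumes H: "ambient_isotopy L A H" and p: "p \<in> A" and g: "(i, x) \<in> germs_over p" and e: "e > 0"
  obtains r where "r > 0" "\<And>z. dist x z < r \<Longrightarrow> 0 < Im z \<Longrightarrow> \<exists>z'. dist x z' < e \<and> 0 < Im z' \<and> q i z' = H 1 (q i z)"
proof -
  have iI: "i \<in> I" and x0: "Im x = 0" "q i x = p" using g by (auto simp: germs_over_def)
  \<comment> \<open>Different real points over \<open>p\<close> are at least \<open>2 * e1\<close>
    apart, so half-discs of radius \<open>e1\<close> in the same chart are disjoint.\<close>
  obtain e1 where e1: "0 < e1" "e1 \<le> e" "\<And>k y. (k, y) \<in> germs_over p \<Longrightarrow> y \<noteq> x \<Longrightarrow> 2 * e1 \<le> dist x y"
  proof -
    have "finite (snd ` germs_over p)" using germs_over_finite[OF p] by simp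
    then obtain d where d: "d > 0" "\<And>y. y \<in> snd ` germs_over p \<Longrightarrow> y \<noteq> x \<Longrightarrow> d \<le> dist x y"
      using finite_set_avoid by metis
    show ?thesis by (rule that[of "min (d/2) e"]) (use d e in \<open>force+\<close>)
  qed
  obtain e2 where e2: "e2 > 0" "\<And>j z. j \<in> I \<Longrightarrow> z \<in> upper \<Longrightarrow> dist p (q j z) < e2 \<Longrightarrow> \<exists>y. (j, y) \<in> germs_over p \<and> dist y z < e1"
    using near_germ[OF p e1(1)] by metis
  obtain r1 where r1: "r1 > 0" "\<And>z t. dist p z < r1 \<Longrightarrow> t \<in> {0..1} \<Longrightarrow> dist p (H t z) < e2"
    using isotopy_near_fixed_point[OF H p e2(1)] by metis
  obtain r2 where r2: "r2 > 0" "\<And>z. z \<in> upper \<Longrightarrow> dist z x < r2 \<Longrightarrow> dist (q i z) (q i x) < r1"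
    using chart_cont[OF iI, unfolded continuous_on_iff, rule_format, of x r1] r1(1) x0 by auto
  define V where "V = q i ` (ball x e1 \<inter> {z. 0 < Im z})"
  define W where "W = (\<Union>(k, y)\<in>germs_over p - {(i, x)}. q k ` (ball y e1 \<inter> {z. 0 < Im z}))"
  have opV: "open V" unfolding V_def by (intro chart_open_map iI open_Int open_halfspace_Im_gt) auto
  have opW: "open W" unfolding W_def
    by (intro open_UN ballI) (auto simp: germs_over_def intro!: chart_open_map open_Int open_halfspace_Im_gt)
  have VW: "V \<inter> W = {}"
  proof (rule ccontr)
    assume "V \<inter> W \<noteq> {}"
    then obtain k y z z' where k: "(k, y) \<in> germs_over p" "(k, y) \<noteq> (i, x)" "dist x z < e1" "0 < Im z"
        "dist y z' < e1" "0 < Im z'" "q i z = q k z'" unfolding V_def W_def by fastforce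
    then have "k \<in> I" by (simp add: germs_over_def)
    then have "i = k" "z = z'" using chart_inj[OF iI _ k(4,6,7)] by auto
    then have "y \<noteq> x" using k(2) by auto
    then have "2 * e1 \<le> dist x y" using e1(3)[OF k(1)] by simp
    moreover have "dist x y \<le> dist x z + dist y z" by (rule dist_triangle2)
    ultimately show False using k(3,5) \<open>z = z'\<close> by simp
  qed
  show ?thesis
  proof (rule that[of "min r2 e1"])
    fix z assume z: "dist x z < min r2 e1" "0 < Im z"
    have nL: "q i z \<notin> L" using chart_L[OF iI, of z] z by simp
    define S where "S = (\<lambda>t. H t (q i z)) ` {0..1}"
    have "dist (q i z) (q i x) < r1" using r2(2)[of z] z by (simp add: dist_commute)
    then have Sp: "dist p w < e2" if "w \<in> S" for w using r1(2)[of "q i z"] that x0 by (auto simp: S_def dist_commute)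
    have "S \<subseteq> V \<union> W"
    proof
      fix w assume w: "w \<in> S"
      obtain j v where jv: "j \<in> I" "v \<in> upper" "q j v = w" using chart_cover by blast
      have "w \<notin> L" using isotopy_orbit(2)[OF H nL] w by (auto simp: S_def)
      then have "0 < Im v" using chart_L[OF jv(1), of v] jv by (auto simp: less_le)
      obtain y where y: "(j, y) \<in> germs_over p" "dist y v < e1" using e2(2)[OF jv(1,2)] Sp[OF w] jv(3) by blast
      have wy: "w \<in> q j ` (ball y e1 \<inter> {z. 0 < Im z})" using \<open>0 < Im v\<close> jv(3) y(2) by auto
      show "w \<in> V \<union> W"
      proof (cases "(j, y) = (i, x)")
        case True then show ?thesis using wy by (simp add: V_def)
      next
        case False
        then have "w \<in> W" unfolding W_def using wy y(1) by (intro UN_I[of "(j, y)"]) auto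
        then show ?thesis by simp
      qed
    qed
    moreover have "q i z \<in> V" using z by (auto simp: V_def)
    moreover have "q i z \<in> S" using isotopy_orbit(3)[OF H nL] by (simp add: S_def)
    ultimately have "S \<subseteq> V"
      using connectedD[of S V W] isotopy_orbit(1)[OF H nL] opV opW VW unfolding S_def[symmetric] by blast
    then have "H 1 (q i z) \<in> V" by (auto simp: S_def)
    then show "\<exists>z'. dist x z' < e \<and> 0 < Im z' \<and> q i z' = H 1 (q i z)" using e1(2) by (force simp: V_def)
  qed (use r2 e1 in simp)
qed

text \<open>The time-one map lifts to the open half-plane, where it carries an open arc into an arc
  of \<open>D\<close>. The ends are controlled by \<open>isotopy_germ\<close> instead of an
  extension to the axis: points near an end over \<open>A\<close> are moved near the same
  end.\<close>

lemma matching_mono: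
  assumes CD: "(C, D) \<in> deformation_rel L A" and i: "i \<in> I"
  shows "matching C i \<subseteq> matching D i"
proof -
  obtain H where C: "curve_system L A C" and D: "curve_system L A D" and H: "ambient_isotopy L A H" "(`) (H 1) ` C = D"
    using CD by (auto simp: deformation_rel_def)
  interpret CC: chart_arcs I q L A "\<lambda>i. components (pre C i)" by (rule curve_system_chart_arcs[OF C])
  interpret CD: chart_arcs I q L A "\<lambda>i. components (pre D i)" by (rule curve_system_chart_arcs[OF D])
  let ?U = "{z. 0 < Im z}"
  have cq: "continuous_on ?U (q i)" by (rule continuous_on_subset[OF chart_cont[OF i]]) force
  have iq: "inj_on (q i) ?U" using chart_inj[OF i i] by (auto simp: inj_on_def)
  obtain g where g: "homeomorphism ?U (q i ` ?U) (q i) g"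
    using invariance_of_domain_homeomorphism[OF open_halfspace_Im_gt cq _ iq] by auto
  define \<kappa> where "\<kappa> = g \<circ> (H 1 \<circ> q i)"
  obtain k where k: "homeomorphism UNIV UNIV (H 1) k"
    using H unfolding ambient_isotopy_def by (metis atLeastAtMost_iff order_refl zero_le_one)
  have Hin: "H 1 (q i z) \<in> q i ` ?U" if "0 < Im z" for z using isotopy_chart[OF H(1) i that] by (metis image_eqI mem_Collect_eq)
  have kap: "0 < Im (\<kappa> z)" "q i (\<kappa> z) = H 1 (q i z)" if "0 < Im z" for z
  proof -
    have "g (H 1 (q i z)) \<in> ?U" "q i (g (H 1 (q i z))) = H 1 (q i z)"
      using g Hin[OF that] by (auto simp: homeomorphism_def)
    then show "0 < Im (\<kappa> z)" "q i (\<kappa> z) = H 1 (q i z)" by (auto simp: \<kappa>_def)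
  qed
  have ck: "continuous_on ?U \<kappa>" unfolding \<kappa>_def
  proof (intro continuous_on_compose cq)
    show "continuous_on (q i ` ?U) (H 1)" using k by (auto simp: homeomorphism_def intro: continuous_on_subset)
    show "continuous_on ((H 1 \<circ> q i) ` ?U) g" using g Hin by (auto simp: homeomorphism_def intro: continuous_on_subset)
  qed
  show ?thesis
  proof
    fix m assume "m \<in> matching C i"
    then obtain a where a: "a \<in> components (pre C i)" "m = a \<inter> \<real>" by (auto simp: matching_def)
    have aE: "(i, a) \<in> CC.E" using a i by (simp add: CC.E_def)
    obtain ga where ga: "arc ga" "path_image ga = a" "a \<inter> \<real> = {pathstart ga, pathfinish ga}" using CC.E_arc[OF aE] by metis
    define W where "W = a - \<real>"
    have Weq: "W = path_image ga - {pathstart ga, pathfinish ga}" using ga(2,3) by (auto simp: W_def)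
    have conW: "connected W" unfolding Weq by (rule connected_simple_path_endless[OF arc_imp_simple_path[OF ga(1)]])
    have aW: "a \<subseteq> closure W" unfolding Weq using arc_subset_closure_endless[OF ga(1)] ga(2) by simp
    have Wpos: "0 < Im z" if "z \<in> W" for z
      using CC.E_upper(2)[OF aE, of z] that by (auto simp: W_def complex_is_Real_iff less_le)
    have kW: "\<kappa> ` W \<subseteq> pre D i"
    proof
      fix v assume "v \<in> \<kappa> ` W"
      then obtain z where z: "z \<in> W" "v = \<kappa> z" by blast
      have "z \<in> pre C i" using z(1) a(1) in_components_subset by (auto simp: W_def)
      then have "H 1 (q i z) \<in> \<Union>D" using H(2) by (auto simp: pre_def)
      then show "v \<in> pre D i" using kap[OF Wpos[OF z(1)]] z(2) by (simp add: pre_def)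
    qed
    have conk: "connected (\<kappa> ` W)" using conW Wpos by (intro connected_continuous_image continuous_on_subset[OF ck]) auto
    have "W \<noteq> {}" using aW ga(2) path_image_nonempty[of ga] by auto
    then obtain z0 where z0: "z0 \<in> W" by blast
    then have "\<kappa> z0 \<in> \<Union>(components (pre D i))" unfolding Union_components using kW by blast
    then obtain b where b: "b \<in> components (pre D i)" "\<kappa> z0 \<in> b" by blast
    have kb: "\<kappa> ` W \<subseteq> b"
      using components_maximal[OF b(1) conk kW] b(2) z0 by blast
    have bE: "(i, b) \<in> CD.E" using b i by (simp add: CD.E_def)
    obtain gb where gb: "arc gb" "path_image gb = b" "b \<inter> \<real> = {pathstart gb, pathfinish gb}" using CD.E_arc[OF bE] by metis
    have clb: "closed b" using closed_arc_image[OF gb(1)] gb(2) by simp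
    have xb: "x \<in> b" if x: "x \<in> a" "x \<in> \<real>" for x
    proof -
      have x0: "Im x = 0" using x by (simp add: complex_is_Real_iff)
      have germ: "(i, x) \<in> germs_over (q i x)" and xA: "q i x \<in> A" using CC.E_arc_from[OF aE x(1) x0] by metis+
      have "x \<in> closure b" unfolding closure_approachable
      proof (intro allI impI)
        fix e :: real assume e: "e > 0"
        obtain r where r: "r > 0" "\<And>z. dist x z < r \<Longrightarrow> 0 < Im z \<Longrightarrow> \<exists>z'. dist x z' < e \<and> 0 < Im z' \<and> q i z' = H 1 (q i z)"
          using isotopy_germ[OF H(1) xA germ e] by metis
        obtain z where z: "z \<in> W" "dist z x < r" using aW x(1) r(1) by (meson closure_approachable subsetD)
        obtain z' where z': "dist x z' < e" "0 < Im z'" "q i z' = H 1 (q i z)"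
          using r(2)[of z] z Wpos by (auto simp: dist_commute)
        have "z' = \<kappa> z" using chart_inj[OF i i z'(2) kap(1)[OF Wpos[OF z(1)]]] z'(3) kap(2)[OF Wpos[OF z(1)]] by simp
        then have "z' \<in> b" using kb z(1) by blast
        then show "\<exists>y\<in>b. dist y x < e" using z'(1) by (intro bexI[of _ z']) (simp_all add: dist_commute)
      qed
      then show ?thesis using clb by simp
    qed
    have "a \<inter> \<real> \<subseteq> b \<inter> \<real>" using xb by blast
    \<comment> \<open>An inclusion between two-point sets.\<close>
    then have "a \<inter> \<real> = b \<inter> \<real>" unfolding ga(3) gb(3) using arc_distinct_ends[OF ga(1)] by auto
    then show "m \<in> matching D i" using a b by (auto simp: matching_def)
  qed
qed

theorem matching_of_deformation:
  assumes "(C, D) \<in> deformation_rel L A" "i \<in> I"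
  shows "matching C i = matching D i"
proof -
  have "(D, C) \<in> deformation_rel L A" using equiv_deformation_rel assms(1) by (metis equiv_def symD)
  then show ?thesis using matching_mono[OF assms] matching_mono[of D C] assms(2) by blast
qed

end

section \<open>Dyck paths and noncrossing pairings\<close>

definition ht :: "step list \<Rightarrow> nat \<Rightarrow> int" where
  "ht P k = int (count_list (take k P) North) - int (count_list (take k P) East)"

lemma ht_0 [simp]: "ht P 0 = 0"
  by (simp add: ht_def)

lemma ht_Suc: "k < length P \<Longrightarrow> ht P (Suc k) = ht P k + (if P ! k = North then 1 else -1)"
  by (cases "P ! k") (simp_all add: ht_def take_Suc_conv_app_nth)

lemma count_North_East: "count_list P North + count_list P East = length P"
proof (induction P)
  case (Cons a P)
  then show ?case by (cases a) auto
qed simp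

lemma dyck_paths_iff: "P \<in> dyck_paths n \<longleftrightarrow> length P = 2 * n \<and> ht P (2 * n) = 0 \<and> (\<forall>k\<le>2 * n. 0 \<le> ht P k)"
proof
  assume P: "P \<in> dyck_paths n"
  then have c: "count_list P East = n" "count_list P North = n"
    by (auto simp: dyck_paths_def vertex_def complex_eq_iff)
  then have "length P = 2 * n" using count_North_East[of P] by simp
  then show "length P = 2 * n \<and> ht P (2 * n) = 0 \<and> (\<forall>k\<le>2 * n. 0 \<le> ht P k)"
    using P c by (auto simp: dyck_paths_def vertex_def ht_def)
next
  assume P: "length P = 2 * n \<and> ht P (2 * n) = 0 \<and> (\<forall>k\<le>2 * n. 0 \<le> ht P k)"
  then have "count_list P North = count_list P East" "count_list P North + count_list P East = 2 * n"
    using count_North_East[of P] by (auto simp: ht_def)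
  then have "count_list P East = n" "count_list P North = n" by auto
  then show "P \<in> dyck_paths n" using P by (auto simp: dyck_paths_def vertex_def ht_def)
qed

lemma ht_parity: "k \<le> length P \<Longrightarrow> even (ht P k + int k)"
proof (induction k)
  case (Suc k)
  then show ?case using ht_Suc[of k P] by (auto split: if_splits)
qed simp

text \<open>Steps are numbered from \<open>0\<close>. If north and east steps are read as opening and closing parentheses,
  the parentheses at \<open>i\<close> and \<open>j\<close> form a pair.\<close>

definition matched :: "step list \<Rightarrow> nat \<Rightarrow> nat \<Rightarrow> bool" where
  "matched P i j \<longleftrightarrow> i < j \<and> j < length P \<and> ht P i = ht P (Suc j) \<and> (\<forall>k. i < k \<and> k \<le> j \<longrightarrow> ht P i < ht P k)"

lemma matched_steps:
  assumes "matched P i j"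
  shows "i < j" "j < length P" "P ! i = North" "P ! j = East" "ht P j = ht P i + 1" "ht P (Suc i) = ht P i + 1"
proof -
  show ij: "i < j" "j < length P" using assms by (auto simp: matched_def)
  have "ht P i < ht P (Suc i)" "ht P i < ht P j" "ht P i = ht P (Suc j)" using assms by (auto simp: matched_def)
  then show "P ! i = North" "P ! j = East" "ht P j = ht P i + 1" "ht P (Suc i) = ht P i + 1"
    using ht_Suc[of i P] ht_Suc[of j P] ij by (cases "P ! i"; cases "P ! j"; auto)+
qed

text \<open>The partner is the step before the first return to a height at most
  \<open>ht P i\<close>; heights change by one, so equality holds there.\<close>

lemma matched_from_North:
  assumes P: "P \<in> dyck_paths n" and i: "i < 2 * n" "P ! i = North"
  obtains j where "matched P i j"
proof -
  note d = P[unfolded dyck_paths_iff]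
  define Q where "Q k \<longleftrightarrow> i < k \<and> ht P k \<le> ht P i" for k
  have "Q (2 * n)" using d i by (auto simp: Q_def)
  define k where "k = (LEAST k. Q k)"
  have k: "Q k" "\<And>l. l < k \<Longrightarrow> \<not> Q l" "k \<le> 2 * n"
    unfolding k_def using \<open>Q (2 * n)\<close> by (auto intro: LeastI Least_le dest: not_less_Least)
  have si: "ht P (Suc i) = ht P i + 1" using ht_Suc[of i P] d i by simp
  have "k \<noteq> Suc i" using k(1) si by (auto simp: Q_def)
  then obtain j where j: "k = Suc j" "i < j" using k(1) by (cases k) (auto simp: Q_def)
  have bet: "ht P i < ht P l" if "i < l" "l \<le> j" for l using k(2)[of l] j that by (auto simp: Q_def)
  have "ht P (Suc j) = ht P i"
    using ht_Suc[of j P] bet[of j] k j d by (auto simp: Q_def split: if_splits)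
  then show ?thesis using that[of j] j k d bet by (auto simp: matched_def)
qed

text \<open>Mirror image: \<open>i\<close> is the last moment up to \<open>j\<close> at a height not
  above the one after step \<open>j\<close>.\<close>

lemma matched_from_East:
  assumes P: "P \<in> dyck_paths n" and j: "j < 2 * n" "P ! j = East"
  obtains i where "matched P i j"
proof -
  note d = P[unfolded dyck_paths_iff]
  define Q where "Q k \<longleftrightarrow> k \<le> j \<and> ht P k \<le> ht P (Suc j)" for k
  have sj: "ht P (Suc j) = ht P j - 1" using ht_Suc[of j P] d j by simp
  have "0 \<le> ht P (Suc j)" using d j by auto
  then have Q0: "Q 0" by (auto simp: Q_def)
  define i where "i = (GREATEST k. Q k)"
  have i: "Q i" "\<And>l. Q l \<Longrightarrow> l \<le> i"
    unfolding i_def using GreatestI_nat[of Q 0 j] Greatest_le_nat[of Q _ j] Q0 by (auto simp: Q_def)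
  have "i \<noteq> j" using i(1) sj by (auto simp: Q_def)
  then have ij: "i < j" using i(1) by (auto simp: Q_def)
  have bet: "ht P (Suc j) < ht P l" if "i < l" "l \<le> j" for l using i(2)[of l] that by (auto simp: Q_def not_le[symmetric])
  have "ht P i = ht P (Suc j)"
    using ht_Suc[of i P] bet[of "Suc i"] i(1) ij d j by (auto simp: Q_def split: if_splits)
  then show ?thesis using that[of i] ij j d bet by (auto simp: matched_def)
qed

lemma matched_unique:
  shows "matched P i j \<Longrightarrow> matched P i j' \<Longrightarrow> j = j'" "matched P i j \<Longrightarrow> matched P i' j \<Longrightarrow> i = i'"
proof -
  show "j = j'" if "matched P i j" "matched P i j'"
  proof (rule ccontr)
    assume "j \<noteq> j'"
    then consider "j < j'" | "j' < j" by linarith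
    then show False
      using that by cases (force simp: matched_def dest: spec[of _ "Suc j"], force simp: matched_def dest: spec[of _ "Suc j'"])
  qed
  show "i = i'" if "matched P i j" "matched P i' j"
  proof (rule ccontr)
    assume "i \<noteq> i'"
    then consider "i < i'" | "i' < i" by linarith
    then show False
      using that by cases (force simp: matched_def dest: spec[of _ i'], force simp: matched_def dest: spec[of _ i])
  qed
qed

lemma matched_noncrossing:
  assumes "matched P i j" "matched P i' j'" "i < i'" "i' < j" "j < j'"
  shows False
proof -
  have "ht P i < ht P i'" using assms by (auto simp: matched_def)
  moreover have "ht P i' < ht P (Suc j)" using assms by (auto simp: matched_def)
  moreover have "ht P i = ht P (Suc j)" using assms by (auto simp: matched_def)
  ultimately show False by simp
qed

text \<open>Source of the colouring by which beams are chosen consistently in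
  \<open>billiard_exists\<close>.\<close>

lemma matched_parity:
  assumes "matched P i j"
  shows "even i \<longleftrightarrow> odd j"
proof -
  have "even (ht P i + int i)" "even (ht P (Suc j) + int (Suc j))" "ht P i = ht P (Suc j)"
    using assms ht_parity[of i P] ht_parity[of "Suc j" P] by (auto simp: matched_def)
  then show ?thesis by presburger
qed

section \<open>Dyck paths and noncrossing pairings\<close>

definition pairs :: "step list \<Rightarrow> nat set set" where
  "pairs P = {{i, j} | i j. matched P i j}"

definition noncrossing_pairing :: "nat \<Rightarrow> nat set set \<Rightarrow> bool" where
  "noncrossing_pairing N M \<longleftrightarrow> (\<forall>e\<in>M. \<exists>i j. i < j \<and> j < N \<and> e = {i, j}) \<and> (\<forall>k<N. \<exists>!e. e \<in> M \<and> k \<in> e) \<and>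
     (\<forall>i i' j j'. {i, j} \<in> M \<and> {i', j'} \<in> M \<and> i < i' \<and> i' < j \<and> j < j' \<longrightarrow> False)"

lemma pair_in_pairs: "i < j \<Longrightarrow> {i, j} \<in> pairs P \<longleftrightarrow> matched P i j"
  by (auto simp: pairs_def doubleton_eq_iff dest: matched_steps(1))

lemma pairs_partition:
  assumes P: "P \<in> dyck_paths n" and k: "k < 2 * n"
  shows "\<exists>!e. e \<in> pairs P \<and> k \<in> e"
proof (cases "P ! k")
  case North
  obtain j where j: "matched P k j" using matched_from_North[OF P k North] by metis
  show ?thesis
  proof (rule ex1I[of _ "{k, j}"])
    show "{k, j} \<in> pairs P \<and> k \<in> {k, j}" using j by (auto simp: pairs_def)
    fix e assume "e \<in> pairs P \<and> k \<in> e"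
    then obtain a b where ab: "matched P a b" "e = {a, b}" "k \<in> {a, b}" by (auto simp: pairs_def)
    then have "k = a" using matched_steps(4)[OF ab(1)] North by auto
    then show "e = {k, j}" using matched_unique(1)[OF j, of b] ab by simp
  qed
next
  case East
  obtain i where i: "matched P i k" using matched_from_East[OF P k East] by metis
  show ?thesis
  proof (rule ex1I[of _ "{i, k}"])
    show "{i, k} \<in> pairs P \<and> k \<in> {i, k}" using i by (auto simp: pairs_def)
    fix e assume "e \<in> pairs P \<and> k \<in> e"
    then obtain a b where ab: "matched P a b" "e = {a, b}" "k \<in> {a, b}" by (auto simp: pairs_def)
    then have "k = b" using matched_steps(3)[OF ab(1)] East by auto
    then show "e = {i, k}" using matched_unique(2)[OF i, of a] ab by simp
  qed
qed

lemma dyck_North_iff: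
  assumes P: "P \<in> dyck_paths n" and k: "k < 2 * n"
  shows "P ! k = North \<longleftrightarrow> (\<exists>j>k. {k, j} \<in> pairs P)"
proof
  assume "P ! k = North"
  then obtain j where "matched P k j" using matched_from_North[OF P k] by metis
  then show "\<exists>j>k. {k, j} \<in> pairs P" using matched_steps(1) by (auto simp: pairs_def)
next
  assume "\<exists>j>k. {k, j} \<in> pairs P"
  then show "P ! k = North" using pair_in_pairs matched_steps(3) by blast
qed

lemma pairs_inj:
  assumes P: "P \<in> dyck_paths n" and Q: "Q \<in> dyck_paths n" and eq: "pairs P = pairs Q"
  shows "P = Q"
proof (rule nth_equalityI)
  show "length P = length Q" using P Q by (simp add: dyck_paths_iff)
  fix k assume "k < length P"
  then have k: "k < 2 * n" using P by (simp add: dyck_paths_iff)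
  have "P ! k = North \<longleftrightarrow> Q ! k = North" using dyck_North_iff[OF P k] dyck_North_iff[OF Q k] eq by simp
  then show "P ! k = Q ! k" by (cases "P ! k"; cases "Q ! k") auto
qed

text \<open>The smaller index of each pair is read as a north step. Heights become sums of signs,
  which cancel over sets closed under the pairing and are nonnegative over intervals that contain
  the partner of each closing index.\<close>

lemma pairs_surj:
  assumes M: "noncrossing_pairing (2 * n) M"
  obtains P where "P \<in> dyck_paths n" "pairs P = M"
proof -
  define N where "N = 2 * n"
  have shape: "\<And>e. e \<in> M \<Longrightarrow> \<exists>i j. i < j \<and> j < N \<and> e = {i, j}"
    and ex1: "\<And>k. k < N \<Longrightarrow> \<exists>!e. e \<in> M \<and> k \<in> e"
    and nc: "\<And>i i' j j'. {i, j} \<in> M \<Longrightarrow> {i', j'} \<in> M \<Longrightarrow> i < i' \<Longrightarrow> i' < j \<Longrightarrow> j < j' \<Longrightarrow> False"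
    using M unfolding noncrossing_pairing_def N_def by blast+
  have "\<exists>j. {k, j} \<in> M \<and> j < N \<and> j \<noteq> k" if "k < N" for k
  proof -
    obtain e where e: "e \<in> M" "k \<in> e" using ex1[OF \<open>k < N\<close>] by blast
    then obtain i j where "i < j" "j < N" "e = {i, j}" using shape by blast
    then show ?thesis using e by (metis insert_commute insert_iff less_trans nat_neq_iff singletonD)
  qed
  then obtain m where m: "\<And>k. k < N \<Longrightarrow> {k, m k} \<in> M \<and> m k < N \<and> m k \<noteq> k" by metis
  have mu: "j = m k" if "k < N" "{k, j} \<in> M" "j \<noteq> k" for k j
    using ex1[OF that(1)] m[OF that(1)] that by (metis doubleton_eq_iff insertI1)
  have mm: "m (m k) = k" if "k < N" for k
    using mu[of "m k" k] m[OF that] by (metis insert_commute)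
  define w :: "nat \<Rightarrow> int" where "w k = (if k < m k then 1 else -1)" for k
  have wm: "w (m k) = - w k" if "k < N" for k using m[OF that] mm[OF that] by (auto simp: w_def)
  define P where "P = map (\<lambda>k. if k < m k then North else East) [0..<N]"
  have len: "length P = N" by (simp add: P_def)
  have htw: "ht P k = (\<Sum>l<k. w l)" if "k \<le> N" for k
    using that
  proof (induction k)
    case (Suc k)
    then show ?case using ht_Suc[of k P] len by (simp add: P_def w_def)
  qed simp
  \<comment> \<open>The pairing is a sign-reversing involution of \<open>S\<close>.\<close>
  have closed0: "sum w S = 0" if S: "S \<subseteq> {..<N}" "m ` S \<subseteq> S" for S
  proof -
    have inj: "inj_on m S" using S mm by (metis inj_on_def lessThan_iff subsetD)
    have "finite S" using S(1) finite_subset by blast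
    then have "m ` S = S" using S(2) inj by (simp add: endo_inj_surj)
    then have "sum w S = sum (w \<circ> m) S" using sum.reindex[OF inj, of w] by simp
    also have "\<dots> = (\<Sum>k\<in>S. - w k)" using wm S by (intro sum.cong) auto
    also have "\<dots> = - sum w S" by (rule sum_negf)
    finally show ?thesis by simp
  qed
  have nonneg: "0 \<le> sum w {a..<b}" if ab: "b \<le> N" "\<And>l. a \<le> l \<Longrightarrow> l < b \<Longrightarrow> m l < l \<Longrightarrow> a \<le> m l" for a b
  proof -
    define U where "U = {l \<in> {a..<b}. l < m l}"
    define K where "K = {l \<in> {a..<b}. m l < l}"
    have ne: "l < m l \<or> m l < l" if "l < b" for l
    proof -
      have "m l \<noteq> l" using m[of l] ab(1) that by simp
      then show ?thesis by linarith
    qed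
    have part1: "{a..<b} = U \<union> K"
    proof (intro equalityI subsetI)
      fix x assume "x \<in> {a..<b}"
      then show "x \<in> U \<union> K" using ne[of x] by (auto simp: U_def K_def)
    qed (auto simp: U_def K_def)
    have part2: "U \<inter> K = {}" by (auto simp: U_def K_def)
    have "m ` K \<subseteq> U"
    proof
      fix v assume "v \<in> m ` K"
      then obtain l where l: "v = m l" "a \<le> l" "l < b" "m l < l" by (auto simp: K_def)
      then show "v \<in> U" using ab(2)[of l] mm[of l] ab(1) by (simp add: U_def)
    qed
    moreover have "inj_on m K" using mm ab(1) by (intro inj_on_inverseI[of _ m]) (auto simp: K_def)
    ultimately have "card K \<le> card U" by (intro card_inj_on_le) (auto simp: U_def)
    moreover have "sum w {a..<b} = int (card U) - int (card K)"
    proof -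
      have "sum w {a..<b} = sum w U + sum w K" unfolding part1
        by (rule sum.union_disjoint[OF _ _ part2]) (simp_all add: U_def K_def)
      also have "sum w U = (\<Sum>l\<in>U. 1)" by (rule sum.cong) (auto simp: w_def U_def)
      also have "sum w K = (\<Sum>l\<in>K. -1)" by (rule sum.cong) (auto simp: w_def K_def)
      finally show ?thesis by simp
    qed
    ultimately show ?thesis by simp
  qed
  have "ht P N = 0" using htw[of N] closed0[of "{..<N}"] m by (auto simp: image_subset_iff)
  moreover have "0 \<le> ht P k" if "k \<le> N" for k
    using htw[OF that] nonneg[OF that, of 0] by (simp add: atLeast0LessThan)
  ultimately have PD: "P \<in> dyck_paths n" using len by (auto simp: dyck_paths_iff N_def)
  have diff: "ht P b - ht P a = sum w {a..<b}" if "a \<le> b" "b \<le> N" for a b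
    using htw[of a] htw[of b] that sum.atLeastLessThan_concat[of 0 a b w] by (simp add: atLeast0LessThan)
  have M_matched: "matched P i j" if ij: "{i, j} \<in> M" "i < j" for i j
  proof -
    obtain a b where "a < b" "b < N" "{i, j} = {a, b}" using shape[OF ij(1)] by blast
    then have jN: "j < N" using ij(2) by (auto simp: doubleton_eq_iff)
    have mi: "m i = j" "m j = i" using mu[of i j] mu[of j i] ij jN by (auto simp: insert_commute)
    \<comment> \<open>Noncrossing enters here: a partner outside would make the pair of
      \<open>l\<close> cross the pair of \<open>i\<close> and \<open>j\<close>.\<close>
    have inside: "i < m l \<and> m l < j" if l: "i < l" "l < j" for l
    proof (rule ccontr)
      assume n: "\<not> (i < m l \<and> m l < j)"
      have lN: "l < N" using l jN by simp
      have "m l \<noteq> i" "m l \<noteq> j" using mm[OF lN] mi l by auto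
      then consider "m l < i" | "j < m l" using n by linarith
      then show False
      proof cases
        case 1
        then show False using nc[of "m l" l i j] m[OF lN] ij l by (simp add: insert_commute)
      next
        case 2
        then show False using nc[of i j l "m l"] m[OF lN] ij l by simp
      qed
    qed
    have s1: "ht P (Suc i) = ht P i + 1" using diff[of i "Suc i"] jN ij(2) mi by (simp add: w_def)
    have s2: "ht P (Suc j) = ht P j - 1" using diff[of j "Suc j"] jN ij(2) mi by (simp add: w_def)
    have "m ` {Suc i..<j} \<subseteq> {Suc i..<j}" using inside by (auto simp: Suc_le_eq)
    then have "sum w {Suc i..<j} = 0" using jN by (intro closed0) auto
    then have "ht P j = ht P (Suc i)" using diff[of "Suc i" j] jN ij(2) by simp
    then have "ht P i = ht P (Suc j)" using s1 s2 by simp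
    moreover have "ht P i < ht P k" if k: "i < k" "k \<le> j" for k
    proof -
      have "0 \<le> sum w {Suc i..<k}" using inside k jN by (intro nonneg) (auto simp: Suc_le_eq)
      then show ?thesis using diff[of "Suc i" k] k jN s1 by simp
    qed
    ultimately show ?thesis using ij(2) jN len by (auto simp: matched_def)
  qed
  have "pairs P = M"
  proof (intro equalityI subsetI)
    fix e assume "e \<in> M"
    then obtain i j where "i < j" "e = {i, j}" using shape by blast
    then show "e \<in> pairs P" using M_matched[of i j] \<open>e \<in> M\<close> by (auto simp: pairs_def)
  next
    fix e assume "e \<in> pairs P"
    then obtain i j where ij: "matched P i j" "e = {i, j}" by (auto simp: pairs_def)
    have iN: "i < N" using matched_steps(1,2)[OF ij(1)] len by simp
    have "i < m i"
      using matched_steps(3)[OF ij(1)] iN by (auto simp: P_def split: if_splits)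
    then have "matched P i (m i)" using M_matched m[OF iN] by blast
    then have "j = m i" using matched_unique(1)[OF ij(1)] by blast
    then show "e \<in> M" using m[OF iN] ij(2) by simp
  qed
  then show ?thesis using that PD by blast
qed

lemma matched_L_path: "matched (L_path n) i j \<longleftrightarrow> i < n \<and> j = 2 * n - 1 - i"
proof -
  have len: "length (L_path n) = 2 * n" by (simp add: L_path_def)
  have cl: "count_list (replicate a x) y = (if x = y then a else 0)" for a and x y :: step
    by (induction a) auto
  have h: "ht (L_path n) k = (if k \<le> n then int k else 2 * int n - int k)" if "k \<le> 2 * n" for k
    using that by (auto simp: ht_def L_path_def cl min_def)
  show ?thesis
  proof
    assume m: "matched (L_path n) i j"
    note ms = matched_steps[OF m]
    have i: "i < n" using ms(1-3) len by (auto simp: L_path_def nth_append split: if_splits)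
    have "ht (L_path n) i = ht (L_path n) (Suc j)" "Suc j \<le> 2 * n" using m len by (auto simp: matched_def)
    then have "int i = (if Suc j \<le> n then int (Suc j) else 2 * int n - int (Suc j))" using h[of i] h[of "Suc j"] i by simp
    then show "i < n \<and> j = 2 * n - 1 - i" using i ms(1) by (auto split: if_splits)
  next
    assume "i < n \<and> j = 2 * n - 1 - i"
    then show "matched (L_path n) i j" unfolding matched_def len using h by auto
  qed
qed

lemma L_path_dyck: "L_path n \<in> dyck_paths n"
proof -
  have cl: "count_list (replicate a x) y = (if x = y then a else 0)" for a and x y :: step
    by (induction a) auto
  show ?thesis by (auto simp: dyck_paths_iff ht_def L_path_def cl min_def)
qed

section \<open>Billiard trajectories in grid polygons\<close>

text \<open>In the rotated coordinates \<open>sc\<close> and \<open>dc\<close>, the path \<open>P\<close> is the graph of \<open>height P\<close>, and \<open>- Q\<close> is the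
  graph of \<open>- height Q\<close>; \<open>level P k\<close> is the height of the midpoint of the \<open>k\<close>-th step.\<close>

definition sc :: "complex \<Rightarrow> real" where "sc z = Re z + Im z"
definition dc :: "complex \<Rightarrow> real" where "dc z = Im z - Re z"

lemma sc_dc_eqI: "sc z = sc w \<Longrightarrow> dc z = dc w \<Longrightarrow> z = w"
  by (simp add: sc_def dc_def complex_eq_iff)

lemma sc_dc_linear [simp]:
  "sc (z + w) = sc z + sc w" "dc (z + w) = dc z + dc w" "sc (z - w) = sc z - sc w" "dc (z - w) = dc z - dc w"
  "sc (r *\<^sub>R z) = r * sc z" "dc (r *\<^sub>R z) = r * dc z"
  by (simp_all add: sc_def dc_def algebra_simps)

lemma sc_dc_continuous [continuous_intros]:
  "continuous_on S f \<Longrightarrow> continuous_on S (\<lambda>x. sc (f x))" "continuous_on S f \<Longrightarrow> continuous_on S (\<lambda>x. dc (f x))"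
  unfolding sc_def dc_def by (intro continuous_intros; assumption)+

definition slope :: "step list \<Rightarrow> nat \<Rightarrow> real" where
  "slope P k = (if P ! k = North then 1 else -1)"

text \<open>One clipped ramp per step: the sum interpolates \<open>ht\<close> linearly, is constant
  outside the range of the path, and is visibly continuous.\<close>

definition height :: "step list \<Rightarrow> real \<Rightarrow> real" where
  "height P s = (\<Sum>k<length P. slope P k * max 0 (min 1 (s - real k)))"

definition level :: "step list \<Rightarrow> nat \<Rightarrow> real" where
  "level P k = ht P k + slope P k / 2"

lemma ht_sum: "k \<le> length P \<Longrightarrow> ht P k = (\<Sum>l<k. slope P l)"
proof (induction k)
  case (Suc k)
  then show ?case using ht_Suc[of k P] by (simp add: slope_def)
qed simp

lemma height_at:
  assumes "k < length P" "real k \<le> s" "s \<le> real k + 1"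
  shows "height P s = ht P k + slope P k * (s - k)"
proof -
  have "height P s = (\<Sum>l<length P. if l < k then slope P l else if l = k then slope P k * (s - k) else 0)"
    unfolding height_def
  proof (rule sum.cong)
    fix l assume "l \<in> {..<length P}"
    show "slope P l * max 0 (min 1 (s - real l)) = (if l < k then slope P l else if l = k then slope P k * (s - k) else 0)"
    proof (cases l k rule: linorder_cases)
      case less
      then have "real l + 1 \<le> real k" by linarith
      then show ?thesis using assms less by (simp add: max_def min_def)
    next
      case greater
      then have "real k + 1 \<le> real l" by linarith
      then show ?thesis using assms greater by (simp add: max_def min_def)
    qed (use assms in \<open>simp add: max_def min_def\<close>)
  qed simp
  also have "{..<length P} = {..<k} \<union> {k} \<union> {k<..<length P}" using assms(1) by auto
  also have "(\<Sum>l\<in>{..<k} \<union> {k} \<union> {k<..<length P}. if l < k then slope P l else if l = k then slope P k * (s - k) else 0)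
    = (\<Sum>l<k. slope P l) + slope P k * (s - k)"
    by (subst sum.union_disjoint; auto simp: sum.union_disjoint)+
  finally show ?thesis using ht_sum[of k P] assms(1) by simp
qed

lemma height_continuous [continuous_intros]:
  "continuous_on S f \<Longrightarrow> continuous_on S (\<lambda>x. height P (f x))"
  unfolding height_def by (intro continuous_intros) auto

lemma height_mid: "k < length P \<Longrightarrow> height P (real k + 1/2) = level P k"
  by (subst height_at[of k]) (auto simp: level_def)

lemma height_neg: "s \<le> 0 \<Longrightarrow> height P s = 0"
  unfolding height_def by (rule sum.neutral) (auto simp: max_def min_def)

lemma height_beyond:
  assumes "P \<in> dyck_paths n" "2 * real n \<le> s"
  shows "height P s = 0"
proof -
  have len: "length P = 2 * n" "ht P (2 * n) = 0" using assms(1) by (auto simp: dyck_paths_iff)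
  have "height P s = (\<Sum>k<2*n. slope P k)" unfolding height_def len
  proof (rule sum.cong)
    fix k assume "k \<in> {..<2 * n}"
    then have "real k + 1 \<le> 2 * real n" by simp
    then show "slope P k * max 0 (min 1 (s - real k)) = slope P k" using assms(2) by (simp add: max_def min_def)
  qed simp
  also have "\<dots> = 0" using ht_sum[of "2 * n" P] len by simp
  finally show ?thesis .
qed

lemma real_between_nats:
  assumes "0 \<le> s" "s \<le> real N" "0 < N"
  obtains k where "k < N" "real k \<le> s" "s \<le> real k + 1"
proof (cases "s = real N")
  case True
  then show ?thesis using that[of "N - 1"] assms by (simp add: of_nat_diff)
next
  case False
  have "nat \<lfloor>s\<rfloor> < N" using False assms by linarith
  then show ?thesis using that[of "nat \<lfloor>s\<rfloor>"] assms by linarith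
qed

lemma height_ge:
  assumes "P \<in> dyck_paths n" "k < 2 * n" "real k \<le> s" "s \<le> real k + 1" "c \<le> ht P k" "c \<le> ht P (Suc k)"
  shows "c \<le> height P s"
proof -
  have len: "k < length P" using assms by (simp add: dyck_paths_iff)
  have "height P s = ht P k + slope P k * (s - k)" using height_at[OF len assms(3,4)] .
  also have "real_of_int (ht P (Suc k)) = ht P k + slope P k" using ht_Suc[OF len] by (simp add: slope_def)
  then have "ht P k + slope P k * (s - k) = (1 - (s - k)) * ht P k + (s - k) * ht P (Suc k)"
    by (simp add: algebra_simps)
  also have "\<dots> \<ge> (1 - (s - k)) * c + (s - k) * c"
    using assms by (intro add_mono mult_left_mono) auto
  finally show ?thesis by (simp add: algebra_simps)
qed

lemma height_nonneg:
  assumes P: "P \<in> dyck_paths n"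
  shows "0 \<le> height P s"
proof -
  consider "s \<le> 0" | "2 * real n \<le> s" | "0 \<le> s" "s \<le> real (2 * n)" "0 < 2 * n" by (cases "n = 0") force+
  then show ?thesis
  proof cases
    case 3
    obtain k where k: "k < 2 * n" "real k \<le> s" "s \<le> real k + 1" using real_between_nats[OF 3] by metis
    then show ?thesis using height_ge[OF P k, of 0] P by (simp add: dyck_paths_iff)
  qed (use height_neg height_beyond[OF P] in auto)
qed

lemma level_pos:
  assumes P: "P \<in> dyck_paths n" and k: "k < 2 * n"
  shows "1/2 \<le> level P k"
proof -
  have "0 \<le> ht P k" "0 \<le> ht P (Suc k)" "k < length P" using P k by (auto simp: dyck_paths_iff)
  then show ?thesis using ht_Suc[of k P] by (auto simp: level_def slope_def split: if_splits)
qed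

text \<open>The right-hand side describes a horizontal chord below the graph between two midpoints;
  in the original coordinates this is a beam of direction (1, 1).\<close>

lemma chord_iff_matched:
  assumes P: "P \<in> dyck_paths n" and ij: "i < j" "j < 2 * n"
  shows "matched P i j \<longleftrightarrow> level P i = level P j \<and> (\<forall>s. real i + 1/2 < s \<and> s < real j + 1/2 \<longrightarrow> level P i < height P s)"
proof
  have len: "length P = 2 * n" using P by (simp add: dyck_paths_iff)
  {
    assume m: "matched P i j"
    note ms = matched_steps[OF m]
    have li: "level P i = ht P i + 1/2" "level P j = ht P i + 1/2" using ms by (simp_all add: level_def slope_def)
    moreover have "level P i < height P s" if s: "real i + 1/2 < s" "s < real j + 1/2" for s
    proof -
      consider "s \<le> real i + 1" | "real i + 1 < s" "s < real j" | "real j \<le> s" using s by linarith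
      then show ?thesis
      proof cases
        case 1
        then show ?thesis using height_at[of i P s] s ij ms len li by (simp add: slope_def)
      next
        case 3
        then show ?thesis using height_at[of j P s] s ij ms len li by (simp add: slope_def)
      next
        case 2
        obtain k where k: "k < j - Suc i" "real k \<le> s - real (Suc i)" "s - real (Suc i) \<le> real k + 1"
        proof -
          have "Suc i < j" using 2 by linarith
          then show ?thesis using real_between_nats[of "s - real (Suc i)" "j - Suc i"] 2 that by (auto simp: of_nat_diff)
        qed
        define l where "l = Suc i + k"
        have l: "i < l" "Suc l \<le> j" "real l \<le> s" "s \<le> real l + 1" using k by (auto simp: l_def)
        have h: "ht P i < ht P l" "ht P i < ht P (Suc l)" using m l by (auto simp: matched_def)
        have "ht P i + 1 \<le> height P s" by (rule height_ge[OF P _ l(3,4)]) (use h l ij in auto)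
        then show ?thesis using li by simp
      qed
    qed
    ultimately show "level P i = level P j \<and> (\<forall>s. real i + 1/2 < s \<and> s < real j + 1/2 \<longrightarrow> level P i < height P s)" by simp
  }
  {
    assume a: "level P i = level P j \<and> (\<forall>s. real i + 1/2 < s \<and> s < real j + 1/2 \<longrightarrow> level P i < height P s)"
    \<comment> \<open>A quarter of a step inside each end of the chord, the graph has to be above
      it; this reveals the directions of the two end steps.\<close>
    have "level P i < height P (real i + 3/4)" using a ij by (auto intro: less_le_trans)
    then have wi: "slope P i = 1" using height_at[of i P "real i + 3/4"] ij len by (auto simp: level_def slope_def split: if_splits)
    have "level P i < height P (real j + 1/4)" using a ij by (auto intro: less_le_trans)
    then have wj: "slope P j = -1" using height_at[of j P "real j + 1/4"] ij len a by (auto simp: level_def slope_def split: if_splits)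
    have hj: "real_of_int (ht P (Suc j)) = ht P j + slope P j" using ht_Suc[of j P] ij len by (simp add: slope_def)
    have "real_of_int (ht P i) = ht P (Suc j)" using a wi wj hj by (simp add: level_def)
    then have "ht P i = ht P (Suc j)" by simp
    moreover have "ht P i < ht P k" if k: "i < k" "k \<le> j" for k
    proof -
      have "level P i < height P (real k)" using a k by auto
      also have "height P (real k) = ht P k" using height_at[of k P "real k"] k ij len by simp
      finally show ?thesis using wi by (simp add: level_def)
    qed
    ultimately show "matched P i j" using ij len by (simp add: matched_def)
  }
qed

section \<open>The interior of the grid polygon\<close>

lemma unbounded_ray:
  fixes v :: complex
  assumes "v \<noteq> 0"
  shows "\<not> bounded {z + t *\<^sub>R v | t. 0 \<le> t}" "connected {z + t *\<^sub>R v | t. 0 \<le> t}"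
proof -
  have eq: "{z + t *\<^sub>R v | t. 0 \<le> t} = (\<lambda>t. z + t *\<^sub>R v) ` {0..}" by auto
  show "connected {z + t *\<^sub>R v | t. 0 \<le> t}" unfolding eq
    by (intro connected_continuous_image continuous_intros) (simp add: connected_iff_interval)
  show "\<not> bounded {z + t *\<^sub>R v | t. 0 \<le> t}"
  proof
    assume "bounded {z + t *\<^sub>R v | t. 0 \<le> t}"
    then obtain B where B: "\<And>t. 0 \<le> t \<Longrightarrow> cmod (z + t *\<^sub>R v) \<le> B" by (auto simp: bounded_iff)
    define t where "t = (\<bar>B\<bar> + cmod z + 1) / cmod v"
    have t: "0 \<le> t" "t * cmod v = \<bar>B\<bar> + cmod z + 1" using assms by (auto simp: t_def)
    have "t * cmod v = cmod (t *\<^sub>R v)" using t by simp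
    also have "\<dots> \<le> cmod (z + t *\<^sub>R v) + cmod z" by (metis add_diff_cancel_left' norm_triangle_ineq4)
    finally show False using B[OF t(1)] t by simp
  qed
qed

lemma not_inside_ray:
  fixes z v :: complex
  assumes "z \<in> inside S" "v \<noteq> 0" "\<And>t. 0 \<le> t \<Longrightarrow> z + t *\<^sub>R v \<notin> S"
  shows False
proof -
  have "{z + t *\<^sub>R v | t. 0 \<le> t} \<subseteq> connected_component_set (- S) z"
    by (rule connected_component_maximal) (use assms unbounded_ray(2)[OF assms(2)] in \<open>auto intro: exI[of _ 0]\<close>)
  then show False using assms(1) unbounded_ray(1)[OF assms(2)] bounded_subset by (auto simp: inside_def)
qed

locale dyck_pair =
  fixes n :: nat and P Q :: "step list"
  assumes n: "0 < n" and P: "P \<in> dyck_paths n" and Q: "Q \<in> dyck_paths n"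
begin

lemma len: "length P = 2 * n" "length Q = 2 * n" using P Q by (auto simp: dyck_paths_iff)

definition path_of :: "bool \<Rightarrow> step list" where "path_of a = (if a then P else Q)"
definition sgn_of :: "bool \<Rightarrow> real" where "sgn_of a = (if a then 1 else -1)"
text \<open>\<open>bs (True, k)\<close> is the \<open>k\<close>-th step of \<open>P\<close>, and \<open>bs (False, k)\<close> that of \<open>- Q\<close>.\<close>

definition bs :: "bool \<times> nat \<Rightarrow> unit_step" where
  "bs v = (if fst v then (vertex P (snd v), P ! snd v) else (vertex (reflect_path Q) (snd v), reflect_path Q ! snd v))"
definition V :: "(bool \<times> nat) set" where "V = UNIV \<times> {..<2 * n}"

lemma path_of: "path_of a \<in> dyck_paths n" "length (path_of a) = 2 * n" using P Q len by (auto simp: path_of_def)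

lemma boundary_steps_bs: "boundary_steps P Q = bs ` V"
proof -
  have so: "steps_of R = (\<lambda>k. (vertex R k, R ! k)) ` {..<length R}" for R by (auto simp: steps_of_def)
  have "V = (\<lambda>k. (True, k)) ` {..<2*n} \<union> (\<lambda>k. (False, k)) ` {..<2*n}"
    by (auto simp: V_def image_iff)
  then have "bs ` V = (\<lambda>k. bs (True, k)) ` {..<2*n} \<union> (\<lambda>k. bs (False, k)) ` {..<2*n}"
    by (simp add: image_Un image_image)
  then show ?thesis by (simp add: boundary_steps_def so bs_def len reflect_path_def)
qed

lemma count_swap: "count_list (map swap_step xs) East = count_list xs North" "count_list (map swap_step xs) North = count_list xs East"
  by (induction xs) (auto split: step.splits, (metis step.exhaust swap_step.simps)+)

lemma bs_vertex:
  assumes "k < 2 * n"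
  shows "sc (fst (bs (a, k))) = real k" "dc (fst (bs (a, k))) = sgn_of a * ht (path_of a) k"
    "sc (step_vec (snd (bs (a, k)))) = 1" "dc (step_vec (snd (bs (a, k)))) = sgn_of a * slope (path_of a) k"
proof -
  have c: "real (count_list (take k xs) East) + real (count_list (take k xs) North) = real k" if "length xs = 2 * n" for xs
    using count_North_East[of "take k xs"] that assms by (metis add.commute length_take less_imp_le min.absorb2 of_nat_add)
  show "sc (fst (bs (a, k))) = real k"
    using c[of P] c[of Q] len by (simp add: bs_def sc_def vertex_def reflect_path_def take_map count_swap add.commute)
  show "dc (fst (bs (a, k))) = sgn_of a * ht (path_of a) k"
    by (simp add: bs_def dc_def vertex_def reflect_path_def take_map count_swap ht_def sgn_of_def path_of_def)
  show "sc (step_vec (snd (bs (a, k)))) = 1" by (cases "snd (bs (a, k))") (auto simp: sc_def)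
  show "dc (step_vec (snd (bs (a, k)))) = sgn_of a * slope (path_of a) k"
    using assms len by (cases "P ! k"; cases "Q ! k") (auto simp: bs_def dc_def slope_def sgn_of_def path_of_def reflect_path_def)
qed

lemma mid_eq: "mid e = fst e + (1/2) *\<^sub>R step_vec (snd e)"
  by (simp add: mid_def midpoint_def scaleR_conv_of_real algebra_simps)

lemma mid_bs:
  assumes "k < 2 * n"
  shows "sc (mid (bs (a, k))) = real k + 1/2" "dc (mid (bs (a, k))) = sgn_of a * level (path_of a) k"
  using bs_vertex[OF assms, of a] by (simp_all add: mid_eq level_def algebra_simps)

text \<open>The coordinate \<open>sc\<close> of a midpoint gives the index. Levels are at least 1/2,
  so midpoints of \<open>P\<close> and of \<open>- Q\<close> lie strictly on different sides of the
  diagonal.\<close>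

lemma bs_inj: "inj_on bs V"
proof (rule inj_onI)
  fix v w assume vw: "v \<in> V" "w \<in> V" "bs v = bs w"
  obtain a k b l where ak: "v = (a, k)" "w = (b, l)" "k < 2 * n" "l < 2 * n" using vw by (auto simp: V_def)
  have "k = l" using mid_bs(1)[OF ak(3), of a] mid_bs(1)[OF ak(4), of b] vw ak by simp
  moreover have "sgn_of a * level (path_of a) k = sgn_of b * level (path_of b) l"
    using mid_bs(2)[OF ak(3), of a] mid_bs(2)[OF ak(4), of b] vw ak by simp
  then have "a = b"
    using level_pos[OF path_of(1) ak(3), of a] level_pos[OF path_of(1) ak(4), of b] by (auto simp: sgn_of_def split: if_splits)
  ultimately show "v = w" using ak by simp
qed

definition Bd :: "complex set" where
  "Bd = {z. 0 \<le> sc z \<and> sc z \<le> 2 * real n \<and> (dc z = height P (sc z) \<or> dc z = - height Q (sc z))}"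

definition U :: "complex set" where "U = {z. - height Q (sc z) < dc z \<and> dc z < height P (sc z)}"

lemma segment_bs:
  assumes k: "k < 2 * n"
  shows "segment_of (bs (a, k)) = {z. real k \<le> sc z \<and> sc z \<le> real k + 1 \<and> dc z = sgn_of a * height (path_of a) (sc z)}"
proof (intro equalityI subsetI)
  note b = bs_vertex[OF k, of a]
  have kl: "k < length (path_of a)" using k path_of by simp
  fix z assume "z \<in> segment_of (bs (a, k))"
  then obtain r where r: "0 \<le> r" "r \<le> 1" "z = fst (bs (a, k)) + r *\<^sub>R step_vec (snd (bs (a, k)))"
    by (auto simp: segment_of_def closed_segment_def algebra_simps)
  then have "sc z = real k + r" "dc z = sgn_of a * (ht (path_of a) k + slope (path_of a) k * r)"
    using b by (simp_all add: algebra_simps)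
  moreover have "height (path_of a) (real k + r) = ht (path_of a) k + slope (path_of a) k * r"
    using height_at[OF kl, of "real k + r"] r by simp
  ultimately show "z \<in> {z. real k \<le> sc z \<and> sc z \<le> real k + 1 \<and> dc z = sgn_of a * height (path_of a) (sc z)}"
    using r by simp
next
  note b = bs_vertex[OF k, of a]
  have kl: "k < length (path_of a)" using k path_of by simp
  fix z assume z: "z \<in> {z. real k \<le> sc z \<and> sc z \<le> real k + 1 \<and> dc z = sgn_of a * height (path_of a) (sc z)}"
  define r where "r = sc z - real k"
  have r: "0 \<le> r" "r \<le> 1" using z by (auto simp: r_def)
  have dz: "dc z = sgn_of a * (ht (path_of a) k + slope (path_of a) k * r)"
    using z height_at[OF kl, of "sc z"] by (simp add: r_def)
  have "z = fst (bs (a, k)) + r *\<^sub>R step_vec (snd (bs (a, k)))"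
  proof (rule sc_dc_eqI)
    show "sc z = sc (fst (bs (a, k)) + r *\<^sub>R step_vec (snd (bs (a, k))))" by (simp add: b r_def)
    show "dc z = dc (fst (bs (a, k)) + r *\<^sub>R step_vec (snd (bs (a, k))))" by (simp add: b dz algebra_simps)
  qed
  then have "z = (1 - r) *\<^sub>R fst (bs (a, k)) + r *\<^sub>R (fst (bs (a, k)) + step_vec (snd (bs (a, k))))"
    by (simp add: algebra_simps)
  then show "z \<in> segment_of (bs (a, k))" using r unfolding segment_of_def closed_segment_def by blast
qed

lemma boundary_Bd: "(\<Union>e\<in>boundary_steps P Q. segment_of e) = Bd"
proof (intro equalityI subsetI)
  fix z assume "z \<in> (\<Union>e\<in>boundary_steps P Q. segment_of e)"
  then obtain a k where k: "k < 2 * n" "z \<in> segment_of (bs (a, k))" by (auto simp: boundary_steps_bs V_def)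
  then have "real k + 1 \<le> 2 * real n" by simp
  then show "z \<in> Bd" using k(2) unfolding segment_bs[OF k(1)] Bd_def
    by (cases a) (auto simp: sgn_of_def path_of_def)
next
  fix z assume z: "z \<in> Bd"
  then obtain k where k: "k < 2 * n" "real k \<le> sc z" "sc z \<le> real k + 1"
    using real_between_nats[of "sc z" "2 * n"] n by (auto simp: Bd_def)
  have "z \<in> segment_of (bs (True, k)) \<or> z \<in> segment_of (bs (False, k))"
    using z k unfolding segment_bs[OF k(1)] by (auto simp: Bd_def sgn_of_def path_of_def)
  then show "z \<in> (\<Union>e\<in>boundary_steps P Q. segment_of e)" using k(1) unfolding boundary_steps_bs V_def by blast
qed

lemma U_strip:
  assumes "z \<in> U"
  shows "0 \<le> sc z \<and> sc z \<le> 2 * real n"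
proof (rule ccontr)
  assume "\<not> ?thesis"
  then consider "sc z \<le> 0" | "2 * real n \<le> sc z" by linarith
  then have "height P (sc z) = 0 \<and> height Q (sc z) = 0"
    by cases (simp_all add: height_neg height_beyond[OF P] height_beyond[OF Q])
  then show False using assms by (auto simp: U_def)
qed

lemma U_open: "open U"
proof -
  have "U = {z. - height Q (sc z) < dc z} \<inter> {z. dc z < height P (sc z)}" by (auto simp: U_def)
  then show ?thesis by (auto intro!: open_Int open_Collect_less continuous_intros)
qed

lemma height_bound: "height (path_of a) s \<le> 2 * real n"
proof -
  have "height (path_of a) s \<le> (\<Sum>k<length (path_of a). 1)"
    unfolding height_def by (intro sum_mono) (auto simp: slope_def max_def min_def)
  then show ?thesis using path_of(2) by simp
qed

lemma U_bounded: "bounded U"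
proof -
  have "cmod z \<le> 4 * real n" if z: "z \<in> U" for z
  proof -
    have "\<bar>dc z\<bar> \<le> 2 * real n" "0 \<le> sc z" "sc z \<le> 2 * real n"
      using z U_strip[OF z] height_bound[of True "sc z"] height_bound[of False "sc z"] by (auto simp: U_def path_of_def)
    then have "\<bar>Re z\<bar> \<le> 2 * real n" "\<bar>Im z\<bar> \<le> 2 * real n" by (auto simp: sc_def dc_def)
    then show ?thesis using cmod_le[of z] by linarith
  qed
  then show ?thesis by (auto simp: bounded_iff)
qed

text \<open>\<open>U\<close> and \<open>W\<close> are disjoint open sets covering the complement of
  the boundary, and \<open>U\<close> is bounded, so its points are inside. Any other point off the
  boundary escapes to infinity along a ray parallel to one of the rotated axes.\<close>

lemma polygon_interior_eq: "polygon_interior P Q = U"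
  unfolding polygon_interior_def boundary_Bd
proof (intro equalityI subsetI)
  fix z assume z: "z \<in> U"
  define W where "W = {z. height P (sc z) < dc z} \<union> {z. dc z < - height Q (sc z)} \<union> {z. sc z < 0} \<union> {z. 2 * real n < sc z}"
  have opW: "open W" unfolding W_def by (intro open_Un open_Collect_less continuous_intros)
  have h0: "0 \<le> height P s" "0 \<le> height Q s" for s using height_nonneg P Q by auto
  have UW: "U \<inter> W = {}" using U_strip by (force simp: U_def W_def)
  have cov: "- Bd \<subseteq> U \<union> W" by (auto simp: U_def W_def Bd_def not_less)
  have "connected_component_set (- Bd) z \<subseteq> U"
  proof -
    have "U \<inter> connected_component_set (- Bd) z = {} \<or> W \<inter> connected_component_set (- Bd) z = {}"
      by (rule connectedD[OF connected_connected_component U_open opW])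
        (use UW cov connected_component_subset in blast)+
    moreover have zB: "z \<in> - Bd" using z by (auto simp: U_def Bd_def)
    then have "z \<in> connected_component_set (- Bd) z" by simp
    ultimately show ?thesis using z cov connected_component_subset[of "- Bd" z] by blast
  qed
  moreover have "z \<notin> Bd" using z by (auto simp: U_def Bd_def)
  ultimately show "z \<in> inside Bd" using U_bounded bounded_subset by (auto simp: inside_def)
next
  fix z assume z: "z \<in> inside Bd"
  then have zB: "z \<notin> Bd" using inside_no_overlap by blast
  have h0: "0 \<le> height P s" "0 \<le> height Q s" for s using height_nonneg P Q by auto
  have v: "sc (Complex (-1) 1) = 0" "dc (Complex (-1) 1) = 2" "sc (Complex 1 (-1)) = 0" "dc (Complex 1 (-1)) = -2"
    "sc (Complex (-1) (-1)) = -2" "sc (Complex 1 1) = 2" by (simp_all add: sc_def dc_def)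
  have nz: "Complex (-1) 1 \<noteq> 0" "Complex 1 (-1) \<noteq> 0" "Complex (-1) (-1) \<noteq> 0" "Complex 1 1 \<noteq> 0"
    by (simp_all add: complex_eq_iff)
  show "z \<in> U"
  proof (rule ccontr)
    assume nU: "z \<notin> U"
    consider "height P (sc z) < dc z" | "dc z < - height Q (sc z)" | "sc z < 0" | "2 * real n < sc z"
      using nU zB by (auto simp: U_def Bd_def not_less)
    then show False
    proof cases
      case 1
      have "z + t *\<^sub>R Complex (-1) 1 \<notin> Bd" if "0 \<le> t" for t
        using 1 that h0(1)[of "sc z"] h0(2)[of "sc z"] by (auto simp: Bd_def v)
      then show False by (rule not_inside_ray[OF z nz(1)])
    next
      case 2
      have "z + t *\<^sub>R Complex 1 (-1) \<notin> Bd" if "0 \<le> t" for t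
        using 2 that h0(1)[of "sc z"] h0(2)[of "sc z"] by (auto simp: Bd_def v)
      then show False by (rule not_inside_ray[OF z nz(2)])
    next
      case 3
      have "z + t *\<^sub>R Complex (-1) (-1) \<notin> Bd" if "0 \<le> t" for t using 3 that by (auto simp: Bd_def v)
      then show False by (rule not_inside_ray[OF z nz(3)])
    next
      case 4
      have "z + t *\<^sub>R Complex 1 1 \<notin> Bd" if "0 \<le> t" for t using 4 that by (auto simp: Bd_def v)
      then show False by (rule not_inside_ray[OF z nz(4)])
    qed
  qed
qed

section \<open>Beams, bounces and the two matings of the boundary steps\<close>

definition partner :: "step list \<Rightarrow> nat \<Rightarrow> nat" where
  "partner R k = (THE j. matched R k j \<or> matched R j k)"

text \<open>The beam along direction \<open>(1, 1)\<close> from a step ends at \<open>mate True\<close>, the one along \<open>(1, -1)\<close> at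
  \<open>mate False\<close>.\<close>

definition mate :: "bool \<Rightarrow> bool \<times> nat \<Rightarrow> bool \<times> nat" where
  "mate t v = (if t then (fst v, partner (path_of (fst v)) (snd v)) else (\<not> fst v, snd v))"

lemma partner_eq:
  assumes "matched (path_of a) i j"
  shows "partner (path_of a) i = j" "partner (path_of a) j = i"
proof -
  note ms = matched_steps[OF assms]
  show "partner (path_of a) i = j" unfolding partner_def
  proof (rule the_equality)
    fix l assume "matched (path_of a) i l \<or> matched (path_of a) l i"
    then show "l = j" using matched_unique(1)[OF assms] matched_steps(4)[of "path_of a" l i] ms by auto
  qed (use assms in simp)
  show "partner (path_of a) j = i" unfolding partner_def
  proof (rule the_equality)
    fix l assume "matched (path_of a) j l \<or> matched (path_of a) l j"
    then show "l = i" using matched_unique(2)[OF assms] matched_steps(3)[of "path_of a" j l] ms by auto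
  qed (use assms in simp)
qed

lemma partner_cases:
  assumes "k < 2 * n"
  obtains j where "matched (path_of a) k j" "partner (path_of a) k = j"
  | i where "matched (path_of a) i k" "partner (path_of a) k = i"
proof (cases "path_of a ! k")
  case North
  then show ?thesis using that(1) matched_from_North[OF path_of(1)[of a] assms] partner_eq(1) by metis
next
  case East
  then show ?thesis using that(2) matched_from_East[OF path_of(1)[of a] assms] partner_eq(2) by metis
qed

lemma partner_V:
  assumes "k < 2 * n"
  shows "partner (path_of a) k < 2 * n"
proof (rule partner_cases[OF assms, of a])
  fix j assume "matched (path_of a) k j" "partner (path_of a) k = j"
  then show ?thesis using matched_steps(2)[of "path_of a" k j] path_of(2) by simp
next
  fix i assume "matched (path_of a) i k" "partner (path_of a) k = i"
  then show ?thesis using matched_steps(1)[of "path_of a" i k] assms by simp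
qed

lemma partner_partner:
  assumes "k < 2 * n"
  shows "partner (path_of a) (partner (path_of a) k) = k"
proof (rule partner_cases[OF assms, of a])
  fix j assume "matched (path_of a) k j" "partner (path_of a) k = j"
  then show ?thesis using partner_eq(2)[of a k j] by simp
next
  fix i assume "matched (path_of a) i k" "partner (path_of a) k = i"
  then show ?thesis using partner_eq(1)[of a i k] by simp
qed

lemma mate_V: "v \<in> V \<Longrightarrow> mate t v \<in> V"
  by (auto simp: V_def mate_def partner_V)

lemma mate_mate: "v \<in> V \<Longrightarrow> mate t (mate t v) = v"
  by (auto simp: V_def mate_def partner_partner)

text \<open>The sense on each diagonal is chosen to point into the polygon: along (1, 1) forwards
  from steps leaving the line \<open>y = x\<close> and backwards from steps returning to it, along
  (1, -1) from \<open>P\<close> towards \<open>- Q\<close> and conversely.\<close>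

definition dirn :: "bool \<Rightarrow> bool \<times> nat \<Rightarrow> complex" where
  "dirn t v = (if t then slope (path_of (fst v)) (snd v) *\<^sub>R Complex 1 1 else sgn_of (fst v) *\<^sub>R Complex 1 (-1))"

definition diag_type :: "complex \<Rightarrow> bool" where "diag_type u \<longleftrightarrow> Re u = Im u"

lemma beam_mate:
  assumes v: "v \<in> V"
  shows "light_beam P Q (bs v) (dirn t v) (bs (mate t v))"
  unfolding light_beam_def
proof (intro conjI)
  show "bs v \<in> boundary_steps P Q" "bs (mate t v) \<in> boundary_steps P Q"
    using v mate_V boundary_steps_bs by auto
  show "dirn t v \<in> diagonal_directions" by (auto simp: dirn_def diagonal_directions_def slope_def sgn_of_def)
  obtain a k where ak: "v = (a, k)" "k < 2 * n" using v by (auto simp: V_def)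
  have h0: "0 \<le> height P s" "0 \<le> height Q s" for s using height_nonneg P Q by auto
  have v11: "sc (Complex 1 1) = 2" "dc (Complex 1 1) = 0" "sc (Complex 1 (-1)) = 0" "dc (Complex 1 (-1)) = -2"
    by (simp_all add: sc_def dc_def)
  note m = mid_bs[OF ak(2), of a]
  have "(\<exists>r>0. mid (bs (mate t v)) = mid (bs v) + r *\<^sub>R dirn t v) \<and> open_segment (mid (bs v)) (mid (bs (mate t v))) \<subseteq> U"
  proof (cases t)
    case True
    define j where "j = partner (path_of a) k"
    have j: "j < 2 * n" using partner_V[OF ak(2)] by (simp add: j_def)
    have mv: "mate t v = (a, j)" using True ak by (simp add: mate_def j_def)
    note mj = mid_bs[OF j, of a]
    \<comment> \<open>In either case the smaller index is the opening one, and \<open>slope\<close>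
      is the sign of \<open>j - k\<close>.\<close>
    have "matched (path_of a) (min k j) (max k j) \<and> slope (path_of a) k * (real j - real k) = \<bar>real j - real k\<bar> \<and> j \<noteq> k"
      by (rule partner_cases[OF ak(2), of a])
        (auto simp: j_def slope_def min_def max_def dest: matched_steps(1,3,4))
    then have md: "matched (path_of a) (min k j) (max k j)" and sl: "slope (path_of a) k * (real j - real k) = \<bar>real j - real k\<bar>" and jk: "j \<noteq> k"
      by auto
    have ch: "level (path_of a) (min k j) = level (path_of a) (max k j)"
      "\<And>s. real (min k j) + 1/2 < s \<Longrightarrow> s < real (max k j) + 1/2 \<Longrightarrow> level (path_of a) (min k j) < height (path_of a) s"
      using chord_iff_matched[OF path_of(1)[of a], of "min k j" "max k j"] md jk ak j by (auto simp: min_def max_def)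
    have lev: "level (path_of a) k = level (path_of a) j" using ch(1) by (auto simp: min_def max_def split: if_splits)
    define r where "r = \<bar>real j - real k\<bar> / 2"
    have r0: "r > 0" using jk by (simp add: r_def)
    have "slope (path_of a) k * r * 2 = real j - real k"
      using sl by (auto simp: r_def slope_def split: if_splits)
    then have "mid (bs (mate t v)) = mid (bs v) + r *\<^sub>R dirn t v"
      by (intro sc_dc_eqI) (use m mj mv ak lev True in \<open>simp_all add: dirn_def v11 algebra_simps\<close>)
    moreover have "open_segment (mid (bs v)) (mid (bs (mate t v))) \<subseteq> U"
    proof
      fix z assume "z \<in> open_segment (mid (bs v)) (mid (bs (mate t v)))"
      then obtain w where w: "0 < w" "w < 1" "z = (1 - w) *\<^sub>R mid (bs v) + w *\<^sub>R mid (bs (mate t v))"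
        by (auto simp: in_segment)
      have dz: "dc z = sgn_of a * level (path_of a) k" unfolding w(3) using m mj mv ak lev by (simp add: algebra_simps)
      have sz: "sc z = real k + 1/2 + w * (real j - real k)" unfolding w(3) using m mj mv ak by (simp add: algebra_simps)
      have "real (min k j) + 1/2 < sc z \<and> sc z < real (max k j) + 1/2"
      proof (cases "k < j")
        case True
        then have "0 < w * (real j - real k)" "0 < (1 - w) * (real j - real k)" using w by simp_all
        then show ?thesis unfolding sz using True by (simp add: algebra_simps)
      next
        case False
        then have "0 < w * (real k - real j)" "0 < (1 - w) * (real k - real j)" using w jk by simp_all
        then show ?thesis unfolding sz using False jk by (simp add: algebra_simps)
      qed
      then have "level (path_of a) k < height (path_of a) (sc z)" using ch lev by (auto simp: min_def max_def split: if_splits)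
      then show "z \<in> U" using level_pos[OF path_of(1) ak(2), of a] dz h0[of "sc z"]
        by (cases a) (auto simp: U_def sgn_of_def path_of_def)
    qed
    ultimately show ?thesis using r0 by blast
  next
    case False
    have mv: "mate t v = (\<not> a, k)" using False ak by (simp add: mate_def)
    note mj = mid_bs[OF ak(2), of "\<not> a"]
    have lp: "1/2 \<le> level P k" "1/2 \<le> level Q k" using level_pos P Q ak by auto
    define r where "r = (level P k + level Q k) / 2"
    have r0: "r > 0" using lp by (simp add: r_def)
    have "mid (bs (mate t v)) = mid (bs v) + r *\<^sub>R dirn t v"
      by (intro sc_dc_eqI) (use m mj mv ak False in \<open>auto simp: dirn_def v11 r_def sgn_of_def path_of_def\<close>)
    moreover have "open_segment (mid (bs v)) (mid (bs (mate t v))) \<subseteq> U"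
    proof
      fix z assume "z \<in> open_segment (mid (bs v)) (mid (bs (mate t v)))"
      then obtain w where w: "0 < w" "w < 1" "z = (1 - w) *\<^sub>R mid (bs v) + w *\<^sub>R mid (bs (mate t v))"
        by (auto simp: in_segment)
      have sz: "sc z = real k + 1/2" unfolding w(3) using m mj mv ak by (simp add: algebra_simps)
      have hz: "height P (sc z) = level P k" "height Q (sc z) = level Q k" unfolding sz using height_mid len ak by auto
      have dz: "dc z = (1 - w) * (sgn_of a * level (path_of a) k) + w * (sgn_of (\<not> a) * level (path_of (\<not> a)) k)"
        unfolding w(3) using m mj mv ak by simp
      have "0 < w * (level P k + level Q k)" "0 < (1 - w) * (level P k + level Q k)" using w lp by simp_all
      then show "z \<in> U" unfolding U_def using dz hz by (cases a) (auto simp: sgn_of_def path_of_def algebra_simps)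
    qed
    ultimately show ?thesis using r0 by blast
  qed
  then show "\<exists>r>0. mid (bs (mate t v)) = mid (bs v) + r *\<^sub>R dirn t v"
    "open_segment (mid (bs v)) (mid (bs (mate t v))) \<subseteq> polygon_interior P Q" using polygon_interior_eq by auto
qed

text \<open>A beam parallel to (1, 1) keeps \<open>dc\<close>, whose sign determines the path; it is
  then a chord, hence comes from a matched pair. A beam parallel to (1, -1) keeps \<open>sc\<close>,
  hence the index.\<close>

lemma beam_unique:
  assumes v: "v \<in> V" and lb: "light_beam P Q (bs v) u f"
  shows "f = bs (mate (diag_type u) v)"
proof -
  have "f \<in> boundary_steps P Q" and u: "\<bar>Re u\<bar> = 1" "\<bar>Im u\<bar> = 1"
    and seg: "open_segment (mid (bs v)) (mid f) \<subseteq> U"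
    using lb by (auto simp: light_beam_def diagonal_directions_def polygon_interior_eq)
  then obtain w where w: "w \<in> V" "f = bs w" using boundary_steps_bs by auto
  obtain r where r: "r > 0" "mid (bs w) = mid (bs v) + r *\<^sub>R u" using lb w by (auto simp: light_beam_def)
  obtain a k where ak: "v = (a, k)" "k < 2 * n" using v by (auto simp: V_def)
  obtain b j where bj: "w = (b, j)" "j < 2 * n" using w by (auto simp: V_def)
  note m = mid_bs[OF ak(2), of a] and mj = mid_bs[OF bj(2), of b]
  have s: "real j = real k + r * sc u" and d: "sgn_of b * level (path_of b) j = sgn_of a * level (path_of a) k + r * dc u"
    using arg_cong[OF r(2), of sc] arg_cong[OF r(2), of dc] m mj ak bj by simp_all
  have lp: "1/2 \<le> level (path_of a) k" "1/2 \<le> level (path_of b) j" using level_pos path_of ak bj by auto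
  have "w = mate (diag_type u) v"
  proof (cases "diag_type u")
    case True
    then have du: "dc u = 0" and su: "sc u \<noteq> 0" using u by (auto simp: diag_type_def dc_def sc_def)
    have ab: "b = a" using d du lp by (auto simp: sgn_of_def split: if_splits)
    have lev: "level (path_of a) j = level (path_of a) k" using d du ab by (auto simp: sgn_of_def split: if_splits)
    have jk: "j \<noteq> k" using s r(1) su by auto
    have "level (path_of a) k < height (path_of a) x" if x: "real (min k j) + 1/2 < x" "x < real (max k j) + 1/2" for x
    proof -
      define q where "q = (x - (real k + 1/2)) / (real j - real k)"
      have q: "0 < q" "q < 1" and xq: "x = real k + 1/2 + q * (real j - real k)"
        using x jk by (auto simp: q_def min_def max_def field_simps split: if_splits)
      define z where "z = (1 - q) *\<^sub>R mid (bs v) + q *\<^sub>R mid (bs w)"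
      have "mid (bs v) \<noteq> mid (bs w)" using m mj ak bj jk by auto
      then have "z \<in> open_segment (mid (bs v)) (mid (bs w))" using q by (auto simp: in_segment z_def)
      then have "z \<in> U" using seg w by auto
      moreover have "sc z = x" using m mj ak bj xq by (simp add: z_def algebra_simps)
      moreover have "dc z = sgn_of a * level (path_of a) k" using m mj ak bj ab lev by (simp add: z_def algebra_simps)
      ultimately show ?thesis by (cases a) (auto simp: U_def sgn_of_def path_of_def)
    qed
    then have "matched (path_of a) (min k j) (max k j)"
      using chord_iff_matched[OF path_of(1)[of a], of "min k j" "max k j"] jk ak bj lev
      by (auto simp: min_def max_def split: if_splits)
    then have "partner (path_of a) k = j" using partner_eq[of a "min k j" "max k j"] by (auto simp: min_def max_def split: if_splits)
    then show ?thesis using True ak bj ab by (simp add: mate_def)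
  next
    case False
    then have du: "dc u \<noteq> 0" and su: "sc u = 0" using u by (auto simp: diag_type_def dc_def sc_def abs_if split: if_splits)
    have "j = k" using s su by simp
    moreover have "b \<noteq> a"
    proof
      assume "b = a"
      then have "r * dc u = 0" using d \<open>j = k\<close> by simp
      then show False using du r(1) by simp
    qed
    ultimately show ?thesis using False ak bj by (auto simp: mate_def)
  qed
  then show ?thesis using w by simp
qed

lemma dirn_bounce:
  assumes "v \<in> V"
  shows "dirn (\<not> t) (mate t v) = bounce (snd (bs (mate t v))) (dirn t v)"
proof -
  obtain a k where ak: "v = (a, k)" "k < 2 * n" using assms by (auto simp: V_def)
  have sq: "snd (bs (False, k)) = swap_step (Q ! k)" "snd (bs (True, k)) = P ! k" if "k < 2 * n" for k
    using that len by (auto simp: bs_def reflect_path_def)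
  show ?thesis
  proof (cases t)
    case True
    define j where "j = partner (path_of a) k"
    have j: "j < 2 * n" using partner_V[OF ak(2)] by (simp add: j_def)
    have "(path_of a ! k = North \<and> path_of a ! j = East) \<or> (path_of a ! k = East \<and> path_of a ! j = North)"
      by (rule partner_cases[OF ak(2), of a]) (auto simp: j_def dest: matched_steps(3,4))
    moreover have "mate t v = (a, j)" using True ak by (simp add: mate_def j_def)
    ultimately show ?thesis using True ak sq[OF j]
      by (cases a) (auto simp: dirn_def path_of_def sgn_of_def slope_def complex_eq_iff)
  next
    case False
    then show ?thesis using ak sq[OF ak(2)]
      by (cases a; cases "P ! k"; cases "Q ! k") (auto simp: mate_def dirn_def path_of_def sgn_of_def slope_def complex_eq_iff)
  qed
qed

lemma bounce_type:
  assumes "u \<in> diagonal_directions"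
  shows "diag_type (bounce x u) \<longleftrightarrow> \<not> diag_type u"
  using assms by (cases x) (auto simp: diag_type_def diagonal_directions_def abs_if split: if_splits)

section \<open>Billiard permutations and their cycles\<close>

definition mates :: "((bool \<times> nat) \<times> (bool \<times> nat)) set" where
  "mates = {(v, w). v \<in> V \<and> (w = mate True v \<or> w = mate False v)}"

lemma mates_V: "(v, w) \<in> mates\<^sup>* \<Longrightarrow> v \<in> V \<Longrightarrow> w \<in> V"
  by (induction rule: rtrancl_induct) (auto simp: mates_def mate_V)

lemma billiard_orbits:
  assumes "billiard_permutation P Q \<pi>"
  shows "card (orbit \<pi> ` boundary_steps P Q) = card ((\<lambda>v. mates\<^sup>* `` {v}) ` V)"
proof -
  obtain u where perm: "\<pi> permutes boundary_steps P Q"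
    and lb: "\<And>e. e \<in> boundary_steps P Q \<Longrightarrow> light_beam P Q e (u e) (\<pi> e)"
    and ub: "\<And>e. e \<in> boundary_steps P Q \<Longrightarrow> u (\<pi> e) = bounce (snd (\<pi> e)) (u e)"
    using assms by (auto simp: billiard_permutation_def)
  define t where "t v = diag_type (u (bs v))" for v
  have bV: "bs v \<in> boundary_steps P Q" if "v \<in> V" for v using that boundary_steps_bs by blast
  have step: "\<pi> (bs v) = bs (mate (t v) v)" if v: "v \<in> V" for v
    using beam_unique[OF v lb[OF bV[OF v]]] by (simp add: t_def)
  have flip: "t (mate (t v) v) = (\<not> t v)" if v: "v \<in> V" for v
  proof -
    have "u (bs v) \<in> diagonal_directions" using lb[OF bV[OF v]] by (simp add: light_beam_def)
    then show ?thesis using ub[OF bV[OF v]] bounce_type step[OF v] by (simp add: t_def)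
  qed
  have fin: "finite (boundary_steps P Q)" by (simp add: boundary_steps_bs V_def)
  have permn: "permutation \<pi>" using perm fin by (auto simp: permutation_permutes)
  have orb: "orbit \<pi> (bs v) = bs ` (mates\<^sup>* `` {v})" if v: "v \<in> V" for v
  proof
    have "\<exists>w. (v, w) \<in> mates\<^sup>* \<and> x = bs w" if "x \<in> orbit \<pi> (bs v)" for x
      using that
    proof (induction rule: orbit.induct)
      case base
      have "(v, mate (t v) v) \<in> mates" using v by (cases "t v") (auto simp: mates_def)
      then show ?case using step[OF v] by blast
    next
      case (step x)
      then obtain w where w: "(v, w) \<in> mates\<^sup>*" "x = bs w" by blast
      have wV: "w \<in> V" using mates_V[OF w(1) v] .
      have "(w, mate (t w) w) \<in> mates" using wV by (cases "t w") (auto simp: mates_def)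
      then show ?case using w \<open>\<And>v. v \<in> V \<Longrightarrow> \<pi> (bs v) = bs (mate (t v) v)\<close>[OF wV] by (metis rtrancl.rtrancl_into_rtrancl)
    qed
    then show "orbit \<pi> (bs v) \<subseteq> bs ` (mates\<^sup>* `` {v})" by blast
    have "bs w \<in> orbit \<pi> (bs v)" if "(v, w) \<in> mates\<^sup>*" for w
      using that
    proof (induction rule: rtrancl_induct)
      case base
      show ?case using permutation_self_in_orbit[OF permn] .
    next
      case (step x y)
      have xV: "x \<in> V" using mates_V[OF step(1) v] .
      obtain s where s: "y = mate s x" using step(2) by (auto simp: mates_def)
      show ?case
      proof (cases "s = t x")
        case True
        then have "bs y = \<pi> (bs x)" using \<open>\<And>v. v \<in> V \<Longrightarrow> \<pi> (bs v) = bs (mate (t v) v)\<close>[OF xV] s by simp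
        then show ?thesis using step(3) by (simp add: orbit.step)
      next
        case False
        \<comment> \<open>The beam of the other type at \<open>x\<close> is the one that arrived
          there, so \<open>y\<close> is the predecessor of \<open>x\<close> under \<pi>; orbits of a
          permutation of a finite set contain predecessors.\<close>
        obtain e where e: "e \<in> boundary_steps P Q" "\<pi> e = bs x"
          using perm bV[OF xV] by (metis image_iff permutes_image)
        then obtain w where w: "w \<in> V" "e = bs w" using boundary_steps_bs by auto
        then have "bs x = bs (mate (t w) w)" using e(2) \<open>\<And>v. v \<in> V \<Longrightarrow> \<pi> (bs v) = bs (mate (t v) v)\<close>[OF w(1)] by simp
        then have xw: "x = mate (t w) w" using bs_inj xV mate_V[OF w(1)] by (auto dest: inj_onD)
        then have "s = t w" using flip[OF w(1)] False by auto
        then have "y = w" using s xw mate_mate[OF w(1)] by simp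
        have "bs w \<in> orbit \<pi> (\<pi> (bs w))"
          by (simp add: permutation_orbit_step[OF permn] permutation_self_in_orbit[OF permn])
        moreover have "\<pi> (bs w) = bs x" using e(2) w by simp
        ultimately show ?thesis using step(3) \<open>y = w\<close> by (metis orbit_trans)
      qed
    qed
    then show "bs ` (mates\<^sup>* `` {v}) \<subseteq> orbit \<pi> (bs v)" by blast
  qed
  have "orbit \<pi> ` boundary_steps P Q = (\<lambda>S. bs ` S) ` (\<lambda>v. mates\<^sup>* `` {v}) ` V"
    unfolding boundary_steps_bs image_image using orb by (intro image_cong) auto
  moreover have "inj_on ((`) bs) ((\<lambda>v. mates\<^sup>* `` {v}) ` V)"
  proof (rule inj_onI)
    fix S T assume "S \<in> (\<lambda>v. mates\<^sup>* `` {v}) ` V" "T \<in> (\<lambda>v. mates\<^sup>* `` {v}) ` V" "bs ` S = bs ` T"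
    moreover then have "S \<subseteq> V" "T \<subseteq> V" using mates_V by auto
    ultimately show "S = T" using inj_on_image_eq_iff[OF bs_inj] by blast
  qed
  ultimately show ?thesis by (simp add: card_image)
qed

lemma billiard_exists: "\<exists>\<pi>. billiard_permutation P Q \<pi>"
proof -
  \<comment> \<open>Mates have opposite colours, so choosing the beam by the colour is consistent with bouncing.\<close>
  define col where "col v \<longleftrightarrow> (even (snd v) \<longleftrightarrow> fst v)" for v :: "bool \<times> nat"
  define nxt where "nxt v = mate (col v) v" for v
  define bi where "bi = inv_into V bs"
  have bib: "bi (bs v) = v" if "v \<in> V" for v using bs_inj that by (simp add: bi_def)
  have col_flip: "col (mate t v) = (\<not> col v)" if v: "v \<in> V" for t v
  proof (cases t)
    case True
    obtain a k where ak: "v = (a, k)" "k < 2 * n" using v by (auto simp: V_def)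
    have "even (partner (path_of a) k) \<longleftrightarrow> odd k"
      by (rule partner_cases[OF ak(2), of a]) (auto dest: matched_parity)
    then show ?thesis using True ak by (auto simp: mate_def col_def)
  qed (auto simp: mate_def col_def)
  have injn: "inj_on nxt V"
  proof (rule inj_onI)
    fix v w assume vw: "v \<in> V" "w \<in> V" "nxt v = nxt w"
    have c: "col (nxt v) = (\<not> col v)" "mate (col v) (nxt v) = v" if "v \<in> V" for v
      using col_flip[OF that] mate_mate[OF that] by (simp_all add: nxt_def)
    have cc: "col v = col w" using c(1)[OF vw(1)] c(1)[OF vw(2)] vw(3) by simp
    have "mate (col w) (nxt w) = v" using c(2)[OF vw(1)] unfolding cc vw(3) .
    then show "v = w" using c(2)[OF vw(2)] by (rule trans[OF sym])
  qed
  have nV: "nxt v \<in> V" if "v \<in> V" for v using mate_V that by (simp add: nxt_def)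
  have finV: "finite V" by (simp add: V_def)
  have bijn: "bij_betw nxt V V" using injn nV finV by (simp add: bij_betw_def endo_inj_surj image_subsetI)
  define \<pi> where "\<pi> e = (if e \<in> boundary_steps P Q then bs (nxt (bi e)) else e)" for e
  have pib: "\<pi> (bs v) = bs (nxt v)" if "v \<in> V" for v using that bib boundary_steps_bs by (simp add: \<pi>_def)
  have bbs: "bij_betw bs V (boundary_steps P Q)" using bs_inj boundary_steps_bs by (simp add: bij_betw_def)
  have "bij_betw (bs \<circ> nxt \<circ> bi) (boundary_steps P Q) (boundary_steps P Q)"
    unfolding bi_def comp_assoc
    by (intro bij_betw_trans[OF bij_betw_trans[OF bij_betw_inv_into[OF bbs] bijn] bbs, unfolded comp_assoc])
  then have "bij_betw \<pi> (boundary_steps P Q) (boundary_steps P Q)"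
    by (rule bij_betw_cong[THEN iffD1, rotated]) (simp add: \<pi>_def)
  then have "\<pi> permutes boundary_steps P Q" by (rule bij_imp_permutes) (simp add: \<pi>_def)
  moreover have "light_beam P Q e (dirn (col (bi e)) (bi e)) (\<pi> e) \<and>
      dirn (col (bi (\<pi> e))) (bi (\<pi> e)) = bounce (snd (\<pi> e)) (dirn (col (bi e)) (bi e))"
    if e: "e \<in> boundary_steps P Q" for e
  proof -
    obtain v where v: "v \<in> V" "e = bs v" using e boundary_steps_bs by auto
    have "dirn (col (nxt v)) (nxt v) = bounce (snd (bs (nxt v))) (dirn (col v) v)"
      using dirn_bounce[OF v(1), of "col v"] col_flip[OF v(1)] by (simp add: nxt_def)
    then show ?thesis using v bib nV pib beam_mate[OF v(1), of "col v"] by (simp add: nxt_def)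
  qed
  ultimately have "billiard_permutation P Q \<pi>"
    unfolding billiard_permutation_def by (intro conjI exI[of _ "\<lambda>e. dirn (col (bi e)) (bi e)"] ballI) auto
  then show ?thesis by blast
qed

lemma traj_mates: "traj P Q = card ((\<lambda>v. mates\<^sup>* `` {v}) ` V)"
  unfolding traj_def
proof (rule the_equality)
  show "\<exists>\<pi>. billiard_permutation P Q \<pi> \<and> card ((\<lambda>v. mates\<^sup>* `` {v}) ` V) = card (orbit \<pi> ` boundary_steps P Q)"
    using billiard_exists billiard_orbits by metis
qed (use billiard_orbits in auto)

end

section \<open>Meanders and semimeanders\<close>

lemma fashoda_interlace_upper:
  fixes f g :: "real \<Rightarrow> complex"
  assumes "path f" "path g" and up: "path_image f \<subseteq> upper" "path_image g \<subseteq> upper"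
    and ends: "pathstart f = of_real x" "pathfinish f = of_real y" "pathstart g = of_real u" "pathfinish g = of_real v"
    and "x < u" "u < y" "y < v"
  shows "path_image f \<inter> path_image g \<noteq> {}"
proof -
  define pr :: "complex \<Rightarrow> real^2" where "pr z = Re z *\<^sub>R axis 1 1 + Im z *\<^sub>R axis 2 1" for z
  have pr [simp]: "pr z $ 1 = Re z" "pr z $ 2 = Im z" for z
    by (simp_all add: pr_def axis_def)
  have inj: "pr z = pr w \<Longrightarrow> z = w" for z w using pr by (metis complex_eqI)
  have cpr: "continuous_on S pr" for S unfolding pr_def by (intro continuous_intros)
  have "bounded (path_image f \<union> path_image g)"
    using assms by (simp add: bounded_path_image)
  then obtain B where B: "\<And>z. z \<in> path_image f \<union> path_image g \<Longrightarrow> cmod z \<le> B" by (auto simp: bounded_iff)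
  have box: "pr z \<in> cbox (pr (of_real (-B))) (pr (Complex B B))" if z: "z \<in> path_image f \<union> path_image g" for z
  proof -
    have "0 \<le> Im z" using z up by auto
    then show ?thesis using B[OF z] abs_Re_le_cmod[of z] abs_Im_le_cmod[of z] by (auto simp: mem_box_cart forall_2)
  qed
  obtain w where "w \<in> path_image (pr \<circ> f)" "w \<in> path_image (pr \<circ> g)"
  proof (rule fashoda_interlace[of "pr \<circ> f" "pr \<circ> g" "pr (of_real (-B))" "pr (Complex B B)"])
    show "path (pr \<circ> f)" "path (pr \<circ> g)" using assms cpr by (auto intro: path_continuous_image)
    show "path_image (pr \<circ> f) \<subseteq> cbox (pr (of_real (-B))) (pr (Complex B B))"
      "path_image (pr \<circ> g) \<subseteq> cbox (pr (of_real (-B))) (pr (Complex B B))"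
      using box by (auto simp: path_image_compose)
  qed (use assms in \<open>auto simp: pathstart_compose pathfinish_compose\<close>)
  then show ?thesis using inj by (auto simp: path_image_compose)
qed

lemma semicircle_arc:
  assumes "x < y"
  shows "\<exists>g. arc g \<and> path_image g = semicircle x y \<and> semicircle x y \<inter> \<real> = {pathstart g, pathfinish g}"
    "semicircle x y \<inter> \<real> = {of_real x, of_real y}"
proof -
  define c r where "c = (x + y) / 2" and "r = (y - x) / 2"
  have r: "r > 0" "c - r = x" "c + r = y" using assms by (auto simp: c_def r_def field_simps)
  let ?g = "part_circlepath (of_real c) r 0 pi"
  have im: "path_image ?g = semicircle x y" using path_image_semicircle[OF assms] by (simp add: c_def r_def)
  show sr: "semicircle x y \<inter> \<real> = {of_real x, of_real y}"
  proof (intro equalityI subsetI)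
    fix z assume "z \<in> semicircle x y \<inter> \<real>"
    then obtain t where t: "z = of_real t" "cmod (of_real t - of_real c) = r"
      by (auto simp: semicircle_def c_def r_def Reals_def)
    then have "\<bar>t - c\<bar> = r" by (metis norm_of_real of_real_diff)
    then show "z \<in> {of_real x, of_real y}" using t r by (auto simp: abs_if split: if_splits)
  next
    fix z assume "z \<in> {complex_of_real x, of_real y}"
    then obtain t where t: "z = of_real t" "t = x \<or> t = y" by auto
    have "cmod (of_real t - of_real c) = \<bar>t - c\<bar>" by (metis norm_of_real of_real_diff)
    also have "\<dots> = r" using t r by auto
    finally show "z \<in> semicircle x y \<inter> \<real>" using t by (simp add: semicircle_def c_def r_def)
  qed
  have "pathstart ?g = of_real y" "pathfinish ?g = of_real x"
    using r by (simp_all add: exp_pi_i' flip: of_real_add of_real_diff)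
  moreover have "arc ?g" using r by (intro arc_part_circlepath) auto
  ultimately show "\<exists>g. arc g \<and> path_image g = semicircle x y \<and> semicircle x y \<inter> \<real> = {pathstart g, pathfinish g}"
    using im sr by (intro exI[of _ ?g]) auto
qed

text \<open>The altitude theorem for the right triangle over the diameter.\<close>

lemma semicircle_eq:
  assumes "z \<in> semicircle x y"
  shows "(Im z)\<^sup>2 = (Re z - x) * (y - Re z)"
proof -
  have "cmod (z - of_real ((x + y) / 2)) = (y - x) / 2" using assms unfolding semicircle_def by blast
  then have "(cmod (z - of_real ((x + y) / 2)))\<^sup>2 = ((y - x) / 2)\<^sup>2" by (rule arg_cong)
  then show ?thesis unfolding cmod_power2 by (simp add: power2_eq_square field_simps)
qed

lemma semicircle_Re:
  assumes "z \<in> semicircle x y" "x < y"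
  shows "x \<le> Re z" "Re z \<le> y"
proof -
  have "\<bar>Re (z - of_real ((x + y) / 2))\<bar> \<le> (y - x) / 2"
    using abs_Re_le_cmod[of "z - of_real ((x + y) / 2)"] assms by (simp add: semicircle_def)
  then show "x \<le> Re z" "Re z \<le> y" by (auto simp: abs_le_iff field_simps)
qed

lemma semicircle_disjoint:
  assumes "x < y" "u < v" and "y < u \<or> x < u \<and> v < y"
  shows "semicircle x y \<inter> semicircle u v = {}"
proof (rule ccontr)
  assume "semicircle x y \<inter> semicircle u v \<noteq> {}"
  then obtain z where z: "z \<in> semicircle x y" "z \<in> semicircle u v" by blast
  note R = semicircle_Re[OF z(1) assms(1)] semicircle_Re[OF z(2) assms(2)]
  have xu: "x < u" "v < y" using assms R by auto
  \<comment> \<open>Over the same real part, the inner semicircle is strictly lower than the outer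
    one.\<close>
  have "(Re z - u) * (v - Re z) < (Re z - x) * (y - Re z)"
    by (rule mult_strict_mono') (use xu R in auto)
  then show False using semicircle_eq[OF z(1)] semicircle_eq[OF z(2)] by simp
qed

lemma dyck_half_plane_arcs:
  assumes P: "P \<in> dyck_paths n" and e: "strict_mono_on {..<2 * n} e"
  obtains \<A> where "half_plane_arcs \<A>" "(\<lambda>a. a \<inter> \<real>) ` \<A> = (\<lambda>s. (\<lambda>k. of_real (e k)) ` s) ` pairs P"
proof -
  have len: "length P = 2 * n" using P by (simp add: dyck_paths_iff)
  define S where "S = {(i, j). matched P i j}"
  define ar where "ar = (\<lambda>(i, j). semicircle (e i) (e j))"
  have SN: "i < j" "j < 2 * n" if "(i, j) \<in> S" for i j using that matched_steps(1,2)[of P i j] len by (auto simp: S_def)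
  have em: "e i < e j" if "i < j" "j < 2 * n" for i j using strict_mono_onD[OF e, of i j] that by auto
  have "S \<subseteq> {..<2*n} \<times> {..<2*n}" using SN by force
  then have fin: "finite S" using finite_subset by blast
  have dis: "ar s \<inter> ar t = {}" if st: "s \<in> S" "t \<in> S" "s \<noteq> t" for s t
  proof -
    obtain i j i' j' where ij: "s = (i, j)" "t = (i', j')" by (cases s, cases t)
    have m: "matched P i j" "matched P i' j'" using st ij by (auto simp: S_def)
    have ne: "i \<noteq> i'" "j \<noteq> j'" "i \<noteq> j'" "j \<noteq> i'"
      using matched_unique(1)[OF m(1), of j'] matched_unique(2)[OF m(1), of i'] m(2) st(3) ij
        matched_steps(3,4)[OF m(1)] matched_steps(3,4)[OF m(2)] by auto
    have lt: "i < j" "j < 2 * n" "i' < j'" "j' < 2 * n" using SN st ij by auto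
    have "\<not> (i < i' \<and> i' < j \<and> j < j')" "\<not> (i' < i \<and> i < j' \<and> j' < j)"
      using matched_noncrossing[OF m] matched_noncrossing[OF m(2,1)] by blast+
    \<comment> \<open>Excluding crossings leaves separated and nested pairs.\<close>
    then have "j < i' \<or> j' < i \<or> i < i' \<and> j' < j \<or> i' < i \<and> j < j'" using ne by linarith
    then consider "j < i'" | "j' < i" | "i < i'" "j' < j" | "i' < i" "j < j'" by blast
    then show ?thesis
    proof cases
      case 1 then show ?thesis using lt by (simp add: ij ar_def semicircle_disjoint em)
    next
      case 2 then show ?thesis using lt semicircle_disjoint[of "e i'" "e j'" "e i" "e j"] by (simp add: ij ar_def em Int_commute)
    next
      case 3 then show ?thesis using lt by (simp add: ij ar_def semicircle_disjoint em)
    next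
      case 4 then show ?thesis using lt semicircle_disjoint[of "e i'" "e j'" "e i" "e j"] by (simp add: ij ar_def em Int_commute)
    qed
  qed
  have up: "semicircle x y \<subseteq> upper" for x y by (auto simp: semicircle_def)
  have "half_plane_arcs (ar ` S)" unfolding half_plane_arcs_def
  proof (intro conjI ballI impI)
    show "finite (ar ` S)" using fin by simp
    show "c \<inter> d = {}" if "c \<in> ar ` S" "d \<in> ar ` S" "c \<noteq> d" for c d using that dis by blast
    fix c assume "c \<in> ar ` S"
    then obtain i j where "(i, j) \<in> S" "c = semicircle (e i) (e j)" by (auto simp: ar_def)
    then show "c \<subseteq> upper" "\<exists>g. arc g \<and> path_image g = c \<and> c \<inter> \<real> = {pathstart g, pathfinish g}"
      using up semicircle_arc(1) em SN by auto
  qed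
  moreover have "(\<lambda>a. a \<inter> \<real>) ` ar ` S = (\<lambda>s. (\<lambda>k. complex_of_real (e k)) ` s) ` pairs P"
  proof -
    have "pairs P = (\<lambda>(i, j). {i, j}) ` S" by (auto simp: pairs_def S_def image_iff)
    then have "(\<lambda>s. (\<lambda>k. complex_of_real (e k)) ` s) ` pairs P = (\<lambda>(i, j). {complex_of_real (e i), of_real (e j)}) ` S"
      by (simp add: image_image case_prod_unfold)
    moreover have "(\<lambda>a. a \<inter> \<real>) ` ar ` S = (\<lambda>(i, j). {complex_of_real (e i), of_real (e j)}) ` S"
      unfolding image_image
    proof (rule image_cong)
      fix t assume t: "t \<in> S"
      then obtain i j where ij: "t = (i, j)" by (cases t)
      then have "e i < e j" using em SN t by blast
      then show "ar t \<inter> \<real> = (case t of (i, j) \<Rightarrow> {complex_of_real (e i), of_real (e j)})"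
        using semicircle_arc(2)[of "e i" "e j"] by (simp add: ij ar_def)
    qed simp
    ultimately show ?thesis by simp
  qed
  ultimately show ?thesis using that by blast
qed

lemma half_plane_arcs_dyck:
  assumes A: "half_plane_arcs \<A>" and e: "strict_mono_on {..<2 * n} e"
    and ends: "\<Union>\<A> \<inter> \<real> = (\<lambda>k. of_real (e k)) ` {..<2 * n}"
  obtains P where "P \<in> dyck_paths n" "(\<lambda>a. a \<inter> \<real>) ` \<A> = (\<lambda>s. (\<lambda>k. of_real (e k)) ` s) ` pairs P"
proof -
  define N where "N = 2 * n"
  define f where "f k = complex_of_real (e k)" for k
  have injf: "inj_on f {..<N}"
    using strict_mono_on_imp_inj_on[OF e] by (auto simp: inj_on_def f_def N_def)
  have arcA: "\<exists>g. arc g \<and> path_image g = a \<and> a \<inter> \<real> = {pathstart g, pathfinish g}" "a \<subseteq> upper" if "a \<in> \<A>" for a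
    using A that unfolding half_plane_arcs_def by auto
  have dis: "a = b" if "a \<in> \<A>" "b \<in> \<A>" "z \<in> a" "z \<in> b" for a b z
    using A that unfolding half_plane_arcs_def by blast
  have two: "\<exists>i j. i < j \<and> j < N \<and> a \<inter> \<real> = f ` {i, j}" if a: "a \<in> \<A>" for a
  proof -
    obtain g where g: "arc g" "path_image g = a" "a \<inter> \<real> = {pathstart g, pathfinish g}" using arcA(1)[OF a] by blast
    have "a \<inter> \<real> \<subseteq> f ` {..<N}" using ends a by (auto simp: f_def N_def)
    then obtain i j where ij: "i < N" "j < N" "pathstart g = f i" "pathfinish g = f j" using g(3) by auto
    have "i \<noteq> j" using ij arc_distinct_ends[OF g(1)] by auto
    then have "i < j \<or> j < i" by linarith
    then show ?thesis using ij g(3) by (auto simp: insert_commute)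
  qed
  \<comment> \<open>Restricting to subsets of \<open>{..<N}\<close>, where \<open>f\<close> is
    injective, makes the index set of each arc unique.\<close>
  define M where "M = {s. s \<subseteq> {..<N} \<and> f ` s \<in> (\<lambda>a. a \<inter> \<real>) ` \<A>}"
  have shape: "\<exists>i j. i < j \<and> j < N \<and> s = {i, j}" if s: "s \<in> M" for s
  proof -
    obtain a where a: "a \<in> \<A>" "f ` s = a \<inter> \<real>" "s \<subseteq> {..<N}" using s by (auto simp: M_def)
    obtain i j where ij: "i < j" "j < N" "f ` s = f ` {i, j}" using two[OF a(1)] a(2) by auto
    then have "s = {i, j}" using inj_on_image_eq_iff[OF injf a(3), of "{i, j}"] by auto
    then show ?thesis using ij by blast
  qed
  have ex1: "\<exists>!s. s \<in> M \<and> k \<in> s" if k: "k < N" for k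
  proof -
    have "f k \<in> \<Union>\<A> \<inter> \<real>" unfolding ends using k by (auto simp: f_def N_def)
    then obtain a where a: "a \<in> \<A>" "f k \<in> a" "f k \<in> \<real>" by blast
    obtain i j where ij: "i < j" "j < N" "a \<inter> \<real> = f ` {i, j}" using two[OF a(1)] by blast
    have "f k \<in> f ` {i, j}" using a ij(3) by blast
    then have "k \<in> {i, j}" using inj_onD[OF injf] k ij by auto
    moreover have "{i, j} \<in> M" using ij a by (auto simp: M_def)
    moreover have "s = {i, j}" if s: "s \<in> M" "k \<in> s" for s
    proof -
      obtain b where b: "b \<in> \<A>" "f ` s = b \<inter> \<real>" "s \<subseteq> {..<N}" using s by (auto simp: M_def)
      then have "b = a" using dis[OF b(1) a(1), of "f k"] a s by blast
      then have "f ` s = f ` {i, j}" using b ij by simp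
      then show ?thesis using inj_on_image_eq_iff[OF injf b(3), of "{i, j}"] ij by auto
    qed
    ultimately show ?thesis by blast
  qed
  have path_between: "\<exists>a g. a \<in> \<A> \<and> a \<inter> \<real> = {f i, f j} \<and> path g \<and> path_image g = a \<and> pathstart g = f i \<and> pathfinish g = f j"
    if ij: "{i, j} \<in> M" for i j
  proof -
    obtain a where a: "a \<in> \<A>" "f ` {i, j} = a \<inter> \<real>" using ij by (auto simp: M_def)
    obtain g where g: "arc g" "path_image g = a" "a \<inter> \<real> = {pathstart g, pathfinish g}" using arcA(1)[OF a(1)] by blast
    have eq: "{pathstart g, pathfinish g} = {f i, f j}" using a(2) g(3) by simp
    show ?thesis
    proof (cases "pathstart g = f i")
      case True
      then have "pathfinish g = f j" using eq arc_distinct_ends[OF g(1)] by (metis doubleton_eq_iff)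
      then show ?thesis using True a g eq arc_imp_path by metis
    next
      case False
      then have "pathstart g = f j" "pathfinish g = f i" using eq by (metis doubleton_eq_iff)+
      then have "path (reversepath g)" "path_image (reversepath g) = a" "pathstart (reversepath g) = f i" "pathfinish (reversepath g) = f j"
        using g arc_imp_path by auto
      then show ?thesis using a g eq by metis
    qed
  qed
  have nc: False if "{i, j} \<in> M" "{i', j'} \<in> M" "i < i'" "i' < j" "j < j'" for i i' j j'
  proof -
    obtain a g where ag: "a \<in> \<A>" "a \<inter> \<real> = {f i, f j}" "path g" "path_image g = a" "pathstart g = f i" "pathfinish g = f j"
      using path_between[OF \<open>{i, j} \<in> M\<close>] by metis
    obtain b h where bh: "b \<in> \<A>" "b \<inter> \<real> = {f i', f j'}" "path h" "path_image h = b" "pathstart h = f i'" "pathfinish h = f j'"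
      using path_between[OF \<open>{i', j'} \<in> M\<close>] by metis
    have N: "i < N" "j < N" "i' < N" "j' < N" using that(1,2) by (auto simp: M_def)
    have lt: "e i < e i'" "e i' < e j" "e j < e j'"
      using strict_mono_onD[OF e] N that(3-5) by (auto simp: N_def)
    have "path_image g \<inter> path_image h \<noteq> {}"
      by (rule fashoda_interlace_upper[OF ag(3) bh(3), of "e i" "e j" "e i'" "e j'"])
        (use ag bh arcA(2) lt in \<open>auto simp: f_def\<close>)
    then have "a = b" using dis ag(1,4) bh(1,4) by blast
    then have "f i \<in> {f i', f j'}" using ag(2) bh(2) by blast
    then show False using lt by (auto simp: f_def)
  qed
  have "noncrossing_pairing N M" unfolding noncrossing_pairing_def
  proof (intro conjI ballI allI impI)
    show "\<exists>!s. s \<in> M \<and> k \<in> s" if "k < N" for k by (rule ex1[OF that])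
    show False if "{i, j} \<in> M \<and> {i', j'} \<in> M \<and> i < i' \<and> i' < j \<and> j < j'" for i i' j j'
      using that nc[of i j i' j'] by simp
  qed (rule shape)
  then obtain P where P: "P \<in> dyck_paths n" "pairs P = M" unfolding N_def by (rule pairs_surj)
  have "(\<lambda>a. a \<inter> \<real>) ` \<A> = (\<lambda>s. f ` s) ` M"
  proof (intro equalityI subsetI)
    fix t assume "t \<in> (\<lambda>a. a \<inter> \<real>) ` \<A>"
    then obtain a where a: "a \<in> \<A>" "t = a \<inter> \<real>" by blast
    obtain i j where "i < j" "j < N" "a \<inter> \<real> = f ` {i, j}" using two[OF a(1)] by blast
    then have "{i, j} \<in> M" "t = f ` {i, j}" using a by (auto simp: M_def)
    then show "t \<in> (\<lambda>s. f ` s) ` M" by blast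
  qed (auto simp: M_def)
  then show ?thesis using that P by (simp add: f_def)
qed

section \<open>Isotopy classes indexed by Dyck paths\<close>

lemma pairs_bounded:
  assumes "P \<in> dyck_paths n" "s \<in> pairs P" "k \<in> s"
  shows "k < 2 * n"
proof -
  obtain a b where "matched P a b" "s = {a, b}" using assms by (auto simp: pairs_def)
  then show ?thesis using matched_steps(1,2)[of P a b] assms by (auto simp: dyck_paths_iff)
qed

text \<open>The real points over \<open>A\<close> are numbered in increasing order in each chart, so
  that noncrossing arcs correspond to noncrossing pairs of indices.\<close>

locale indexed_charts = half_plane_charts I q L A for I :: "'i set" and q L A +
  fixes n :: nat and e :: "'i \<Rightarrow> nat \<Rightarrow> real"
  assumes e_mono: "\<And>i. i \<in> I \<Longrightarrow> strict_mono_on {..<2 * n} (e i)"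
    and e_enum: "\<And>i. i \<in> I \<Longrightarrow> {x. Im x = 0 \<and> q i x \<in> A} = (\<lambda>k. of_real (e i k)) ` {..<2 * n}"
begin

definition pt :: "'i \<Rightarrow> nat \<Rightarrow> complex" where "pt i k = of_real (e i k)"

text \<open>Defined by the pairings instead of a representative;
  \<open>deformation_of_matching\<close> and \<open>matching_of_deformation\<close> make it an
  isotopy class as soon as it is nonempty.\<close>

definition cls :: "('i \<Rightarrow> step list) \<Rightarrow> complex set set set" where
  "cls d = {C. curve_system L A C \<and> (\<forall>i\<in>I. matching C i = (\<lambda>s. pt i ` s) ` pairs (d i))}"

definition point_link :: "('i \<Rightarrow> step list) \<Rightarrow> (complex \<times> complex) set" where
  "point_link d = {(p, p'). \<exists>i\<in>I. \<exists>s\<in>pairs (d i). \<exists>k\<in>s. \<exists>l\<in>s. p = q i (pt i k) \<and> p' = q i (pt i l)}"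

lemma cls_D:
  assumes "C \<in> cls d"
  shows "curve_system L A C" "i \<in> I \<Longrightarrow> matching C i = (\<lambda>s. pt i ` s) ` pairs (d i)"
  using assms by (simp_all add: cls_def)

lemma cls_is_class:
  assumes "C \<in> cls d"
  shows "cls d = deformation_rel L A `` {C}"
proof (intro equalityI subsetI)
  fix D assume "D \<in> cls d"
  then show "D \<in> deformation_rel L A `` {C}" using deformation_of_matching[of C D] assms by (auto simp: cls_def)
next
  fix D assume D: "D \<in> deformation_rel L A `` {C}"
  then have "curve_system L A D" by (auto simp: deformation_rel_def)
  moreover have "matching D i = matching C i" if "i \<in> I" for i using matching_of_deformation[of C D i] D that by auto
  ultimately show "D \<in> cls d" using assms by (simp add: cls_def)
qed

lemma cls_nonempty:
  assumes d: "\<And>i. i \<in> I \<Longrightarrow> d i \<in> dyck_paths n"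
  obtains C where "C \<in> cls d"
proof -
  have "\<forall>i\<in>I. \<exists>\<A>. half_plane_arcs \<A> \<and> (\<lambda>a. a \<inter> \<real>) ` \<A> = (\<lambda>s. pt i ` s) ` pairs (d i)"
    using dyck_half_plane_arcs[OF d e_mono] unfolding pt_def by metis
  then obtain \<A> where A: "\<forall>i\<in>I. half_plane_arcs (\<A> i) \<and> (\<lambda>a. a \<inter> \<real>) ` \<A> i = (\<lambda>s. pt i ` s) ` pairs (d i)"
    by (rule bchoice[THEN exE])
  have ends: "\<Union>(\<A> i) \<inter> \<real> = {x. Im x = 0 \<and> q i x \<in> A}" if i: "i \<in> I" for i
  proof -
    have "\<Union>(pairs (d i)) = {..<2 * n}"
    proof (intro equalityI subsetI)
      fix k assume "k \<in> \<Union>(pairs (d i))"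
      then show "k \<in> {..<2 * n}" using pairs_bounded[OF d[OF i]] by auto
    next
      fix k assume "k \<in> {..<2 * n}"
      then show "k \<in> \<Union>(pairs (d i))" using pairs_partition[OF d[OF i], of k] by blast
    qed
    moreover have "\<Union>(\<A> i) \<inter> \<real> = \<Union>((\<lambda>a. a \<inter> \<real>) ` \<A> i)" by blast
    moreover have "\<dots> = pt i ` \<Union>(pairs (d i))" using A i by auto
    ultimately show ?thesis unfolding e_enum[OF i] by (simp add: pt_def)
  qed
  interpret CA: chart_arcs I q L A \<A> by unfold_locales (use A ends in auto)
  obtain C where C: "curve_system L A C" "\<And>i. i \<in> I \<Longrightarrow> pre C i = \<Union>(\<A> i)" using CA.realization by metis
  have "matching C i = (\<lambda>s. pt i ` s) ` pairs (d i)" if i: "i \<in> I" for i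
    unfolding matching_def C(2)[OF i] using half_plane_arcs_components A i by simp
  then have "C \<in> cls d" using C(1) by (simp add: cls_def)
  then show ?thesis by (rule that)
qed

lemma cls_quotient:
  assumes "\<And>i. i \<in> I \<Longrightarrow> d i \<in> dyck_paths n"
  shows "cls d \<in> {C. curve_system L A C} // deformation_rel L A"
proof -
  obtain C where C: "C \<in> cls d" by (rule cls_nonempty[of d]) (rule assms)
  have "C \<in> {C. curve_system L A C}" using cls_D(1)[OF C] by simp
  then show ?thesis unfolding cls_is_class[OF C] by (rule quotientI)
qed

text \<open>The class has a member, which determines the pairings, and these determine the
  paths.\<close>

lemma cls_inj:
  assumes d: "\<And>i. i \<in> I \<Longrightarrow> d i \<in> dyck_paths n" and d': "\<And>i. i \<in> I \<Longrightarrow> d' i \<in> dyck_paths n"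
    and eq: "cls d = cls d'" and i: "i \<in> I"
  shows "d i = d' i"
proof -
  obtain C where C: "C \<in> cls d" by (rule cls_nonempty[of d]) (rule d)
  have m: "(\<lambda>s. pt i ` s) ` pairs (d i) = (\<lambda>s. pt i ` s) ` pairs (d' i)"
    using cls_D(2)[OF C i] cls_D(2)[OF C[unfolded eq] i] by (rule trans[OF sym])
  have "inj_on (e i) {..<2 * n}" using strict_mono_on_imp_inj_on[OF e_mono[OF i]] .
  then have "inj_on (pt i) {..<2 * n}" by (auto simp: inj_on_def pt_def)
  then have inj: "inj_on (\<lambda>s. pt i ` s) (Pow {..<2 * n})" by (rule inj_on_image_Pow)
  have sub: "pairs R \<subseteq> Pow {..<2 * n}" if R: "R \<in> dyck_paths n" for R
  proof
    fix s assume "s \<in> pairs R"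
    then show "s \<in> Pow {..<2 * n}" using pairs_bounded[OF R] by auto
  qed
  have "pairs (d i) = pairs (d' i)" using inj_on_image_eq_iff[OF inj sub[OF d[OF i]] sub[OF d'[OF i]]] m by simp
  then show ?thesis using pairs_inj[OF d[OF i] d'[OF i]] by simp
qed

lemma cls_surj:
  assumes X: "X \<in> {C. curve_system L A C} // deformation_rel L A"
  obtains d where "\<And>i. i \<in> I \<Longrightarrow> d i \<in> dyck_paths n" "X = cls d"
proof -
  obtain C where C: "curve_system L A C" "X = deformation_rel L A `` {C}" using X by (auto elim: quotientE)
  interpret CA: chart_arcs I q L A "\<lambda>i. components (pre C i)" by (rule curve_system_chart_arcs[OF C(1)])
  have "\<forall>i\<in>I. \<exists>P. P \<in> dyck_paths n \<and> matching C i = (\<lambda>s. pt i ` s) ` pairs P"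
  proof
    fix i assume i: "i \<in> I"
    show "\<exists>P. P \<in> dyck_paths n \<and> matching C i = (\<lambda>s. pt i ` s) ` pairs P"
      by (rule half_plane_arcs_dyck[OF CA.arcs[OF i] e_mono[OF i] CA.ends[OF i, unfolded e_enum[OF i]]])
        (auto simp: matching_def pt_def)
  qed
  then obtain d where d: "\<forall>i\<in>I. d i \<in> dyck_paths n \<and> matching C i = (\<lambda>s. pt i ` s) ` pairs (d i)"
    by (rule bchoice[THEN exE])
  then have "C \<in> cls d" using C(1) by (simp add: cls_def)
  then show ?thesis using that[of d] d cls_is_class C(2) by simp
qed

lemma num_components_cls:
  assumes "\<And>i. i \<in> I \<Longrightarrow> d i \<in> dyck_paths n"
  shows "num_components (cls d) = card ((\<lambda>p. (point_link d)\<^sup>* `` {p}) ` A)"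
proof -
  obtain C where C: "C \<in> cls d" by (rule cls_nonempty[of d]) (rule assms)
  note cs = cls_D(1)[OF C] and m = cls_D(2)[OF C]
  have "(\<exists>t\<in>matching C i. p \<in> q i ` t \<and> p' \<in> q i ` t) \<longleftrightarrow>
      (\<exists>s\<in>pairs (d i). \<exists>k\<in>s. \<exists>l\<in>s. p = q i (pt i k) \<and> p' = q i (pt i l))" if i: "i \<in> I" for i p p'
    unfolding m[OF i] bex_simps image_iff by blast
  then have "adjacent (matching C) = point_link d"
    unfolding adjacent_def point_link_def by (intro Collect_cong) (simp add: case_prod_unfold)
  then show ?thesis unfolding cls_is_class[OF C] num_components_class[OF cs] card_curve_system[OF cs] by simp
qed

lemma point_linkI:
  "i \<in> I \<Longrightarrow> s \<in> pairs (d i) \<Longrightarrow> k \<in> s \<Longrightarrow> l \<in> s \<Longrightarrow> (q i (pt i k), q i (pt i l)) \<in> point_link d"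
  by (auto simp: point_link_def)

lemma point_link_sub:
  assumes "\<And>i. i \<in> I \<Longrightarrow> d i \<in> dyck_paths n"
  shows "point_link d \<subseteq> A \<times> A" "sym (point_link d)"
proof -
  have "q i (pt i k) \<in> A" if i: "i \<in> I" "s \<in> pairs (d i)" "k \<in> s" for i s k
  proof -
    have "k < 2 * n" using pairs_bounded[OF assms[OF i(1)] i(2,3)] .
    then have "pt i k \<in> {x. Im x = 0 \<and> q i x \<in> A}" unfolding e_enum[OF i(1)] by (auto simp: pt_def)
    then show ?thesis by simp
  qed
  then show "point_link d \<subseteq> A \<times> A" by (auto simp: point_link_def)
  show "sym (point_link d)" by (auto simp: point_link_def sym_def)
qed

end

text \<open>The map \<open>f\<close> may identify points, but only within one class, so it induces a
  bijection of classes. It is applied three times: to forget the side of a boundary step, to number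
  the points on the line, and to fold the indices onto the half-line.\<close>

lemma card_classes_transfer:
  assumes f: "f ` V = V'" and R: "sym R" and R': "R' \<subseteq> V' \<times> V'" "sym R'"
    and step: "\<And>v w. v \<in> V \<Longrightarrow> (v, w) \<in> R \<Longrightarrow> w \<in> V \<and> (f v, f w) \<in> R'\<^sup>*"
    and fib: "\<And>v w. v \<in> V \<Longrightarrow> w \<in> V \<Longrightarrow> f v = f w \<Longrightarrow> (v, w) \<in> R\<^sup>*"
    and lift: "\<And>a b. (a, b) \<in> R' \<Longrightarrow> \<exists>v\<in>V. \<exists>w\<in>V. a = f v \<and> b = f w \<and> (v, w) \<in> R\<^sup>*"
  shows "card ((\<lambda>v. R\<^sup>* `` {v}) ` V) = card ((\<lambda>v. R'\<^sup>* `` {v}) ` V')"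
proof -
  have fwd: "w \<in> V \<and> (f v, f w) \<in> R'\<^sup>*" if "(v, w) \<in> R\<^sup>*" "v \<in> V" for v w
    using that by (induction rule: rtrancl_induct) (auto dest: step intro: rtrancl_trans)
  have bwd: "(v, w) \<in> R\<^sup>*" if "(a, b) \<in> R'\<^sup>*" "v \<in> V" "w \<in> V" "a = f v" "b = f w" for a b v w
    using that
  proof (induction arbitrary: w rule: rtrancl_induct)
    case base
    then show ?case using fib by simp
  next
    case (step y z)
    obtain v' w' where vw: "v' \<in> V" "w' \<in> V" "y = f v'" "z = f w'" "(v', w') \<in> R\<^sup>*" using lift[OF step(2)] by blast
    have "(v, v') \<in> R\<^sup>*" using step(3)[of v'] step vw by simp
    moreover have "(w', w) \<in> R\<^sup>*" using fib[of w' w] vw step by simp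
    ultimately show ?case using vw(5) by (meson rtrancl_trans)
  qed
  have cl: "S\<^sup>* `` {x} = S\<^sup>* `` {y} \<longleftrightarrow> (x, y) \<in> S\<^sup>*" if "sym S" for S :: "('z \<times> 'z) set" and x y
  proof
    assume "S\<^sup>* `` {x} = S\<^sup>* `` {y}"
    then show "(x, y) \<in> S\<^sup>*" by blast
  next
    assume xy: "(x, y) \<in> S\<^sup>*"
    then have "(y, x) \<in> S\<^sup>*" using that by (metis symD sym_rtrancl)
    then show "S\<^sup>* `` {x} = S\<^sup>* `` {y}" using xy by (auto intro: rtrancl_trans)
  qed
  have key: "R\<^sup>* `` {v} = R\<^sup>* `` {w} \<longleftrightarrow> R'\<^sup>* `` {f v} = R'\<^sup>* `` {f w}" if "v \<in> V" "w \<in> V" for v w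
    unfolding cl[OF R] cl[OF R'(2)] using fwd[of v w] bwd[of "f v" "f w" v w] that by blast
  define h where "h X = R'\<^sup>* `` {f (SOME v. v \<in> V \<and> R\<^sup>* `` {v} = X)}" for X
  have hv: "h (R\<^sup>* `` {v}) = R'\<^sup>* `` {f v}" if v: "v \<in> V" for v
  proof -
    have "(SOME u. u \<in> V \<and> R\<^sup>* `` {u} = R\<^sup>* `` {v}) \<in> V \<and> R\<^sup>* `` {SOME u. u \<in> V \<and> R\<^sup>* `` {u} = R\<^sup>* `` {v}} = R\<^sup>* `` {v}"
      by (rule someI[of _ v]) (use v in simp)
    then show ?thesis unfolding h_def using key v by blast
  qed
  have "bij_betw h ((\<lambda>v. R\<^sup>* `` {v}) ` V) ((\<lambda>v. R'\<^sup>* `` {v}) ` V')"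
    unfolding bij_betw_def
  proof
    show "inj_on h ((\<lambda>v. R\<^sup>* `` {v}) ` V)" using hv key by (auto simp: inj_on_def)
    show "h ` (\<lambda>v. R\<^sup>* `` {v}) ` V = (\<lambda>v. R'\<^sup>* `` {v}) ` V'"
      unfolding f[symmetric] image_image using hv by (intro image_cong) auto
  qed
  then show ?thesis by (rule bij_betw_same_card)
qed

definition index_link :: "nat set set \<Rightarrow> (nat \<times> nat) set" where
  "index_link \<E> = {(k, l). \<exists>s\<in>\<E>. k \<in> s \<and> l \<in> s}"

lemma index_link_sym: "sym (index_link \<E>)"
  by (auto simp: index_link_def sym_def)

text \<open>Beams of direction (1, -1) link the two steps with the same index, so the side can be
  forgotten, and the other mating becomes the two pairings of indices.\<close>

theorem traj_eq:
  assumes n: "0 < n" and P: "P \<in> dyck_paths n" and Q: "Q \<in> dyck_paths n"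
  shows "traj P Q = card ((\<lambda>k. (index_link (pairs P \<union> pairs Q))\<^sup>* `` {k}) ` {..<2 * n})"
proof -
  interpret D: dyck_pair n P Q by unfold_locales (use assms in auto)
  show ?thesis unfolding D.traj_mates
  proof (rule card_classes_transfer[of snd])
    show "snd ` D.V = {..<2 * n}" by (auto simp: D.V_def image_iff)
    show "sym D.mates" using D.mate_V D.mate_mate by (fastforce simp: D.mates_def sym_def)
    show "sym (index_link (pairs P \<union> pairs Q))" by (rule index_link_sym)
    show "index_link (pairs P \<union> pairs Q) \<subseteq> {..<2 * n} \<times> {..<2 * n}"
      using pairs_bounded[OF P] pairs_bounded[OF Q] by (auto simp: index_link_def)
    have part: "{k, D.partner (D.path_of a) k} \<in> pairs P \<union> pairs Q" if "k < 2 * n" for a k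
      by (rule D.partner_cases[OF that, of a]) (auto simp: pairs_def D.path_of_def insert_commute split: if_splits)
    show "w \<in> D.V \<and> (snd v, snd w) \<in> (index_link (pairs P \<union> pairs Q))\<^sup>*" if vw: "v \<in> D.V" "(v, w) \<in> D.mates" for v w
    proof -
      obtain a k where v: "v = (a, k)" "k < 2 * n" using vw(1) by (auto simp: D.V_def)
      consider "w = (a, D.partner (D.path_of a) k)" | "w = (\<not> a, k)" using vw(2) v by (auto simp: D.mates_def D.mate_def)
      then have "(snd v, snd w) \<in> (index_link (pairs P \<union> pairs Q))\<^sup>*"
      proof cases
        case 1
        then have "(snd v, snd w) \<in> index_link (pairs P \<union> pairs Q)"
          using part[OF v(2), of a] v unfolding index_link_def by auto
        then show ?thesis by blast
      qed (simp add: v)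
      moreover have "w \<in> D.V" using vw D.mate_V[of v] v(1) by (auto simp: D.mates_def)
      ultimately show ?thesis by blast
    qed
    show "(v, w) \<in> D.mates\<^sup>*" if "v \<in> D.V" "w \<in> D.V" "snd v = snd w" for v w
    proof (cases "v = w")
      case False
      then have "w = D.mate False v" using that by (auto simp: D.mate_def prod_eq_iff)
      then show ?thesis using that by (auto simp: D.mates_def)
    qed simp
    show "\<exists>v\<in>D.V. \<exists>w\<in>D.V. k = snd v \<and> l = snd w \<and> (v, w) \<in> D.mates\<^sup>*"
      if kl: "(k, l) \<in> index_link (pairs P \<union> pairs Q)" for k l
    proof -
      obtain s where s: "s \<in> pairs P \<union> pairs Q" "k \<in> s" "l \<in> s" using kl by (auto simp: index_link_def)
      define a where "a \<longleftrightarrow> s \<in> pairs P"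
      have "s \<in> pairs (D.path_of a)" using s by (auto simp: a_def D.path_of_def)
      then obtain i j where ij: "matched (D.path_of a) i j" "s = {i, j}" by (auto simp: pairs_def)
      have lt: "i < 2 * n" "j < 2 * n" using matched_steps(1,2)[OF ij(1)] D.path_of(2) by auto
      have V: "(a, k) \<in> D.V" "(a, l) \<in> D.V" using s ij lt by (auto simp: D.V_def)
      have "k = l \<or> D.partner (D.path_of a) k = l" using s ij D.partner_eq[OF ij(1)] by auto
      then have "((a, k), (a, l)) \<in> D.mates\<^sup>*" using V by (auto simp: D.mates_def D.mate_def)
      then show ?thesis using V by force
    qed
  qed
qed

section \<open>The two instances: charts for meanders and for semimeanders\<close>

lemma constant_sign:
  fixes f :: "real \<Rightarrow> real"
  assumes "continuous_on {s..t} f" "\<And>r. r \<in> {s<..<t} \<Longrightarrow> f r \<noteq> 0"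
  shows "(\<forall>r\<in>{s<..<t}. 0 < f r) \<or> (\<forall>r\<in>{s<..<t}. f r < 0)"
proof (rule ccontr)
  assume n: "\<not> ?thesis"
  have "connected (f ` {s<..<t})"
    by (intro connected_continuous_image continuous_on_subset[OF assms(1)]) auto
  moreover obtain a b where "a \<in> {s<..<t}" "b \<in> {s<..<t}" "f a \<le> 0" "0 \<le> f b" using n by (auto simp: not_less)
  ultimately have "0 \<in> f ` {s<..<t}" by (meson connectedD_interval imageI)
  then show False using assms(2) by auto
qed

definition meander_chart :: "bool \<Rightarrow> complex \<Rightarrow> complex" where
  "meander_chart b z = (if b then z else cnj z)"

text \<open>The chart \<open>True\<close> is the upper and \<open>False\<close> the lower
  half-plane; the shift by 1 takes indices counted from 0 to the points counted from 1.\<close>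

interpretation meander: indexed_charts UNIV meander_chart \<real> "of_nat ` {1..2 * n}" n "\<lambda>b k. real k + 1" for n
proof unfold_locales
  show "continuous_on upper (meander_chart b)" for b
    unfolding meander_chart_def by (cases b) (auto intro: continuous_intros)
  show "i = j \<and> z = w" if "0 < Im z" "0 < Im w" "meander_chart i z = meander_chart j w" for i j z w
    using that by (cases i; cases j) (auto simp: meander_chart_def complex_eq_iff)
  show "meander_chart i z \<in> \<real> \<longleftrightarrow> Im z = 0" for i z by (cases i) (auto simp: meander_chart_def complex_is_Real_iff)
  show "\<exists>i\<in>UNIV. \<exists>z\<in>upper. meander_chart i z = w" for w
  proof (cases "0 \<le> Im w")
    case True then show ?thesis by (auto simp: meander_chart_def intro!: exI[of _ True])
  next
    case False then show ?thesis by (intro bexI[of _ False] bexI[of _ "cnj w"]) (auto simp: meander_chart_def)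
  qed
  show "\<exists>R. \<forall>i\<in>UNIV. \<forall>z\<in>upper. cmod (meander_chart i z) \<le> B \<longrightarrow> cmod z \<le> R" for B
    by (intro exI[of _ B]) (auto simp: meander_chart_def)
  show "\<exists>i\<in>UNIV. \<exists>h. continuous_on {s..t} h \<and> (\<forall>r\<in>{s..t}. h r \<in> upper \<and> meander_chart i (h r) = g r)"
    if st: "s < t" "continuous_on {s..t} g" "g s \<in> of_nat ` {1..2 * n}" "g t \<in> of_nat ` {1..2 * n}"
      "\<And>r. r \<in> {s<..<t} \<Longrightarrow> g r \<notin> \<real>" for g :: "real \<Rightarrow> complex" and s t n
  proof -
    have ends: "Im (g s) = 0" "Im (g t) = 0" using st by auto
    have "(\<forall>r\<in>{s<..<t}. 0 < Im (g r)) \<or> (\<forall>r\<in>{s<..<t}. Im (g r) < 0)"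
      by (rule constant_sign) (use st in \<open>auto intro: continuous_intros simp: complex_is_Real_iff\<close>)
    then obtain b where b: "\<And>r. r \<in> {s<..<t} \<Longrightarrow> 0 \<le> Im (meander_chart b (g r))"
    proof
      assume "\<forall>r\<in>{s<..<t}. 0 < Im (g r)"
      then show thesis by (intro that[of True]) (auto simp: meander_chart_def less_imp_le)
    next
      assume "\<forall>r\<in>{s<..<t}. Im (g r) < 0"
      then show thesis by (intro that[of False]) (auto simp: meander_chart_def less_imp_le)
    qed
    have "0 \<le> Im (meander_chart b (g r))" if "r \<in> {s..t}" for r
      using b[of r] ends that by (cases "r = s \<or> r = t") (auto simp: meander_chart_def)
    moreover have "continuous_on {s..t} (\<lambda>r. meander_chart b (g r))"
      using st(2) by (cases b) (auto simp: meander_chart_def intro: continuous_intros)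
    ultimately show ?thesis
      by (intro bexI[of _ b] exI[of _ "\<lambda>r. meander_chart b (g r)"]) (auto simp: meander_chart_def)
  qed
  show "t *\<^sub>R z \<in> \<real>" if "0 < t" "z \<in> \<real>" for t and z :: complex using that by (auto simp: complex_is_Real_iff)
  show "\<exists>\<delta>>0. ball p \<delta> \<inter> \<real> \<subseteq> \<real>" for p :: complex by (intro exI[of _ 1]) auto
  show "\<exists>i x j y \<epsilon>. (i, x) \<noteq> (j, y) \<and> {(k, z). k \<in> UNIV \<and> Im z = 0 \<and> meander_chart k z = p} = {(i, x), (j, y)} \<and> 0 < \<epsilon> \<and>
      (\<forall>z\<in>ball x \<epsilon>. 0 < Im z \<longrightarrow> 0 < Im (meander_chart i z)) \<and> (\<forall>z\<in>ball y \<epsilon>. 0 < Im z \<longrightarrow> Im (meander_chart j z) < 0)"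
    if "p \<in> of_nat ` {1..2 * n}" for p n
  proof (intro exI conjI)
    show "(True, p) \<noteq> (False, p)" by simp
    have "Im p = 0" using that by auto
    then show "{(k, z). k \<in> UNIV \<and> Im z = 0 \<and> meander_chart k z = p} = {(True, p), (False, p)}"
      by (auto simp: meander_chart_def complex_eq_iff)
    show "0 < (1::real)" by simp
  qed (auto simp: meander_chart_def)
  show "strict_mono_on {..<2 * n} (\<lambda>k. real k + 1)" for n by (auto simp: strict_mono_on_def)
  show "{x. Im x = 0 \<and> meander_chart i x \<in> of_nat ` {1..2 * n}} = (\<lambda>k. of_real (real k + 1)) ` {..<2 * n}" for i n
  proof -
    have "(\<lambda>k. complex_of_real (real k + 1)) ` {..<2 * n} = of_nat ` Suc ` {..<2 * n}"
      unfolding image_image by (intro image_cong) auto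
    also have "Suc ` {..<2 * n} = {1..2 * n}" by (simp add: lessThan_atLeast0 image_Suc_atLeastLessThan atLeastLessThanSuc_atLeastAtMost)
    finally show ?thesis by (cases i) (auto simp: meander_chart_def complex_eq_iff image_iff)
  qed
qed (auto intro: finite_imageI)

definition fold_chart :: "unit \<Rightarrow> complex \<Rightarrow> complex" where
  "fold_chart u z = z\<^sup>2"

text \<open>Point \<open>m\<close> of the half-line has the square roots at the positions \<open>n - m\<close> and \<open>n + m - 1\<close> among
  the \<open>2 * n\<close> points on the axis.\<close>

definition fold_index :: "nat \<Rightarrow> nat \<Rightarrow> real" where
  "fold_index n k = (if k < n then - sqrt (real (n - k)) else sqrt (real (Suc k - n)))"

lemma fold_index_sq: "(fold_index n k)\<^sup>2 = real (if k < n then n - k else Suc k - n)"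
  by (simp add: fold_index_def)

interpretation semimeander: indexed_charts UNIV fold_chart "\<real>\<^sub>\<ge>\<^sub>0" "of_nat ` {1..n}" n "\<lambda>u. fold_index n" for n
proof unfold_locales
  show "continuous_on upper (fold_chart u)" for u unfolding fold_chart_def by (intro continuous_intros)
  show "i = j \<and> z = w" if "0 < Im z" "0 < Im w" "fold_chart i z = fold_chart j w" for i j z w
    using that by (auto simp: fold_chart_def power2_eq_iff)
  show fL: "fold_chart i z \<in> \<real>\<^sub>\<ge>\<^sub>0 \<longleftrightarrow> Im z = 0" for i z
    by (auto simp: fold_chart_def complex_nonneg_Reals_iff Re_power2 Im_power2 power2_eq_square)
      (metis mult_eq_0_iff not_square_less_zero order_antisym zero_le_square)+
  show "\<exists>i\<in>UNIV. \<exists>z\<in>upper. fold_chart i z = w" for w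
  proof (cases "0 \<le> Im (csqrt w)")
    case True then show ?thesis by (intro bexI[of _ "()"] bexI[of _ "csqrt w"]) (auto simp: fold_chart_def)
  next
    case False then show ?thesis by (intro bexI[of _ "()"] bexI[of _ "- csqrt w"]) (auto simp: fold_chart_def)
  qed
  show "\<exists>R. \<forall>i\<in>UNIV. \<forall>z\<in>upper. cmod (fold_chart i z) \<le> B \<longrightarrow> cmod z \<le> R" for B
    by (intro exI[of _ "sqrt \<bar>B\<bar>"]) (auto simp: fold_chart_def norm_power intro!: real_le_rsqrt)
  show "\<exists>i\<in>UNIV. \<exists>h. continuous_on {s..t} h \<and> (\<forall>r\<in>{s..t}. h r \<in> upper \<and> fold_chart i (h r) = g r)"
    if st: "s < t" "continuous_on {s..t} g" "g s \<in> of_nat ` {1..n}" "g t \<in> of_nat ` {1..n}"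
      "\<And>r. r \<in> {s<..<t} \<Longrightarrow> g r \<notin> \<real>\<^sub>\<ge>\<^sub>0" for g :: "real \<Rightarrow> complex" and s t n
  proof -
    have "g r \<noteq> 0" if "r \<in> {s..t}" for r
    proof (cases "r = s \<or> r = t")
      case False
      then show ?thesis using st(5)[of r] that by auto
    qed (use st in auto)
    \<comment> \<open>Along an interval a nonvanishing function has a continuous square root;
      \<open>g\<close> does not vanish because 0 belongs to the half-line but not to
      \<open>A\<close>.\<close>
    then obtain h where h: "continuous_on {s..t} h" "\<And>r. r \<in> {s..t} \<Longrightarrow> g r = (h r)\<^sup>2"
      using continuous_sqrt_on_contractible[OF st(2) convex_imp_contractible[OF convex_real_interval(5)]] by metis
    have nz: "Im (h r) \<noteq> 0" if "r \<in> {s<..<t}" for r using fL[of "()" "h r"] h(2)[of r] st(5)[OF that] that by (auto simp: fold_chart_def)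
    have ends: "Im (h s) = 0" "Im (h t) = 0"
      using fL[of "()" "h s"] fL[of "()" "h t"] h(2)[of s] h(2)[of t] st by (auto simp: fold_chart_def)
    have "(\<forall>r\<in>{s<..<t}. 0 < Im (h r)) \<or> (\<forall>r\<in>{s<..<t}. Im (h r) < 0)"
      by (rule constant_sign) (use h nz in \<open>auto intro: continuous_intros\<close>)
    \<comment> \<open>The sign \<sigma> turns the square root into the closed upper
      half-plane.\<close>
    then obtain \<sigma> :: complex where sg: "\<sigma>\<^sup>2 = 1" "\<And>r. r \<in> {s<..<t} \<Longrightarrow> 0 \<le> Im (\<sigma> * h r)" "\<And>r. Im (h r) = 0 \<Longrightarrow> Im (\<sigma> * h r) = 0"
    proof
      assume "\<forall>r\<in>{s<..<t}. 0 < Im (h r)"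
      then show thesis by (intro that[of 1]) (auto simp: less_imp_le)
    next
      assume "\<forall>r\<in>{s<..<t}. Im (h r) < 0"
      then show thesis by (intro that[of "-1"]) (auto simp: less_imp_le)
    qed
    have "0 \<le> Im (\<sigma> * h r)" if "r \<in> {s..t}" for r
      using sg(2)[of r] sg(3)[of r] ends that by (cases "r = s \<or> r = t") (auto simp del: times_complex.sel)
    moreover have "fold_chart () (\<sigma> * h r) = g r" if "r \<in> {s..t}" for r
      using h(2)[OF that] sg(1) by (simp add: fold_chart_def power_mult_distrib)
    moreover have "continuous_on {s..t} (\<lambda>r. \<sigma> * h r)" by (intro continuous_intros h)
    ultimately show ?thesis by (intro bexI[of _ "()"] exI[of _ "\<lambda>r. \<sigma> * h r"]) auto
  qed
  show "t *\<^sub>R z \<in> \<real>\<^sub>\<ge>\<^sub>0" if "0 < t" "z \<in> \<real>\<^sub>\<ge>\<^sub>0" for t and z :: complex using that by (auto simp: complex_nonneg_Reals_iff)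
  show "\<real>\<^sub>\<ge>\<^sub>0 \<subseteq> (\<real> :: complex set)" by (auto simp: complex_nonneg_Reals_iff complex_is_Real_iff)
  show "of_nat ` {1..n} \<subseteq> (\<real>\<^sub>\<ge>\<^sub>0 :: complex set)" for n by auto
  show "\<exists>\<delta>>0. ball p \<delta> \<inter> \<real> \<subseteq> \<real>\<^sub>\<ge>\<^sub>0" if "p \<in> of_nat ` {1..n}" for p :: complex and n
  \<comment> \<open>Radius 1 suffices because the points of \<open>A\<close> have real part at least
    1.\<close>
  proof (intro exI[of _ 1] conjI subsetI)
    fix z assume z: "z \<in> ball p 1 \<inter> \<real>"
    have "\<bar>Re (p - z)\<bar> < 1" using z abs_Re_le_cmod[of "p - z"] by (auto simp: dist_norm)
    moreover have "1 \<le> Re p" using that by auto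
    ultimately show "z \<in> \<real>\<^sub>\<ge>\<^sub>0" using z by (auto simp: complex_nonneg_Reals_iff complex_is_Real_iff abs_if split: if_splits)
  qed simp
  show "\<exists>i x j y \<epsilon>. (i, x) \<noteq> (j, y) \<and> {(k, z). k \<in> UNIV \<and> Im z = 0 \<and> fold_chart k z = p} = {(i, x), (j, y)} \<and> 0 < \<epsilon> \<and>
      (\<forall>z\<in>ball x \<epsilon>. 0 < Im z \<longrightarrow> 0 < Im (fold_chart i z)) \<and> (\<forall>z\<in>ball y \<epsilon>. 0 < Im z \<longrightarrow> Im (fold_chart j z) < 0)"
    if p: "p \<in> of_nat ` {1..n}" for p n
  proof -
    obtain m where m: "p = of_nat m" "1 \<le> m" using p by auto
    \<comment> \<open>The number \<open>x\<close> also serves as the radius \<epsilon>: in the ball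
      about \<open>x\<close> or \<open>- x\<close> the real part keeps its sign, and for
      \<open>Im z > 0\<close> the imaginary part \<open>2 * Re z * Im z\<close> of the square has
      that sign.\<close>
    define x where "x = sqrt (real m)"
    have x: "0 < x" "p = of_real (x\<^sup>2)" using m by (auto simp: x_def)
    show ?thesis
    proof (intro exI conjI)
      show "((), complex_of_real x) \<noteq> ((), - of_real x)" using x by (auto simp: complex_eq_iff)
      show "{(k, z). k \<in> UNIV \<and> Im z = 0 \<and> fold_chart k z = p} = {((), complex_of_real x), ((), - of_real x)}"
      proof (intro equalityI subsetI)
        fix u assume "u \<in> {(k, z). k \<in> UNIV \<and> Im z = 0 \<and> fold_chart k z = p}"
        then obtain z where "u = ((), z)" "z\<^sup>2 = (of_real x)\<^sup>2" using x by (auto simp: fold_chart_def)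
        then show "u \<in> {((), complex_of_real x), ((), - of_real x)}" by (auto simp: power2_eq_iff)
      qed (use x in \<open>auto simp: fold_chart_def\<close>)
      show "0 < x" by (rule x)
      show "\<forall>z\<in>ball (complex_of_real x) x. 0 < Im z \<longrightarrow> 0 < Im (fold_chart () z)"
      proof (intro ballI impI)
        fix z assume z: "z \<in> ball (complex_of_real x) x" "0 < Im z"
        have "\<bar>Re (of_real x - z)\<bar> < x" using z abs_Re_le_cmod[of "of_real x - z"] by (auto simp: dist_norm)
        then have "0 < Re z" by (simp add: abs_if split: if_splits)
        then show "0 < Im (fold_chart () z)" using z by (simp add: fold_chart_def Im_power2)
      qed
      show "\<forall>z\<in>ball (- complex_of_real x) x. 0 < Im z \<longrightarrow> Im (fold_chart () z) < 0"
      proof (intro ballI impI)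
        fix z assume z: "z \<in> ball (- complex_of_real x) x" "0 < Im z"
        have "\<bar>Re (- of_real x - z)\<bar> < x" using z abs_Re_le_cmod[of "- of_real x - z"] by (auto simp: dist_norm)
        then have "Re z < 0" by (simp add: abs_if split: if_splits)
        then show "Im (fold_chart () z) < 0" using z by (simp add: fold_chart_def Im_power2 mult_neg_pos)
      qed
    qed
  qed
  show "strict_mono_on {..<2 * n} (fold_index n)" for n
  proof (rule strict_mono_onI)
    fix k l assume kl: "k \<in> {..<2 * n}" "l \<in> {..<2 * n}" "k < l"
    consider "l < n" | "k < n" "n \<le> l" | "n \<le> k" using kl by linarith
    then show "fold_index n k < fold_index n l"
    proof cases
      case 2
      then have "fold_index n k < 0" "0 < fold_index n l" by (auto simp: fold_index_def)
      then show ?thesis by simp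
    qed (use kl in \<open>auto simp: fold_index_def\<close>)
  qed
  show "{x. Im x = 0 \<and> fold_chart i x \<in> of_nat ` {1..n}} = (\<lambda>k. of_real (fold_index n k)) ` {..<2 * n}" for i n
  proof (intro equalityI subsetI)
    fix x assume "x \<in> {x. Im x = 0 \<and> fold_chart i x \<in> of_nat ` {1..n}}"
    then obtain m where m: "Im x = 0" "x\<^sup>2 = of_nat m" "1 \<le> m" "m \<le> n" by (auto simp: fold_chart_def)
    have "x\<^sup>2 = (of_real (sqrt (real m)))\<^sup>2" using m(2) by (simp flip: of_real_power)
    then consider "x = of_real (sqrt (real m))" | "x = of_real (- sqrt (real m))" by (auto simp: power2_eq_iff)
    then show "x \<in> (\<lambda>k. of_real (fold_index n k)) ` {..<2 * n}"
    proof cases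
      case 1
      then show ?thesis using m by (intro image_eqI[of _ _ "n + m - 1"]) (auto simp: fold_index_def)
    next
      case 2
      then show ?thesis using m by (intro image_eqI[of _ _ "n - m"]) (auto simp: fold_index_def)
    qed
  next
    fix x assume "x \<in> (\<lambda>k. complex_of_real (fold_index n k)) ` {..<2 * n}"
    then obtain k where k: "k < 2 * n" "x = of_real (fold_index n k)" by auto
    have "x\<^sup>2 = of_real ((fold_index n k)\<^sup>2)" using k by simp
    also have "\<dots> = of_nat (if k < n then n - k else Suc k - n)" unfolding fold_index_sq by simp
    finally have "fold_chart i x = of_nat (if k < n then n - k else Suc k - n)" by (simp only: fold_chart_def)
    moreover have "(if k < n then n - k else Suc k - n) \<in> {1..n}" using k by auto
    ultimately have "fold_chart i x \<in> of_nat ` {1..n}" by (rule image_eqI)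
    then show "x \<in> {x. Im x = 0 \<and> fold_chart i x \<in> of_nat ` {1..n}}" using k by simp
  qed
qed (auto intro: finite_imageI)

section \<open>The two bijections\<close>

theorem theorem1p1:
  fixes n :: nat
  assumes "n \<ge> 1"
  shows "(\<exists>F. bij_betw F (dyck_paths n \<times> dyck_paths n) (meanders n) \<and>
            (\<forall>P\<in>dyck_paths n. \<forall>Q\<in>dyck_paths n. traj P Q = num_components (F (P, Q)))) \<and>
         (\<exists>G. bij_betw G (dyck_paths n) (semimeanders n) \<and>
            (\<forall>P\<in>dyck_paths n. traj P (L_path n) = num_components (G P)))"
proof
  have n: "0 < n" using assms by simp
  \<comment> \<open>\<open>P\<close> governs the arcs above the line and \<open>Q\<close> those
    below.\<close>
  define d where "d PQ b = (if b then fst PQ else snd PQ)" for PQ :: "step list \<times> step list" and b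
  define F where "F PQ = meander.cls n (d PQ)" for PQ
  have dD: "d PQ b \<in> dyck_paths n" if "PQ \<in> dyck_paths n \<times> dyck_paths n" for PQ b using that by (auto simp: d_def)
  have "bij_betw F (dyck_paths n \<times> dyck_paths n) (meanders n)"
    unfolding bij_betw_def
  proof
    show "inj_on F (dyck_paths n \<times> dyck_paths n)"
    proof (rule inj_onI)
      fix X Y assume XY: "X \<in> dyck_paths n \<times> dyck_paths n" "Y \<in> dyck_paths n \<times> dyck_paths n" "F X = F Y"
      have "d X b = d Y b" for b by (rule meander.cls_inj[OF dD[OF XY(1)] dD[OF XY(2)]]) (use XY(3) in \<open>auto simp: F_def\<close>)
      from this[of True] this[of False] show "X = Y" by (simp add: d_def prod_eq_iff)
    qed
    show "F ` (dyck_paths n \<times> dyck_paths n) = meanders n"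
    proof (intro equalityI subsetI)
      fix T assume "T \<in> F ` (dyck_paths n \<times> dyck_paths n)"
      then show "T \<in> meanders n" using meander.cls_quotient[OF dD] by (auto simp: F_def meanders_def Let_def)
    next
      fix T assume "T \<in> meanders n"
      then obtain d' where d': "\<And>b. d' b \<in> dyck_paths n" "T = meander.cls n d'"
        unfolding meanders_def Let_def using meander.cls_surj by (metis UNIV_I)
      have "d (d' True, d' False) = d'" by (rule ext) (simp add: d_def)
      then have "T = F (d' True, d' False)" using d'(2) by (simp add: F_def)
      then show "T \<in> F ` (dyck_paths n \<times> dyck_paths n)" using d'(1) by blast
    qed
  qed
  moreover have "traj P Q = num_components (F (P, Q))" if PQ: "P \<in> dyck_paths n" "Q \<in> dyck_paths n" for P Q
  proof -
    have dd: "d (P, Q) b \<in> dyck_paths n" for b using PQ by (simp add: d_def)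
    let ?f = "\<lambda>k. complex_of_nat (Suc k)"
    have pt: "meander_chart b (meander.pt b k) = ?f k" for b k by (simp add: meander.pt_def meander_chart_def)
    have "card ((\<lambda>k. (index_link (pairs P \<union> pairs Q))\<^sup>* `` {k}) ` {..<2 * n}) =
        card ((\<lambda>p. (meander.point_link (d (P, Q)))\<^sup>* `` {p}) ` (of_nat ` {1..2 * n}))"
    proof (rule card_classes_transfer[of ?f])
      have "Suc ` {..<2 * n} = {1..2 * n}" by (simp add: lessThan_atLeast0 image_Suc_atLeastLessThan atLeastLessThanSuc_atLeastAtMost)
      then show "?f ` {..<2 * n} = of_nat ` {1..2 * n}" by (metis image_image)
      show "sym (index_link (pairs P \<union> pairs Q))" by (rule index_link_sym)
      show "meander.point_link (d (P, Q)) \<subseteq> of_nat ` {1..2 * n} \<times> of_nat ` {1..2 * n}" "sym (meander.point_link (d (P, Q)))"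
        using meander.point_link_sub[of "d (P, Q)" n] dd by auto
      show "l \<in> {..<2 * n} \<and> (?f k, ?f l) \<in> (meander.point_link (d (P, Q)))\<^sup>*" if kl: "(k, l) \<in> index_link (pairs P \<union> pairs Q)" for k l
      proof -
        obtain s where s: "s \<in> pairs P \<union> pairs Q" "k \<in> s" "l \<in> s" using kl by (auto simp: index_link_def)
        define b where "b \<longleftrightarrow> s \<in> pairs P"
        have sb: "s \<in> pairs (d (P, Q) b)" using s by (auto simp: b_def d_def)
        then have "(?f k, ?f l) \<in> meander.point_link (d (P, Q))"
          using meander.point_linkI[where i=b and s=s and d="d (P, Q)" and k=k and l=l] s(2,3) by (simp add: pt)
        moreover have "l < 2 * n" using pairs_bounded[OF dd sb s(3)] .
        ultimately show ?thesis by blast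
      qed
      show "(k, l) \<in> (index_link (pairs P \<union> pairs Q))\<^sup>*" if "?f k = ?f l" for k l
        using that by (simp only: of_nat_eq_iff) simp
      show "\<exists>k\<in>{..<2 * n}. \<exists>l\<in>{..<2 * n}. p = ?f k \<and> p' = ?f l \<and> (k, l) \<in> (index_link (pairs P \<union> pairs Q))\<^sup>*"
        if pp: "(p, p') \<in> meander.point_link (d (P, Q))" for p p'
      proof -
        obtain b s k l where s: "s \<in> pairs (d (P, Q) b)" "k \<in> s" "l \<in> s" "p = ?f k" "p' = ?f l"
          using pp pt unfolding meander.point_link_def by auto
        have "s \<in> pairs P \<union> pairs Q" using s(1) by (auto simp: d_def split: if_splits)
        then have "(k, l) \<in> index_link (pairs P \<union> pairs Q)" using s by (auto simp: index_link_def)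
        moreover have "k < 2 * n" "l < 2 * n" using pairs_bounded[OF dd s(1)] s(2,3) by auto
        ultimately show ?thesis using s(4,5) by blast
      qed
    qed
    then show ?thesis
      unfolding F_def using traj_eq[OF n PQ] meander.num_components_cls[of "d (P, Q)" n] dd by simp
  qed
  ultimately show "\<exists>F. bij_betw F (dyck_paths n \<times> dyck_paths n) (meanders n) \<and>
            (\<forall>P\<in>dyck_paths n. \<forall>Q\<in>dyck_paths n. traj P Q = num_components (F (P, Q)))" by blast
next
  have n: "0 < n" using assms by simp
  define G where "G P = semimeander.cls n (\<lambda>u. P)" for P
  have "bij_betw G (dyck_paths n) (semimeanders n)"
    unfolding bij_betw_def
  proof
    show "inj_on G (dyck_paths n)"
    proof (rule inj_onI)
      fix X Y assume XY: "X \<in> dyck_paths n" "Y \<in> dyck_paths n" "G X = G Y"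
      show "X = Y" using semimeander.cls_inj[of "\<lambda>u. X" n "\<lambda>u. Y" "()"] XY by (simp add: G_def)
    qed
    show "G ` dyck_paths n = semimeanders n"
    proof (intro equalityI subsetI)
      fix T assume "T \<in> G ` dyck_paths n"
      then obtain P where "P \<in> dyck_paths n" "T = G P" by blast
      then show "T \<in> semimeanders n" using semimeander.cls_quotient[of "\<lambda>u. P" n] by (simp add: G_def semimeanders_def Let_def)
    next
      fix T assume "T \<in> semimeanders n"
      then obtain d' where d': "\<And>u. d' u \<in> dyck_paths n" "T = semimeander.cls n d'"
        unfolding semimeanders_def Let_def using semimeander.cls_surj by (metis UNIV_I)
      have "d' = (\<lambda>u. d' ())" by (rule ext) simp
      then have "T = G (d' ())" using d'(2) unfolding G_def by metis
      then show "T \<in> G ` dyck_paths n" using d'(1) by blast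
    qed
  qed
  moreover have "traj P (L_path n) = num_components (G P)" if P: "P \<in> dyck_paths n" for P
  proof -
    let ?R = "index_link (pairs P \<union> pairs (L_path n))"
    let ?S = "semimeander.point_link n (\<lambda>u. P)"
    \<comment> \<open>\<open>m k\<close> is the label on the half-line of the point with index
      \<open>k\<close>; the indices \<open>k\<close> and \<open>2 * n - 1 - k\<close> share their
      label.\<close>
    define m where "m k = (if k < n then n - k else Suc k - n)" for k
    have pt: "fold_chart u (semimeander.pt n u k) = of_nat (m k)" for u k
    proof -
      have "fold_chart u (semimeander.pt n u k) = of_real ((fold_index n k)\<^sup>2)" by (simp add: semimeander.pt_def fold_chart_def)
      then show ?thesis unfolding fold_index_sq by (simp add: m_def)
    qed
    have "card ((\<lambda>k. ?R\<^sup>* `` {k}) ` {..<2 * n}) = card ((\<lambda>p. ?S\<^sup>* `` {p}) ` (of_nat ` {1..n}))"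
    proof (rule card_classes_transfer[of "\<lambda>k. of_nat (m k)"])
      have "m ` {..<2 * n} = {1..n}"
      proof (intro equalityI subsetI)
        fix j assume "j \<in> {1..n}"
        then show "j \<in> m ` {..<2 * n}" by (intro image_eqI[of _ _ "n - j"]) (auto simp: m_def)
      qed (auto simp: m_def)
      then show "(\<lambda>k. complex_of_nat (m k)) ` {..<2 * n} = of_nat ` {1..n}" by (metis image_image)
      show "sym ?R" by (rule index_link_sym)
      show "?S \<subseteq> of_nat ` {1..n} \<times> of_nat ` {1..n}" "sym ?S"
        using semimeander.point_link_sub[of "\<lambda>u. P" n] P by auto
      show "l \<in> {..<2 * n} \<and> (complex_of_nat (m k), of_nat (m l)) \<in> ?S\<^sup>*" if kl: "(k, l) \<in> ?R" for k l
      proof -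
        obtain s where s: "s \<in> pairs P \<union> pairs (L_path n)" "k \<in> s" "l \<in> s" using kl by (auto simp: index_link_def)
        have "l < 2 * n" using s pairs_bounded[OF P] pairs_bounded[OF L_path_dyck] by blast
        moreover have "(complex_of_nat (m k), of_nat (m l)) \<in> ?S\<^sup>*"
        proof (cases "s \<in> pairs P")
          case True
          then have "(complex_of_nat (m k), of_nat (m l)) \<in> ?S"
            using semimeander.point_linkI[where n=n and i="()" and s=s and d="\<lambda>u. P" and k=k and l=l] s(2,3) by (simp add: pt)
          then show ?thesis by blast
        next
          case False
          \<comment> \<open>A pair of \<open>L_path n\<close> joins the two indices over one point,
            so it becomes trivial on the half-line.\<close>
          then obtain i j where "matched (L_path n) i j" "s = {i, j}" using s(1) by (auto simp: pairs_def)
          then have "i < n" "s = {i, 2 * n - 1 - i}" by (auto simp: matched_L_path)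
          then have "m k = m l" using s(2,3) by (auto simp: m_def)
          then show ?thesis by simp
        qed
        ultimately show ?thesis by blast
      qed
      show "(k, l) \<in> ?R\<^sup>*" if kl: "k \<in> {..<2 * n}" "l \<in> {..<2 * n}" "complex_of_nat (m k) = of_nat (m l)" for k l
      proof (cases "k = l")
        case False
        \<comment> \<open>Conversely, two different indices over one point are paired by
          \<open>L_path n\<close>.\<close>
        have "m k = m l" using kl(3) by (simp only: of_nat_eq_iff)
        then have "(k < n \<and> l = 2 * n - 1 - k) \<or> (l < n \<and> k = 2 * n - 1 - l)"
          using kl(1,2) False by (auto simp: m_def split: if_splits)
        then have "matched (L_path n) k l \<or> matched (L_path n) l k" by (simp add: matched_L_path)
        then have "{k, l} \<in> pairs (L_path n)" by (auto simp: pairs_def insert_commute)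
        then have "(k, l) \<in> ?R" by (auto simp: index_link_def)
        then show ?thesis by blast
      qed simp
      show "\<exists>k\<in>{..<2 * n}. \<exists>l\<in>{..<2 * n}. p = of_nat (m k) \<and> p' = of_nat (m l) \<and> (k, l) \<in> ?R\<^sup>*"
        if pp: "(p, p') \<in> ?S" for p p'
      proof -
        obtain s k l where s: "s \<in> pairs P" "k \<in> s" "l \<in> s" "p = of_nat (m k)" "p' = of_nat (m l)"
          using pp pt unfolding semimeander.point_link_def by auto
        then have "(k, l) \<in> ?R" by (auto simp: index_link_def)
        moreover have "k < 2 * n" "l < 2 * n" using pairs_bounded[OF P s(1)] s(2,3) by auto
        ultimately show ?thesis using s(4,5) by blast
      qed
    qed
    then show ?thesis
      unfolding G_def using traj_eq[OF n P L_path_dyck] semimeander.num_components_cls[of "\<lambda>u. P" n] P by simp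
  qed
  ultimately show "\<exists>G. bij_betw G (dyck_paths n) (semimeanders n) \<and>
            (\<forall>P\<in>dyck_paths n. traj P (L_path n) = num_components (G P))" by blast
qed

end
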